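(* Let $S$ be an affine difference scheme and let $G$ be an affine flat difference $S$-group. Then the functors $\mathrm{H}^n(G,-)$ are the enriched derived functors of $\mathrm{H}^0(G,-)$ on the enriched abelian category $G\text{-}\mathcal{A}(S)_\infty\text{-Mod}\simeq\mathcal{A}(G)_\infty\text{-Comod}$, i.e. for every $\mathcal{F}$ in this category and every $n\ge0$, $$\mathrm{H}^n(G,\mathcal{F})=\mathrm{Ext}^n_{\mathcal{A}(G)_\infty\text{-Comod}}(\mathcal{A}(S),\mathcal{F}).$$
   Context: A difference ring $k$ is a commutative ring with identity $\lfloor k\rfloor$ with an endomorphism $\sigma_k$; a difference $k$-module is a $\lfloor k\rfloor$-module $M$ with an additive $\sigma_M$ such that $\sigma_M(rm)=\sigma_k(r)\sigma_M(m)$; morphisms are module maps commuting with $\sigma$. Tensor products carry $\sigma\otimes\sigma$. The internal hom $[M,N]$ is the set of sequences $(f_i)_{i\in\mathbb{N}}$ of $\lfloor k\rfloor$-linear maps $M\to N$ with $f_{i+1}\sigma_M=\sigma_Nf_i$, with difference operator the shift $(f_0,f_1,\ldots)\mapsto(f_1,f_2,\ldots)$ and scalar action $r\cdot(f_i)=(\sigma_k^i(r)f_i)$. An affine difference scheme $S$ corresponds to a difference ring $\mathcal{A}(S)$; an affine difference $S$-group $G$ corresponds to a commutative difference Hopf algebra $\mathcal{A}(G)$ over $\mathcal{A}(S)$ (a Hopf algebra with endomorphism compatible with $\sigma_{\mathcal{A}(S)}$, all structure maps commuting with $\sigma$), with comultiplication $\Delta$. $G$ is flat if $\lfloor\mathcal{A}(G)\rfloor$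 is flat over $\lfloor\mathcal{A}(S)\rfloor$. The objects of $\mathcal{A}(G)_\infty\text{-Comod}$ are difference $\mathcal{A}(S)$-modules $\mathcal{F}$ with a coassociative counital coaction $\mu_{\mathcal{F}}:\mathcal{F}\to\mathcal{F}\otimes_{\mathcal{A}(S)}\mathcal{A}(G)$ which is a morphism of difference modules; the enriched hom $\mathcal{A}(G)_\infty\text{-Comod}(\mathcal{F},\mathcal{F}')$ is the difference submodule of $[\mathcal{F},\mathcal{F}']$ of those $(\varphi_i)$ with $\mu_{\mathcal{F}'}\varphi_i=(\varphi_i\otimes\mathrm{id})\mu_{\mathcal{F}}$ for all $i$. $\mathcal{A}(S)$ is a comodule via $1\mapsto1\otimes1$. $\mathrm{H}^n(G,\mathcal{F})$ is the $n$-th cohomology (a difference $\mathcal{A}(S)$-module) of the complex $\mathrm{C}^n(G,\mathcal{F})=\mathcal{F}\otimes\mathcal{A}(G)^{\otimes n}$ with $\partial(f\otimes a_1\otimes\cdots\otimes a_n)=\mu_{\mathcal{F}}(f)\otimes a_1\otimes\cdots\otimes a_n+\sum_{i=1}^n(-1)^if\otimes a_1\otimes\cdots\otimes\Delta a_i\otimes\cdots\otimes a_n+(-1)^{n+1}f\otimes a_1\otimes\cdots\otimes a_n\otimes1.$ In particular $\mathrm{H}^0(G,\mathcal{F})=\{f\in\mathcal{F}:\mu_{\mathcal{F}}(f)=f\otimes1\}=\mathcal{A}(G)_\infty\text{-Comod}(\mathcal{A}(S),\mathcal{F})$. An object $I$ is enriched injective if both the ordinary hom functor $\mathrm{Hom}(-,I)$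 and the enriched hom functor into difference abelian groups $\mathcal{A}(G)_\infty\text{-Comod}(-,I)$ are exact on the underlying abelian category of difference comodules. The $n$-th enriched derived functor of a left-exact enriched functor $F$ is $\mathbf{R}^nF(\mathcal{F})=\mathrm{H}^n(F(I^\bullet))$ for an enriched injective resolution $\mathcal{F}\to I^\bullet$, with its induced action on enriched hom objects; $\mathrm{Ext}^n_{\mathcal{A}(G)_\infty\text{-Comod}}(\mathcal{A}(S),-)$ denotes the $n$-th enriched derived functor of $\mathcal{A}(G)_\infty\text{-Comod}(\mathcal{A}(S),-)$, with values in difference abelian groups (difference $\mathcal{A}(S)$-modules). *)

theory Defs
  imports "HOL-Algebra.Module" "HOL-Algebra.AbelCoset"
    "HOL-Algebra.Free_Abelian_Groups" "HOL-Library.Infinite_Typeclass"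
begin

section \<open>Difference rings and difference modules\<close>

text \<open>Modules are library records; their \<^const>\<open>mult\<close> and \<^const>\<open>one\<close> fields
  only matter when the module is an algebra.\<close>

record 'r dring = "'r ring" +
  rsigma :: "'r \<Rightarrow> 'r"

record ('r, 'm) dmod = "('r, 'm) module" +
  dsigma :: "'m \<Rightarrow> 'm"

definition difference_ring :: "('r, 'z) dring_scheme \<Rightarrow> bool" where
  "difference_ring R \<longleftrightarrow> cring R \<and> rsigma R \<in> ring_hom R R"

definition difference_module :: "('r, 'z) dring_scheme \<Rightarrow> ('r, 'm, 'y) dmod_scheme \<Rightarrow> bool" where
  "difference_module R M \<longleftrightarrow> Module.module R M \<and>
     dsigma M \<in> carrier M \<rightarrow> carrier M \<and>
     (\<forall>x\<in>carrier M. \<forall>y\<in>carrier M. dsigma M (x \<oplus>\<^bsub>M\<^esub> y) = dsigma M x \<oplus>\<^bsub>M\<^esub> dsigma M y) \<and>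
     (\<forall>r\<in>carrier R. \<forall>x\<in>carrier M. dsigma M (r \<odot>\<^bsub>M\<^esub> x) = rsigma R r \<odot>\<^bsub>M\<^esub> dsigma M x)"

definition linear_map ::
    "('r, 'z) ring_scheme \<Rightarrow> ('r, 'm, 'x) module_scheme \<Rightarrow> ('r, 'n, 'y) module_scheme \<Rightarrow>
     ('m \<Rightarrow> 'n) \<Rightarrow> bool" where
  "linear_map R M N f \<longleftrightarrow> f \<in> carrier M \<rightarrow> carrier N \<and>
     (\<forall>x\<in>carrier M. \<forall>y\<in>carrier M. f (x \<oplus>\<^bsub>M\<^esub> y) = f x \<oplus>\<^bsub>N\<^esub> f y) \<and>
     (\<forall>r\<in>carrier R. \<forall>x\<in>carrier M. f (r \<odot>\<^bsub>M\<^esub> x) = r \<odot>\<^bsub>N\<^esub> f x)"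

definition dmod_map ::
    "('r, 'z) ring_scheme \<Rightarrow> ('r, 'm, 'x) dmod_scheme \<Rightarrow> ('r, 'n, 'y) dmod_scheme \<Rightarrow>
     ('m \<Rightarrow> 'n) \<Rightarrow> bool" where
  "dmod_map R M N f \<longleftrightarrow> linear_map R M N f \<and>
     (\<forall>x\<in>carrier M. f (dsigma M x) = dsigma N (f x))"

definition dmod_iso ::
    "('r, 'z) ring_scheme \<Rightarrow> ('r, 'm, 'x) dmod_scheme \<Rightarrow> ('r, 'n, 'y) dmod_scheme \<Rightarrow>
     ('m \<Rightarrow> 'n) \<Rightarrow> bool" where
  "dmod_iso R M N f \<longleftrightarrow> dmod_map R M N f \<and> bij_betw f (carrier M) (carrier N)"

text \<open>Where maps are themselves elements of a hom object they are taken extensional, so that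
  equality of maps is equality on the carrier.\<close>

definition linear_maps ::
    "('r, 'z) ring_scheme \<Rightarrow> ('r, 'm, 'x) module_scheme \<Rightarrow> ('r, 'n, 'y) module_scheme \<Rightarrow>
     ('m \<Rightarrow> 'n) set" where
  "linear_maps R M N = {f \<in> extensional (carrier M). linear_map R M N f}"

definition internal_hom ::
    "('r, 'z) dring_scheme \<Rightarrow> ('r, 'm, 'x) dmod_scheme \<Rightarrow> ('r, 'n, 'y) dmod_scheme \<Rightarrow>
     ('r, nat \<Rightarrow> 'm \<Rightarrow> 'n) dmod" where
  "internal_hom R M N =
    \<lparr>carrier = {\<phi>. (\<forall>i. \<phi> i \<in> linear_maps R M N) \<and>
                    (\<forall>i. \<forall>x\<in>carrier M. \<phi> (Suc i) (dsigma M x) = dsigma N (\<phi> i x))},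
     monoid.mult = undefined, one = undefined,
     ring.zero = (\<lambda>i. \<lambda>x\<in>carrier M. \<zero>\<^bsub>N\<^esub>),
     ring.add = (\<lambda>\<phi> \<psi> i. \<lambda>x\<in>carrier M. \<phi> i x \<oplus>\<^bsub>N\<^esub> \<psi> i x),
     smult = (\<lambda>r \<phi> i. \<lambda>x\<in>carrier M. (rsigma R ^^ i) r \<odot>\<^bsub>N\<^esub> \<phi> i x),
     dsigma = (\<lambda>\<phi> i. \<phi> (Suc i))\<rparr>"


section \<open>Tensor products\<close>

text \<open>The tensor product \<open>M \<otimes> A \<otimes> \<dots> \<otimes> A\<close> over \<open>R\<close> with \<open>n\<close> factors \<open>A\<close>: the free abelian group
  on pairs of an element of \<open>M\<close> and a list of \<open>n\<close> elements of \<open>A\<close>, modulo additivity in each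
  slot and \<open>r m \<otimes> \<dots> a \<dots> = m \<otimes> \<dots> r a \<dots>\<close> for each factor \<open>A\<close>. Lists keep the type of elements
  independent of \<open>n\<close>; \<open>M \<otimes> A\<close> is the case \<open>n = 1\<close>, and \<open>n = 0\<close> gives a copy of \<open>M\<close>.\<close>

type_synonym ('m, 'a) tens = "('m \<times> 'a list \<Rightarrow>\<^sub>0 int) set"

definition tens_gens ::
    "('m, 'x) partial_object_scheme \<Rightarrow> ('a, 'y) partial_object_scheme \<Rightarrow> nat \<Rightarrow> ('m \<times> 'a list) set" where
  "tens_gens M A n = carrier M \<times> {as. set as \<subseteq> carrier A \<and> length as = n}"

definition tens_rels ::
    "('r, 'z) ring_scheme \<Rightarrow> ('r, 'm, 'x) module_scheme \<Rightarrow> ('r, 'a, 'y) module_scheme \<Rightarrow> nat \<Rightarrow>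
     ('m \<times> 'a list \<Rightarrow>\<^sub>0 int) set" where
  "tens_rels R M A n =
     {frag_of (m \<oplus>\<^bsub>M\<^esub> m', as) - frag_of (m, as) - frag_of (m', as) | m m' as.
        (m, as) \<in> tens_gens M A n \<and> m' \<in> carrier M} \<union>
     {frag_of (m, as[i := as ! i \<oplus>\<^bsub>A\<^esub> a]) - frag_of (m, as) - frag_of (m, as[i := a]) | m as i a.
        (m, as) \<in> tens_gens M A n \<and> i < n \<and> a \<in> carrier A} \<union>
     {frag_of (r \<odot>\<^bsub>M\<^esub> m, as) - frag_of (m, as[i := r \<odot>\<^bsub>A\<^esub> as ! i]) | m as i r.
        (m, as) \<in> tens_gens M A n \<and> i < n \<and> r \<in> carrier R}"

definition tens_sub ::
    "('r, 'z) ring_scheme \<Rightarrow> ('r, 'm, 'x) module_scheme \<Rightarrow> ('r, 'a, 'y) module_scheme \<Rightarrow> nat \<Rightarrow>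
     ('m, 'a) tens" where
  "tens_sub R M A n = generate (free_Abelian_group (tens_gens M A n)) (tens_rels R M A n)"

text \<open>\<open>pure_tens R M A m as\<close> is the elementary tensor \<open>m \<otimes> a\<^sub>1 \<otimes> \<dots> \<otimes> a\<^sub>n\<close>, \<open>n = length as\<close>.\<close>

definition pure_tens ::
    "('r, 'z) ring_scheme \<Rightarrow> ('r, 'm, 'x) module_scheme \<Rightarrow> ('r, 'a, 'y) module_scheme \<Rightarrow>
     'm \<Rightarrow> 'a list \<Rightarrow> ('m, 'a) tens" where
  "pure_tens R M A m as =
     tens_sub R M A (length as) #>\<^bsub>free_Abelian_group (tens_gens M A (length as))\<^esub> frag_of (m, as)"

text \<open>The additive map out of a tensor product with values in \<open>B\<close> that is prescribed by \<open>g\<close> on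
  elementary tensors: the common value, over all representatives of the class \<open>X\<close>, of the
  additive extension of \<open>g\<close> to the free abelian group. It is meaningful when \<open>g\<close> respects
  \<^const>\<open>tens_rels\<close>.\<close>

definition tens_ext ::
    "('b, 'z) ring_scheme \<Rightarrow> ('m \<times> 'a list \<Rightarrow> 'b) \<Rightarrow> ('m, 'a) tens \<Rightarrow> 'b" where
  "tens_ext B g X =
     the_elem ((\<lambda>x. \<Oplus>\<^bsub>B\<^esub>p\<in>Poly_Mapping.keys x. [(Poly_Mapping.lookup x p)] \<cdot>\<^bsub>B\<^esub> g p) ` X)"

text \<open>Multiplication and unit are the factorwise ones; they make \<open>M \<otimes> A \<otimes> \<dots> \<otimes> A\<close> a ring when
  \<open>M\<close> is an algebra, and are junk otherwise.\<close>

definition tens_group ::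
    "('r, 'z) ring_scheme \<Rightarrow> ('r, 'm, 'x) module_scheme \<Rightarrow> ('r, 'a, 'y) module_scheme \<Rightarrow> nat \<Rightarrow>
     ('m, 'a) tens ring" where
  "tens_group R M A n =
     (let Q = free_Abelian_group (tens_gens M A n) Mod tens_sub R M A n in
      \<lparr>carrier = carrier Q, monoid.mult = undefined, one = undefined,
       ring.zero = \<one>\<^bsub>Q\<^esub>, ring.add = monoid.mult Q\<rparr>)"

definition tens ::
    "('r, 'z) ring_scheme \<Rightarrow> ('r, 'm, 'x) module_scheme \<Rightarrow> ('r, 'a, 'y) module_scheme \<Rightarrow> nat \<Rightarrow>
     ('r, ('m, 'a) tens) module" where
  "tens R M A n =
     (let T = tens_group R M A n in
      \<lparr>carrier = carrier T,
       monoid.mult = (\<lambda>X Y. tens_ext T (\<lambda>(m, as).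
          tens_ext T (\<lambda>(m', as'). pure_tens R M A (m \<otimes>\<^bsub>M\<^esub> m') (map2 (monoid.mult A) as as')) Y) X),
       one = pure_tens R M A \<one>\<^bsub>M\<^esub> (replicate n \<one>\<^bsub>A\<^esub>),
       ring.zero = \<zero>\<^bsub>T\<^esub>, ring.add = ring.add T,
       smult = (\<lambda>r. tens_ext T (\<lambda>(m, as). pure_tens R M A (r \<odot>\<^bsub>M\<^esub> m) as))\<rparr>)"

text \<open>The difference module structure \<open>\<sigma> \<otimes> \<dots> \<otimes> \<sigma>\<close> on the tensor product.\<close>

definition dtens ::
    "('r, 'z) ring_scheme \<Rightarrow> ('r, 'm, 'x) dmod_scheme \<Rightarrow> ('r, 'a, 'y) dmod_scheme \<Rightarrow> nat \<Rightarrow>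
     ('r, ('m, 'a) tens) dmod" where
  "dtens R M A n = module.extend (tens R M A n)
     \<lparr>dsigma = tens_ext (tens R M A n)
        (\<lambda>(m, as). pure_tens R M A (dsigma M m) (map (dsigma A) as))\<rparr>"

text \<open>\<open>f \<otimes> id \<otimes> \<dots> \<otimes> id\<close>, for \<open>f\<close> with values in \<open>N\<close>.\<close>

definition tens_map ::
    "('r, 'z) ring_scheme \<Rightarrow> ('r, 'n, 'x) module_scheme \<Rightarrow> ('r, 'a, 'y) module_scheme \<Rightarrow> nat \<Rightarrow>
     ('m \<Rightarrow> 'n) \<Rightarrow> ('m, 'a) tens \<Rightarrow> ('n, 'a) tens" where
  "tens_map R N A n f = tens_ext (tens R N A n) (\<lambda>(m, as). pure_tens R N A (f m) as)"

text \<open>\<open>\<mu> \<otimes> id \<otimes> \<dots> \<otimes> id\<close> on \<open>M \<otimes> A \<otimes> \<dots> \<otimes> A\<close> (\<open>n\<close> factors \<open>A\<close>), for \<open>\<mu> : M \<rightarrow> M \<otimes> A\<close>.\<close>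

definition coact_first ::
    "('r, 'z) ring_scheme \<Rightarrow> ('r, 'm, 'x) module_scheme \<Rightarrow> ('r, 'a, 'y) module_scheme \<Rightarrow>
     ('m \<Rightarrow> ('m, 'a) tens) \<Rightarrow> nat \<Rightarrow> ('m, 'a) tens \<Rightarrow> ('m, 'a) tens" where
  "coact_first R M A \<mu> n = tens_ext (tens R M A (Suc n))
     (\<lambda>(m, as). tens_ext (tens R M A (Suc n)) (\<lambda>(m', bs). pure_tens R M A m' (bs @ as)) (\<mu> m))"

text \<open>\<open>id \<otimes> \<dots> \<otimes> \<Delta> \<otimes> \<dots> \<otimes> id\<close> on \<open>M \<otimes> A \<otimes> \<dots> \<otimes> A\<close> (\<open>n\<close> factors \<open>A\<close>), with \<open>\<Delta> : A \<rightarrow> A \<otimes> A\<close> applied to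
  the factor \<open>A\<close> with index \<open>i < n\<close>, counting from \<open>0\<close>.\<close>

definition comult_at ::
    "('r, 'z) ring_scheme \<Rightarrow> ('r, 'm, 'x) module_scheme \<Rightarrow> ('r, 'a, 'y) module_scheme \<Rightarrow>
     ('a \<Rightarrow> ('a, 'a) tens) \<Rightarrow> nat \<Rightarrow> nat \<Rightarrow> ('m, 'a) tens \<Rightarrow> ('m, 'a) tens" where
  "comult_at R M A \<Delta> n i = tens_ext (tens R M A (Suc n))
     (\<lambda>(m, as). tens_ext (tens R M A (Suc n))
        (\<lambda>(b, bs). pure_tens R M A m (take i as @ b # bs @ drop (Suc i) as)) (\<Delta> (as ! i)))"


section \<open>Difference Hopf algebras and flatness\<close>

record ('r, 'a) dhopf = "('r, 'a) dmod" +
  comult :: "'a \<Rightarrow> ('a, 'a) tens"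
  counit :: "'a \<Rightarrow> 'r"
  antipode :: "'a \<Rightarrow> 'a"

definition difference_hopf_algebra ::
    "('r, 'z) dring_scheme \<Rightarrow> ('r, 'a, 'y) dhopf_scheme \<Rightarrow> bool" where
  "difference_hopf_algebra R A \<longleftrightarrow>
     difference_ring R \<and>
     \<comment> \<open>commutative difference algebra\<close>
     algebra R A \<and> difference_module R A \<and> dsigma A \<in> ring_hom A A \<and>
     \<comment> \<open>comultiplication and counit are morphisms of difference algebras\<close>
     dmod_map R A (dtens R A A 1) (comult A) \<and> comult A \<in> ring_hom A (tens R A A 1) \<and>
     counit A \<in> ring_hom A R \<and>
     (\<forall>r\<in>carrier R. \<forall>a\<in>carrier A. counit A (r \<odot>\<^bsub>A\<^esub> a) = r \<otimes>\<^bsub>R\<^esub> counit A a) \<and>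
     (\<forall>a\<in>carrier A. counit A (dsigma A a) = rsigma R (counit A a)) \<and>
     dmod_map R A A (antipode A) \<and>
     \<comment> \<open>coassociativity, counit and antipode laws\<close>
     (\<forall>a\<in>carrier A. coact_first R A A (comult A) 1 (comult A a) =
                     comult_at R A A (comult A) 1 0 (comult A a)) \<and>
     (\<forall>a\<in>carrier A. tens_ext A (\<lambda>(b, cs). counit A (hd cs) \<odot>\<^bsub>A\<^esub> b) (comult A a) = a) \<and>
     (\<forall>a\<in>carrier A. tens_ext A (\<lambda>(b, cs). counit A b \<odot>\<^bsub>A\<^esub> hd cs) (comult A a) = a) \<and>
     (\<forall>a\<in>carrier A. tens_ext A (\<lambda>(b, cs). antipode A b \<otimes>\<^bsub>A\<^esub> hd cs) (comult A a)
                     = counit A a \<odot>\<^bsub>A\<^esub> \<one>\<^bsub>A\<^esub>) \<and>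
     (\<forall>a\<in>carrier A. tens_ext A (\<lambda>(b, cs). b \<otimes>\<^bsub>A\<^esub> antipode A (hd cs)) (comult A a)
                     = counit A a \<odot>\<^bsub>A\<^esub> \<one>\<^bsub>A\<^esub>)"

text \<open>Flatness of \<open>A\<close> over the underlying ring of \<open>R\<close>. The test modules live in the type of ring
  elements; this loses nothing, because ideals of \<open>R\<close> are among them.\<close>

definition flat ::
    "('r, 'z) ring_scheme \<Rightarrow> ('r, 'a, 'y) module_scheme \<Rightarrow> bool" where
  "flat R A \<longleftrightarrow> Module.module R A \<and>
     (\<forall>(M :: ('r, 'r) module) (N :: ('r, 'r) module) f.
        Module.module R M \<and> Module.module R N \<and> linear_map R M N f \<and> inj_on f (carrier M) \<longrightarrow>
        inj_on (tens_map R N A 1 f) (carrier (tens R M A 1)))"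


section \<open>The enriched category of difference comodules\<close>

record ('r, 'a, 'm) dcomod = "('r, 'm) dmod" +
  coact :: "'m \<Rightarrow> ('m, 'a) tens"

definition difference_comodule ::
    "('r, 'z) dring_scheme \<Rightarrow> ('r, 'a, 'y) dhopf_scheme \<Rightarrow> ('r, 'a, 'm, 'x) dcomod_scheme \<Rightarrow> bool" where
  "difference_comodule R A F \<longleftrightarrow>
     difference_module R F \<and> dmod_map R F (dtens R F A 1) (coact F) \<and>
     (\<forall>f\<in>carrier F. coact_first R F A (coact F) 1 (coact F f) =
                     comult_at R F A (comult A) 1 0 (coact F f)) \<and>
     (\<forall>f\<in>carrier F. tens_ext F (\<lambda>(g, as). counit A (hd as) \<odot>\<^bsub>F\<^esub> g) (coact F f) = f)"

definition base_module :: "('r, 'z) dring_scheme \<Rightarrow> ('r, 'r) dmod" where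
  "base_module R = \<lparr>carrier = carrier R, monoid.mult = monoid.mult R, one = \<one>\<^bsub>R\<^esub>,
     ring.zero = \<zero>\<^bsub>R\<^esub>, ring.add = ring.add R, smult = monoid.mult R, dsigma = rsigma R\<rparr>"

definition base_comodule ::
    "('r, 'z) dring_scheme \<Rightarrow> ('r, 'a, 'y) dhopf_scheme \<Rightarrow> ('r, 'a, 'r) dcomod" where
  "base_comodule R A = dmod.extend (base_module R)
     \<lparr>coact = (\<lambda>r. pure_tens R (base_module R) A r [\<one>\<^bsub>A\<^esub>])\<rparr>"

text \<open>Morphisms of the underlying ordinary category.\<close>

definition comod_hom ::
    "('r, 'z) dring_scheme \<Rightarrow> ('r, 'a, 'y) dhopf_scheme \<Rightarrow>
     ('r, 'a, 'm, 'x) dcomod_scheme \<Rightarrow> ('r, 'a, 'n, 'w) dcomod_scheme \<Rightarrow> ('m \<Rightarrow> 'n) set" where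
  "comod_hom R A F F' = {f \<in> extensional (carrier F). dmod_map R F F' f \<and>
     (\<forall>x\<in>carrier F. coact F' (f x) = tens_map R F' A 1 f (coact F x))}"

text \<open>The hom object of the enriched category.\<close>

definition comod_ehom ::
    "('r, 'z) dring_scheme \<Rightarrow> ('r, 'a, 'y) dhopf_scheme \<Rightarrow>
     ('r, 'a, 'm, 'x) dcomod_scheme \<Rightarrow> ('r, 'a, 'n, 'w) dcomod_scheme \<Rightarrow>
     ('r, nat \<Rightarrow> 'm \<Rightarrow> 'n) dmod" where
  "comod_ehom R A F F' = (internal_hom R F F')
     \<lparr>carrier := {\<phi> \<in> carrier (internal_hom R F F').
        \<forall>i. \<forall>x\<in>carrier F. coact F' (\<phi> i x) = tens_map R F' A 1 (\<phi> i) (coact F x)}\<rparr>"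

definition short_exact ::
    "'x set \<Rightarrow> ('x \<Rightarrow> 'y) \<Rightarrow> 'y set \<Rightarrow> ('y \<Rightarrow> 'z) \<Rightarrow> 'z set \<Rightarrow> 'z \<Rightarrow> bool" where
  "short_exact X u Y v Z z0 \<longleftrightarrow>
     inj_on u X \<and> u ` X = {y \<in> Y. v y = z0} \<and> v ` Y = Z"

text \<open>Over a flat \<open>A\<close>, kernels and cokernels of difference comodules are those of the underlying
  modules, so exactness can be tested on carriers.\<close>

definition comod_ses ::
    "('r, 'z) dring_scheme \<Rightarrow> ('r, 'a, 'y) dhopf_scheme \<Rightarrow> ('r, 'a, 'm) dcomod \<Rightarrow> ('m \<Rightarrow> 'm) \<Rightarrow>
     ('r, 'a, 'm) dcomod \<Rightarrow> ('m \<Rightarrow> 'm) \<Rightarrow> ('r, 'a, 'm) dcomod \<Rightarrow> bool" where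
  "comod_ses R A F' u F v F'' \<longleftrightarrow>
     difference_comodule R A F' \<and> difference_comodule R A F \<and> difference_comodule R A F'' \<and>
     u \<in> comod_hom R A F' F \<and> v \<in> comod_hom R A F F'' \<and>
     short_exact (carrier F') u (carrier F) v (carrier F'') \<zero>\<^bsub>F''\<^esub>"

text \<open>The category consists of the difference comodules with carrier in a fixed type \<open>'m\<close>, which
  plays the role of a universe; the functors \<open>Hom(-, I)\<close> and \<open>Comod(-, I)\<close> are tested on it.
  Enough enriched injectives exist in \<open>'m\<close> as soon as \<open>'m\<close> is infinite, admits an injection from
  \<open>A\<close>, and admits an injection from the maps \<open>nat \<times> R \<rightarrow> 'm\<close>: an \<open>F\<close> embeds into \<open>J\<^sup>\<nat> \<otimes> A\<close> with \<open>J\<close>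
  the additive maps from \<open>R\<close> to the divisible hull of \<open>F\<close>, and \<open>J\<^sup>\<nat>\<close> the cofree difference module.\<close>

definition enriched_injective ::
    "('r, 'z) dring_scheme \<Rightarrow> ('r, 'a, 'y) dhopf_scheme \<Rightarrow> ('r, 'a, 'm) dcomod \<Rightarrow> bool" where
  "enriched_injective R A I \<longleftrightarrow> difference_comodule R A I \<and>
     (\<forall>(F' :: ('r, 'a, 'm) dcomod) u F v F''. comod_ses R A F' u F v F'' \<longrightarrow>
        short_exact (comod_hom R A F'' I) (\<lambda>f. compose (carrier F) f v)
                    (comod_hom R A F I) (\<lambda>f. compose (carrier F') f u)
                    (comod_hom R A F' I) (\<lambda>x\<in>carrier F'. \<zero>\<^bsub>I\<^esub>) \<and>
        short_exact (carrier (comod_ehom R A F'' I)) (\<lambda>\<phi> i. compose (carrier F) (\<phi> i) v)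
                    (carrier (comod_ehom R A F I)) (\<lambda>\<phi> i. compose (carrier F') (\<phi> i) u)
                    (carrier (comod_ehom R A F' I)) \<zero>\<^bsub>comod_ehom R A F' I\<^esub>)"

record ('r, 'a, 'm) resolution =
  aug :: "'m \<Rightarrow> 'm"
  res_obj :: "nat \<Rightarrow> ('r, 'a, 'm) dcomod"
  res_diff :: "nat \<Rightarrow> 'm \<Rightarrow> 'm"

definition enriched_injective_resolution ::
    "('r, 'z) dring_scheme \<Rightarrow> ('r, 'a, 'y) dhopf_scheme \<Rightarrow> ('r, 'a, 'm) dcomod \<Rightarrow>
     ('r, 'a, 'm) resolution \<Rightarrow> bool" where
  "enriched_injective_resolution R A F I \<longleftrightarrow>
     (\<forall>n. enriched_injective R A (res_obj I n)) \<and>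
     aug I \<in> comod_hom R A F (res_obj I 0) \<and>
     (\<forall>n. res_diff I n \<in> comod_hom R A (res_obj I n) (res_obj I (Suc n))) \<and>
     inj_on (aug I) (carrier F) \<and>
     aug I ` carrier F = {x \<in> carrier (res_obj I 0). res_diff I 0 x = \<zero>\<^bsub>res_obj I 1\<^esub>} \<and>
     (\<forall>n. res_diff I n ` carrier (res_obj I n) =
          {x \<in> carrier (res_obj I (Suc n)). res_diff I (Suc n) x = \<zero>\<^bsub>res_obj I (Suc (Suc n))\<^esub>})"


section \<open>Cohomology of complexes of difference modules\<close>

definition cocycles :: "(nat \<Rightarrow> ('r, 'x) dmod) \<Rightarrow> (nat \<Rightarrow> 'x \<Rightarrow> 'x) \<Rightarrow> nat \<Rightarrow> 'x set" where
  "cocycles C d n = {x \<in> carrier (C n). d n x = \<zero>\<^bsub>C (Suc n)\<^esub>}"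

definition coboundaries :: "(nat \<Rightarrow> ('r, 'x) dmod) \<Rightarrow> (nat \<Rightarrow> 'x \<Rightarrow> 'x) \<Rightarrow> nat \<Rightarrow> 'x set" where
  "coboundaries C d n =
     (case n of 0 \<Rightarrow> {\<zero>\<^bsub>C 0\<^esub>} | Suc m \<Rightarrow> d m ` carrier (C m))"

text \<open>The map on cosets modulo \<open>B \<subseteq> N\<close> induced by \<open>f\<close>.\<close>

definition coset_map :: "('r, 'y, 'w) module_scheme \<Rightarrow> 'y set \<Rightarrow> ('x \<Rightarrow> 'y) \<Rightarrow> 'x set \<Rightarrow> 'y set" where
  "coset_map N B f X = (\<Union>x\<in>X. B +>\<^bsub>N\<^esub> f x)"

definition cohomology ::
    "(nat \<Rightarrow> ('r, 'x) dmod) \<Rightarrow> (nat \<Rightarrow> 'x \<Rightarrow> 'x) \<Rightarrow> nat \<Rightarrow> ('r, 'x set) dmod" where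
  "cohomology C d n =
     (let B = coboundaries C d n in
      \<lparr>carrier = (\<lambda>x. B +>\<^bsub>C n\<^esub> x) ` cocycles C d n,
       monoid.mult = undefined, one = undefined,
       ring.zero = B,
       ring.add = (\<lambda>X Y. X <+>\<^bsub>C n\<^esub> Y),
       smult = (\<lambda>r. coset_map (C n) B (\<lambda>x. r \<odot>\<^bsub>C n\<^esub> x)),
       dsigma = coset_map (C n) B (dsigma (C n))\<rparr>)"


section \<open>Enriched functors and their derived functors\<close>

text \<open>Data of an enriched functor on difference comodules with values in difference modules:
  objects, and the action \<open>Comod(F, F') \<rightarrow> [T F, T F']\<close> on hom objects. An ordinary morphism
  \<open>f\<close> is the constant sequence in \<open>Comod(F, F')\<close>, and \<open>T f\<close> is the entry with index \<open>0\<close> of its image.\<close>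

record ('r, 'a, 'm, 'x) efunctor =
  on_obj :: "('r, 'a, 'm) dcomod \<Rightarrow> ('r, 'x) dmod"
  on_hom :: "('r, 'a, 'm) dcomod \<Rightarrow> ('r, 'a, 'm) dcomod \<Rightarrow> (nat \<Rightarrow> 'm \<Rightarrow> 'm) \<Rightarrow> nat \<Rightarrow> 'x \<Rightarrow> 'x"

definition applied_complex ::
    "('r, 'a, 'm, 'x) efunctor \<Rightarrow> ('r, 'a, 'm) resolution \<Rightarrow> nat \<Rightarrow> ('r, 'x) dmod" where
  "applied_complex T I n = on_obj T (res_obj I n)"

definition applied_diff ::
    "('r, 'a, 'm, 'x) efunctor \<Rightarrow> ('r, 'a, 'm) resolution \<Rightarrow> nat \<Rightarrow> 'x \<Rightarrow> 'x" where
  "applied_diff T I n = on_hom T (res_obj I n) (res_obj I (Suc n)) (\<lambda>_. res_diff I n) 0"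

definition derived_obj ::
    "('r, 'a, 'm, 'x) efunctor \<Rightarrow> ('r, 'a, 'm) resolution \<Rightarrow> nat \<Rightarrow> ('r, 'x set) dmod" where
  "derived_obj T I n = cohomology (applied_complex T I) (applied_diff T I) n"

text \<open>Lifts of \<open>\<phi> \<in> Comod(F, F')\<close> to sequences of chain maps between resolutions \<open>I\<close> and \<open>I'\<close>.\<close>

definition resolution_lifts ::
    "('r, 'z) dring_scheme \<Rightarrow> ('r, 'a, 'y) dhopf_scheme \<Rightarrow> ('r, 'a, 'm) dcomod \<Rightarrow>
     ('r, 'a, 'm) resolution \<Rightarrow> ('r, 'a, 'm) resolution \<Rightarrow> (nat \<Rightarrow> 'm \<Rightarrow> 'm) \<Rightarrow>
     (nat \<Rightarrow> nat \<Rightarrow> 'm \<Rightarrow> 'm) set" where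
  "resolution_lifts R A F I I' \<phi> =
     {\<psi>. (\<forall>n. \<psi> n \<in> carrier (comod_ehom R A (res_obj I n) (res_obj I' n))) \<and>
          (\<forall>i. \<forall>x\<in>carrier F. \<psi> 0 i (aug I x) = aug I' (\<phi> i x)) \<and>
          (\<forall>n i. \<forall>x\<in>carrier (res_obj I n).
             \<psi> (Suc n) i (res_diff I n x) = res_diff I' n (\<psi> n i x))}"

text \<open>The action of \<open>\<phi> \<in> Comod(F, F')\<close> on derived functors: the map on cohomology induced by any
  lift of \<open>\<phi>\<close> (the common value over all lifts).\<close>

definition derived_act ::
    "('r, 'z) dring_scheme \<Rightarrow> ('r, 'a, 'y) dhopf_scheme \<Rightarrow> ('r, 'a, 'm, 'x) efunctor \<Rightarrow>
     ('r, 'a, 'm) dcomod \<Rightarrow> ('r, 'a, 'm) resolution \<Rightarrow> ('r, 'a, 'm) resolution \<Rightarrow> nat \<Rightarrow>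
     (nat \<Rightarrow> 'm \<Rightarrow> 'm) \<Rightarrow> nat \<Rightarrow> 'x set \<Rightarrow> 'x set" where
  "derived_act R A T F I I' n \<phi> i X =
     the_elem ((\<lambda>\<psi>. coset_map (applied_complex T I' n)
                       (coboundaries (applied_complex T I') (applied_diff T I') n)
                       (on_hom T (res_obj I n) (res_obj I' n) (\<psi> n) i) X)
               ` resolution_lifts R A F I I' \<phi>)"

text \<open>\<open>H\<close> is the \<open>n\<close>-th enriched derived functor of \<open>T\<close>: computed by any enriched injective
  resolutions, there are isomorphisms of difference modules \<open>H F \<cong> H\<^sup>n(T I)\<close> that are natural
  for the action of the hom objects \<open>Comod(F, F')\<close>.\<close>

definition enriched_derived_functor ::
    "('r, 'z) dring_scheme \<Rightarrow> ('r, 'a, 'y) dhopf_scheme \<Rightarrow> ('r, 'a, 'm, 'x) efunctor \<Rightarrow> nat \<Rightarrow>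
     ('r, 'a, 'm, 'h) efunctor \<Rightarrow> bool" where
  "enriched_derived_functor R A T n H \<longleftrightarrow>
     (\<exists>\<Theta>. (\<forall>F I. difference_comodule R A F \<and> enriched_injective_resolution R A F I \<longrightarrow>
              dmod_iso R (on_obj H F) (derived_obj T I n) (\<Theta> F I)) \<and>
           (\<forall>F F' I I' \<phi> i x.
              difference_comodule R A F \<and> enriched_injective_resolution R A F I \<and>
              difference_comodule R A F' \<and> enriched_injective_resolution R A F' I' \<and>
              \<phi> \<in> carrier (comod_ehom R A F F') \<and> x \<in> carrier (on_obj H F) \<longrightarrow>
              \<Theta> F' I' (on_hom H F F' \<phi> i x) = derived_act R A T F I I' n \<phi> i (\<Theta> F I x)))"


section \<open>Cohomology of difference groups and Ext\<close>

text \<open>The covariant enriched hom functor \<open>Comod(E, -)\<close>; composition in the enriched category is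
  termwise, so entry \<open>j\<close> of the image of \<open>\<phi>\<close> sends \<open>(f\<^sub>i)\<close> to \<open>(\<phi>\<^sub>i\<^sub>+\<^sub>j f\<^sub>i)\<close>.\<close>

definition ehom_functor ::
    "('r, 'z) dring_scheme \<Rightarrow> ('r, 'a, 'y) dhopf_scheme \<Rightarrow> ('r, 'a, 'e) dcomod \<Rightarrow>
     ('r, 'a, 'm, nat \<Rightarrow> 'e \<Rightarrow> 'm) efunctor" where
  "ehom_functor R A E =
     \<lparr>on_obj = (\<lambda>F. comod_ehom R A E F),
      on_hom = (\<lambda>F F' \<phi> j. \<lambda>f\<in>carrier (comod_ehom R A E F).
                (\<lambda>i. compose (carrier E) (\<phi> (i + j)) (f i)))\<rparr>"

definition hoch_complex ::
    "('r, 'z) dring_scheme \<Rightarrow> ('r, 'a, 'y) dhopf_scheme \<Rightarrow> ('r, 'a, 'm) dcomod \<Rightarrow> nat \<Rightarrow>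
     ('r, ('m, 'a) tens) dmod" where
  "hoch_complex R A F n = dtens R F A n"

definition hoch_diff ::
    "('r, 'z) dring_scheme \<Rightarrow> ('r, 'a, 'y) dhopf_scheme \<Rightarrow> ('r, 'a, 'm) dcomod \<Rightarrow> nat \<Rightarrow>
     ('m, 'a) tens \<Rightarrow> ('m, 'a) tens" where
  "hoch_diff R A F n X =
     (let C = tens R F A (Suc n) in
      coact_first R F A (coact F) n X
      \<oplus>\<^bsub>C\<^esub> (\<Oplus>\<^bsub>C\<^esub>i\<in>{1..n}. [((-1 :: int) ^ i)] \<cdot>\<^bsub>C\<^esub> comult_at R F A (comult A) n (i - 1) X)
      \<oplus>\<^bsub>C\<^esub> [((-1 :: int) ^ (n + 1))] \<cdot>\<^bsub>C\<^esub>
            tens_ext C (\<lambda>(f, as). pure_tens R F A f (as @ [\<one>\<^bsub>A\<^esub>])) X)"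

text \<open>The enriched functor \<open>H\<^sup>n(G, -)\<close>; entry \<open>i\<close> of the image of \<open>\<phi>\<close> is induced by
  \<open>\<phi>\<^sub>i \<otimes> id \<otimes> \<dots> \<otimes> id\<close>.\<close>

definition group_cohomology ::
    "('r, 'z) dring_scheme \<Rightarrow> ('r, 'a, 'y) dhopf_scheme \<Rightarrow> nat \<Rightarrow>
     ('r, 'a, 'm, ('m, 'a) tens set) efunctor" where
  "group_cohomology R A n =
     \<lparr>on_obj = (\<lambda>F. cohomology (hoch_complex R A F) (hoch_diff R A F) n),
      on_hom = (\<lambda>F F' \<phi> i.
        \<lambda>X\<in>carrier (cohomology (hoch_complex R A F) (hoch_diff R A F) n).
          coset_map (hoch_complex R A F' n)
            (coboundaries (hoch_complex R A F') (hoch_diff R A F') n)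
            (tens_map R F' A n (\<phi> i)) X)\<rparr>"

end

theory Submission
  imports Defs
begin

text \<open>For an enriched injective resolution \<open>F \<rightarrow> I\<^sup>\<bullet>\<close>, consider the double complex of the Hochschild
  complexes \<open>C\<^sup>p(G, I\<^sup>q)\<close>. The edge \<open>q = -1\<close> is \<open>C\<^sup>\<bullet>(G, F)\<close> and the edge \<open>p = -1\<close> is the complex of
  invariants of \<open>I\<^sup>\<bullet>\<close>. Since \<open>A\<close> is flat, tensoring the resolution with powers of \<open>A\<close> keeps it
  exact. An enriched injective \<open>I\<close> is a comodule retract of the cofree comodule \<open>I \<otimes> A\<close>, because the
  coaction \<open>I \<rightarrow> I \<otimes> A\<close> is injective and an isomorphic copy of \<open>I \<otimes> A\<close> lies in the universe, which is
  infinite; the retraction yields a contracting homotopy of \<open>C\<^sup>\<bullet>(G, I)\<close> in positive degrees. Hence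
  all other rows and columns are exact, and the two edges have the same cohomology. The isomorphism
  is given by zigzags through the double complex, an additive relation that depends on no choices,
  so it commutes with scalars, with \<open>\<sigma>\<close>, and with every component of a morphism of the enriched
  category. Finally, both \<open>H\<^sup>0(G, -)\<close> and \<open>Comod(A(S), -)\<close> are the functor of invariants: an element
  of the latter is determined by its value \<open>m\<close> at \<open>(0, 1)\<close>, its entry \<open>i\<close> being \<open>r \<mapsto> r \<sigma>\<^sup>i(m)\<close>.\<close>

section \<open>Maps out of tensor products\<close>

text \<open>Two obstacles shape the argument. Flatness and injectivity are only tested on objects
  with carrier in \<open>'u\<close>, whereas tensor products and cofree comodules live in
  \<open>('u, 'u) tens\<close>. They are moved into \<open>'u\<close> by an injection before either
  hypothesis is applied, and cokernels are built inside \<open>'u\<close>; the notion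
  \<open>is_quot\<close> covers both constructions. Second, multiplication by a scalar, \<sigma> and
  the components of an enriched morphism are in general not morphisms of difference comodules: the
  first and the last need not commute with \<sigma>, and \<sigma> itself is only semilinear. A
  dimension shift would call for connecting maps natural in all three senses. Here naturality is
  proved once, for families of semilinear maps that respect the coactions (\<open>compat\<close>,
  \<open>hrel_map\<close>), because any family commuting with both differentials maps zigzags to
  zigzags. Finally, \<partial>\<partial> = 0 is not obtained by cancelling terms of a double sum:
  factors are kept in lists, and the differential is analysed by splitting off the leading
  factor.\<close>

definition additive_map :: "('x, 'b) ring_scheme \<Rightarrow> ('y, 'c) ring_scheme \<Rightarrow> ('x \<Rightarrow> 'y) \<Rightarrow> bool" where
  "additive_map X Y f \<longleftrightarrow> f \<in> carrier X \<rightarrow> carrier Y \<and>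
     (\<forall>x\<in>carrier X. \<forall>y\<in>carrier X. f (x \<oplus>\<^bsub>X\<^esub> y) = f x \<oplus>\<^bsub>Y\<^esub> f y)"

lemma additive_mapI:
  "(\<And>x. x \<in> carrier X \<Longrightarrow> f x \<in> carrier Y) \<Longrightarrow>
   (\<And>x y. x \<in> carrier X \<Longrightarrow> y \<in> carrier X \<Longrightarrow> f (x \<oplus>\<^bsub>X\<^esub> y) = f x \<oplus>\<^bsub>Y\<^esub> f y) \<Longrightarrow> additive_map X Y f"
  by (auto simp: additive_map_def)

lemma additive_map_closed: "additive_map X Y f \<Longrightarrow> x \<in> carrier X \<Longrightarrow> f x \<in> carrier Y"
  by (auto simp: additive_map_def)

lemma additive_map_add:
  "additive_map X Y f \<Longrightarrow> x \<in> carrier X \<Longrightarrow> y \<in> carrier X \<Longrightarrow> f (x \<oplus>\<^bsub>X\<^esub> y) = f x \<oplus>\<^bsub>Y\<^esub> f y"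
  by (auto simp: additive_map_def)

lemma additive_map_hom: "additive_map X Y f \<longleftrightarrow> f \<in> hom (add_monoid X) (add_monoid Y)"
  by (auto simp: additive_map_def hom_def)

lemma additive_map_group_hom:
  assumes "abelian_group X" "abelian_group Y" "additive_map X Y f"
  shows "group_hom (add_monoid X) (add_monoid Y) f"
  using assms by (auto simp: additive_map_hom group_hom_def group_hom_axioms_def intro: abelian_group.a_group)

lemma additive_map_zero:
  assumes "abelian_group X" "abelian_group Y" "additive_map X Y f"
  shows "f \<zero>\<^bsub>X\<^esub> = \<zero>\<^bsub>Y\<^esub>"
  using group_hom.hom_one[OF additive_map_group_hom[OF assms]] by simp

lemma additive_map_neg:
  assumes "abelian_group X" "abelian_group Y" "additive_map X Y f" "x \<in> carrier X"
  shows "f (\<ominus>\<^bsub>X\<^esub> x) = \<ominus>\<^bsub>Y\<^esub> f x"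
  using group_hom.hom_inv[OF additive_map_group_hom[OF assms(1-3)]] assms(4)
  by (simp add: a_inv_def)

lemma additive_map_minus:
  assumes "abelian_group X" "abelian_group Y" "additive_map X Y f" "x \<in> carrier X" "y \<in> carrier X"
  shows "f (x \<ominus>\<^bsub>X\<^esub> y) = f x \<ominus>\<^bsub>Y\<^esub> f y"
  using assms
  by (simp add: a_minus_def additive_map_add additive_map_neg abelian_group.a_inv_closed)

lemma additive_map_comp:
  "additive_map X Y f \<Longrightarrow> additive_map Y Z g \<Longrightarrow> additive_map X Z (\<lambda>x. g (f x))"
  by (auto simp: additive_map_def Pi_iff)

lemma additive_map_plus:
  assumes "abelian_group Y" "additive_map X Y f" "additive_map X Y g"
  shows "additive_map X Y (\<lambda>x. f x \<oplus>\<^bsub>Y\<^esub> g x)"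
proof -
  interpret abelian_group Y by fact
  show ?thesis using assms(2,3) by (auto simp: additive_map_def Pi_iff a_ac)
qed

lemma additive_map_minus_fun:
  assumes "abelian_group Y" "additive_map X Y f" "additive_map X Y g"
  shows "additive_map X Y (\<lambda>x. f x \<ominus>\<^bsub>Y\<^esub> g x)"
proof -
  interpret abelian_group Y by fact
  show ?thesis using assms(2,3)
    by (auto simp: additive_map_def Pi_iff a_minus_def minus_add a_ac)
qed

lemma additive_map_zero_fun:
  assumes "abelian_group Y" shows "additive_map X Y (\<lambda>x. \<zero>\<^bsub>Y\<^esub>)"
proof -
  interpret abelian_group Y by fact
  show ?thesis by (auto simp: additive_map_def)
qed

lemma hom_finsum:
  assumes "abelian_group X" "abelian_group Y" "additive_map X Y f" "finite S"
    "\<And>i. i \<in> S \<Longrightarrow> g i \<in> carrier X"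
  shows "f (\<Oplus>\<^bsub>X\<^esub>i\<in>S. g i) = (\<Oplus>\<^bsub>Y\<^esub>i\<in>S. f (g i))"
proof -
  interpret X: abelian_group X by fact
  interpret Y: abelian_group Y by fact
  show ?thesis using assms(4,5)
    by (induction S rule: finite_induct)
      (auto simp: additive_map_zero[OF assms(1-3)] additive_map_add[OF assms(3)] Pi_iff
        additive_map_closed[OF assms(3)])
qed

text \<open>Slots are addressed by cutting the list as \<open>xs @ a # ys\<close> instead of by
  index and update as in \<open>tens_rels\<close>, so that for a concrete \<open>g\<close> the
  conditions follow by rewriting lists. As in the relations, scalars only pass between the first
  factor and a slot.\<close>

definition balanced ::
    "('r, 'z) ring_scheme \<Rightarrow> ('r, 'm, 'x) module_scheme \<Rightarrow> ('r, 'a, 'y) module_scheme \<Rightarrow> nat \<Rightarrow>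
     ('b, 'w) ring_scheme \<Rightarrow> ('m \<Rightarrow> 'a list \<Rightarrow> 'b) \<Rightarrow> bool" where
  "balanced R M A n B g \<longleftrightarrow>
     (\<forall>m\<in>carrier M. \<forall>as. set as \<subseteq> carrier A \<longrightarrow> length as = n \<longrightarrow> g m as \<in> carrier B) \<and>
     (\<forall>m\<in>carrier M. \<forall>m'\<in>carrier M. \<forall>as. set as \<subseteq> carrier A \<longrightarrow> length as = n \<longrightarrow>
        g (m \<oplus>\<^bsub>M\<^esub> m') as = g m as \<oplus>\<^bsub>B\<^esub> g m' as) \<and>
     (\<forall>m\<in>carrier M. \<forall>xs ys. \<forall>a\<in>carrier A. \<forall>b\<in>carrier A.
        set xs \<subseteq> carrier A \<longrightarrow> set ys \<subseteq> carrier A \<longrightarrow> length xs + Suc (length ys) = n \<longrightarrow>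
        g m (xs @ (a \<oplus>\<^bsub>A\<^esub> b) # ys) = g m (xs @ a # ys) \<oplus>\<^bsub>B\<^esub> g m (xs @ b # ys)) \<and>
     (\<forall>m\<in>carrier M. \<forall>xs ys. \<forall>a\<in>carrier A. \<forall>r\<in>carrier R.
        set xs \<subseteq> carrier A \<longrightarrow> set ys \<subseteq> carrier A \<longrightarrow> length xs + Suc (length ys) = n \<longrightarrow>
        g (r \<odot>\<^bsub>M\<^esub> m) (xs @ a # ys) = g m (xs @ (r \<odot>\<^bsub>A\<^esub> a) # ys))"

lemma balancedI:
  assumes "\<And>m as. m \<in> carrier M \<Longrightarrow> set as \<subseteq> carrier A \<Longrightarrow> length as = n \<Longrightarrow> g m as \<in> carrier B"
    and "\<And>m m' as. m \<in> carrier M \<Longrightarrow> m' \<in> carrier M \<Longrightarrow> set as \<subseteq> carrier A \<Longrightarrow> length as = n \<Longrightarrow>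
        g (m \<oplus>\<^bsub>M\<^esub> m') as = g m as \<oplus>\<^bsub>B\<^esub> g m' as"
    and "\<And>m xs ys a b. m \<in> carrier M \<Longrightarrow> a \<in> carrier A \<Longrightarrow> b \<in> carrier A \<Longrightarrow>
        set xs \<subseteq> carrier A \<Longrightarrow> set ys \<subseteq> carrier A \<Longrightarrow> length xs + Suc (length ys) = n \<Longrightarrow>
        g m (xs @ (a \<oplus>\<^bsub>A\<^esub> b) # ys) = g m (xs @ a # ys) \<oplus>\<^bsub>B\<^esub> g m (xs @ b # ys)"
    and "\<And>m xs ys a r. m \<in> carrier M \<Longrightarrow> a \<in> carrier A \<Longrightarrow> r \<in> carrier R \<Longrightarrow>
        set xs \<subseteq> carrier A \<Longrightarrow> set ys \<subseteq> carrier A \<Longrightarrow> length xs + Suc (length ys) = n \<Longrightarrow>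
        g (r \<odot>\<^bsub>M\<^esub> m) (xs @ a # ys) = g m (xs @ (r \<odot>\<^bsub>A\<^esub> a) # ys)"
  shows "balanced R M A n B g"
  using assms unfolding balanced_def by blast

lemma add_pow_int_0 [simp]: "[(0::int)] \<cdot>\<^bsub>G\<^esub> x = \<zero>\<^bsub>G\<^esub>"
  by (simp add: add_pow_def)

text \<open>The formula inside \<open>tens_ext\<close> is the additive extension of \<open>g\<close>
  from generators to the free abelian group.\<close>

lemma finsum_frag_hom:
  assumes "abelian_group B" "\<And>p. p \<in> S \<Longrightarrow> g p \<in> carrier B"
  shows "(\<lambda>x. \<Oplus>\<^bsub>B\<^esub>p\<in>Poly_Mapping.keys x. [(Poly_Mapping.lookup x p)] \<cdot>\<^bsub>B\<^esub> g p)
     \<in> hom (free_Abelian_group S) (add_monoid B)"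
proof -
  interpret abelian_group B by fact
  \<comment> \<open>Coefficients may cancel, so the support of \<open>x + y\<close> can be smaller
    than the union of the supports. All three sums are taken over that union, where a missing key
    has coefficient 0.\<close>
  have ext: "(\<Oplus>\<^bsub>B\<^esub>p\<in>Poly_Mapping.keys x. [(Poly_Mapping.lookup x p)] \<cdot>\<^bsub>B\<^esub> g p)
      = (\<Oplus>\<^bsub>B\<^esub>p\<in>T. [(Poly_Mapping.lookup x p)] \<cdot>\<^bsub>B\<^esub> g p)"
    if "Poly_Mapping.keys x \<subseteq> T" "T \<subseteq> S" "finite T" for x :: "'c \<Rightarrow>\<^sub>0 int" and T
    using that assms(2)
    by (intro add.finprod_mono_neutral_cong_left)
       (auto simp: in_keys_iff subset_iff)
  show ?thesis
  proof (rule homI)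
    fix x assume "x \<in> carrier (free_Abelian_group S)"
    then show "(\<Oplus>\<^bsub>B\<^esub>p\<in>Poly_Mapping.keys x. [(Poly_Mapping.lookup x p)] \<cdot>\<^bsub>B\<^esub> g p) \<in> carrier (add_monoid B)"
      using assms(2) by (auto intro!: finsum_closed)
  next
    fix x y assume xy: "x \<in> carrier (free_Abelian_group S)" "y \<in> carrier (free_Abelian_group S)"
    let ?T = "Poly_Mapping.keys x \<union> Poly_Mapping.keys y"
    have T: "?T \<subseteq> S" "finite ?T" using xy by auto
    have "Poly_Mapping.keys (x + y) \<subseteq> ?T" by (rule keys_add)
    then have "(\<Oplus>\<^bsub>B\<^esub>p\<in>Poly_Mapping.keys (x + y). [(Poly_Mapping.lookup (x + y) p)] \<cdot>\<^bsub>B\<^esub> g p)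
       = (\<Oplus>\<^bsub>B\<^esub>p\<in>?T. [(Poly_Mapping.lookup (x + y) p)] \<cdot>\<^bsub>B\<^esub> g p)"
      using T by (intro ext) auto
    also have "\<dots> = (\<Oplus>\<^bsub>B\<^esub>p\<in>?T. [(Poly_Mapping.lookup x p)] \<cdot>\<^bsub>B\<^esub> g p \<oplus>\<^bsub>B\<^esub> [(Poly_Mapping.lookup y p)] \<cdot>\<^bsub>B\<^esub> g p)"
      using T assms(2)
      by (intro finsum_cong') (auto simp: lookup_add add.int_pow_mult subset_iff)
    also have "\<dots> = (\<Oplus>\<^bsub>B\<^esub>p\<in>?T. [(Poly_Mapping.lookup x p)] \<cdot>\<^bsub>B\<^esub> g p) \<oplus>\<^bsub>B\<^esub> (\<Oplus>\<^bsub>B\<^esub>p\<in>?T. [(Poly_Mapping.lookup y p)] \<cdot>\<^bsub>B\<^esub> g p)"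
      using T assms(2)
      by (intro finsum_addf) (auto simp: subset_iff)
    finally show "(\<Oplus>\<^bsub>B\<^esub>p\<in>Poly_Mapping.keys (x \<otimes>\<^bsub>free_Abelian_group S\<^esub> y). [(Poly_Mapping.lookup (x \<otimes>\<^bsub>free_Abelian_group S\<^esub> y) p)] \<cdot>\<^bsub>B\<^esub> g p) =
        (\<Oplus>\<^bsub>B\<^esub>p\<in>Poly_Mapping.keys x. [(Poly_Mapping.lookup x p)] \<cdot>\<^bsub>B\<^esub> g p) \<otimes>\<^bsub>add_monoid B\<^esub>
        (\<Oplus>\<^bsub>B\<^esub>p\<in>Poly_Mapping.keys y. [(Poly_Mapping.lookup y p)] \<cdot>\<^bsub>B\<^esub> g p)"
      using ext[OF Un_upper1 T] ext[OF Un_upper2 T] by simp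
  qed
qed

text \<open>The same group occurs in records of different types; its structure is carried over
  through the three fields that determine it.\<close>

lemma abelian_group_of_comm_group:
  assumes "comm_group Q" "carrier X = carrier Q" "\<zero>\<^bsub>X\<^esub> = \<one>\<^bsub>Q\<^esub>" "ring.add X = monoid.mult Q"
  shows "abelian_group X"
proof -
  interpret comm_group Q by fact
  show ?thesis
    using assms(2-4) by (intro abelian_groupI) (auto simp: m_ac intro: l_inv_ex)
qed

lemma free_Abelian_add_closed:
  "x \<in> carrier (free_Abelian_group S) \<Longrightarrow> y \<in> carrier (free_Abelian_group S) \<Longrightarrow>
   x + y \<in> carrier (free_Abelian_group S)"
  using keys_add[of x y] by auto

lemma free_Abelian_diff_closed:
  "x \<in> carrier (free_Abelian_group S) \<Longrightarrow> y \<in> carrier (free_Abelian_group S) \<Longrightarrow>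
   x - y \<in> carrier (free_Abelian_group S)"
  using keys_diff[of x y] by auto

section \<open>Tensor products as quotients of free abelian groups\<close>

locale tensor_base =
  fixes R :: "('r, 'z) ring_scheme" and A :: "('r, 'a, 'y) module_scheme"
  assumes module_A: "Module.module R A"
begin

lemma ring_R: "cring R" by (rule module.axioms(1)[OF module_A])

lemma tens_simps:
  "carrier (tens R M A n) = carrier (free_Abelian_group (tens_gens M A n) Mod tens_sub R M A n)"
  "\<zero>\<^bsub>tens R M A n\<^esub> = \<one>\<^bsub>free_Abelian_group (tens_gens M A n) Mod tens_sub R M A n\<^esub>"
  "x \<oplus>\<^bsub>tens R M A n\<^esub> y = x \<otimes>\<^bsub>free_Abelian_group (tens_gens M A n) Mod tens_sub R M A n\<^esub> y"
  by (simp_all add: tens_def tens_group_def Let_def)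

context
  fixes M :: "('r, 'm, 'x) module_scheme" and n :: nat
  assumes M: "Module.module R M"
begin

lemma tens_rels_subset: "tens_rels R M A n \<subseteq> carrier (free_Abelian_group (tens_gens M A n))"
proof
  interpret M: Module.module R M by (rule M)
  interpret A: Module.module R A by (rule module_A)
  fix x assume "x \<in> tens_rels R M A n"
  then show "x \<in> carrier (free_Abelian_group (tens_gens M A n))"
    unfolding tens_rels_def
  proof (elim UnE CollectE exE conjE)
    fix m m' as
    assume "x = frag_of (m \<oplus>\<^bsub>M\<^esub> m', as) - frag_of (m, as) - frag_of (m', as)"
      "(m, as) \<in> tens_gens M A n" "m' \<in> carrier M"
    then show ?thesis
      by (auto intro!: free_Abelian_diff_closed simp del: carrier_free_Abelian_group_iff
          simp: frag_of_in_free_Abelian_group tens_gens_def)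
  next
    fix m as i a
    assume *: "x = frag_of (m, as[i := as ! i \<oplus>\<^bsub>A\<^esub> a]) - frag_of (m, as) - frag_of (m, as[i := a])"
      "(m, as) \<in> tens_gens M A n" "i < n" "a \<in> carrier A"
    then have "as ! i \<in> carrier A" by (auto simp: tens_gens_def subset_iff)
    then have "(m, as[i := as ! i \<oplus>\<^bsub>A\<^esub> a]) \<in> tens_gens M A n" "(m, as[i := a]) \<in> tens_gens M A n"
      using * by (simp_all add: tens_gens_def set_update_subsetI)
    then show ?thesis using *
      by (auto intro!: free_Abelian_diff_closed simp del: carrier_free_Abelian_group_iff
          simp: frag_of_in_free_Abelian_group)
  next
    fix m as i r
    assume *: "x = frag_of (r \<odot>\<^bsub>M\<^esub> m, as) - frag_of (m, as[i := r \<odot>\<^bsub>A\<^esub> as ! i])"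
      "(m, as) \<in> tens_gens M A n" "i < n" "r \<in> carrier R"
    then have "as ! i \<in> carrier A" by (auto simp: tens_gens_def subset_iff)
    then have "(r \<odot>\<^bsub>M\<^esub> m, as) \<in> tens_gens M A n" "(m, as[i := r \<odot>\<^bsub>A\<^esub> as ! i]) \<in> tens_gens M A n"
      using * by (simp_all add: tens_gens_def set_update_subsetI)
    then show ?thesis using *
      by (auto intro!: free_Abelian_diff_closed simp del: carrier_free_Abelian_group_iff
          simp: frag_of_in_free_Abelian_group)
  qed
qed

lemma tens_sub_normal: "tens_sub R M A n \<lhd> free_Abelian_group (tens_gens M A n)"
  unfolding tens_sub_def
  by (intro comm_group.subgroup_imp_normal abelian_free_Abelian_group
      group.generate_is_subgroup group_free_Abelian_group tens_rels_subset)

lemma tens_comm_group: "comm_group (free_Abelian_group (tens_gens M A n) Mod tens_sub R M A n)"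
  by (intro comm_group.abelian_FactGroup abelian_free_Abelian_group normal_imp_subgroup tens_sub_normal)

lemma abelian_group_tens: "abelian_group (tens R M A n)"
  by (rule abelian_group_of_comm_group[OF tens_comm_group]) (simp_all add: tens_simps fun_eq_iff del: mult_FactGroup one_FactGroup)

lemma coset_add:
  assumes "x \<in> carrier (free_Abelian_group (tens_gens M A n))" "y \<in> carrier (free_Abelian_group (tens_gens M A n))"
  shows "tens_sub R M A n #>\<^bsub>free_Abelian_group (tens_gens M A n)\<^esub> (x + y) =
    (tens_sub R M A n #>\<^bsub>free_Abelian_group (tens_gens M A n)\<^esub> x) \<oplus>\<^bsub>tens R M A n\<^esub>
    (tens_sub R M A n #>\<^bsub>free_Abelian_group (tens_gens M A n)\<^esub> y)"
  using normal.rcos_sum[OF tens_sub_normal assms] by (simp add: tens_simps FactGroup_def)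

lemma coset_hom:
  "(\<lambda>x. tens_sub R M A n #>\<^bsub>free_Abelian_group (tens_gens M A n)\<^esub> x)
    \<in> hom (free_Abelian_group (tens_gens M A n)) (add_monoid (tens R M A n))"
  using normal.r_coset_hom_Mod[OF tens_sub_normal] by (simp add: hom_def tens_simps)

lemma coset_rel:
  assumes "x - y \<in> tens_rels R M A n" "x \<in> carrier (free_Abelian_group (tens_gens M A n))"
    "y \<in> carrier (free_Abelian_group (tens_gens M A n))"
  shows "tens_sub R M A n #>\<^bsub>free_Abelian_group (tens_gens M A n)\<^esub> x =
     tens_sub R M A n #>\<^bsub>free_Abelian_group (tens_gens M A n)\<^esub> y"
proof (rule group.repr_independence[OF group_free_Abelian_group, symmetric])
  have "x - y \<in> tens_sub R M A n" using assms(1) by (auto simp: tens_sub_def intro: generate.incl)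
  then show "x \<in> tens_sub R M A n #>\<^bsub>free_Abelian_group (tens_gens M A n)\<^esub> y"
    by (auto simp: r_coset_def intro!: bexI[of _ "x - y"])
  show "y \<in> carrier (free_Abelian_group (tens_gens M A n))" by fact
  show "subgroup (tens_sub R M A n) (free_Abelian_group (tens_gens M A n))"
    by (rule normal_imp_subgroup[OF tens_sub_normal])
qed

lemma pure_tens_closed:
  assumes "m \<in> carrier M" "set as \<subseteq> carrier A" "length as = n"
  shows "pure_tens R M A m as \<in> carrier (tens R M A n)"
  using coset_hom assms by (auto simp: pure_tens_def hom_def Pi_iff tens_gens_def)

lemma pure_tens_add:
  assumes "m \<in> carrier M" "m' \<in> carrier M" "set as \<subseteq> carrier A" "length as = n"
  shows "pure_tens R M A (m \<oplus>\<^bsub>M\<^esub> m') as = pure_tens R M A m as \<oplus>\<^bsub>tens R M A n\<^esub> pure_tens R M A m' as"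
proof -
  interpret M: Module.module R M by (rule M)
  let ?G = "free_Abelian_group (tens_gens M A n)"
  have c: "frag_of (m, as) \<in> carrier ?G" "frag_of (m', as) \<in> carrier ?G" "frag_of (m \<oplus>\<^bsub>M\<^esub> m', as) \<in> carrier ?G"
    using assms by (auto simp: tens_gens_def)
  have "frag_of (m \<oplus>\<^bsub>M\<^esub> m', as) - (frag_of (m, as) + frag_of (m', as)) \<in> tens_rels R M A n"
    unfolding tens_rels_def using assms by (auto simp: tens_gens_def diff_diff_add)
  from coset_rel[OF this c(3) free_Abelian_add_closed[OF c(1,2)]] show ?thesis
    using coset_add[OF c(1,2)] assms by (simp add: pure_tens_def)
qed

lemma pure_tens_add_slot:
  assumes "m \<in> carrier M" "a \<in> carrier A" "b \<in> carrier A" "set xs \<subseteq> carrier A" "set ys \<subseteq> carrier A"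
    "length xs + Suc (length ys) = n"
  shows "pure_tens R M A m (xs @ (a \<oplus>\<^bsub>A\<^esub> b) # ys) =
     pure_tens R M A m (xs @ a # ys) \<oplus>\<^bsub>tens R M A n\<^esub> pure_tens R M A m (xs @ b # ys)"
proof -
  interpret A: Module.module R A by (rule module_A)
  let ?G = "free_Abelian_group (tens_gens M A n)"
  have c: "frag_of (m, xs @ a # ys) \<in> carrier ?G" "frag_of (m, xs @ b # ys) \<in> carrier ?G"
    "frag_of (m, xs @ (a \<oplus>\<^bsub>A\<^esub> b) # ys) \<in> carrier ?G"
    using assms by (auto simp: tens_gens_def)
  have "\<exists>m' as i a'. frag_of (m, xs @ (a \<oplus>\<^bsub>A\<^esub> b) # ys) - (frag_of (m, xs @ a # ys) + frag_of (m, xs @ b # ys)) =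
     frag_of (m', as[i := as ! i \<oplus>\<^bsub>A\<^esub> a']) - frag_of (m', as) - frag_of (m', as[i := a']) \<and>
     (m', as) \<in> tens_gens M A n \<and> i < n \<and> a' \<in> carrier A"
    using assms
    by (intro exI[of _ m] exI[of _ "xs @ a # ys"] exI[of _ "length xs"] exI[of _ b])
      (auto simp: tens_gens_def nth_append diff_diff_add)
  then have "frag_of (m, xs @ (a \<oplus>\<^bsub>A\<^esub> b) # ys) - (frag_of (m, xs @ a # ys) + frag_of (m, xs @ b # ys)) \<in> tens_rels R M A n"
    unfolding tens_rels_def by blast
  from coset_rel[OF this c(3) free_Abelian_add_closed[OF c(1,2)]] show ?thesis
    using coset_add[OF c(1,2)] assms by (simp add: pure_tens_def)
qed

lemma pure_tens_smult_slot:
  assumes "m \<in> carrier M" "a \<in> carrier A" "r \<in> carrier R" "set xs \<subseteq> carrier A" "set ys \<subseteq> carrier A"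
    "length xs + Suc (length ys) = n"
  shows "pure_tens R M A (r \<odot>\<^bsub>M\<^esub> m) (xs @ a # ys) = pure_tens R M A m (xs @ (r \<odot>\<^bsub>A\<^esub> a) # ys)"
proof -
  interpret M: Module.module R M by (rule M)
  interpret A: Module.module R A by (rule module_A)
  let ?G = "free_Abelian_group (tens_gens M A n)"
  have c: "frag_of (r \<odot>\<^bsub>M\<^esub> m, xs @ a # ys) \<in> carrier ?G" "frag_of (m, xs @ (r \<odot>\<^bsub>A\<^esub> a) # ys) \<in> carrier ?G"
    using assms by (auto simp: tens_gens_def)
  have "\<exists>m' as i r'. frag_of (r \<odot>\<^bsub>M\<^esub> m, xs @ a # ys) - frag_of (m, xs @ (r \<odot>\<^bsub>A\<^esub> a) # ys) =
      frag_of (r' \<odot>\<^bsub>M\<^esub> m', as) - frag_of (m', as[i := r' \<odot>\<^bsub>A\<^esub> as ! i]) \<and>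
     (m', as) \<in> tens_gens M A n \<and> i < n \<and> r' \<in> carrier R"
    using assms
    by (intro exI[of _ m] exI[of _ "xs @ a # ys"] exI[of _ "length xs"] exI[of _ r])
      (auto simp: tens_gens_def nth_append)
  then have "frag_of (r \<odot>\<^bsub>M\<^esub> m, xs @ a # ys) - frag_of (m, xs @ (r \<odot>\<^bsub>A\<^esub> a) # ys) \<in> tens_rels R M A n"
    unfolding tens_rels_def by blast
  from coset_rel[OF this c] show ?thesis
    using assms by (simp add: pure_tens_def)
qed

text \<open>Elementary tensors generate the tensor product, and the set on which two additive maps
  agree is closed under differences. Almost every identity between maps out of a tensor product is
  reduced to elementary tensors by this rule.\<close>

lemma tens_eqI:
  assumes "abelian_group B" "additive_map (tens R M A n) B f" "additive_map (tens R M A n) B g"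
    and eq: "\<And>m as. m \<in> carrier M \<Longrightarrow> set as \<subseteq> carrier A \<Longrightarrow> length as = n \<Longrightarrow>
      f (pure_tens R M A m as) = g (pure_tens R M A m as)"
    and X: "X \<in> carrier (tens R M A n)"
  shows "f X = g X"
proof -
  interpret T: abelian_group "tens R M A n" by (rule abelian_group_tens)
  let ?G = "free_Abelian_group (tens_gens M A n)"
  let ?c = "\<lambda>x. tens_sub R M A n #>\<^bsub>?G\<^esub> x"
  obtain x where x: "Poly_Mapping.keys x \<subseteq> tens_gens M A n" "X = ?c x"
    using X by (auto simp: tens_simps FactGroup_def RCOSETS_def)
  \<comment> \<open>The induction rule for free abelian groups builds elements by differences, so
    the coset map has to be controlled on differences and not only on sums.\<close>
  have *: "?c (x - y) = ?c x \<ominus>\<^bsub>tens R M A n\<^esub> ?c y"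
    if "Poly_Mapping.keys x \<subseteq> tens_gens M A n" "Poly_Mapping.keys y \<subseteq> tens_gens M A n" for x y
  proof -
    have d: "x - y \<in> carrier ?G" using that by (intro free_Abelian_diff_closed) auto
    have "?c x = ?c (x - y) \<oplus>\<^bsub>tens R M A n\<^esub> ?c y"
      using coset_add[OF d, of y] that by simp
    then show ?thesis
      using d that coset_hom unfolding hom_def Pi_iff
      by (simp add: T.minus_eq T.a_assoc T.r_neg)
  qed
  have cl: "?c x \<in> carrier (tens R M A n)" if "Poly_Mapping.keys x \<subseteq> tens_gens M A n" for x
    using coset_hom that by (auto simp: hom_def)
  have "f (?c x) = g (?c x)"
  proof (rule free_Abelian_group_induct[OF x(1)])
    have "?c 0 = \<zero>\<^bsub>tens R M A n\<^esub>"
      using *[of 0 0] cl[of 0] by (simp add: T.minus_eq T.r_neg)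
    then show "f (?c 0) = g (?c 0)"
      using assms(1-3) by (simp add: additive_map_zero[OF abelian_group_tens])
  next
    fix x y :: "'m \<times> 'a list \<Rightarrow>\<^sub>0 int"
    assume "Poly_Mapping.keys x \<subseteq> tens_gens M A n" "Poly_Mapping.keys y \<subseteq> tens_gens M A n"
      "f (?c x) = g (?c x)" "f (?c y) = g (?c y)"
    then show "f (?c (x - y)) = g (?c (x - y))"
      using assms(1-3) by (simp add: * additive_map_minus[OF abelian_group_tens] cl)
  next
    fix a assume "a \<in> tens_gens M A n"
    then show "f (?c (frag_of a)) = g (?c (frag_of a))"
      using eq by (auto simp: pure_tens_def tens_gens_def)
  qed
  then show ?thesis using x by simp
qed

context
  fixes B :: "('b, 'w) ring_scheme" and g :: "'m \<Rightarrow> 'a list \<Rightarrow> 'b"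
  assumes B: "abelian_group B" and g: "balanced R M A n B g"
begin

text \<open>\<open>tens_ext\<close> picks the single element of the image of a coset. The image is
  indeed a singleton, because the additive extension of a balanced map vanishes on the subgroup of
  relations.\<close>

lemma tens_ext_coset:
  assumes x: "x \<in> carrier (free_Abelian_group (tens_gens M A n))"
  shows "tens_ext B (case_prod g) (tens_sub R M A n #>\<^bsub>free_Abelian_group (tens_gens M A n)\<^esub> x)
    = (\<Oplus>\<^bsub>B\<^esub>p\<in>Poly_Mapping.keys x. [(Poly_Mapping.lookup x p)] \<cdot>\<^bsub>B\<^esub> case_prod g p)"
proof -
  interpret B: abelian_group B by (rule B)
  interpret A: Module.module R A by (rule module_A)
  interpret M: Module.module R M by (rule M)
  let ?S = "tens_gens M A n" let ?G = "free_Abelian_group ?S"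
  define h where "h x = (\<Oplus>\<^bsub>B\<^esub>p\<in>Poly_Mapping.keys x. [(Poly_Mapping.lookup x p)] \<cdot>\<^bsub>B\<^esub> case_prod g p)" for x :: "'m \<times> 'a list \<Rightarrow>\<^sub>0 int"
  have gB: "case_prod g p \<in> carrier B" if "p \<in> ?S" for p
    using that g by (auto simp: balanced_def tens_gens_def)
  have hom: "h \<in> hom ?G (add_monoid B)"
    unfolding h_def by (intro finsum_frag_hom B gB)
  interpret h: group_hom ?G "add_monoid B" h
    using hom by (simp add: group_hom_def group_hom_axioms_def B.a_group)
  have hfrag: "h (frag_of p) = case_prod g p" if "p \<in> ?S" for p
    using gB[OF that] by (simp add: h_def)
  have hadd: "h (x + y) = h x \<oplus>\<^bsub>B\<^esub> h y" if "x \<in> carrier ?G" "y \<in> carrier ?G" for x y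
    using h.hom_mult[OF that] by simp
  have hdiff: "h (x - y) = h x \<ominus>\<^bsub>B\<^esub> h y" if "x \<in> carrier ?G" "y \<in> carrier ?G" for x y
    using hadd[of x "- y"] h.hom_inv[OF that(2)] that by (simp add: a_minus_def a_inv_def)
  have hB: "h x \<in> carrier B" if "x \<in> carrier ?G" for x using h.hom_closed[OF that] by simp
  have cl: "x - y \<in> carrier ?G" if "x \<in> carrier ?G" "y \<in> carrier ?G" for x y
    using that by (rule free_Abelian_diff_closed)
  have z: "(x \<oplus>\<^bsub>B\<^esub> y) \<ominus>\<^bsub>B\<^esub> x \<ominus>\<^bsub>B\<^esub> y = \<zero>\<^bsub>B\<^esub>" if "x \<in> carrier B" "y \<in> carrier B" for x y
    using that by (simp add: B.minus_eq B.a_assoc B.r_neg B.a_comm[of x y])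
  \<comment> \<open>The three families of relations correspond to the last three clauses of
    \<open>balanced\<close>.\<close>
  have rel: "h r = \<zero>\<^bsub>B\<^esub>" if "r \<in> tens_rels R M A n" for r
    using that unfolding tens_rels_def
  proof (elim UnE CollectE exE conjE)
    fix m m' as
    assume r: "r = frag_of (m \<oplus>\<^bsub>M\<^esub> m', as) - frag_of (m, as) - frag_of (m', as)"
      and "(m, as) \<in> tens_gens M A n" "m' \<in> carrier M"
    then have *: "(m, as) \<in> ?S" "(m', as) \<in> ?S" "(m \<oplus>\<^bsub>M\<^esub> m', as) \<in> ?S" by (auto simp: tens_gens_def)
    then have "g (m \<oplus>\<^bsub>M\<^esub> m') as = g m as \<oplus>\<^bsub>B\<^esub> g m' as"
      using g by (auto simp: balanced_def tens_gens_def)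
    then show ?thesis
      using * gB[OF *(1)] gB[OF *(2)] unfolding r
      by (subst hdiff) (auto intro!: cl simp del: carrier_free_Abelian_group_iff simp: hdiff hfrag z)
  next
    fix m as i a
    assume r: "r = frag_of (m, as[i := as ! i \<oplus>\<^bsub>A\<^esub> a]) - frag_of (m, as) - frag_of (m, as[i := a])"
      and *: "(m, as) \<in> tens_gens M A n" "i < n" "a \<in> carrier A"
    \<comment> \<open>The relation updates slot \<open>i\<close>, while \<open>balanced\<close>
      speaks of a list cut in two; cutting \<open>as\<close> at \<open>i\<close> translates one form
      into the other.\<close>
    define xs ys where "xs = take i as" and "ys = drop (Suc i) as"
    define b where "b = as ! i"
    have as: "as = xs @ b # ys" "length xs = i"
      using * by (auto simp: xs_def ys_def b_def tens_gens_def id_take_nth_drop)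
    have S: "m \<in> carrier M" "set xs \<subseteq> carrier A" "set ys \<subseteq> carrier A" "b \<in> carrier A" "length xs + Suc (length ys) = n"
      using * as by (auto simp: tens_gens_def)
    have r': "r = frag_of (m, xs @ (b \<oplus>\<^bsub>A\<^esub> a) # ys) - frag_of (m, xs @ b # ys) - frag_of (m, xs @ a # ys)"
      using r as by (auto simp: nth_append)
    have **: "(m, xs @ b # ys) \<in> ?S" "(m, xs @ a # ys) \<in> ?S" "(m, xs @ (b \<oplus>\<^bsub>A\<^esub> a) # ys) \<in> ?S"
      using S *(3) by (auto simp: tens_gens_def)
    have "g m (xs @ (b \<oplus>\<^bsub>A\<^esub> a) # ys) = g m (xs @ b # ys) \<oplus>\<^bsub>B\<^esub> g m (xs @ a # ys)"
      using g S *(3) unfolding balanced_def by blast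
    then show ?thesis
      using ** gB[OF **(1)] gB[OF **(2)] unfolding r'
      by (subst hdiff) (auto intro!: cl simp del: carrier_free_Abelian_group_iff simp: hdiff hfrag z)
  next
    fix m as i s
    assume r: "r = frag_of (s \<odot>\<^bsub>M\<^esub> m, as) - frag_of (m, as[i := s \<odot>\<^bsub>A\<^esub> as ! i])"
      and *: "(m, as) \<in> tens_gens M A n" "i < n" "s \<in> carrier R"
    define xs ys where "xs = take i as" and "ys = drop (Suc i) as"
    define b where "b = as ! i"
    have as: "as = xs @ b # ys" "length xs = i"
      using * by (auto simp: xs_def ys_def b_def tens_gens_def id_take_nth_drop)
    have S: "m \<in> carrier M" "set xs \<subseteq> carrier A" "set ys \<subseteq> carrier A" "b \<in> carrier A" "length xs + Suc (length ys) = n"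
      using * as by (auto simp: tens_gens_def)
    have r': "r = frag_of (s \<odot>\<^bsub>M\<^esub> m, xs @ b # ys) - frag_of (m, xs @ (s \<odot>\<^bsub>A\<^esub> b) # ys)"
      using r as by (auto simp: nth_append)
    have **: "(s \<odot>\<^bsub>M\<^esub> m, xs @ b # ys) \<in> ?S" "(m, xs @ (s \<odot>\<^bsub>A\<^esub> b) # ys) \<in> ?S"
      using S *(3) by (auto simp: tens_gens_def)
    have "g (s \<odot>\<^bsub>M\<^esub> m) (xs @ b # ys) = g m (xs @ (s \<odot>\<^bsub>A\<^esub> b) # ys)"
      using g S *(3) unfolding balanced_def by blast
    then show ?thesis
      using ** gB[OF **(2)] unfolding r'
      by (subst hdiff) (auto simp: hfrag B.minus_eq B.r_neg)
  qed
  have sub: "h y = \<zero>\<^bsub>B\<^esub> \<and> y \<in> carrier ?G" if "y \<in> tens_sub R M A n" for y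
    using that unfolding tens_sub_def
  proof (induction y rule: generate.induct)
    case one
    then show ?case using h.hom_one by simp
  next
    case (incl r)
    then show ?case using rel tens_rels_subset by blast
  next
    case (inv r)
    then have "r \<in> carrier ?G" using tens_rels_subset by blast
    then show ?case using rel[OF inv] h.hom_inv[of r] by (simp add: B.add.inv_one)
  next
    case (eng y z)
    then show ?case using hadd[of y z] free_Abelian_add_closed[of y _ z] by auto
  qed
  have "h (y + x) = h x" if "y \<in> tens_sub R M A n" for y
    using sub[OF that] hadd[of y x] x hB[OF x] by auto
  moreover have "0 \<in> tens_sub R M A n"
    unfolding tens_sub_def using generate.one[of ?G] by simp
  ultimately have "h ` (tens_sub R M A n #>\<^bsub>?G\<^esub> x) = {h x}"
    by (fastforce simp: r_coset_def)
  then show ?thesis unfolding tens_ext_def h_def[symmetric] by (simp add: h_def)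
qed

text \<open>Together with \<open>tens_ext_pure\<close> and \<open>tens_eqI\<close> this is the
  universal property of the tensor product. Maps are handled through these three facts instead of
  through representatives in the free group.\<close>

lemma tens_ext_additive: "additive_map (tens R M A n) B (tens_ext B (case_prod g))"
proof -
  let ?S = "tens_gens M A n" let ?G = "free_Abelian_group ?S"
  define h where "h x = (\<Oplus>\<^bsub>B\<^esub>p\<in>Poly_Mapping.keys x. [(Poly_Mapping.lookup x p)] \<cdot>\<^bsub>B\<^esub> case_prod g p)" for x :: "'m \<times> 'a list \<Rightarrow>\<^sub>0 int"
  have hom: "h \<in> hom ?G (add_monoid B)"
    unfolding h_def using g by (intro finsum_frag_hom B) (auto simp: balanced_def tens_gens_def)
  have rep: "\<exists>x\<in>carrier ?G. X = tens_sub R M A n #>\<^bsub>?G\<^esub> x" if "X \<in> carrier (tens R M A n)" for X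
    using that by (auto simp: tens_simps FactGroup_def RCOSETS_def)
  show ?thesis
  proof (rule additive_mapI)
    fix X assume "X \<in> carrier (tens R M A n)"
    then show "tens_ext B (case_prod g) X \<in> carrier B"
      using rep[of X] hom by (auto simp: tens_ext_coset h_def[symmetric] hom_def)
  next
    fix X Y assume "X \<in> carrier (tens R M A n)" "Y \<in> carrier (tens R M A n)"
    then obtain x y where x: "x \<in> carrier ?G" "X = tens_sub R M A n #>\<^bsub>?G\<^esub> x"
      and y: "y \<in> carrier ?G" "Y = tens_sub R M A n #>\<^bsub>?G\<^esub> y" using rep by metis
    have "x + y \<in> carrier ?G" using x y by (blast intro: free_Abelian_add_closed)
    moreover have "h (x + y) = h x \<oplus>\<^bsub>B\<^esub> h y" using hom x y by (auto simp: hom_def)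
    ultimately show "tens_ext B (case_prod g) (X \<oplus>\<^bsub>tens R M A n\<^esub> Y) = tens_ext B (case_prod g) X \<oplus>\<^bsub>B\<^esub> tens_ext B (case_prod g) Y"
      unfolding x y coset_add[OF x(1) y(1), symmetric]
      using x(1) y(1) by (simp only: tens_ext_coset h_def[symmetric])
  qed
qed

lemma tens_ext_pure:
  assumes "m \<in> carrier M" "set as \<subseteq> carrier A" "length as = n"
  shows "tens_ext B (case_prod g) (pure_tens R M A m as) = g m as"
proof -
  interpret B: abelian_group B by (rule B)
  have "(m, as) \<in> tens_gens M A n" using assms by (auto simp: tens_gens_def)
  moreover have "g m as \<in> carrier B" using g assms by (auto simp: balanced_def)
  ultimately show ?thesis
    using assms(3)
    by (auto simp: pure_tens_def tens_ext_coset)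
qed

end

end

end

section \<open>Operations on tensors\<close>

text \<open>Covers linear maps (identity twist) and difference operators (twist
  \<open>rsigma R\<close>), so that functoriality of tensor products is proved only once.\<close>

definition semilinear ::
    "('r, 'z) ring_scheme \<Rightarrow> ('r \<Rightarrow> 'r) \<Rightarrow> ('r, 'm, 'x) module_scheme \<Rightarrow> ('r, 'n, 'y) module_scheme \<Rightarrow>
     ('m \<Rightarrow> 'n) \<Rightarrow> bool" where
  "semilinear R \<theta> M N f \<longleftrightarrow> additive_map M N f \<and> \<theta> \<in> carrier R \<rightarrow> carrier R \<and>
     (\<forall>r\<in>carrier R. \<forall>x\<in>carrier M. f (r \<odot>\<^bsub>M\<^esub> x) = \<theta> r \<odot>\<^bsub>N\<^esub> f x)"

lemma semilinearD:
  assumes "semilinear R \<theta> M N f"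
  shows "additive_map M N f"
    and "x \<in> carrier M \<Longrightarrow> f x \<in> carrier N"
    and "x \<in> carrier M \<Longrightarrow> y \<in> carrier M \<Longrightarrow> f (x \<oplus>\<^bsub>M\<^esub> y) = f x \<oplus>\<^bsub>N\<^esub> f y"
    and "r \<in> carrier R \<Longrightarrow> \<theta> r \<in> carrier R"
    and "r \<in> carrier R \<Longrightarrow> x \<in> carrier M \<Longrightarrow> f (r \<odot>\<^bsub>M\<^esub> x) = \<theta> r \<odot>\<^bsub>N\<^esub> f x"
  using assms by (auto simp: semilinear_def additive_map_def)

lemma linear_map_iff: "linear_map R M N f \<longleftrightarrow> semilinear R (\<lambda>r. r) M N f"
  by (auto simp: linear_map_def semilinear_def additive_map_def)

lemma linear_mapD:
  assumes "linear_map R M N f"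
  shows "additive_map M N f"
    and "x \<in> carrier M \<Longrightarrow> f x \<in> carrier N"
    and "x \<in> carrier M \<Longrightarrow> y \<in> carrier M \<Longrightarrow> f (x \<oplus>\<^bsub>M\<^esub> y) = f x \<oplus>\<^bsub>N\<^esub> f y"
    and "r \<in> carrier R \<Longrightarrow> x \<in> carrier M \<Longrightarrow> f (r \<odot>\<^bsub>M\<^esub> x) = r \<odot>\<^bsub>N\<^esub> f x"
  using assms by (auto simp: linear_map_def additive_map_def)

lemma linear_map_comp:
  "linear_map R M N f \<Longrightarrow> linear_map R N P g \<Longrightarrow> linear_map R M P (\<lambda>x. g (f x))"
  by (auto simp: linear_map_def Pi_iff)

lemma linear_map_id: "linear_map R M M (\<lambda>x. x)"
  by (auto simp: linear_map_def)

text \<open>\<open>\<phi>\<close> on the first factor and \<open>\<tau>\<close> on every factor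
  \<open>A\<close>: the common generalization of \<open>tens_map\<close> and of the operator
  \<sigma> \<otimes> ... \<otimes> \<sigma> in \<open>dtens\<close>.\<close>

definition gmap ::
    "('r, 'z) ring_scheme \<Rightarrow> ('r, 'n, 'x) module_scheme \<Rightarrow> ('r, 'a, 'y) module_scheme \<Rightarrow> nat \<Rightarrow>
     ('m \<Rightarrow> 'n) \<Rightarrow> ('a \<Rightarrow> 'a) \<Rightarrow> ('m, 'a) tens \<Rightarrow> ('n, 'a) tens" where
  "gmap R N A n \<phi> \<tau> = tens_ext (tens R N A n) (\<lambda>(m, as). pure_tens R N A (\<phi> m) (map \<tau> as))"

definition app ::
    "('r, 'z) ring_scheme \<Rightarrow> ('r, 'm, 'x) module_scheme \<Rightarrow> ('r, 'a, 'y) module_scheme \<Rightarrow> nat \<Rightarrow>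
     'a list \<Rightarrow> ('m, 'a) tens \<Rightarrow> ('m, 'a) tens" where
  "app R M A n as = tens_ext (tens R M A n) (\<lambda>(m, bs). pure_tens R M A m (bs @ as))"

text \<open>The inner map of \<open>comult_at\<close>. With both lists empty it sends
  \<open>Y\<close> to \<open>m \<otimes> Y\<close>, the form on which the induction over the degree
  rests.\<close>

definition wrap ::
    "('r, 'z) ring_scheme \<Rightarrow> ('r, 'm, 'x) module_scheme \<Rightarrow> ('r, 'a, 'y) module_scheme \<Rightarrow> nat \<Rightarrow>
     'm \<Rightarrow> 'a list \<Rightarrow> 'a list \<Rightarrow> ('a, 'a) tens \<Rightarrow> ('m, 'a) tens" where
  "wrap R M A n m xs ys = tens_ext (tens R M A n) (\<lambda>(b, bs). pure_tens R M A m (xs @ b # bs @ ys))"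

text \<open>When \<open>r\<close> is a retraction of the coaction that commutes with the coactions, \<open>con\<close> is a contracting
  homotopy of the Hochschild complex in positive degrees.\<close>

definition con ::
    "('r, 'z) ring_scheme \<Rightarrow> ('r, 'm, 'x) module_scheme \<Rightarrow> ('r, 'n, 'v) module_scheme \<Rightarrow>
     ('r, 'a, 'y) module_scheme \<Rightarrow> nat \<Rightarrow> (('m, 'a) tens \<Rightarrow> 'n) \<Rightarrow> ('m, 'a) tens \<Rightarrow> ('n, 'a) tens" where
  "con R M N A n r = tens_ext (tens R N A n)
     (\<lambda>(m, as). pure_tens R N A (r (pure_tens R M A m [hd as])) (tl as))"

context tensor_base
begin

lemmas tens_group = abelian_group_tens

lemma balanced_smult:
  assumes M: "Module.module R M" and r: "r \<in> carrier R"
  shows "balanced R M A n (tens R M A n) (\<lambda>m as. pure_tens R M A (r \<odot>\<^bsub>M\<^esub> m) as)"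
proof -
  interpret M: Module.module R M by (rule M)
  interpret A: Module.module R A by (rule module_A)
  show ?thesis
  proof (rule balancedI)
    fix m xs ys a s
    assume *: "m \<in> carrier M" "a \<in> carrier A" "s \<in> carrier R" "set xs \<subseteq> carrier A" "set ys \<subseteq> carrier A"
        "length xs + Suc (length ys) = n"
    have "r \<odot>\<^bsub>M\<^esub> (s \<odot>\<^bsub>M\<^esub> m) = s \<odot>\<^bsub>M\<^esub> (r \<odot>\<^bsub>M\<^esub> m)"
      using r * by (simp add: M.smult_assoc1[symmetric] M.R.m_comm)
    then show "pure_tens R M A (r \<odot>\<^bsub>M\<^esub> (s \<odot>\<^bsub>M\<^esub> m)) (xs @ a # ys) =
        pure_tens R M A (r \<odot>\<^bsub>M\<^esub> m) (xs @ (s \<odot>\<^bsub>A\<^esub> a) # ys)"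
      using pure_tens_smult_slot[OF M, of "r \<odot>\<^bsub>M\<^esub> m" a s xs ys n] r * by simp
  qed (use r in \<open>simp_all add: pure_tens_closed[OF M] pure_tens_add[OF M, where n=n]
         pure_tens_add_slot[OF M, where n=n] M.smult_r_distr\<close>)
qed

text \<open>The scalar action of \<open>tens\<close> is defined by extension into the bare group
  record \<open>tens_group\<close>, so facts have to pass between the two records.\<close>

lemma tens_group_simps:
  "carrier (tens_group R M A n) = carrier (tens R M A n)"
  "\<zero>\<^bsub>tens_group R M A n\<^esub> = \<zero>\<^bsub>tens R M A n\<^esub>"
  "ring.add (tens_group R M A n) = ring.add (tens R M A n)"
  by (simp_all add: tens_def Let_def)

lemma smult_tens_ext:
  "r \<odot>\<^bsub>tens R M A n\<^esub> X = tens_ext (tens_group R M A n) (\<lambda>(m, as). pure_tens R M A (r \<odot>\<^bsub>M\<^esub> m) as) X"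
  by (simp add: tens_def Let_def)

lemma abelian_group_tens_group:
  assumes "Module.module R M"
  shows "abelian_group (tens_group R M A n)"
  by (rule abelian_group_of_comm_group[OF abelian_group.a_comm_group[OF tens_group[OF assms, of n]]])
    (simp_all add: tens_group_simps)

lemma smult_pure:
  assumes "Module.module R M" "r \<in> carrier R" "m \<in> carrier M" "set as \<subseteq> carrier A" "length as = n"
  shows "r \<odot>\<^bsub>tens R M A n\<^esub> pure_tens R M A m as = pure_tens R M A (r \<odot>\<^bsub>M\<^esub> m) as"
  unfolding smult_tens_ext
  by (rule tens_ext_pure[OF assms(1) abelian_group_tens_group[OF assms(1)] _ assms(3-5)])
    (use balanced_smult[OF assms(1,2), of n] in \<open>simp add: balanced_def tens_group_simps\<close>)

lemma smult_additive:
  assumes "Module.module R M" "r \<in> carrier R"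
  shows "additive_map (tens R M A n) (tens R M A n) (\<lambda>X. r \<odot>\<^bsub>tens R M A n\<^esub> X)"
proof -
  have "balanced R M A n (tens_group R M A n) (\<lambda>m as. pure_tens R M A (r \<odot>\<^bsub>M\<^esub> m) as)"
    using balanced_smult[OF assms, of n] by (simp add: balanced_def tens_group_simps)
  from tens_ext_additive[OF assms(1) abelian_group_tens_group[OF assms(1)] this]
  show ?thesis by (simp add: smult_tens_ext additive_map_def tens_group_simps)
qed

lemma module_tens:
  assumes M: "Module.module R M"
  shows "Module.module R (tens R M A n)"
proof -
  interpret M: Module.module R M by (rule M)
  interpret T: abelian_group "tens R M A n" by (rule tens_group[OF M])
  note [simp] = smult_pure[OF M, where n = n] pure_tens_closed[OF M, where n = n]
  note add = smult_additive[OF M, where n = n]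
  show ?thesis
  proof (rule moduleI)
    fix a b X assume *: "a \<in> carrier R" "b \<in> carrier R" "X \<in> carrier (tens R M A n)"
    show "a \<odot>\<^bsub>tens R M A n\<^esub> X \<in> carrier (tens R M A n)"
      by (rule additive_map_closed[OF add[OF *(1)] *(3)])
    show "(a \<oplus>\<^bsub>R\<^esub> b) \<odot>\<^bsub>tens R M A n\<^esub> X = a \<odot>\<^bsub>tens R M A n\<^esub> X \<oplus>\<^bsub>tens R M A n\<^esub> b \<odot>\<^bsub>tens R M A n\<^esub> X"
      using *
      by (intro tens_eqI[OF M tens_group[OF M] add additive_map_plus[OF tens_group[OF M] add add] _ *(3)])
         (auto simp: M.smult_l_distr pure_tens_add[OF M, where n=n])
    show "(a \<otimes>\<^bsub>R\<^esub> b) \<odot>\<^bsub>tens R M A n\<^esub> X = a \<odot>\<^bsub>tens R M A n\<^esub> (b \<odot>\<^bsub>tens R M A n\<^esub> X)"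
      using *
      by (intro tens_eqI[OF M tens_group[OF M] add additive_map_comp[OF add add] _ *(3)])
         (auto simp: M.smult_assoc1)
  next
    fix X assume *: "X \<in> carrier (tens R M A n)"
    have i: "additive_map (tens R M A n) (tens R M A n) (\<lambda>X. X)" by (simp add: additive_map_def)
    show "\<one>\<^bsub>R\<^esub> \<odot>\<^bsub>tens R M A n\<^esub> X = X"
      by (rule tens_eqI[OF M tens_group[OF M] add i _ *]) auto
  next
    fix a X Y assume "a \<in> carrier R" "X \<in> carrier (tens R M A n)" "Y \<in> carrier (tens R M A n)"
    then show "a \<odot>\<^bsub>tens R M A n\<^esub> (X \<oplus>\<^bsub>tens R M A n\<^esub> Y) = a \<odot>\<^bsub>tens R M A n\<^esub> X \<oplus>\<^bsub>tens R M A n\<^esub> a \<odot>\<^bsub>tens R M A n\<^esub> Y"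
      using add by (intro additive_map_add)
  qed (simp_all add: ring_R T.abelian_group_axioms)
qed

lemma linear_map_eqI:
  assumes "Module.module R M" "Module.module R N" "additive_map (tens R M A n) N f"
    and "\<And>r m as. r \<in> carrier R \<Longrightarrow> m \<in> carrier M \<Longrightarrow> set as \<subseteq> carrier A \<Longrightarrow> length as = n \<Longrightarrow>
      f (pure_tens R M A (r \<odot>\<^bsub>M\<^esub> m) as) = r \<odot>\<^bsub>N\<^esub> f (pure_tens R M A m as)"
  shows "linear_map R (tens R M A n) N f"
proof -
  interpret N: Module.module R N by fact
  have s: "additive_map N N (\<lambda>x. r \<odot>\<^bsub>N\<^esub> x)" if "r \<in> carrier R" for r
    using that by (simp add: additive_map_def N.smult_r_distr)
  have "f (r \<odot>\<^bsub>tens R M A n\<^esub> X) = r \<odot>\<^bsub>N\<^esub> f X" if "r \<in> carrier R" "X \<in> carrier (tens R M A n)" for r X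
    using assms that
    by (intro tens_eqI[OF assms(1) N.abelian_group_axioms additive_map_comp[OF smult_additive assms(3)]
           additive_map_comp[OF assms(3) s] _ that(2)])
       (auto simp: smult_pure[where n = n])
  then show ?thesis using assms(3) by (auto simp: linear_map_def additive_map_def)
qed

text \<open>Commutativity of \<open>R\<close> enters here. It allows the scalar action to be treated
  as one more compatible family of linear maps in the naturality argument.\<close>

lemma semilinear_smult:
  assumes "Module.module R M" "r \<in> carrier R"
  shows "linear_map R M M (\<lambda>x. r \<odot>\<^bsub>M\<^esub> x)"
proof -
  interpret M: Module.module R M by fact
  show ?thesis using assms(2)
    by (auto simp: linear_map_def M.smult_r_distr M.smult_assoc1[symmetric] M.R.m_comm)
qed

subsection \<open>Maps induced on all factors\<close>

lemma balanced_gmap: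
  assumes N: "Module.module R N" and \<phi>: "semilinear R \<theta> M N \<phi>" and \<tau>: "semilinear R \<theta> A A \<tau>"
  shows "balanced R M A n (tens R N A n) (\<lambda>m as. pure_tens R N A (\<phi> m) (map \<tau> as))"
proof -
  have s: "set (map \<tau> as) \<subseteq> carrier A" if "set as \<subseteq> carrier A" for as
    using that semilinearD(2)[OF \<tau>] by auto
  note [simp] = semilinearD(2-5)[OF \<phi>] semilinearD(2-5)[OF \<tau>]
  show ?thesis
  proof (rule balancedI)
    fix m xs ys a b
    assume *: "m \<in> carrier M" "a \<in> carrier A" "b \<in> carrier A" "set xs \<subseteq> carrier A" "set ys \<subseteq> carrier A"
        "length xs + Suc (length ys) = n"
    show "pure_tens R N A (\<phi> m) (map \<tau> (xs @ (a \<oplus>\<^bsub>A\<^esub> b) # ys)) =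
       pure_tens R N A (\<phi> m) (map \<tau> (xs @ a # ys)) \<oplus>\<^bsub>tens R N A n\<^esub> pure_tens R N A (\<phi> m) (map \<tau> (xs @ b # ys))"
      using * pure_tens_add_slot[OF N, of "\<phi> m" "\<tau> a" "\<tau> b" "map \<tau> xs" "map \<tau> ys" n] s by simp
  next
    fix m xs ys a r
    assume *: "m \<in> carrier M" "a \<in> carrier A" "r \<in> carrier R" "set xs \<subseteq> carrier A" "set ys \<subseteq> carrier A"
        "length xs + Suc (length ys) = n"
    show "pure_tens R N A (\<phi> (r \<odot>\<^bsub>M\<^esub> m)) (map \<tau> (xs @ a # ys)) =
        pure_tens R N A (\<phi> m) (map \<tau> (xs @ (r \<odot>\<^bsub>A\<^esub> a) # ys))"
      using * pure_tens_smult_slot[OF N, of "\<phi> m" "\<tau> a" "\<theta> r" "map \<tau> xs" "map \<tau> ys" n] s by simp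
  qed (simp_all add: pure_tens_closed[OF N] pure_tens_add[OF N, where n=n] s del: set_map)
qed

lemma gmap_additive:
  assumes "Module.module R M" "Module.module R N" "semilinear R \<theta> M N \<phi>" "semilinear R \<theta> A A \<tau>"
  shows "additive_map (tens R M A n) (tens R N A n) (gmap R N A n \<phi> \<tau>)"
  unfolding gmap_def by (rule tens_ext_additive[OF assms(1) tens_group[OF assms(2)] balanced_gmap[OF assms(2-4)]])

lemma gmap_pure:
  assumes "Module.module R M" "Module.module R N" "semilinear R \<theta> M N \<phi>" "semilinear R \<theta> A A \<tau>"
    "m \<in> carrier M" "set as \<subseteq> carrier A" "length as = n"
  shows "gmap R N A n \<phi> \<tau> (pure_tens R M A m as) = pure_tens R N A (\<phi> m) (map \<tau> as)"
  unfolding gmap_def by (rule tens_ext_pure[OF assms(1) tens_group[OF assms(2)] balanced_gmap[OF assms(2-4)] assms(5-7)])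

lemma semilinear_id: "semilinear R (\<lambda>r. r) A A (\<lambda>a. a)"
  by (auto simp: semilinear_def additive_map_def)

lemma tens_map_gmap: "tens_map R N A n f = gmap R N A n f (\<lambda>a. a)"
  by (simp add: tens_map_def gmap_def)

lemma tens_map_additive:
  assumes "Module.module R M" "Module.module R N" "linear_map R M N \<phi>"
  shows "additive_map (tens R M A n) (tens R N A n) (tens_map R N A n \<phi>)"
  unfolding tens_map_gmap by (rule gmap_additive[OF assms(1,2) _ semilinear_id]) (use assms(3) in \<open>simp add: linear_map_iff\<close>)

lemma tens_map_pure:
  assumes "Module.module R M" "Module.module R N" "linear_map R M N \<phi>"
    "m \<in> carrier M" "set as \<subseteq> carrier A" "length as = n"
  shows "tens_map R N A n \<phi> (pure_tens R M A m as) = pure_tens R N A (\<phi> m) as"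
  unfolding tens_map_gmap
  using gmap_pure[OF assms(1,2) _ semilinear_id assms(4-6)] assms(3) by (simp add: linear_map_iff)

lemma gmap_comp:
  assumes M: "Module.module R M" "Module.module R N" "Module.module R P"
    and 1: "semilinear R \<theta> M N \<phi>" "semilinear R \<theta> A A \<tau>"
    and 2: "semilinear R \<theta>' N P \<phi>'" "semilinear R \<theta>' A A \<tau>'"
    and X: "X \<in> carrier (tens R M A n)"
  shows "gmap R P A n \<phi>' \<tau>' (gmap R N A n \<phi> \<tau> X) = gmap R P A n (\<lambda>x. \<phi>' (\<phi> x)) (\<lambda>x. \<tau>' (\<tau> x)) X"
proof -
  have 3: "semilinear R (\<lambda>r. \<theta>' (\<theta> r)) M P (\<lambda>x. \<phi>' (\<phi> x))" "semilinear R (\<lambda>r. \<theta>' (\<theta> r)) A A (\<lambda>x. \<tau>' (\<tau> x))"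
    using 1 2 by (auto simp: semilinear_def additive_map_def Pi_iff)
  have s: "set (map \<tau> as) \<subseteq> carrier A" if "set as \<subseteq> carrier A" for as
    using that semilinearD(2)[OF 1(2)] by auto
  show ?thesis
    by (rule tens_eqI[OF M(1) tens_group[OF M(3)]
          additive_map_comp[OF gmap_additive[OF M(1,2) 1] gmap_additive[OF M(2,3) 2]]
          gmap_additive[OF M(1,3) 3] _ X])
       (simp add: gmap_pure[OF M(1,2) 1] gmap_pure[OF M(2,3) 2] gmap_pure[OF M(1,3) 3] s semilinearD(2)[OF 1(1)]
         comp_def del: set_map)
qed

lemma gmap_cong:
  assumes M: "Module.module R M" "Module.module R N"
    and 1: "semilinear R \<theta> M N \<phi>" "semilinear R \<theta> A A \<tau>"
    and 2: "semilinear R \<theta>' M N \<phi>'" "semilinear R \<theta>' A A \<tau>'"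
    and eq: "\<And>x. x \<in> carrier M \<Longrightarrow> \<phi> x = \<phi>' x" "\<And>x. x \<in> carrier A \<Longrightarrow> \<tau> x = \<tau>' x"
    and X: "X \<in> carrier (tens R M A n)"
  shows "gmap R N A n \<phi> \<tau> X = gmap R N A n \<phi>' \<tau>' X"
  using M
  by (intro tens_eqI[OF M(1) tens_group[OF M(2)] gmap_additive[OF M 1] gmap_additive[OF M 2] _ X])
     (auto simp: gmap_pure[OF M 1] gmap_pure[OF M 2] eq subset_iff cong: map_cong)

lemma tens_map_comp:
  assumes M: "Module.module R M" "Module.module R N" "Module.module R P"
    and 1: "linear_map R M N \<phi>" "linear_map R N P \<psi>"
    and X: "X \<in> carrier (tens R M A n)"
  shows "tens_map R P A n \<psi> (tens_map R N A n \<phi> X) = tens_map R P A n (\<lambda>x. \<psi> (\<phi> x)) X"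
  unfolding tens_map_gmap
  using gmap_comp[OF M _ semilinear_id _ semilinear_id X] 1 by (simp add: linear_map_iff)

lemma tens_map_cong:
  assumes M: "Module.module R M" "Module.module R N"
    and 1: "linear_map R M N \<phi>" "linear_map R M N \<phi>'"
    and eq: "\<And>x. x \<in> carrier M \<Longrightarrow> \<phi> x = \<phi>' x"
    and X: "X \<in> carrier (tens R M A n)"
  shows "tens_map R N A n \<phi> X = tens_map R N A n \<phi>' X"
  unfolding tens_map_gmap
  using gmap_cong[OF M _ semilinear_id _ semilinear_id eq _ X] 1 by (simp add: linear_map_iff)

lemma tens_map_id:
  assumes M: "Module.module R M" and X: "X \<in> carrier (tens R M A n)"
    and \<phi>: "linear_map R M M \<phi>" "\<And>x. x \<in> carrier M \<Longrightarrow> \<phi> x = x"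
  shows "tens_map R M A n \<phi> X = X"
proof (rule tens_eqI[OF M tens_group[OF M] tens_map_additive[OF M M \<phi>(1)] _ _ X])
  show "additive_map (tens R M A n) (tens R M A n) (\<lambda>X. X)" by (simp add: additive_map_def)
qed (simp add: tens_map_pure[OF M M \<phi>(1)] \<phi>(2))

lemma tens_map_zero:
  assumes M: "Module.module R M" "Module.module R N" and X: "X \<in> carrier (tens R M A n)"
    and \<phi>: "linear_map R M N \<phi>" "\<And>x. x \<in> carrier M \<Longrightarrow> \<phi> x = \<zero>\<^bsub>N\<^esub>"
  shows "tens_map R N A n \<phi> X = \<zero>\<^bsub>tens R N A n\<^esub>"
proof (rule tens_eqI[OF M(1) tens_group[OF M(2)] tens_map_additive[OF M \<phi>(1)] additive_map_zero_fun[OF tens_group[OF M(2)]] _ X])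
  interpret N: Module.module R N by (rule M(2))
  interpret T: abelian_group "tens R N A n" by (rule tens_group[OF M(2)])
  fix m as assume *: "m \<in> carrier M" "set as \<subseteq> carrier A" "length as = n"
  \<comment> \<open>Additivity at 0 + 0 gives x = x + x for this tensor, hence x = 0.\<close>
  have "pure_tens R N A (\<zero>\<^bsub>N\<^esub> \<oplus>\<^bsub>N\<^esub> \<zero>\<^bsub>N\<^esub>) as = pure_tens R N A \<zero>\<^bsub>N\<^esub> as \<oplus>\<^bsub>tens R N A n\<^esub> pure_tens R N A \<zero>\<^bsub>N\<^esub> as"
    using * by (intro pure_tens_add[OF M(2)]) auto
  then have "pure_tens R N A \<zero>\<^bsub>N\<^esub> as = \<zero>\<^bsub>tens R N A n\<^esub>"
    using pure_tens_closed[OF M(2), of "\<zero>\<^bsub>N\<^esub>" as n] * by simp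
  then show "tens_map R N A n \<phi> (pure_tens R M A m as) = \<zero>\<^bsub>tens R N A n\<^esub>"
    using * by (simp add: tens_map_pure[OF M \<phi>(1)] \<phi>(2))
qed

lemma tens_map_linear:
  assumes M: "Module.module R M" "Module.module R N" "linear_map R M N \<phi>"
  shows "linear_map R (tens R M A n) (tens R N A n) (tens_map R N A n \<phi>)"
proof (rule linear_map_eqI[OF M(1) module_tens[OF M(2)] tens_map_additive[OF M]])
  interpret M: Module.module R M by (rule M(1))
  fix r m as assume *: "r \<in> carrier R" "m \<in> carrier M" "set as \<subseteq> carrier A" "length as = n"
  then show "tens_map R N A n \<phi> (pure_tens R M A (r \<odot>\<^bsub>M\<^esub> m) as) =
    r \<odot>\<^bsub>tens R N A n\<^esub> tens_map R N A n \<phi> (pure_tens R M A m as)"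
    by (simp add: tens_map_pure[OF M] smult_pure[OF M(2)] linear_mapD[OF M(3)])
qed

text \<open>Scalars act through the first factor. In this form the scalar action on tensors is an
  instance of functoriality.\<close>

lemma smult_gmap:
  assumes M: "Module.module R M" and r: "r \<in> carrier R" and X: "X \<in> carrier (tens R M A n)"
  shows "r \<odot>\<^bsub>tens R M A n\<^esub> X = tens_map R M A n (\<lambda>x. r \<odot>\<^bsub>M\<^esub> x) X"
  by (rule tens_eqI[OF M tens_group[OF M] smult_additive[OF M r] tens_map_additive[OF M M semilinear_smult[OF M r]] _ X])
     (simp add: tens_map_pure[OF M M semilinear_smult[OF M r]] smult_pure[OF M r])

end

text \<open>The definitions write \<open>M \<otimes> A\<close> with degree \<open>1\<close>, whereas
  list lengths produce \<open>Suc 0\<close>. Orienting the equation towards \<open>1\<close> keeps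
  the degrees of statements and definitions in the same form.\<close>

declare One_nat_def [simp del] One_nat_def [symmetric, simp]

lemma drop_1_Cons [simp]: "drop 1 (x # xs) = xs"
  by (simp add: One_nat_def del: One_nat_def [symmetric])

section \<open>Appending, inserting and contracting factors\<close>

context tensor_base
begin

lemma balanced_app:
  assumes M: "Module.module R M" and as: "set as \<subseteq> carrier A"
  shows "balanced R M A k (tens R M A (k + length as)) (\<lambda>m bs. pure_tens R M A m (bs @ as))"
  unfolding balanced_def
  using as by (simp add: pure_tens_closed[OF M] pure_tens_add[OF M, where n = "k + length as"]
     pure_tens_add_slot[OF M, where n = "k + length as"] pure_tens_smult_slot[OF M, where n = "k + length as"])

lemma app_additive:
  assumes M: "Module.module R M" and as: "set as \<subseteq> carrier A" "n = k + length as"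
  shows "additive_map (tens R M A k) (tens R M A n) (app R M A n as)"
  unfolding app_def assms(3) by (rule tens_ext_additive[OF M tens_group[OF M] balanced_app[OF assms(1,2)]])

lemma app_pure:
  assumes M: "Module.module R M" and as: "set as \<subseteq> carrier A" "n = length bs + length as"
    and "m \<in> carrier M" "set bs \<subseteq> carrier A"
  shows "app R M A n as (pure_tens R M A m bs) = pure_tens R M A m (bs @ as)"
  unfolding app_def assms(3)
  by (rule tens_ext_pure[OF M tens_group[OF M] balanced_app[OF assms(1,2)] assms(4,5) refl])

lemma app_linear:
  assumes M: "Module.module R M" and as: "set as \<subseteq> carrier A" "n = k + length as"
  shows "linear_map R (tens R M A k) (tens R M A n) (app R M A n as)"
proof -
  interpret M: Module.module R M by fact
  show ?thesis
    by (rule linear_map_eqI[OF M module_tens[OF M] app_additive[OF assms]])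
       (use as in \<open>auto simp: app_pure[OF M] smult_pure[OF M]\<close>)
qed

text \<open>With \<open>app_smult_slot\<close> this says that appending is balanced in the appended
  list, which makes \<open>coact_first\<close> well defined.\<close>

lemma app_add_slot:
  assumes M: "Module.module R M" and "a \<in> carrier A" "b \<in> carrier A" "set xs \<subseteq> carrier A" "set ys \<subseteq> carrier A"
    "n = k + (length xs + Suc (length ys))" "X \<in> carrier (tens R M A k)"
  shows "app R M A n (xs @ (a \<oplus>\<^bsub>A\<^esub> b) # ys) X = app R M A n (xs @ a # ys) X \<oplus>\<^bsub>tens R M A n\<^esub> app R M A n (xs @ b # ys) X"
proof -
  interpret A: Module.module R A by (rule module_A)
  note ad = app_additive[OF M, of _ n k]
  have *: "pure_tens R M A m ((bs @ xs) @ (a \<oplus>\<^bsub>A\<^esub> b) # ys) = pure_tens R M A m ((bs @ xs) @ a # ys) \<oplus>\<^bsub>tens R M A n\<^esub>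
     pure_tens R M A m ((bs @ xs) @ b # ys)" if "m \<in> carrier M" "set bs \<subseteq> carrier A" "length bs = k" for m bs
    using that assms by (intro pure_tens_add_slot[OF M]) auto
  show ?thesis
    by (rule tens_eqI[OF M tens_group[OF M] ad additive_map_plus[OF tens_group[OF M] ad ad] _ assms(7)])
       (use assms(2-6) * in \<open>auto simp: app_pure[OF M]\<close>)
qed

lemma app_smult_slot:
  assumes M: "Module.module R M" and "a \<in> carrier A" "r \<in> carrier R" "set xs \<subseteq> carrier A" "set ys \<subseteq> carrier A"
    "n = k + (length xs + Suc (length ys))" "X \<in> carrier (tens R M A k)"
  shows "app R M A n (xs @ (r \<odot>\<^bsub>A\<^esub> a) # ys) X = app R M A n (xs @ a # ys) (r \<odot>\<^bsub>tens R M A k\<^esub> X)"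
proof -
  interpret A: Module.module R A by (rule module_A)
  interpret M: Module.module R M by (rule M)
  note ad = app_additive[OF M, of _ n k]
  have *: "pure_tens R M A (r \<odot>\<^bsub>M\<^esub> m) ((bs @ xs) @ a # ys) = pure_tens R M A m ((bs @ xs) @ (r \<odot>\<^bsub>A\<^esub> a) # ys)"
     if "m \<in> carrier M" "set bs \<subseteq> carrier A" "length bs = k" for m bs
    using that assms by (intro pure_tens_smult_slot[OF M, where n = n]) auto
  show ?thesis
    by (rule tens_eqI[OF M tens_group[OF M] ad additive_map_comp[OF smult_additive[OF M assms(3)] ad] _ assms(7)])
       (use assms(2-6) * in \<open>auto simp: app_pure[OF M] smult_pure[OF M]\<close>)
qed

lemma balanced_wrap:
  assumes M: "Module.module R M" and m: "m \<in> carrier M" and xs: "set xs \<subseteq> carrier A" and ys: "set ys \<subseteq> carrier A"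
  shows "balanced R A A k (tens R M A (length xs + Suc (k + length ys))) (\<lambda>b bs. pure_tens R M A m (xs @ b # bs @ ys))"
proof (rule balancedI)
  fix b us vs a r
  assume *: "b \<in> carrier A" "a \<in> carrier A" "r \<in> carrier R" "set us \<subseteq> carrier A" "set vs \<subseteq> carrier A"
      "length us + Suc (length vs) = k"
  interpret A: Module.module R A by (rule module_A)
  interpret M: Module.module R M by (rule M)
  let ?n = "length xs + Suc (k + length ys)"
  have "pure_tens R M A (r \<odot>\<^bsub>M\<^esub> m) (xs @ b # (us @ a # vs @ ys)) = pure_tens R M A m (xs @ (r \<odot>\<^bsub>A\<^esub> b) # (us @ a # vs @ ys))"
    using * assms by (intro pure_tens_smult_slot[OF M, of _ _ _ _ _ ?n]) auto
  moreover have "pure_tens R M A (r \<odot>\<^bsub>M\<^esub> m) ((xs @ b # us) @ a # (vs @ ys)) = pure_tens R M A m ((xs @ b # us) @ (r \<odot>\<^bsub>A\<^esub> a) # (vs @ ys))"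
    using * assms by (intro pure_tens_smult_slot[OF M, of _ _ _ _ _ ?n]) auto
  ultimately show "pure_tens R M A m (xs @ (r \<odot>\<^bsub>A\<^esub> b) # (us @ a # vs) @ ys) = pure_tens R M A m (xs @ b # (us @ (r \<odot>\<^bsub>A\<^esub> a) # vs) @ ys)"
    by simp
next
  fix b us vs a a'
  assume *: "b \<in> carrier A" "a \<in> carrier A" "a' \<in> carrier A" "set us \<subseteq> carrier A" "set vs \<subseteq> carrier A"
      "length us + Suc (length vs) = k"
  let ?n = "length xs + Suc (k + length ys)"
  have "pure_tens R M A m ((xs @ b # us) @ (a \<oplus>\<^bsub>A\<^esub> a') # (vs @ ys)) =
     pure_tens R M A m ((xs @ b # us) @ a # (vs @ ys)) \<oplus>\<^bsub>tens R M A ?n\<^esub> pure_tens R M A m ((xs @ b # us) @ a' # (vs @ ys))"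
    using * assms by (intro pure_tens_add_slot[OF M, of _ _ _ _ _ ?n]) auto
  then show "pure_tens R M A m (xs @ b # (us @ (a \<oplus>\<^bsub>A\<^esub> a') # vs) @ ys) =
     pure_tens R M A m (xs @ b # (us @ a # vs) @ ys) \<oplus>\<^bsub>tens R M A ?n\<^esub> pure_tens R M A m (xs @ b # (us @ a' # vs) @ ys)"
    by simp
qed (use assms in \<open>simp_all add: pure_tens_closed[OF M] pure_tens_add_slot[OF M, where n="length xs + Suc (k + length ys)"]\<close>)

lemma wrap_additive:
  assumes "Module.module R M" "m \<in> carrier M" "set xs \<subseteq> carrier A" "set ys \<subseteq> carrier A"
    "n = length xs + Suc (k + length ys)"
  shows "additive_map (tens R A A k) (tens R M A n) (wrap R M A n m xs ys)"
  unfolding wrap_def assms(5) by (rule tens_ext_additive[OF module_A tens_group[OF assms(1)] balanced_wrap[OF assms(1-4)]])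

lemma wrap_pure:
  assumes "Module.module R M" "m \<in> carrier M" "set xs \<subseteq> carrier A" "set ys \<subseteq> carrier A"
    "n = length xs + Suc (length bs + length ys)" "b \<in> carrier A" "set bs \<subseteq> carrier A"
  shows "wrap R M A n m xs ys (pure_tens R A A b bs) = pure_tens R M A m (xs @ b # bs @ ys)"
  unfolding wrap_def assms(5)
  by (rule tens_ext_pure[OF module_A tens_group[OF assms(1)] balanced_wrap[OF assms(1-4)] assms(6,7) refl])

lemma wrap_add:
  assumes M: "Module.module R M" and "m \<in> carrier M" "m' \<in> carrier M" "set xs \<subseteq> carrier A" "set ys \<subseteq> carrier A"
    "n = length xs + Suc (k + length ys)" "X \<in> carrier (tens R A A k)"
  shows "wrap R M A n (m \<oplus>\<^bsub>M\<^esub> m') xs ys X = wrap R M A n m xs ys X \<oplus>\<^bsub>tens R M A n\<^esub> wrap R M A n m' xs ys X"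
proof -
  interpret M: Module.module R M by (rule M)
  note ad = wrap_additive[OF M, of _ _ _ n k]
  show ?thesis
    by (rule tens_eqI[OF module_A tens_group[OF M] ad additive_map_plus[OF tens_group[OF M] ad ad] _ assms(7)])
       (use assms(2-6) in \<open>simp_all add: wrap_pure[OF M] pure_tens_add[OF M, where n=n]\<close>)
qed

lemma wrap_add_left:
  assumes M: "Module.module R M" and "m \<in> carrier M" "a \<in> carrier A" "b \<in> carrier A"
    "set us \<subseteq> carrier A" "set vs \<subseteq> carrier A" "set ys \<subseteq> carrier A"
    "n = length us + Suc (length vs) + Suc (k + length ys)" "X \<in> carrier (tens R A A k)"
  shows "wrap R M A n m (us @ (a \<oplus>\<^bsub>A\<^esub> b) # vs) ys X =
     wrap R M A n m (us @ a # vs) ys X \<oplus>\<^bsub>tens R M A n\<^esub> wrap R M A n m (us @ b # vs) ys X"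
proof -
  interpret A: Module.module R A by (rule module_A)
  note ad = wrap_additive[OF M, of _ _ _ n k]
  show ?thesis
    by (rule tens_eqI[OF module_A tens_group[OF M] ad additive_map_plus[OF tens_group[OF M] ad ad] _ assms(9)])
       (use assms(2-8) in \<open>simp_all add: wrap_pure[OF M] pure_tens_add_slot[OF M, where n=n]\<close>)
qed

lemma wrap_add_right:
  assumes M: "Module.module R M" and "m \<in> carrier M" "a \<in> carrier A" "b \<in> carrier A"
    "set xs \<subseteq> carrier A" "set us \<subseteq> carrier A" "set vs \<subseteq> carrier A"
    "n = length xs + Suc (k + (length us + Suc (length vs)))" "X \<in> carrier (tens R A A k)"
  shows "wrap R M A n m xs (us @ (a \<oplus>\<^bsub>A\<^esub> b) # vs) X =
     wrap R M A n m xs (us @ a # vs) X \<oplus>\<^bsub>tens R M A n\<^esub> wrap R M A n m xs (us @ b # vs) X"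
proof -
  interpret A: Module.module R A by (rule module_A)
  note ad = wrap_additive[OF M, of _ _ _ n k]
  have *: "pure_tens R M A m ((xs @ c # cs @ us) @ (a \<oplus>\<^bsub>A\<^esub> b) # vs) =
      pure_tens R M A m ((xs @ c # cs @ us) @ a # vs) \<oplus>\<^bsub>tens R M A n\<^esub> pure_tens R M A m ((xs @ c # cs @ us) @ b # vs)"
    if "c \<in> carrier A" "set cs \<subseteq> carrier A" "length cs = k" for c cs
    using that assms(2-8) by (intro pure_tens_add_slot[OF M]) auto
  show ?thesis
    by (rule tens_eqI[OF module_A tens_group[OF M] ad additive_map_plus[OF tens_group[OF M] ad ad] _ assms(9)])
       (use assms(2-8) * in \<open>auto simp: wrap_pure[OF M]\<close>)
qed

lemma wrap_smult:
  assumes M: "Module.module R M" and "m \<in> carrier M" "r \<in> carrier R" "set xs \<subseteq> carrier A" "set ys \<subseteq> carrier A"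
    "n = length xs + Suc (k + length ys)" "X \<in> carrier (tens R A A k)"
  shows "wrap R M A n m xs ys (r \<odot>\<^bsub>tens R A A k\<^esub> X) = wrap R M A n (r \<odot>\<^bsub>M\<^esub> m) xs ys X"
proof -
  interpret M: Module.module R M by (rule M)
  interpret A: Module.module R A by (rule module_A)
  note ad = wrap_additive[OF M, of _ _ _ n k]
  show ?thesis
    by (rule tens_eqI[OF module_A tens_group[OF M] additive_map_comp[OF smult_additive[OF module_A assms(3)] ad] ad _ assms(7)])
       (use assms(2-6) in \<open>simp_all add: wrap_pure[OF M] smult_pure[OF module_A] pure_tens_smult_slot[OF M, where n=n]\<close>)
qed

lemma wrap_smult_left:
  assumes M: "Module.module R M" and "m \<in> carrier M" "a \<in> carrier A" "r \<in> carrier R"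
    "set us \<subseteq> carrier A" "set vs \<subseteq> carrier A" "set ys \<subseteq> carrier A"
    "n = length us + Suc (length vs) + Suc (k + length ys)" "X \<in> carrier (tens R A A k)"
  shows "wrap R M A n (r \<odot>\<^bsub>M\<^esub> m) (us @ a # vs) ys X = wrap R M A n m (us @ (r \<odot>\<^bsub>A\<^esub> a) # vs) ys X"
proof -
  interpret M: Module.module R M by (rule M)
  interpret A: Module.module R A by (rule module_A)
  note ad = wrap_additive[OF M, of _ _ _ n k]
  show ?thesis
    by (rule tens_eqI[OF module_A tens_group[OF M] ad ad _ assms(9)])
       (use assms(2-8) in \<open>simp_all add: wrap_pure[OF M] pure_tens_smult_slot[OF M, where n=n]\<close>)
qed

lemma wrap_smult_right:
  assumes M: "Module.module R M" and "m \<in> carrier M" "a \<in> carrier A" "r \<in> carrier R"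
    "set xs \<subseteq> carrier A" "set us \<subseteq> carrier A" "set vs \<subseteq> carrier A"
    "n = length xs + Suc (k + (length us + Suc (length vs)))" "X \<in> carrier (tens R A A k)"
  shows "wrap R M A n (r \<odot>\<^bsub>M\<^esub> m) xs (us @ a # vs) X = wrap R M A n m xs (us @ (r \<odot>\<^bsub>A\<^esub> a) # vs) X"
proof -
  interpret M: Module.module R M by (rule M)
  interpret A: Module.module R A by (rule module_A)
  note ad = wrap_additive[OF M, of _ _ _ n k]
  have *: "pure_tens R M A (r \<odot>\<^bsub>M\<^esub> m) ((xs @ c # cs @ us) @ a # vs) = pure_tens R M A m ((xs @ c # cs @ us) @ (r \<odot>\<^bsub>A\<^esub> a) # vs)"
    if "c \<in> carrier A" "set cs \<subseteq> carrier A" "length cs = k" for c cs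
    using that assms(2-8) by (intro pure_tens_smult_slot[OF M, where n=n]) auto
  show ?thesis
    by (rule tens_eqI[OF module_A tens_group[OF M] ad ad _ assms(9)])
       (use assms(2-8) * in \<open>auto simp: wrap_pure[OF M]\<close>)
qed

lemma balanced_con:
  assumes M: "Module.module R M" "Module.module R N" and r: "linear_map R (tens R M A 1) N r"
  shows "balanced R M A (Suc n) (tens R N A n) (\<lambda>m as. pure_tens R N A (r (pure_tens R M A m [hd as])) (tl as))"
proof -
  interpret M: Module.module R M by (rule M)
  interpret A: Module.module R A by (rule module_A)
  note [simp] = pure_tens_closed[OF M(1)] linear_mapD(2)[OF r]
  have hd_tl: "hd as \<in> carrier A \<and> set (tl as) \<subseteq> carrier A \<and> length (tl as) = n" if "set as \<subseteq> carrier A" "length as = Suc n" for as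
    using that by (cases as) auto
  have lin: "r (pure_tens R M A (m \<oplus>\<^bsub>M\<^esub> m') [a]) = r (pure_tens R M A m [a]) \<oplus>\<^bsub>N\<^esub> r (pure_tens R M A m' [a])"
    if "m \<in> carrier M" "m' \<in> carrier M" "a \<in> carrier A" for m m' a
    using that pure_tens_add[OF M(1), of m m' "[a]" 1] by (simp add: linear_mapD(3)[OF r])
  have lin2: "r (pure_tens R M A m [a \<oplus>\<^bsub>A\<^esub> b]) = r (pure_tens R M A m [a]) \<oplus>\<^bsub>N\<^esub> r (pure_tens R M A m [b])"
    if "m \<in> carrier M" "b \<in> carrier A" "a \<in> carrier A" for m a b
    using that pure_tens_add_slot[OF M(1), of m a b "[]" "[]" 1] by (simp add: linear_mapD(3)[OF r])
  have lin3: "r (pure_tens R M A (s \<odot>\<^bsub>M\<^esub> m) [a]) = s \<odot>\<^bsub>N\<^esub> r (pure_tens R M A m [a])"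
    if "m \<in> carrier M" "a \<in> carrier A" "s \<in> carrier R" for m s a
    using that smult_pure[OF M(1), of s m "[a]" 1] by (simp add: linear_mapD(4)[OF r, symmetric])
  have lin4: "pure_tens R M A (s \<odot>\<^bsub>M\<^esub> m) [a] = pure_tens R M A m [s \<odot>\<^bsub>A\<^esub> a]"
    if "m \<in> carrier M" "a \<in> carrier A" "s \<in> carrier R" for m s a
    using that pure_tens_smult_slot[OF M(1), of m a s "[]" "[]" 1] by simp
  show ?thesis
  proof (rule balancedI)
    fix m xs ys a b
    assume *: "m \<in> carrier M" "a \<in> carrier A" "b \<in> carrier A" "set xs \<subseteq> carrier A" "set ys \<subseteq> carrier A"
        "length xs + Suc (length ys) = Suc n"
    show "pure_tens R N A (r (pure_tens R M A m [hd (xs @ (a \<oplus>\<^bsub>A\<^esub> b) # ys)])) (tl (xs @ (a \<oplus>\<^bsub>A\<^esub> b) # ys)) =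
       pure_tens R N A (r (pure_tens R M A m [hd (xs @ a # ys)])) (tl (xs @ a # ys)) \<oplus>\<^bsub>tens R N A n\<^esub>
       pure_tens R N A (r (pure_tens R M A m [hd (xs @ b # ys)])) (tl (xs @ b # ys))"
    \<comment> \<open>For empty \<open>xs\<close> the varied slot is the head, which
      \<open>r\<close> absorbs; otherwise it lies in the tail and survives as a slot of the
      result.\<close>
    proof (cases xs)
      case Nil
      then show ?thesis using * by (simp add: lin2 pure_tens_add[OF M(2), where n=n])
    next
      case (Cons x xs')
      then show ?thesis using * by (simp add: pure_tens_add_slot[OF M(2), where n=n])
    qed
  next
    fix m xs ys a s
    assume *: "m \<in> carrier M" "a \<in> carrier A" "s \<in> carrier R" "set xs \<subseteq> carrier A" "set ys \<subseteq> carrier A"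
        "length xs + Suc (length ys) = Suc n"
    show "pure_tens R N A (r (pure_tens R M A (s \<odot>\<^bsub>M\<^esub> m) [hd (xs @ a # ys)])) (tl (xs @ a # ys)) =
       pure_tens R N A (r (pure_tens R M A m [hd (xs @ (s \<odot>\<^bsub>A\<^esub> a) # ys)])) (tl (xs @ (s \<odot>\<^bsub>A\<^esub> a) # ys))"
    proof (cases xs)
      case Nil
      then show ?thesis using * by (simp add: lin4)
    next
      case (Cons x xs')
      then show ?thesis using * by (simp add: lin3 pure_tens_smult_slot[OF M(2), where n=n])
    qed
  qed (use hd_tl in \<open>simp_all add: pure_tens_closed[OF M(2)] lin pure_tens_add[OF M(2), where n=n]\<close>)
qed

lemma con_additive:
  assumes M: "Module.module R M" "Module.module R N" and r: "linear_map R (tens R M A 1) N r"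
  shows "additive_map (tens R M A (Suc n)) (tens R N A n) (con R M N A n r)"
  unfolding con_def by (rule tens_ext_additive[OF M(1) tens_group[OF M(2)] balanced_con[OF assms]])

lemma con_pure:
  assumes M: "Module.module R M" "Module.module R N" and r: "linear_map R (tens R M A 1) N r"
   and "m \<in> carrier M" "a \<in> carrier A" "set as \<subseteq> carrier A" "length as = n"
  shows "con R M N A n r (pure_tens R M A m (a # as)) = pure_tens R N A (r (pure_tens R M A m [a])) as"
  unfolding con_def
  by (subst tens_ext_pure[OF M(1) tens_group[OF M(2)] balanced_con[OF assms(1-3)]]) (use assms(4-) in auto)

text \<open>\<open>X\<close> fills exactly the two leading factors, so the contraction applies
  \<open>r\<close> to all of it. For \<open>X = \<mu> m\<close> this is how a retraction of the
  coaction undoes the first face.\<close>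

lemma con_app:
  assumes M: "Module.module R M" "Module.module R N" and r: "linear_map R (tens R M A 1) N r"
   and "X \<in> carrier (tens R M A 1)" "set as \<subseteq> carrier A" "length as = n"
  shows "con R M N A n r (app R M A (Suc n) as X) = pure_tens R N A (r X) as"
proof (rule tens_eqI[OF M(1) tens_group[OF M(2)] additive_map_comp[OF app_additive[OF M(1) assms(5)] con_additive[OF assms(1-3)]] _ _ assms(4)])
  show "additive_map (tens R M A 1) (tens R N A n) (\<lambda>X. pure_tens R N A (r X) as)"
    using assms(5,6) by (simp add: additive_map_def linear_mapD[OF r] pure_tens_closed[OF M(2)] pure_tens_add[OF M(2), where n=n] Pi_iff)
  fix m bs assume *: "m \<in> carrier M" "set bs \<subseteq> carrier A" "length bs = 1"
  then obtain b where "bs = [b]" "b \<in> carrier A" by (cases bs) auto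
  then show "con R M N A n r (app R M A (Suc n) as (pure_tens R M A m bs)) = pure_tens R N A (r (pure_tens R M A m bs)) as"
    using * assms(5,6) by (simp add: app_pure[OF M(1)] con_pure[OF assms(1-3)])
qed (use assms in auto)

lemma app_gmap:
  assumes M: "Module.module R M" "Module.module R N" and \<phi>: "semilinear R \<theta> M N \<phi>" and \<tau>: "semilinear R \<theta> A A \<tau>"
    and as: "set as \<subseteq> carrier A" "n = k + length as" and X: "X \<in> carrier (tens R M A k)"
  shows "gmap R N A n \<phi> \<tau> (app R M A n as X) = app R N A n (map \<tau> as) (gmap R N A k \<phi> \<tau> X)"
proof -
  have s: "set (map \<tau> as) \<subseteq> carrier A" if "set as \<subseteq> carrier A" for as
    using that semilinearD(2)[OF \<tau>] by auto
  note g = gmap_additive[OF M \<phi> \<tau>] and gp = gmap_pure[OF M \<phi> \<tau>]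
  show ?thesis
    by (rule tens_eqI[OF M(1) tens_group[OF M(2)] additive_map_comp[OF app_additive[OF M(1) as] g]
         additive_map_comp[OF g app_additive[OF M(2) s[OF as(1)]]] _ X])
       (use as s in \<open>auto simp: app_pure[OF M(1)] app_pure[OF M(2)] gp semilinearD(2)[OF \<phi>] simp del: set_map\<close>)
qed

lemma wrap_gmap:
  assumes M: "Module.module R M" "Module.module R N" and \<phi>: "semilinear R \<theta> M N \<phi>" and \<tau>: "semilinear R \<theta> A A \<tau>"
    and as: "m \<in> carrier M" "set xs \<subseteq> carrier A" "set ys \<subseteq> carrier A" "n = length xs + Suc (k + length ys)" and X: "X \<in> carrier (tens R A A k)"
  shows "gmap R N A n \<phi> \<tau> (wrap R M A n m xs ys X) = wrap R N A n (\<phi> m) (map \<tau> xs) (map \<tau> ys) (gmap R A A k \<tau> \<tau> X)"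
proof -
  have s: "set (map \<tau> as) \<subseteq> carrier A" if "set as \<subseteq> carrier A" for as
    using that semilinearD(2)[OF \<tau>] by auto
  note g = gmap_additive[OF M \<phi> \<tau>] and gp = gmap_pure[OF M \<phi> \<tau>]
  note g' = gmap_additive[OF module_A module_A \<tau> \<tau>] and gp' = gmap_pure[OF module_A module_A \<tau> \<tau>]
  show ?thesis
    by (rule tens_eqI[OF module_A tens_group[OF M(2)] additive_map_comp[OF wrap_additive[OF M(1) as] g]
         additive_map_comp[OF g' wrap_additive[OF M(2)]] _ X])
       (use as s semilinearD(2)[OF \<phi>] semilinearD(2)[OF \<tau>] in \<open>auto simp: wrap_pure[OF M(1)] wrap_pure[OF M(2)] gp gp' simp del: set_map\<close>)
qed

subsection \<open>Coaction and comultiplication in a slot\<close>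

lemma coact_first_app:
  "coact_first R M A \<mu> n = tens_ext (tens R M A (Suc n)) (\<lambda>(m, as). app R M A (Suc n) as (\<mu> m))"
  by (simp add: coact_first_def app_def)

lemma comult_at_wrap:
  "comult_at R M A \<Delta> n i = tens_ext (tens R M A (Suc n)) (\<lambda>(m, as). wrap R M A (Suc n) m (take i as) (drop (Suc i) as) (\<Delta> (as ! i)))"
  by (simp add: comult_at_def wrap_def)

text \<open>Source \<open>P\<close> and target \<open>M\<close> are kept apart, because in
  \<open>con_inj\<close> the map is the inverse of a transport of structure and not a
  coaction.\<close>

lemma balanced_coact_first:
  assumes M: "Module.module R M" and \<mu>: "linear_map R P (tens R M A 1) \<mu>"
  shows "balanced R P A n (tens R M A (Suc n)) (\<lambda>m as. app R M A (Suc n) as (\<mu> m))"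
proof -
  note ad = app_linear[OF M, of _ "Suc n" 1]
  note [simp] = linear_mapD[OF \<mu>] linear_mapD(2,3)[OF ad]
  show ?thesis
    by (rule balancedI) (simp_all add: app_smult_slot[OF M, where k=1] app_add_slot[OF M, where k=1])
qed

lemma coact_first_additive:
  assumes M: "Module.module R M" and \<mu>: "linear_map R M (tens R M A 1) \<mu>"
  shows "additive_map (tens R M A n) (tens R M A (Suc n)) (coact_first R M A \<mu> n)"
  unfolding coact_first_app by (rule tens_ext_additive[OF M tens_group[OF M] balanced_coact_first[OF assms]])

lemma coact_first_pure:
  assumes M: "Module.module R M" and \<mu>: "linear_map R M (tens R M A 1) \<mu>"
    and "m \<in> carrier M" "set as \<subseteq> carrier A" "length as = n"
  shows "coact_first R M A \<mu> n (pure_tens R M A m as) = app R M A (Suc n) as (\<mu> m)"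
  unfolding coact_first_app by (rule tens_ext_pure[OF M tens_group[OF M] balanced_coact_first[OF assms(1,2)] assms(3-)])

lemma balanced_comult_at:
  assumes M: "Module.module R M" and \<Delta>: "linear_map R A (tens R A A 1) \<Delta>" and i: "i < n"
  shows "balanced R M A n (tens R M A (Suc n)) (\<lambda>m as. wrap R M A (Suc n) m (take i as) (drop (Suc i) as) (\<Delta> (as ! i)))"
proof -
  interpret M: Module.module R M by (rule M)
  interpret A: Module.module R A by (rule module_A)
  have td: "set (take i as) \<subseteq> carrier A \<and> set (drop (Suc i) as) \<subseteq> carrier A \<and> as ! i \<in> carrier A"
    if "set as \<subseteq> carrier A" "length as = n" for as
    using that i set_take_subset[of i as] set_drop_subset[of "Suc i" as] by (auto simp: subset_iff)
  have td': "set (take j as) \<subseteq> carrier A" "set (drop j as) \<subseteq> carrier A"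
    if "set as \<subseteq> carrier A" for as j
    using that set_take_subset[of j as] set_drop_subset[of j as] by auto
  note ad = wrap_additive[OF M, of _ _ _ "Suc n" 1]
  note \<Delta>s = linear_mapD[OF \<Delta>]
  note add = additive_map_add[OF ad] and closed = additive_map_closed[OF ad]
  show ?thesis
  proof (rule balancedI)
    fix m xs ys a b
    assume *: "m \<in> carrier M" "a \<in> carrier A" "b \<in> carrier A" "set xs \<subseteq> carrier A" "set ys \<subseteq> carrier A"
        "length xs + Suc (length ys) = n"
    \<comment> \<open>The slot that is comultiplied lies left of, at, or right of the slot that is
      varied. In the two outer cases the variation only concerns a list surrounding the comultiplied
      factor; in the middle case it uses linearity of \<open>\<Delta>\<close>.\<close>
    consider "i < length xs" | "i = length xs" | j where "i = Suc (length xs + j)" "j < length ys"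
      using i *(6) by (metis add_Suc_right add_less_cancel_left less_antisym linorder_neqE_nat less_imp_Suc_add Suc_less_eq plus_1_eq_Suc)
    then show "wrap R M A (Suc n) m (take i (xs @ (a \<oplus>\<^bsub>A\<^esub> b) # ys)) (drop (Suc i) (xs @ (a \<oplus>\<^bsub>A\<^esub> b) # ys)) (\<Delta> ((xs @ (a \<oplus>\<^bsub>A\<^esub> b) # ys) ! i)) =
        wrap R M A (Suc n) m (take i (xs @ a # ys)) (drop (Suc i) (xs @ a # ys)) (\<Delta> ((xs @ a # ys) ! i)) \<oplus>\<^bsub>tens R M A (Suc n)\<^esub>
        wrap R M A (Suc n) m (take i (xs @ b # ys)) (drop (Suc i) (xs @ b # ys)) (\<Delta> ((xs @ b # ys) ! i))"
    proof cases
      case 1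
      then have "xs ! i \<in> carrier A" using * by (auto simp: subset_iff)
      with 1 show ?thesis
        using * td' by (simp add: nth_append wrap_add_right[OF M, where k=1] \<Delta>s)
    next
      case 2
      then show ?thesis
        using * by (simp add: \<Delta>s add)
    next
      case 3
      then have "ys ! j \<in> carrier A" using * by (auto simp: subset_iff)
      with 3 show ?thesis
        using * td' by (simp add: nth_append Suc_diff_le wrap_add_left[OF M, where k=1] \<Delta>s)
    qed
  next
    fix m xs ys a r
    assume *: "m \<in> carrier M" "a \<in> carrier A" "r \<in> carrier R" "set xs \<subseteq> carrier A" "set ys \<subseteq> carrier A"
        "length xs + Suc (length ys) = n"
    consider "i < length xs" | "i = length xs" | j where "i = Suc (length xs + j)" "j < length ys"
      using i *(6) by (metis add_Suc_right add_less_cancel_left less_antisym linorder_neqE_nat less_imp_Suc_add Suc_less_eq plus_1_eq_Suc)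
    then show "wrap R M A (Suc n) (r \<odot>\<^bsub>M\<^esub> m) (take i (xs @ a # ys)) (drop (Suc i) (xs @ a # ys)) (\<Delta> ((xs @ a # ys) ! i)) =
        wrap R M A (Suc n) m (take i (xs @ (r \<odot>\<^bsub>A\<^esub> a) # ys)) (drop (Suc i) (xs @ (r \<odot>\<^bsub>A\<^esub> a) # ys)) (\<Delta> ((xs @ (r \<odot>\<^bsub>A\<^esub> a) # ys) ! i))"
    proof cases
      case 1
      then have "xs ! i \<in> carrier A" using * by (auto simp: subset_iff)
      with 1 show ?thesis
        using * td' by (simp add: nth_append wrap_smult_right[OF M, where k=1] \<Delta>s)
    next
      case 2
      then show ?thesis
        using * by (simp add: \<Delta>s wrap_smult[OF M, where k=1])
    next
      case 3
      then have "ys ! j \<in> carrier A" using * by (auto simp: subset_iff)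
      with 3 show ?thesis
        using * td' by (simp add: nth_append Suc_diff_le wrap_smult_left[OF M, where k=1] \<Delta>s)
    qed
  next
    fix m as assume *: "m \<in> carrier M" "set as \<subseteq> carrier A" "length as = n"
    then show "wrap R M A (Suc n) m (take i as) (drop (Suc i) as) (\<Delta> (as ! i)) \<in> carrier (tens R M A (Suc n))"
      using td[OF *(2,3)] i by (intro closed) (auto simp: \<Delta>s)
  next
    fix m m' as assume *: "m \<in> carrier M" "m' \<in> carrier M" "set as \<subseteq> carrier A" "length as = n"
    then show "wrap R M A (Suc n) (m \<oplus>\<^bsub>M\<^esub> m') (take i as) (drop (Suc i) as) (\<Delta> (as ! i)) =
       wrap R M A (Suc n) m (take i as) (drop (Suc i) as) (\<Delta> (as ! i)) \<oplus>\<^bsub>tens R M A (Suc n)\<^esub>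
       wrap R M A (Suc n) m' (take i as) (drop (Suc i) as) (\<Delta> (as ! i))"
      using td[OF *(3,4)] i by (intro wrap_add[OF M, where k=1]) (auto simp: \<Delta>s)
  qed
qed

lemma comult_at_additive:
  assumes "Module.module R M" "linear_map R A (tens R A A 1) \<Delta>" "i < n"
  shows "additive_map (tens R M A n) (tens R M A (Suc n)) (comult_at R M A \<Delta> n i)"
  unfolding comult_at_wrap
  by (rule tens_ext_additive[OF assms(1) tens_group[OF assms(1)] balanced_comult_at[OF assms]])

lemma comult_at_pure:
  assumes "Module.module R M" "linear_map R A (tens R A A 1) \<Delta>" "i < n"
    "m \<in> carrier M" "set as \<subseteq> carrier A" "length as = n"
  shows "comult_at R M A \<Delta> n i (pure_tens R M A m as) =
    wrap R M A (Suc n) m (take i as) (drop (Suc i) as) (\<Delta> (as ! i))"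
  unfolding comult_at_wrap
  by (rule tens_ext_pure[OF assms(1) tens_group[OF assms(1)] balanced_comult_at[OF assms(1-3)] assms(4-)])

end

section \<open>The Hochschild differential\<close>

text \<open>The recursion is chosen so that the differential of \<open>m \<otimes> Y\<close> splits off its first face and
  leaves the differential of \<open>Y\<close> in the Hochschild complex of \<open>A\<close>.\<close>

primrec altsum :: "('x, 'b) ring_scheme \<Rightarrow> nat \<Rightarrow> (nat \<Rightarrow> 'x) \<Rightarrow> 'x" where
  "altsum C 0 g = g 0"
| "altsum C (Suc k) g = g 0 \<ominus>\<^bsub>C\<^esub> altsum C k (\<lambda>i. g (Suc i))"

lemma altsum_closed:
  assumes "abelian_group C" "\<And>i. i \<le> k \<Longrightarrow> g i \<in> carrier C"
  shows "altsum C k g \<in> carrier C"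
proof -
  interpret abelian_group C by fact
  show ?thesis using assms(2) by (induction k arbitrary: g) auto
qed

lemma altsum_hom:
  assumes "abelian_group C" "abelian_group C'" "additive_map C C' f" "\<And>i. i \<le> k \<Longrightarrow> g i \<in> carrier C"
  shows "f (altsum C k g) = altsum C' k (\<lambda>i. f (g i))"
  using assms(4)
proof (induction k arbitrary: g)
  case (Suc k)
  then show ?case
    by (simp add: additive_map_minus[OF assms(1-3)] altsum_closed[OF assms(1)])
qed simp

lemma altsum_cong:
  "(\<And>i. i \<le> k \<Longrightarrow> g i = h i) \<Longrightarrow> altsum C k g = altsum C k h"
proof (induction k arbitrary: g h)
  case (Suc k)
  have "altsum C k (\<lambda>i. g (Suc i)) = altsum C k (\<lambda>i. h (Suc i))"
    by (rule Suc.IH) (simp add: Suc.prems)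
  then show ?case by (simp add: Suc.prems)
qed simp

lemma altsum_additive:
  assumes "abelian_group C" "\<And>i. i \<le> k \<Longrightarrow> additive_map X C (\<lambda>x. g x i)"
  shows "additive_map X C (\<lambda>x. altsum C k (g x))"
  using assms(2)
proof (induction k arbitrary: g)
  case (Suc k)
  show ?case
    using additive_map_minus_fun[OF assms(1) Suc.prems[of 0] Suc.IH[of "\<lambda>x i. g x (Suc i)"]] Suc.prems
    by simp
qed simp

lemma altsum_finsum:
  assumes "abelian_group C" "\<And>i. i \<le> k \<Longrightarrow> g i \<in> carrier C"
  shows "altsum C k g = (\<Oplus>\<^bsub>C\<^esub>i\<in>{..k}. [((-1 :: int) ^ i)] \<cdot>\<^bsub>C\<^esub> g i)"
  using assms(2)
proof (induction k arbitrary: g)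
  interpret abelian_group C by fact
  case 0
  then show ?case by (simp add: Pi_iff)
next
  interpret abelian_group C by fact
  case (Suc k)
  have neg: "additive_map C C (a_inv C)" by (auto simp: additive_map_def minus_add)
  have int_neg: "\<ominus>\<^bsub>C\<^esub> ([(m::int)] \<cdot>\<^bsub>C\<^esub> x) = [(- m)] \<cdot>\<^bsub>C\<^esub> x" if "x \<in> carrier C" for m x
    using that add.int_pow_neg[of x m] by simp
  have "altsum C (Suc k) g = g 0 \<oplus>\<^bsub>C\<^esub> \<ominus>\<^bsub>C\<^esub> (\<Oplus>\<^bsub>C\<^esub>i\<in>{..k}. [((-1 :: int) ^ i)] \<cdot>\<^bsub>C\<^esub> g (Suc i))"
    using Suc by (simp add: minus_eq)
  also have "\<ominus>\<^bsub>C\<^esub> (\<Oplus>\<^bsub>C\<^esub>i\<in>{..k}. [((-1 :: int) ^ i)] \<cdot>\<^bsub>C\<^esub> g (Suc i)) =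
      (\<Oplus>\<^bsub>C\<^esub>i\<in>{..k}. \<ominus>\<^bsub>C\<^esub> ([((-1 :: int) ^ i)] \<cdot>\<^bsub>C\<^esub> g (Suc i)))"
    using Suc.prems by (intro hom_finsum[OF assms(1) assms(1) neg]) auto
  also have "\<dots> = (\<Oplus>\<^bsub>C\<^esub>i\<in>{..k}. [((-1 :: int) ^ Suc i)] \<cdot>\<^bsub>C\<^esub> g (Suc i))"
    using Suc.prems by (intro finsum_cong') (auto simp: int_neg)
  finally show ?case
    using Suc.prems by (subst finsum_Suc2) (auto simp: a_comm Pi_iff)
qed

text \<open>This is the shape of \<open>hoch_diff\<close>, which keeps the first and the last face
  outside the signed sum.\<close>

lemma altsum_split:
  assumes "abelian_group C" and g: "\<And>i. g i \<in> carrier C"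
  shows "altsum C (Suc n) g = g 0 \<oplus>\<^bsub>C\<^esub> (\<Oplus>\<^bsub>C\<^esub>i\<in>{1..n}. [((-1 :: int) ^ i)] \<cdot>\<^bsub>C\<^esub> g i) \<oplus>\<^bsub>C\<^esub> [((-1 :: int) ^ (n + 1))] \<cdot>\<^bsub>C\<^esub> g (Suc n)"
proof -
  interpret abelian_group C by fact
  have s: "{..n} = insert 0 {1..n}" by auto
  show ?thesis
    unfolding altsum_finsum[OF assms]
    using g by (subst finsum_Suc) (simp_all add: s Pi_iff a_ac power_add)
qed

lemma dtens_simps [simp]:
  "carrier (dtens R M A n) = carrier (tens R M A n)"
  "\<zero>\<^bsub>dtens R M A n\<^esub> = \<zero>\<^bsub>tens R M A n\<^esub>"
  "ring.add (dtens R M A n) = ring.add (tens R M A n)"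
  "smult (dtens R M A n) = smult (tens R M A n)"
  "dsigma (dtens R M A n) = gmap R M A n (dsigma M) (dsigma A)"
  by (simp_all add: dtens_def module.extend_def gmap_def)

lemma linear_map_dtens [simp]: "linear_map R M (dtens R N A n) f \<longleftrightarrow> linear_map R M (tens R N A n) f"
  by (simp add: linear_map_def)

locale hopf_base =
  fixes R :: "('r, 'z) dring_scheme" and A :: "('r, 'a, 'y) dhopf_scheme"
  assumes hopf: "difference_hopf_algebra R A"

sublocale hopf_base \<subseteq> tensor_base R A
  by (rule tensor_base.intro) (use hopf in \<open>simp add: difference_hopf_algebra_def difference_module_def\<close>)

context hopf_base
begin

abbreviation "\<Delta> \<equiv> comult A"

text \<open>The comodule laws without \<sigma> and with the coaction separated from the record, so
  that \<open>A\<close> with \<open>\<Delta>\<close> is itself an instance.\<close>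

definition comod :: "('r, 'm, 'x) module_scheme \<Rightarrow> ('m \<Rightarrow> ('m, 'a) tens) \<Rightarrow> bool" where
  "comod M \<mu> \<longleftrightarrow> Module.module R M \<and> linear_map R M (tens R M A 1) \<mu> \<and>
     (\<forall>f\<in>carrier M. coact_first R M A \<mu> 1 (\<mu> f) = comult_at R M A \<Delta> 1 0 (\<mu> f)) \<and>
     (\<forall>f\<in>carrier M. tens_ext M (\<lambda>(g, as). counit A (hd as) \<odot>\<^bsub>M\<^esub> g) (\<mu> f) = f)"

lemma one_closed [simp]: "\<one>\<^bsub>A\<^esub> \<in> carrier A"
proof -
  interpret algebra R A using hopf by (simp add: difference_hopf_algebra_def)
  show ?thesis by simp
qed

lemma comult_linear: "linear_map R A (tens R A A 1) \<Delta>"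
  using hopf by (simp add: difference_hopf_algebra_def dmod_map_def)

text \<open>The last face appends the unit, so \<partial>\<partial> = 0 depends on the unit being
  grouplike.\<close>

lemma comult_one: "\<Delta> \<one>\<^bsub>A\<^esub> = pure_tens R A A \<one>\<^bsub>A\<^esub> [\<one>\<^bsub>A\<^esub>]"
proof -
  have "\<Delta> \<in> ring_hom A (tens R A A 1)" using hopf by (simp add: difference_hopf_algebra_def)
  then have "\<Delta> \<one>\<^bsub>A\<^esub> = \<one>\<^bsub>tens R A A 1\<^esub>" by (rule ring_hom_one)
  then show ?thesis by (simp add: tens_def Let_def One_nat_def del: One_nat_def [symmetric])
qed

text \<open>Coassociativity and one of the counit laws of \<open>A\<close> are literally the
  comodule laws for \<open>\<Delta>\<close>. This instance anchors the induction for
  \<partial>\<partial> = 0 and is the source of the comodule structure on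
  \<open>M \<otimes> A\<close>.\<close>

lemma comod_hopf: "comod A \<Delta>"
  using hopf comult_linear module_A
  by (simp add: comod_def difference_hopf_algebra_def)

lemma comodD:
  assumes "comod M \<mu>"
  shows "Module.module R M" "linear_map R M (tens R M A 1) \<mu>"
    and "f \<in> carrier M \<Longrightarrow> coact_first R M A \<mu> 1 (\<mu> f) = comult_at R M A \<Delta> 1 0 (\<mu> f)"
    and "f \<in> carrier M \<Longrightarrow> tens_ext M (\<lambda>(g, as). counit A (hd as) \<odot>\<^bsub>M\<^esub> g) (\<mu> f) = f"
  using assms by (auto simp: comod_def)

text \<open>The coface maps of the cobar construction. Slots count from 0, so face \<open>i\<close>
  comultiplies slot \<open>i - 1\<close>. Every index beyond \<open>n\<close> gives the last face,
  which makes \<open>face_additive\<close> hold without a bound on \<open>i\<close>.\<close>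

definition face ::
    "('r, 'm, 'x) module_scheme \<Rightarrow> ('m \<Rightarrow> ('m, 'a) tens) \<Rightarrow> nat \<Rightarrow> nat \<Rightarrow> ('m, 'a) tens \<Rightarrow> ('m, 'a) tens" where
  "face M \<mu> n i X = (if i = 0 then coact_first R M A \<mu> n X
     else if i \<le> n then comult_at R M A \<Delta> n (i - 1) X else app R M A (Suc n) [\<one>\<^bsub>A\<^esub>] X)"

definition hdiff ::
    "('r, 'm, 'x) module_scheme \<Rightarrow> ('m \<Rightarrow> ('m, 'a) tens) \<Rightarrow> nat \<Rightarrow> ('m, 'a) tens \<Rightarrow> ('m, 'a) tens" where
  "hdiff M \<mu> n X = altsum (tens R M A (Suc n)) (Suc n) (\<lambda>i. face M \<mu> n i X)"

lemma face_additive: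
  assumes "Module.module R M" "linear_map R M (tens R M A 1) \<mu>"
  shows "additive_map (tens R M A n) (tens R M A (Suc n)) (face M \<mu> n i)"
  using coact_first_additive[OF assms, of n] comult_at_additive[OF assms(1) comult_linear, of "i - 1" n]
    app_additive[OF assms(1), of "[\<one>\<^bsub>A\<^esub>]" "Suc n" n]
  by (cases "i = 0"; cases "i \<le> n") (auto simp: face_def[abs_def])

lemma hdiff_additive:
  assumes "Module.module R M" "linear_map R M (tens R M A 1) \<mu>"
  shows "additive_map (tens R M A n) (tens R M A (Suc n)) (hdiff M \<mu> n)"
  unfolding hdiff_def[abs_def] by (intro altsum_additive tens_group face_additive assms)

lemma hdiff_closed:
  assumes "Module.module R M" "linear_map R M (tens R M A 1) \<mu>" "X \<in> carrier (tens R M A n)"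
  shows "hdiff M \<mu> n X \<in> carrier (tens R M A (Suc n))"
  by (rule additive_map_closed[OF hdiff_additive[OF assms(1,2)] assms(3)])

lemma hoch_diff_eq:
  fixes F :: "('r, 'a, 'm) dcomod"
  assumes "Module.module R F" "linear_map R F (tens R F A 1) (coact F)" "X \<in> carrier (tens R F A n)"
  shows "hoch_diff R A F n X = hdiff F (coact F) n X"
proof -
  interpret abelian_group "tens R F A (Suc n)" by (rule tens_group[OF assms(1)])
  have f: "face F (coact F) n i X \<in> carrier (tens R F A (Suc n))" for i
    by (rule additive_map_closed[OF face_additive[OF assms(1,2)] assms(3)])
  have "(\<Oplus>\<^bsub>tens R F A (Suc n)\<^esub>i\<in>{1..n}. [((-1 :: int) ^ i)] \<cdot>\<^bsub>tens R F A (Suc n)\<^esub> comult_at R F A (comult A) n (i - 1) X) =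
     (\<Oplus>\<^bsub>tens R F A (Suc n)\<^esub>i\<in>{1..n}. [((-1 :: int) ^ i)] \<cdot>\<^bsub>tens R F A (Suc n)\<^esub> face F (coact F) n i X)"
    using f by (intro finsum_cong') (auto simp: face_def)
  then show ?thesis
    unfolding hdiff_def
    by (subst altsum_split[OF tens_group[OF assms(1)] f])
       (simp add: hoch_diff_def Let_def face_def app_def)
qed

text \<open>The two cases of interest are \<open>\<theta> = \<sigma>\<close>, \<open>\<tau> = \<sigma>\<close> and, for linear \<open>\<phi>\<close>, \<open>\<theta> = id\<close>, \<open>\<tau> = id\<close>.\<close>

definition compat ::
    "('r \<Rightarrow> 'r) \<Rightarrow> ('r, 'm, 'x) module_scheme \<Rightarrow> ('m \<Rightarrow> ('m, 'a) tens) \<Rightarrow>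
     ('r, 'n, 'v) module_scheme \<Rightarrow> ('n \<Rightarrow> ('n, 'a) tens) \<Rightarrow> ('m \<Rightarrow> 'n) \<Rightarrow> ('a \<Rightarrow> 'a) \<Rightarrow> bool" where
  "compat \<theta> M \<mu> N \<nu> \<phi> \<tau> \<longleftrightarrow> semilinear R \<theta> M N \<phi> \<and> semilinear R \<theta> A A \<tau> \<and> \<tau> \<one>\<^bsub>A\<^esub> = \<one>\<^bsub>A\<^esub> \<and>
     (\<forall>x\<in>carrier M. \<nu> (\<phi> x) = gmap R N A 1 \<phi> \<tau> (\<mu> x)) \<and>
     (\<forall>a\<in>carrier A. \<Delta> (\<tau> a) = gmap R A A 1 \<tau> \<tau> (\<Delta> a))"

lemma coact_first_gmap:
  assumes "Module.module R M" "linear_map R M (tens R M A 1) \<mu>" "Module.module R N" "linear_map R N (tens R N A 1) \<nu>"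
    and c: "compat \<theta> M \<mu> N \<nu> \<phi> \<tau>" and X: "X \<in> carrier (tens R M A n)"
  shows "coact_first R N A \<nu> n (gmap R N A n \<phi> \<tau> X) = gmap R N A (Suc n) \<phi> \<tau> (coact_first R M A \<mu> n X)"
proof -
  have \<phi>: "semilinear R \<theta> M N \<phi>" and \<tau>: "semilinear R \<theta> A A \<tau>"
    and e: "\<And>x. x \<in> carrier M \<Longrightarrow> \<nu> (\<phi> x) = gmap R N A 1 \<phi> \<tau> (\<mu> x)"
    using c by (auto simp: compat_def)
  have s: "set (map \<tau> as) \<subseteq> carrier A" if "set as \<subseteq> carrier A" for as
    using that semilinearD(2)[OF \<tau>] by auto
  note g = gmap_additive[OF assms(1,3) \<phi> \<tau>] and gp = gmap_pure[OF assms(1,3) \<phi> \<tau>]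
  show ?thesis
    by (rule tens_eqI[OF assms(1) tens_group[OF assms(3)] additive_map_comp[OF g coact_first_additive[OF assms(3,4)]]
          additive_map_comp[OF coact_first_additive[OF assms(1,2)] g] _ X])
       (simp add: gp coact_first_pure[OF assms(1,2)] coact_first_pure[OF assms(3,4)] s semilinearD(2)[OF \<phi>] e
         app_gmap[OF assms(1,3) \<phi> \<tau>, where k=1] linear_mapD(2)[OF assms(2)] del: set_map)
qed

lemma comult_at_gmap:
  assumes "Module.module R M" "Module.module R N"
    and c: "compat \<theta> M \<mu> N \<nu> \<phi> \<tau>" and i: "i < n" and X: "X \<in> carrier (tens R M A n)"
  shows "comult_at R N A \<Delta> n i (gmap R N A n \<phi> \<tau> X) = gmap R N A (Suc n) \<phi> \<tau> (comult_at R M A \<Delta> n i X)"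
proof -
  have \<phi>: "semilinear R \<theta> M N \<phi>" and \<tau>: "semilinear R \<theta> A A \<tau>"
    and e: "\<And>x. x \<in> carrier A \<Longrightarrow> \<Delta> (\<tau> x) = gmap R A A 1 \<tau> \<tau> (\<Delta> x)"
    using c by (auto simp: compat_def)
  have s: "set (map \<tau> as) \<subseteq> carrier A" if "set as \<subseteq> carrier A" for as
    using that semilinearD(2)[OF \<tau>] by auto
  have td': "set (take j as) \<subseteq> carrier A" "set (drop j as) \<subseteq> carrier A"
    if "set as \<subseteq> carrier A" for as j
    using that set_take_subset[of j as] set_drop_subset[of j as] by auto
  have nth: "as ! i \<in> carrier A" if "set as \<subseteq> carrier A" "length as = n" for as
    using that i by (auto simp: subset_iff)
  note g = gmap_additive[OF assms(1,2) \<phi> \<tau>] and gp = gmap_pure[OF assms(1,2) \<phi> \<tau>]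
  show ?thesis
    by (rule tens_eqI[OF assms(1) tens_group[OF assms(2)] additive_map_comp[OF g comult_at_additive[OF assms(2) comult_linear i]]
          additive_map_comp[OF comult_at_additive[OF assms(1) comult_linear i] g] _ X])
       (use i in \<open>simp add: gp comult_at_pure[OF assms(1) comult_linear] comult_at_pure[OF assms(2) comult_linear] s semilinearD(2)[OF \<phi>]
         wrap_gmap[OF assms(1,2) \<phi> \<tau>, where k=1] linear_mapD(2)[OF comult_linear] nth td' e take_map drop_map del: set_map\<close>)
qed

text \<open>Each face commutes with the induced map: the first because the coactions are respected,
  the middle ones because \<open>\<tau>\<close> respects \<open>\<Delta>\<close>, the last because
  \<open>\<tau>\<close> fixes the unit.\<close>

lemma hdiff_gmap:
  assumes "Module.module R M" "linear_map R M (tens R M A 1) \<mu>" "Module.module R N" "linear_map R N (tens R N A 1) \<nu>"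
    and c: "compat \<theta> M \<mu> N \<nu> \<phi> \<tau>" and X: "X \<in> carrier (tens R M A n)"
  shows "hdiff N \<nu> n (gmap R N A n \<phi> \<tau> X) = gmap R N A (Suc n) \<phi> \<tau> (hdiff M \<mu> n X)"
proof -
  have \<phi>: "semilinear R \<theta> M N \<phi>" and \<tau>: "semilinear R \<theta> A A \<tau>" and \<tau>1: "\<tau> \<one>\<^bsub>A\<^esub> = \<one>\<^bsub>A\<^esub>"
    using c by (auto simp: compat_def)
  have f: "face M \<mu> n i X \<in> carrier (tens R M A (Suc n))" for i
    by (rule additive_map_closed[OF face_additive[OF assms(1,2)] X])
  have "face N \<nu> n i (gmap R N A n \<phi> \<tau> X) = gmap R N A (Suc n) \<phi> \<tau> (face M \<mu> n i X)" for i
    using coact_first_gmap[OF assms] comult_at_gmap[OF assms(1,3) c _ X, of "i - 1"]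
      app_gmap[OF assms(1,3) \<phi> \<tau> _ _ X, of "[\<one>\<^bsub>A\<^esub>]" "Suc n"]
    by (auto simp: face_def \<tau>1)
  then show ?thesis
    unfolding hdiff_def
    by (subst altsum_hom[OF tens_group[OF assms(1)] tens_group[OF assms(3)] gmap_additive[OF assms(1,3) \<phi> \<tau>]])
       (auto intro: f)
qed

subsection \<open>The square of the differential\<close>

text \<open>\<open>m \<otimes> a\<^sub>1 \<otimes> \<dots> \<otimes> a\<^sub>k \<mapsto> m \<otimes> a\<^sub>1 \<otimes> \<dots> \<otimes> a\<^sub>k \<otimes> Y\<close>, the first summand in the differential of \<open>m \<otimes> Y\<close>. Its own
  differential satisfies a Leibniz rule, from which \<open>\<partial>\<partial> = 0\<close> follows by induction on the degree,
  first for \<open>A\<close> and then for arbitrary comodules.\<close>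

definition star ::
    "('r, 'm, 'x) module_scheme \<Rightarrow> nat \<Rightarrow> ('a, 'a) tens \<Rightarrow> ('m, 'a) tens \<Rightarrow> ('m, 'a) tens" where
  "star M n Y = tens_ext (tens R M A n) (\<lambda>(m, as). wrap R M A n m as [] Y)"

lemma balanced_star:
  assumes M: "Module.module R M" and Y: "Y \<in> carrier (tens R A A k)" and n: "n = l + Suc k"
  shows "balanced R M A l (tens R M A n) (\<lambda>m as. wrap R M A n m as [] Y)"
  unfolding balanced_def
  using Y n by (simp add: wrap_add[OF M, where k=k] wrap_add_left[OF M, where k=k] wrap_smult_left[OF M, where k=k]
     additive_map_closed[OF wrap_additive[OF M, where k=k]])

lemma star_additive:
  assumes M: "Module.module R M" and Y: "Y \<in> carrier (tens R A A k)" and n: "n = l + Suc k"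
  shows "additive_map (tens R M A l) (tens R M A n) (star M n Y)"
  unfolding star_def by (rule tens_ext_additive[OF M tens_group[OF M] balanced_star[OF assms]])

lemma star_pure:
  assumes M: "Module.module R M" and Y: "Y \<in> carrier (tens R A A k)" and n: "n = length as + Suc k"
    and "m \<in> carrier M" "set as \<subseteq> carrier A"
  shows "star M n Y (pure_tens R M A m as) = wrap R M A n m as [] Y"
  unfolding star_def by (rule tens_ext_pure[OF M tens_group[OF M] balanced_star[OF assms(1-3)] assms(4,5) refl])

lemma star_app:
  assumes M: "Module.module R M" and b: "b \<in> carrier A" "set bs \<subseteq> carrier A" and n: "n = l + Suc (length bs)"
    and X: "X \<in> carrier (tens R M A l)"
  shows "star M n (pure_tens R A A b bs) X = app R M A n (b # bs) X"
  by (rule tens_eqI[OF M tens_group[OF M] star_additive[OF M pure_tens_closed[OF module_A]] app_additive[OF M] _ X])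
    (use b n in \<open>simp_all add: star_pure[OF M pure_tens_closed[OF module_A]] app_pure[OF M] wrap_pure[OF M]\<close>)

lemma wrap_wrap:
  assumes M: "Module.module R M" and m: "m \<in> carrier M" and b: "b \<in> carrier A"
    and l: "set xs \<subseteq> carrier A" "set us \<subseteq> carrier A" "set vs \<subseteq> carrier A" "set zs \<subseteq> carrier A"
    and k: "k = length us + Suc (l + length vs)" and n: "n = length xs + Suc (k + length zs)"
    and Y: "Y \<in> carrier (tens R A A l)"
  shows "wrap R M A n m xs zs (wrap R A A k b us vs Y) = wrap R M A n m (xs @ b # us) (vs @ zs) Y"
  by (rule tens_eqI[OF module_A tens_group[OF M] additive_map_comp[OF wrap_additive[OF module_A b l(2,3) k] wrap_additive[OF M m l(1,4) n]]
       wrap_additive[OF M m] _ Y])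
     (use assms in \<open>simp_all add: wrap_pure[OF M] wrap_pure[OF module_A]\<close>)

lemma wrap_app:
  assumes M: "Module.module R M" and m: "m \<in> carrier M"
    and l: "set xs \<subseteq> carrier A" "set us \<subseteq> carrier A" "set zs \<subseteq> carrier A"
    and k: "k = l + length us" and n: "n = length xs + Suc (k + length zs)"
    and Y: "Y \<in> carrier (tens R A A l)"
  shows "wrap R M A n m xs zs (app R A A k us Y) = wrap R M A n m xs (us @ zs) Y"
  by (rule tens_eqI[OF module_A tens_group[OF M] additive_map_comp[OF app_additive[OF module_A l(2) k] wrap_additive[OF M m l(1,3) n]]
       wrap_additive[OF M m] _ Y])
     (use assms in \<open>simp_all add: wrap_pure[OF M] app_pure[OF module_A]\<close>)

lemma app_wrap:
  assumes M: "Module.module R M" and m: "m \<in> carrier M"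
    and l: "set xs \<subseteq> carrier A" "set us \<subseteq> carrier A" "set zs \<subseteq> carrier A"
    and k: "k = length xs + Suc (l + length zs)" and n: "n = k + length us"
    and Y: "Y \<in> carrier (tens R A A l)"
  shows "app R M A n us (wrap R M A k m xs zs Y) = wrap R M A n m xs (zs @ us) Y"
  by (rule tens_eqI[OF module_A tens_group[OF M] additive_map_comp[OF wrap_additive[OF M m l(1,3) k] app_additive[OF M l(2) n]]
       wrap_additive[OF M m] _ Y])
     (use assms in \<open>simp_all add: wrap_pure[OF M] app_pure[OF M]\<close>)

abbreviation pre :: "('r, 'm, 'x) module_scheme \<Rightarrow> nat \<Rightarrow> 'm \<Rightarrow> ('a, 'a) tens \<Rightarrow> ('m, 'a) tens" where
  "pre M n m \<equiv> wrap R M A n m [] []"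

context
  fixes M :: "('r, 'm, 'x) module_scheme" and \<mu>
  assumes M: "Module.module R M" and \<mu>: "linear_map R M (tens R M A 1) \<mu>"
begin

lemma coact_first_pre:
  assumes m: "m \<in> carrier M" and Y: "Y \<in> carrier (tens R A A n)"
  shows "coact_first R M A \<mu> (Suc n) (pre M (Suc n) m Y) = star M (Suc (Suc n)) Y (\<mu> m)"
proof (rule tens_eqI[OF module_A tens_group[OF M] _ _ _ Y])
  show "additive_map (tens R A A n) (tens R M A (Suc (Suc n))) (\<lambda>Y. coact_first R M A \<mu> (Suc n) (pre M (Suc n) m Y))"
    by (rule additive_map_comp[OF wrap_additive[OF M m] coact_first_additive[OF M \<mu>]]) auto
  \<comment> \<open>\<open>star\<close> is an extension in its tensor argument, so its additivity in
    \<open>Y\<close> is a separate fact, checked on elementary tensors of that argument.\<close>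
  have "star M (Suc (Suc n)) (Y \<oplus>\<^bsub>tens R A A n\<^esub> Z) X = star M (Suc (Suc n)) Y X \<oplus>\<^bsub>tens R M A (Suc (Suc n))\<^esub> star M (Suc (Suc n)) Z X"
    if Y: "Y \<in> carrier (tens R A A n)" and Z: "Z \<in> carrier (tens R A A n)" and X: "X \<in> carrier (tens R M A 1)" for X Y Z
  proof -
    have YZ: "Y \<oplus>\<^bsub>tens R A A n\<^esub> Z \<in> carrier (tens R A A n)"
      using Y Z abelian_monoid.a_closed[OF abelian_group.axioms(1)[OF tens_group[OF module_A]]] by blast
    show ?thesis
      by (rule tens_eqI[OF M tens_group[OF M] star_additive[OF M YZ]
          additive_map_plus[OF tens_group[OF M] star_additive[OF M Y] star_additive[OF M Z]] _ X])
         (simp_all add: star_pure[OF M YZ] star_pure[OF M Y] star_pure[OF M Z] additive_map_add[OF wrap_additive[OF M, where k=n]] Y Z)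
  qed
  then show "additive_map (tens R A A n) (tens R M A (Suc (Suc n))) (\<lambda>Y. star M (Suc (Suc n)) Y (\<mu> m))"
    using linear_mapD(2)[OF \<mu> m]
    by (intro additive_mapI) (simp_all add: additive_map_closed[OF star_additive[OF M, where l = 1 and k = n]])
qed (use m linear_mapD(2)[OF \<mu> m] in \<open>simp add: star_app[OF M, where l=1] wrap_pure[OF M] coact_first_pure[OF M \<mu>]\<close>)

lemma comult_at_pre_0:
  assumes m: "m \<in> carrier M" and Y: "Y \<in> carrier (tens R A A n)"
  shows "comult_at R M A \<Delta> (Suc n) 0 (pre M (Suc n) m Y) = pre M (Suc (Suc n)) m (coact_first R A A \<Delta> n Y)"
  by (rule tens_eqI[OF module_A tens_group[OF M]
     additive_map_comp[OF wrap_additive[OF M m] comult_at_additive[OF M comult_linear]]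
     additive_map_comp[OF coact_first_additive[OF module_A comult_linear] wrap_additive[OF M m]] _ Y])
   (use m in \<open>simp_all add: wrap_pure[OF M] comult_at_pure[OF M comult_linear] coact_first_pure[OF module_A comult_linear]
      wrap_app[OF M, where l=1] linear_mapD(2)[OF comult_linear]\<close>)

lemma comult_at_pre_Suc:
  assumes m: "m \<in> carrier M" and i: "i < n" and Y: "Y \<in> carrier (tens R A A n)"
  shows "comult_at R M A \<Delta> (Suc n) (Suc i) (pre M (Suc n) m Y) = pre M (Suc (Suc n)) m (comult_at R A A \<Delta> n i Y)"
proof -
  have td': "set (take j as) \<subseteq> carrier A" "set (drop j as) \<subseteq> carrier A"
    if "set as \<subseteq> carrier A" for as j
    using that set_take_subset[of j as] set_drop_subset[of j as] by auto
  have nth: "as ! i \<in> carrier A" if "set as \<subseteq> carrier A" "length as = n" for as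
    using that i by (auto simp: subset_iff)
  show ?thesis
    by (rule tens_eqI[OF module_A tens_group[OF M]
     additive_map_comp[OF wrap_additive[OF M m] comult_at_additive[OF M comult_linear]]
     additive_map_comp[OF comult_at_additive[OF module_A comult_linear i] wrap_additive[OF M m]] _ Y])
   (use m i in \<open>simp_all add: wrap_pure[OF M] comult_at_pure[OF M comult_linear] comult_at_pure[OF module_A comult_linear]
      wrap_wrap[OF M, where l=1] linear_mapD(2)[OF comult_linear] td' nth\<close>)
qed

text \<open>All faces but the first leave \<open>m\<close> alone. On \<open>m \<otimes> Y\<close>
  they are the faces of \<open>Y\<close> with index lowered by one; comultiplying the leading slot
  of \<open>Y\<close> is its coaction face, because \<open>A\<close> coacts on itself by
  \<open>\<Delta>\<close>.\<close>

lemma face_pre_Suc: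
  assumes m: "m \<in> carrier M" and Y: "Y \<in> carrier (tens R A A n)"
  shows "face M \<mu> (Suc n) (Suc i) (pre M (Suc n) m Y) = pre M (Suc (Suc n)) m (face A \<Delta> n i Y)"
proof (cases i)
  case 0
  then show ?thesis using comult_at_pre_0[OF assms] by (simp add: face_def)
next
  case (Suc j)
  then show ?thesis
    using comult_at_pre_Suc[OF m _ Y, of j] m Y
    by (simp del: One_nat_def[symmetric] add: face_def Suc_le_eq app_wrap[OF M, where l=n] wrap_app[OF M, where l=n])
qed

text \<open>The minus sign is the one in the recursion of \<open>altsum\<close>: after face 0 is
  removed, the shifted faces sum to the differential of \<open>Y\<close>.\<close>

lemma hdiff_pre:
  assumes m: "m \<in> carrier M" and Y: "Y \<in> carrier (tens R A A n)"
  shows "hdiff M \<mu> (Suc n) (pre M (Suc n) m Y) =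
     star M (Suc (Suc n)) Y (\<mu> m) \<ominus>\<^bsub>tens R M A (Suc (Suc n))\<^esub> pre M (Suc (Suc n)) m (hdiff A \<Delta> n Y)"
proof -
  have f: "face A \<Delta> n i Y \<in> carrier (tens R A A (Suc n))" for i
    by (rule additive_map_closed[OF face_additive[OF module_A comult_linear] Y])
  have "hdiff M \<mu> (Suc n) (pre M (Suc n) m Y) = face M \<mu> (Suc n) 0 (pre M (Suc n) m Y) \<ominus>\<^bsub>tens R M A (Suc (Suc n))\<^esub>
     altsum (tens R M A (Suc (Suc n))) (Suc n) (\<lambda>i. pre M (Suc (Suc n)) m (face A \<Delta> n i Y))"
    unfolding hdiff_def by (subst altsum.simps(2)) (simp only: face_pre_Suc[OF assms])
  moreover have "altsum (tens R M A (Suc (Suc n))) (Suc n) (\<lambda>i. pre M (Suc (Suc n)) m (face A \<Delta> n i Y)) =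
      pre M (Suc (Suc n)) m (hdiff A \<Delta> n Y)"
    unfolding hdiff_def
    by (rule altsum_hom[OF tens_group[OF module_A] tens_group[OF M] wrap_additive[OF M m], symmetric])
      (auto intro: f)
  moreover have "face M \<mu> (Suc n) 0 (pre M (Suc n) m Y) = star M (Suc (Suc n)) Y (\<mu> m)"
    using coact_first_pre[OF assms] by (simp add: face_def)
  ultimately show ?thesis by simp
qed

end

end

lemma (in abelian_group) minus_self: "x \<in> carrier G \<Longrightarrow> x \<ominus> x = \<zero>"
  by (simp add: minus_eq r_neg)

lemma (in abelian_group) minus_zero_right: "x \<in> carrier G \<Longrightarrow> x \<ominus> \<zero> = x"
  by (simp add: minus_eq)

lemma (in abelian_group) minus_minus_cancel:
  "x \<in> carrier G \<Longrightarrow> y \<in> carrier G \<Longrightarrow> x \<ominus> (x \<ominus> y) = y"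
  by (simp add: minus_eq minus_add a_assoc[symmetric] r_neg)

lemma (in abelian_group) minus_eq_zeroD:
  assumes "x \<ominus> y = \<zero>" "x \<in> carrier G" "y \<in> carrier G" shows "x = y"
proof -
  have "x = (x \<ominus> y) \<oplus> y" using assms(2,3) by (simp add: minus_eq a_assoc l_neg)
  then show ?thesis using assms by simp
qed

context hopf_base
begin

lemma face_simps:
  "face M \<mu> n 0 X = coact_first R M A \<mu> n X"
  "i < n \<Longrightarrow> face M \<mu> n (Suc i) X = comult_at R M A \<Delta> n i X"
  "\<not> i < n \<Longrightarrow> face M \<mu> n (Suc i) X = app R M A (Suc n) [\<one>\<^bsub>A\<^esub>] X"
  by (simp_all add: face_def One_nat_def del: One_nat_def[symmetric])

lemma face_simps_1:
  "0 < n \<Longrightarrow> face M \<mu> n 1 X = comult_at R M A \<Delta> n 0 X"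
  "face M \<mu> 0 1 X = app R M A 1 [\<one>\<^bsub>A\<^esub>] X"
  "face M \<mu> 1 2 X = app R M A 2 [\<one>\<^bsub>A\<^esub>] X"
  by (simp_all add: face_def numeral_2_eq_2 One_nat_def del: One_nat_def[symmetric])

lemma altsum_2: "altsum C 2 g = g 0 \<ominus>\<^bsub>C\<^esub> (g 1 \<ominus>\<^bsub>C\<^esub> g 2)"
  by (simp add: numeral_2_eq_2 One_nat_def del: One_nat_def[symmetric])

lemma altsum_1: "altsum C 1 g = g 0 \<ominus>\<^bsub>C\<^esub> g (Suc 0)"
  by (simp add: One_nat_def del: One_nat_def[symmetric])

text \<open>Obtained by applying \<open>hdiff_pre\<close> twice, to the two leading factors of
  \<open>m \<otimes> a \<otimes> Y\<close>. The bracket measures the failure of coassociativity at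
  \<open>X\<close>; it vanishes for \<open>X = \<mu> m\<close>.\<close>

lemma hdiff_star:
  assumes M: "Module.module R M" and \<mu>: "linear_map R M (tens R M A 1) \<mu>"
    and Y: "Y \<in> carrier (tens R A A n)" and X: "X \<in> carrier (tens R M A 1)"
  defines "N \<equiv> Suc (Suc (Suc n))"
  shows "hdiff M \<mu> (Suc (Suc n)) (star M (Suc (Suc n)) Y X) =
     (star M N Y (coact_first R M A \<mu> 1 X) \<ominus>\<^bsub>tens R M A N\<^esub> star M N Y (comult_at R M A \<Delta> 1 0 X))
     \<oplus>\<^bsub>tens R M A N\<^esub> star M N (hdiff A \<Delta> n Y) X"
proof -
  have dY: "hdiff A \<Delta> n Y \<in> carrier (tens R A A (Suc n))"
    by (rule hdiff_closed[OF module_A comult_linear Y])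
  have 1: "Suc (Suc n) = 1 + Suc n" "N = Suc 1 + Suc n" "N = 1 + Suc (Suc n)" by (simp_all add: N_def)
  interpret T: abelian_group "tens R M A N" by (rule tens_group[OF M])
  have hd: "additive_map (tens R M A (Suc (Suc n))) (tens R M A N) (hdiff M \<mu> (Suc (Suc n)))"
    unfolding N_def by (rule hdiff_additive[OF M \<mu>])
  have c0: "additive_map (tens R M A 1) (tens R M A (Suc 1)) (comult_at R M A \<Delta> 1 0)"
    by (rule comult_at_additive[OF M comult_linear]) simp
  show ?thesis
  proof (rule tens_eqI[OF M tens_group[OF M] additive_map_comp[OF star_additive[OF M Y 1(1)] hd]
        additive_map_plus[OF tens_group[OF M] additive_map_minus_fun[OF tens_group[OF M] additive_map_comp[OF
           coact_first_additive[OF M \<mu>] star_additive[OF M Y 1(2)]] additive_map_comp[OF c0 star_additive[OF M Y 1(2)]]] star_additive[OF M dY 1(3)]] _ X])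
    fix m as assume m: "m \<in> carrier M" and "set as \<subseteq> carrier A" "length as = 1"
    then obtain a where as: "as = [a]" and a: "a \<in> carrier A" by (cases as) auto
    note wc = additive_map_closed[OF wrap_additive[OF module_A, where k = n]]
    have cl: "star M N Y (app R M A (Suc 1) [a] (\<mu> m)) \<in> carrier (tens R M A N)"
      "star M N Y (pre M (Suc 1) m (\<Delta> a)) \<in> carrier (tens R M A N)"
      using a m linear_mapD(2)[OF \<mu> m] linear_mapD(2)[OF comult_linear a]
      by (auto intro!: additive_map_closed[OF star_additive[OF M Y 1(2)]] additive_map_closed[OF app_additive[OF M, where k=1]]
            additive_map_closed[OF wrap_additive[OF M, where k=1]])
    have preY: "pre A (Suc n) a Y \<in> carrier (tens R A A (Suc n))"
      using a Y by (intro wc) auto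
    \<comment> \<open>For \<open>X = m \<otimes> a\<close> the product is
      \<open>m \<otimes> (a \<otimes> Y)\<close>, so that \<open>hdiff_pre\<close> applies first to
      \<open>m\<close> and then to \<open>a\<close>.\<close>
    have "star M (Suc (Suc n)) Y (pure_tens R M A m [a]) = pre M (Suc (Suc n)) m (pre A (Suc n) a Y)"
      using m a Y by (simp add: star_pure[OF M, where k=n] wrap_wrap[OF M, where l=n])
    then have "hdiff M \<mu> (Suc (Suc n)) (star M (Suc (Suc n)) Y (pure_tens R M A m [a])) =
       star M N (pre A (Suc n) a Y) (\<mu> m) \<ominus>\<^bsub>tens R M A N\<^esub>
       pre M N m (star A (Suc (Suc n)) Y (\<Delta> a) \<ominus>\<^bsub>tens R A A (Suc (Suc n))\<^esub> pre A (Suc (Suc n)) a (hdiff A \<Delta> n Y))"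
      using hdiff_pre[OF M \<mu> m preY] hdiff_pre[OF module_A comult_linear a Y] by (simp add: N_def)
    also have "pre M N m (star A (Suc (Suc n)) Y (\<Delta> a) \<ominus>\<^bsub>tens R A A (Suc (Suc n))\<^esub> pre A (Suc (Suc n)) a (hdiff A \<Delta> n Y)) =
       pre M N m (star A (Suc (Suc n)) Y (\<Delta> a)) \<ominus>\<^bsub>tens R M A N\<^esub> pre M N m (pre A (Suc (Suc n)) a (hdiff A \<Delta> n Y))"
      by (rule additive_map_minus[OF tens_group[OF module_A] tens_group[OF M] wrap_additive[OF M m, where k="Suc (Suc n)"]])
         (use m a dY linear_mapD(2)[OF comult_linear a] in
           \<open>simp_all add: N_def additive_map_closed[OF star_additive[OF module_A Y 1(1)]] additive_map_closed[OF wrap_additive[OF module_A, where k="Suc n"]]\<close>)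
    also have "pre M N m (pre A (Suc (Suc n)) a (hdiff A \<Delta> n Y)) = star M N (hdiff A \<Delta> n Y) (pure_tens R M A m [a])"
      using m a dY by (simp add: N_def star_pure[OF M, where k="Suc n"] wrap_wrap[OF M, where l="Suc n"])
    \<comment> \<open>With an elementary tensor \<open>b \<otimes> c\<close> in place of
      \<open>\<Delta> a\<close>, both sides are
      \<open>m \<otimes> b \<otimes> c \<otimes> Y\<close>.\<close>
    also have "pre M N m (star A (Suc (Suc n)) Y (\<Delta> a)) = star M N Y (pre M (Suc 1) m (\<Delta> a))"
      by (rule tens_eqI[OF module_A tens_group[OF M] additive_map_comp[OF star_additive[OF module_A Y 1(1)] wrap_additive[OF M m]]
          additive_map_comp[OF wrap_additive[OF M m] star_additive[OF M Y 1(2)]] _ linear_mapD(2)[OF comult_linear a]])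
        (use m Y in \<open>simp_all add: N_def star_pure[OF module_A, where k=n] star_pure[OF M, where k=n] wrap_pure[OF M] wrap_wrap[OF M, where l=n]\<close>)
    \<comment> \<open>With an elementary tensor \<open>x \<otimes> b\<close> in place of
      \<open>\<mu> m\<close>, both sides are
      \<open>x \<otimes> b \<otimes> a \<otimes> Y\<close>.\<close>
    also have "star M N (pre A (Suc n) a Y) (\<mu> m) = star M N Y (app R M A (Suc 1) [a] (\<mu> m))"
      by (rule tens_eqI[OF M tens_group[OF M] star_additive[OF M preY]
          additive_map_comp[OF app_additive[OF M] star_additive[OF M Y 1(2)]] _ linear_mapD(2)[OF \<mu> m]])
        (use a Y preY in \<open>simp_all add: N_def star_pure[OF M, where k="Suc n"] star_pure[OF M, where k=n] app_pure[OF M] wrap_wrap[OF M, where l=n]\<close>)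
    finally have "hdiff M \<mu> (Suc (Suc n)) (star M (Suc (Suc n)) Y (pure_tens R M A m [a])) =
        (star M N Y (app R M A (Suc 1) [a] (\<mu> m)) \<ominus>\<^bsub>tens R M A N\<^esub> star M N Y (pre M (Suc 1) m (\<Delta> a)))
        \<oplus>\<^bsub>tens R M A N\<^esub> star M N (hdiff A \<Delta> n Y) (pure_tens R M A m [a])"
      using cl additive_map_closed[OF star_additive[OF M dY 1(3)] pure_tens_closed[OF M m]] a
      by (simp add: T.minus_eq T.minus_add T.a_assoc)
    then show "hdiff M \<mu> (Suc (Suc n)) (star M (Suc (Suc n)) Y (pure_tens R M A m as)) =
       (star M N Y (coact_first R M A \<mu> 1 (pure_tens R M A m as)) \<ominus>\<^bsub>tens R M A N\<^esub>
        star M N Y (comult_at R M A \<Delta> 1 0 (pure_tens R M A m as)))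
       \<oplus>\<^bsub>tens R M A N\<^esub> star M N (hdiff A \<Delta> n Y) (pure_tens R M A m as)"
      using m a by (simp add: as coact_first_pure[OF M \<mu>] comult_at_pure[OF M comult_linear])
  qed
qed

text \<open>The differential of \<open>m \<otimes> Y\<close> is
  \<open>\<mu> m * Y - m \<otimes> \<partial>Y\<close>, with \<open>*\<close> standing for
  \<open>star\<close>. By the Leibniz rule and coassociativity the first term has differential
  \<open>\<mu> m * \<partial>Y\<close>; the second contributes the same element, up to
  \<open>m \<otimes> \<partial>\<partial>Y\<close>, which is 0 by hypothesis.\<close>

lemma hdiff_hdiff_step:
  assumes c: "comod M \<mu>" and IH: "\<And>Y. Y \<in> carrier (tens R A A n) \<Longrightarrow> hdiff A \<Delta> (Suc n) (hdiff A \<Delta> n Y) = \<zero>\<^bsub>tens R A A (Suc (Suc n))\<^esub>"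
    and X: "X \<in> carrier (tens R M A (Suc n))"
  shows "hdiff M \<mu> (Suc (Suc n)) (hdiff M \<mu> (Suc n) X) = \<zero>\<^bsub>tens R M A (Suc (Suc (Suc n)))\<^esub>"
proof (rule tens_eqI[OF comodD(1)[OF c] tens_group[OF comodD(1)[OF c]] additive_map_comp[OF hdiff_additive[OF comodD(1,2)[OF c]] hdiff_additive[OF comodD(1,2)[OF c]]]
     additive_map_zero_fun[OF tens_group[OF comodD(1)[OF c]]] _ X])
  note M = comodD(1)[OF c] and \<mu> = comodD(2)[OF c]
  let ?N = "Suc (Suc (Suc n))"
  interpret T: abelian_group "tens R M A ?N" by (rule tens_group[OF M])
  fix m as assume m: "m \<in> carrier M" and as: "set as \<subseteq> carrier A" "length as = Suc n"
  then obtain b bs where b: "as = b # bs" "b \<in> carrier A" "set bs \<subseteq> carrier A" "length bs = n" by (cases as) auto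
  define Y where "Y = pure_tens R A A b bs"
  have Y: "Y \<in> carrier (tens R A A n)" using b by (auto simp: Y_def intro: pure_tens_closed[OF module_A])
  have dY: "hdiff A \<Delta> n Y \<in> carrier (tens R A A (Suc n))"
    by (rule hdiff_closed[OF module_A comult_linear Y])
  have \<mu>m: "\<mu> m \<in> carrier (tens R M A 1)" by (rule linear_mapD(2)[OF \<mu> m])
  have p: "pure_tens R M A m as = pre M (Suc n) m Y" using m b by (simp add: Y_def wrap_pure[OF M])
  have s: "star M (Suc (Suc n)) Y (\<mu> m) \<in> carrier (tens R M A (Suc (Suc n)))"
    by (rule additive_map_closed[OF star_additive[OF M Y] \<mu>m]) simp
  have s2: "star M ?N Y Z \<in> carrier (tens R M A ?N)" if "Z \<in> carrier (tens R M A (Suc 1))" for Z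
    by (rule additive_map_closed[OF star_additive[OF M Y] that]) simp
  have s3: "star M ?N (hdiff A \<Delta> n Y) (\<mu> m) \<in> carrier (tens R M A ?N)"
    by (rule additive_map_closed[OF star_additive[OF M dY] \<mu>m]) simp
  have q: "pre M (Suc (Suc n)) m (hdiff A \<Delta> n Y) \<in> carrier (tens R M A (Suc (Suc n)))"
    by (rule additive_map_closed[OF wrap_additive[OF M m] dY]) auto
  have cf: "coact_first R M A \<mu> 1 (\<mu> m) \<in> carrier (tens R M A (Suc 1))"
    by (rule additive_map_closed[OF coact_first_additive[OF M \<mu>] \<mu>m])
  have z: "pre M ?N m \<zero>\<^bsub>tens R A A (Suc (Suc n))\<^esub> = \<zero>\<^bsub>tens R M A ?N\<^esub>"
    by (rule additive_map_zero[OF tens_group[OF module_A] tens_group[OF M] wrap_additive[OF M m]]) auto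
  show "hdiff M \<mu> (Suc (Suc n)) (hdiff M \<mu> (Suc n) (pure_tens R M A m as)) = \<zero>\<^bsub>tens R M A ?N\<^esub>"
    unfolding p hdiff_pre[OF M \<mu> m Y]
      additive_map_minus[OF tens_group[OF M] tens_group[OF M] hdiff_additive[OF M \<mu>] s q]
      hdiff_star[OF M \<mu> Y \<mu>m] hdiff_pre[OF M \<mu> m dY] IH[OF Y] z
    using s2[OF cf] s3 by (simp add: comodD(3)[OF c m, symmetric] T.minus_self T.minus_zero_right)
qed

lemma app_Nil:
  assumes M: "Module.module R M" and X: "X \<in> carrier (tens R M A n)"
  shows "app R M A n [] X = X"
  by (rule tens_eqI[OF M tens_group[OF M] app_additive[OF M] _ _ X])
     (auto simp: app_pure[OF M] additive_map_def)

lemma hdiff_0: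
  assumes c: "comod M \<mu>" and m: "m \<in> carrier M"
  shows "hdiff M \<mu> 0 (pure_tens R M A m []) = \<mu> m \<ominus>\<^bsub>tens R M A 1\<^esub> pure_tens R M A m [\<one>\<^bsub>A\<^esub>]"
  using m linear_mapD(2)[OF comodD(2)[OF c] m]
  by (simp add: hdiff_def altsum_1 face_simps face_simps_1 coact_first_pure[OF comodD(1,2)[OF c]] app_pure[OF comodD(1)[OF c]] app_Nil[OF comodD(1)[OF c]])

text \<open>Degree 0 has no factor \<open>Y\<close> to split off and is computed by hand:
  \<open>\<mu> m\<close> and \<open>m \<otimes> 1\<close> have the same differential, namely
  \<open>\<mu> m\<close> with a unit appended.\<close>

lemma hdiff_hdiff_0:
  assumes c: "comod M \<mu>" and X: "X \<in> carrier (tens R M A 0)"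
  shows "hdiff M \<mu> 1 (hdiff M \<mu> 0 X) = \<zero>\<^bsub>tens R M A (Suc 1)\<^esub>"
proof -
  note M = comodD(1)[OF c] and \<mu> = comodD(2)[OF c]
  interpret T: abelian_group "tens R M A (Suc 1)" by (rule tens_group[OF M])
  have ad: "additive_map (tens R M A 0) (tens R M A (Suc 1)) (\<lambda>X. hdiff M \<mu> 1 (hdiff M \<mu> 0 X))"
    using additive_map_comp[OF hdiff_additive[OF M \<mu>, of 0] hdiff_additive[OF M \<mu>, of "Suc 0"]] by simp
  have z: "hdiff M \<mu> 1 (hdiff M \<mu> 0 (pure_tens R M A m as)) = \<zero>\<^bsub>tens R M A (Suc 1)\<^esub>"
    if m: "m \<in> carrier M" and as: "set as \<subseteq> carrier A" "length as = 0" for m as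
  proof -
    have \<mu>m: "\<mu> m \<in> carrier (tens R M A 1)" by (rule linear_mapD(2)[OF \<mu> m])
    have p: "pure_tens R M A m [\<one>\<^bsub>A\<^esub>] \<in> carrier (tens R M A 1)" using m by (intro pure_tens_closed[OF M]) auto
    have p1: "pure_tens R A A \<one>\<^bsub>A\<^esub> [] \<in> carrier (tens R A A 0)" by (intro pure_tens_closed[OF module_A]) auto
    have p2: "pure_tens R A A \<one>\<^bsub>A\<^esub> [\<one>\<^bsub>A\<^esub>] \<in> carrier (tens R A A 1)" by (intro pure_tens_closed[OF module_A]) auto
    interpret T1: abelian_group "tens R A A 1" by (rule tens_group[OF module_A])
    have ca: "coact_first R M A \<mu> 1 (\<mu> m) \<in> carrier (tens R M A (Suc 1))"
      by (rule additive_map_closed[OF coact_first_additive[OF M \<mu>] \<mu>m])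
    have ap: "app R M A (Suc 1) [\<one>\<^bsub>A\<^esub>] (\<mu> m) \<in> carrier (tens R M A (Suc 1))"
      by (rule additive_map_closed[OF app_additive[OF M] \<mu>m]) auto
    \<comment> \<open>The first two faces agree on \<open>\<mu> m\<close> by coassociativity, so
      only the last one remains.\<close>
    have "hdiff M \<mu> 1 (\<mu> m) = app R M A (Suc 1) [\<one>\<^bsub>A\<^esub>] (\<mu> m)"
    proof -
      have "hdiff M \<mu> 1 (\<mu> m) = coact_first R M A \<mu> 1 (\<mu> m) \<ominus>\<^bsub>tens R M A (Suc 1)\<^esub>
         (comult_at R M A \<Delta> 1 0 (\<mu> m) \<ominus>\<^bsub>tens R M A (Suc 1)\<^esub> app R M A (Suc 1) [\<one>\<^bsub>A\<^esub>] (\<mu> m))"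
        unfolding hdiff_def by (simp add: face_simps face_simps_1 altsum_2)
      then show ?thesis using T.minus_minus_cancel[OF ca ap] comodD(3)[OF c m] by simp
    qed
    \<comment> \<open>Here \<open>m \<otimes> 1\<close> is read as \<open>m \<otimes> Y\<close> with
      \<open>Y\<close> the unit in degree 0 of the complex of \<open>A\<close>; its differential
      vanishes because the unit is grouplike.\<close>
    moreover have "hdiff M \<mu> 1 (pure_tens R M A m [\<one>\<^bsub>A\<^esub>]) = app R M A (Suc 1) [\<one>\<^bsub>A\<^esub>] (\<mu> m)"
    proof -
      have "pure_tens R M A m [\<one>\<^bsub>A\<^esub>] = pre M 1 m (pure_tens R A A \<one>\<^bsub>A\<^esub> [])"
        using m by (simp add: wrap_pure[OF M])
      moreover have "hdiff A \<Delta> 0 (pure_tens R A A \<one>\<^bsub>A\<^esub> []) = \<zero>\<^bsub>tens R A A 1\<^esub>"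
        using p2 by (simp add: hdiff_0[OF comod_hopf] comult_one T1.minus_eq T1.r_neg)
      moreover have "pre M (Suc 1) m \<zero>\<^bsub>tens R A A 1\<^esub> = \<zero>\<^bsub>tens R M A (Suc 1)\<^esub>"
        by (rule additive_map_zero[OF tens_group[OF module_A] tens_group[OF M] wrap_additive[OF M m]]) auto
      ultimately show ?thesis
        using hdiff_pre[OF M \<mu> m p1] \<mu>m T.minus_zero_right[OF ap] by (simp add: star_app[OF M, where l=1])
    qed
    moreover have "hdiff M \<mu> 0 (pure_tens R M A m as) = \<mu> m \<ominus>\<^bsub>tens R M A 1\<^esub> pure_tens R M A m [\<one>\<^bsub>A\<^esub>]"
      using as(2) hdiff_0[OF c m] by simp
    ultimately show ?thesis
      using additive_map_minus[OF tens_group[OF M] tens_group[OF M] hdiff_additive[OF M \<mu>] \<mu>m p] T.minus_self[OF ap]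
      by (simp only:)
  qed
  show ?thesis
    by (rule tens_eqI[OF M tens_group[OF M] ad additive_map_zero_fun[OF tens_group[OF M]] z X])
qed

lemma hdiff_hdiff_hopf:
  "X \<in> carrier (tens R A A n) \<Longrightarrow> hdiff A \<Delta> (Suc n) (hdiff A \<Delta> n X) = \<zero>\<^bsub>tens R A A (Suc (Suc n))\<^esub>"
proof (induction n arbitrary: X)
  case 0
  then show ?case using hdiff_hdiff_0[OF comod_hopf] by simp
next
  case (Suc n)
  then show ?case using hdiff_hdiff_step[OF comod_hopf] by simp
qed

lemma hdiff_hdiff:
  assumes c: "comod M \<mu>" and X: "X \<in> carrier (tens R M A n)"
  shows "hdiff M \<mu> (Suc n) (hdiff M \<mu> n X) = \<zero>\<^bsub>tens R M A (Suc (Suc n))\<^esub>"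
  using assms hdiff_hdiff_0[OF c] hdiff_hdiff_step[OF c hdiff_hdiff_hopf] by (cases n) auto

subsection \<open>The contracting homotopy of a relatively injective comodule\<close>

context
  fixes M :: "('r, 'm, 'x) module_scheme" and \<mu> and r
  assumes c: "comod M \<mu>" and r: "linear_map R (tens R M A 1) M r"
    and r\<mu>: "\<And>m. m \<in> carrier M \<Longrightarrow> r (\<mu> m) = m"
    and \<mu>r: "\<And>X. X \<in> carrier (tens R M A 1) \<Longrightarrow> \<mu> (r X) = con R M M A 1 r (comult_at R M A \<Delta> 1 0 X)"
begin

text \<open>The first face inserts \<open>\<mu> m\<close>, and \<open>r\<close> collapses it to
  \<open>m\<close> again.\<close>

lemma con_face_0:
  assumes X: "X \<in> carrier (tens R M A (Suc n))"
  shows "con R M M A (Suc n) r (face M \<mu> (Suc n) 0 X) = X"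
proof -
  note M = comodD(1)[OF c] and \<mu> = comodD(2)[OF c]
  have "con R M M A (Suc n) r (coact_first R M A \<mu> (Suc n) X) = X"
  proof (rule tens_eqI[OF M tens_group[OF M] additive_map_comp[OF coact_first_additive[OF M \<mu>] con_additive[OF M M r]] _ _ X])
    show "additive_map (tens R M A (Suc n)) (tens R M A (Suc n)) (\<lambda>X. X)" by (simp add: additive_map_def)
  qed (simp add: coact_first_pure[OF M \<mu>] con_app[OF M M r] linear_mapD(2)[OF \<mu>] r\<mu>)
  then show ?thesis by (simp add: face_simps face_simps_1)
qed

text \<open>The only face that interacts with the contraction: it comultiplies the slot that
  \<open>r\<close> consumes. The hypothesis on \<open>\<mu> (r X)\<close> says that \<open>r\<close>
  is a comodule map from the cofree comodule, and this turns the second face into a coaction after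
  the contraction.\<close>

lemma con_face_1:
  assumes X: "X \<in> carrier (tens R M A (Suc n))"
  shows "con R M M A (Suc n) r (face M \<mu> (Suc n) (Suc 0) X) = face M \<mu> n 0 (con R M M A n r X)"
proof -
  note M = comodD(1)[OF c] and \<mu> = comodD(2)[OF c]
  have *: "con R M M A (Suc n) r (wrap R M A (Suc (Suc n)) m [] as Y) = app R M A (Suc n) as (con R M M A 1 r (pre M (Suc 1) m Y))"
    if "m \<in> carrier M" "set as \<subseteq> carrier A" "length as = n" and Y: "Y \<in> carrier (tens R A A 1)" for m as Y
    by (rule tens_eqI[OF module_A tens_group[OF M] additive_map_comp[OF wrap_additive[OF M] con_additive[OF M M r]]
          additive_map_comp[OF additive_map_comp[OF wrap_additive[OF M] con_additive[OF M M r]] app_additive[OF M]] _ Y])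
       (use that in \<open>auto simp: wrap_pure[OF M] con_pure[OF M M r] app_pure[OF M] linear_mapD(2)[OF r] pure_tens_closed[OF M]\<close>)
  have p: "\<mu> (r (pure_tens R M A m [a])) = con R M M A 1 r (pre M (Suc 1) m (\<Delta> a))" if "m \<in> carrier M" "a \<in> carrier A" for m a
    using that \<mu>r[of "pure_tens R M A m [a]"] pure_tens_closed[OF M, of m "[a]" 1]
    by (simp add: comult_at_pure[OF M comult_linear])
  have "con R M M A (Suc n) r (comult_at R M A \<Delta> (Suc n) 0 X) = coact_first R M A \<mu> n (con R M M A n r X)"
  proof (rule tens_eqI[OF M tens_group[OF M] additive_map_comp[OF comult_at_additive[OF M comult_linear] con_additive[OF M M r]]
        additive_map_comp[OF con_additive[OF M M r] coact_first_additive[OF M \<mu>]] _ X])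
    fix m as assume m: "m \<in> carrier M" and as: "set as \<subseteq> carrier A" "length as = Suc n"
    then obtain b bs where b: "as = b # bs" "b \<in> carrier A" "set bs \<subseteq> carrier A" "length bs = n" by (cases as) auto
    show "con R M M A (Suc n) r (comult_at R M A \<Delta> (Suc n) 0 (pure_tens R M A m as)) = coact_first R M A \<mu> n (con R M M A n r (pure_tens R M A m as))"
      using m b pure_tens_closed[OF M, of m "[b]" 1]
      by (simp add: comult_at_pure[OF M comult_linear] con_pure[OF M M r] coact_first_pure[OF M \<mu>] * p
         linear_mapD(2)[OF r] linear_mapD(2)[OF comult_linear])
  qed simp
  then show ?thesis by (simp add: face_simps face_simps_1)
qed

text \<open>These faces act to the right of the two factors that \<open>r\<close> consumes, so they
  commute with the contraction up to the loss of one slot.\<close>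

lemma con_face_Suc:
  assumes X: "X \<in> carrier (tens R M A (Suc n))"
  shows "con R M M A (Suc n) r (face M \<mu> (Suc n) (Suc (Suc i)) X) = face M \<mu> n (Suc i) (con R M M A n r X)"
proof -
  note M = comodD(1)[OF c] and \<mu> = comodD(2)[OF c]
  have td': "set (take j as) \<subseteq> carrier A" "set (drop j as) \<subseteq> carrier A"
    if "set as \<subseteq> carrier A" for as j
    using that set_take_subset[of j as] set_drop_subset[of j as] by auto
  have *: "con R M M A (Suc n) r (wrap R M A (Suc (Suc n)) m (a # xs) ys Y) = wrap R M A (Suc n) (r (pure_tens R M A m [a])) xs ys Y"
    if "m \<in> carrier M" "a \<in> carrier A" "set xs \<subseteq> carrier A" "set ys \<subseteq> carrier A" "Suc (length xs + length ys) = n" and Y: "Y \<in> carrier (tens R A A 1)" for m a xs ys Y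
    by (rule tens_eqI[OF module_A tens_group[OF M] additive_map_comp[OF wrap_additive[OF M] con_additive[OF M M r]]
          wrap_additive[OF M] _ Y])
       (use that in \<open>auto simp: wrap_pure[OF M] con_pure[OF M M r] linear_mapD(2)[OF r] pure_tens_closed[OF M]\<close>)
  have 1: "con R M M A (Suc n) r (comult_at R M A \<Delta> (Suc n) (Suc i) X) = comult_at R M A \<Delta> n i (con R M M A n r X)" if i: "i < n"
  proof (rule tens_eqI[OF M tens_group[OF M] additive_map_comp[OF comult_at_additive[OF M comult_linear] con_additive[OF M M r]]
        additive_map_comp[OF con_additive[OF M M r] comult_at_additive[OF M comult_linear i]] _ X])
    fix m as assume m: "m \<in> carrier M" and as: "set as \<subseteq> carrier A" "length as = Suc n"
    then obtain b bs where b: "as = b # bs" "b \<in> carrier A" "set bs \<subseteq> carrier A" "length bs = n" by (cases as) auto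
    have nth: "bs ! i \<in> carrier A" using b i by (auto simp: subset_iff)
    show "con R M M A (Suc n) r (comult_at R M A \<Delta> (Suc n) (Suc i) (pure_tens R M A m as)) = comult_at R M A \<Delta> n i (con R M M A n r (pure_tens R M A m as))"
      using m b i pure_tens_closed[OF M, of m "[b]" 1] nth
      by (simp add: comult_at_pure[OF M comult_linear] con_pure[OF M M r] * td'
         linear_mapD(2)[OF r] linear_mapD(2)[OF comult_linear])
  qed (use i in simp)
  have 2: "con R M M A (Suc n) r (app R M A (Suc (Suc n)) [\<one>\<^bsub>A\<^esub>] X) = app R M A (Suc n) [\<one>\<^bsub>A\<^esub>] (con R M M A n r X)"
  proof (rule tens_eqI[OF M tens_group[OF M] additive_map_comp[OF app_additive[OF M] con_additive[OF M M r]]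
        additive_map_comp[OF con_additive[OF M M r] app_additive[OF M]] _ X])
    fix m as assume m: "m \<in> carrier M" and as: "set as \<subseteq> carrier A" "length as = Suc n"
    then obtain b bs where b: "as = b # bs" "b \<in> carrier A" "set bs \<subseteq> carrier A" "length bs = n" by (cases as) auto
    show "con R M M A (Suc n) r (app R M A (Suc (Suc n)) [\<one>\<^bsub>A\<^esub>] (pure_tens R M A m as)) =
        app R M A (Suc n) [\<one>\<^bsub>A\<^esub>] (con R M M A n r (pure_tens R M A m as))"
      using m b pure_tens_closed[OF M, of m "[b]" 1]
      by (simp add: app_pure[OF M] con_pure[OF M M r] linear_mapD(2)[OF r])
  qed auto
  show ?thesis
  proof (cases "i < n")
    case True
    then show ?thesis using 1 by (simp add: face_simps)
  next
    case False
    then show ?thesis using 2 by (simp add: face_simps)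
  qed
qed

text \<open>Face 0 gives \<open>X\<close> back and every later face becomes the face of one lower
  index on the contracted tensor. The sign in the recursion of \<open>altsum\<close> then yields
  h\<partial> = id - \<partial>h.\<close>

lemma con_hdiff:
  assumes X: "X \<in> carrier (tens R M A (Suc n))"
  shows "con R M M A (Suc n) r (hdiff M \<mu> (Suc n) X) = X \<ominus>\<^bsub>tens R M A (Suc n)\<^esub> hdiff M \<mu> n (con R M M A n r X)"
proof -
  note M = comodD(1)[OF c] and \<mu> = comodD(2)[OF c]
  have f: "face M \<mu> (Suc n) i X \<in> carrier (tens R M A (Suc (Suc n)))" for i
    by (rule additive_map_closed[OF face_additive[OF M \<mu>] X])
  have "con R M M A (Suc n) r (hdiff M \<mu> (Suc n) X) =
     altsum (tens R M A (Suc n)) (Suc (Suc n)) (\<lambda>i. con R M M A (Suc n) r (face M \<mu> (Suc n) i X))"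
    unfolding hdiff_def by (rule altsum_hom[OF tens_group[OF M] tens_group[OF M] con_additive[OF M M r]]) (rule f)
  also have "\<dots> = X \<ominus>\<^bsub>tens R M A (Suc n)\<^esub>
     altsum (tens R M A (Suc n)) (Suc n) (\<lambda>i. con R M M A (Suc n) r (face M \<mu> (Suc n) (Suc i) X))"
    by (subst altsum.simps(2)) (simp only: con_face_0[OF X])
  also have "altsum (tens R M A (Suc n)) (Suc n) (\<lambda>i. con R M M A (Suc n) r (face M \<mu> (Suc n) (Suc i) X)) =
     hdiff M \<mu> n (con R M M A n r X)"
    unfolding hdiff_def
  proof (rule altsum_cong)
    fix i show "con R M M A (Suc n) r (face M \<mu> (Suc n) (Suc i) X) = face M \<mu> n i (con R M M A n r X)"
      using con_face_1[OF X] con_face_Suc[OF X, of "i - 1"] by (cases i) auto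
  qed
  finally show ?thesis .
qed

lemma hdiff_acyclic:
  assumes X: "X \<in> carrier (tens R M A (Suc n))" and z: "hdiff M \<mu> (Suc n) X = \<zero>\<^bsub>tens R M A (Suc (Suc n))\<^esub>"
  shows "\<exists>Y\<in>carrier (tens R M A n). hdiff M \<mu> n Y = X"
proof (rule bexI)
  note M = comodD(1)[OF c] and \<mu> = comodD(2)[OF c]
  interpret T: abelian_group "tens R M A (Suc n)" by (rule tens_group[OF M])
  show Y: "con R M M A n r X \<in> carrier (tens R M A n)"
    by (rule additive_map_closed[OF con_additive[OF M M r] X])
  have "X \<ominus>\<^bsub>tens R M A (Suc n)\<^esub> hdiff M \<mu> n (con R M M A n r X) = \<zero>\<^bsub>tens R M A (Suc n)\<^esub>"
    using con_hdiff[OF X] additive_map_zero[OF tens_group[OF M] tens_group[OF M] con_additive[OF M M r]] by (simp add: z)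
  then show "hdiff M \<mu> n (con R M M A n r X) = X"
    using hdiff_closed[OF M \<mu> Y] X by (metis T.minus_eq_zeroD)
qed

end

end

section \<open>Quotients and cofree comodules\<close>

text \<open>Tensor products see only these five fields, so records that differ in \<sigma>, coaction
  or further extensions have equal tensor products. The multiplicative fields occur because
  \<open>tens\<close> also carries a multiplication.\<close>

lemma tens_cong:
  assumes "carrier M = carrier M'" "ring.add M = ring.add M'" "smult M = smult M'"
    "monoid.mult M = monoid.mult M'" "one M = one M'"
  shows "tens R M A n = tens R M' A n" and "pure_tens R M A = pure_tens R M' A"
proof -
  have g: "tens_gens M A k = tens_gens M' A k" for k by (simp add: tens_gens_def assms)
  have "tens_rels R M A k = tens_rels R M' A k" for k by (simp add: tens_rels_def g assms)
  then have s: "tens_sub R M A k = tens_sub R M' A k" for k by (simp add: tens_sub_def g)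
  then show p: "pure_tens R M A = pure_tens R M' A" by (simp add: pure_tens_def fun_eq_iff g)
  have t: "tens_group R M A n = tens_group R M' A n" by (simp add: tens_group_def g s)
  then show "tens R M A n = tens R M' A n" by (simp add: tens_def p t assms)
qed

lemma module_cong:
  assumes "Module.module R M" "carrier M = carrier M'" "ring.add M = ring.add M'" "smult M = smult M'" "\<zero>\<^bsub>M\<^esub> = \<zero>\<^bsub>M'\<^esub>"
  shows "Module.module R M'"
proof -
  interpret M: Module.module R M by fact
  have ab: "abelian_group M'"
    by (rule abelian_group_of_comm_group[OF M.a_comm_group]) (simp_all add: assms)
  show ?thesis
  proof (rule moduleI[OF module.axioms(1)[OF assms(1)] ab])
  qed (use M.smult_closed M.smult_l_distr M.smult_r_distr M.smult_assoc1 M.smult_one assms(2-) in auto)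
qed

text \<open>\<open>q\<close> realizes \<open>M / K\<close> with values in an arbitrary type: its
  fibres are the cosets of \<open>K\<close>. This covers transport along an injection
  (\<open>K\<close> zero), the image of a linear map (\<open>K\<close> its kernel) and
  cokernels.\<close>

definition is_quot ::
    "('r, 'z) ring_scheme \<Rightarrow> ('r, 'm, 'x) module_scheme \<Rightarrow> 'm set \<Rightarrow> ('m \<Rightarrow> 'p) \<Rightarrow> bool" where
  "is_quot R M K q \<longleftrightarrow> K \<subseteq> carrier M \<and>
     (\<forall>x\<in>K. \<forall>y\<in>K. x \<oplus>\<^bsub>M\<^esub> y \<in> K) \<and> (\<forall>r\<in>carrier R. \<forall>x\<in>K. r \<odot>\<^bsub>M\<^esub> x \<in> K) \<and>
     (\<forall>x\<in>carrier M. \<forall>y\<in>carrier M. q x = q y \<longleftrightarrow> x \<ominus>\<^bsub>M\<^esub> y \<in> K)"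

text \<open>The operations go through arbitrary preimages; under \<open>is_quot\<close> the result
  does not depend on them.\<close>

definition quot_mod :: "('r, 'm, 'x) module_scheme \<Rightarrow> ('m \<Rightarrow> 'p) \<Rightarrow> ('r, 'p) module" where
  "quot_mod M q = (let i = inv_into (carrier M) q in
     \<lparr>carrier = q ` carrier M, monoid.mult = undefined, one = undefined,
      ring.zero = q \<zero>\<^bsub>M\<^esub>, ring.add = (\<lambda>x y. q (i x \<oplus>\<^bsub>M\<^esub> i y)), smult = (\<lambda>r x. q (r \<odot>\<^bsub>M\<^esub> i x))\<rparr>)"

lemma quot_mod_simps:
  "carrier (quot_mod M q) = q ` carrier M"
  "\<zero>\<^bsub>quot_mod M q\<^esub> = q \<zero>\<^bsub>M\<^esub>"
  by (simp_all add: quot_mod_def Let_def)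

context
  fixes R :: "('r, 'z) ring_scheme" and M :: "('r, 'm, 'x) module_scheme" and K :: "'m set" and q :: "'m \<Rightarrow> 'p"
  assumes M: "Module.module R M" and Q: "is_quot R M K q"
begin

lemma quot_inv:
  assumes x: "x \<in> carrier M"
  shows "inv_into (carrier M) q (q x) \<in> carrier M" "inv_into (carrier M) q (q x) \<ominus>\<^bsub>M\<^esub> x \<in> K"
proof -
  show i: "inv_into (carrier M) q (q x) \<in> carrier M" using x by (intro inv_into_into) auto
  have "q (inv_into (carrier M) q (q x)) = q x" using x by (intro f_inv_into_f) auto
  then show "inv_into (carrier M) q (q x) \<ominus>\<^bsub>M\<^esub> x \<in> K" using Q x i by (auto simp: is_quot_def)
qed

lemma quot_eqI: "x \<in> carrier M \<Longrightarrow> y \<in> carrier M \<Longrightarrow> x \<ominus>\<^bsub>M\<^esub> y \<in> K \<Longrightarrow> q x = q y"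
  using Q by (auto simp: is_quot_def)

lemma quot_add:
  assumes x: "x \<in> carrier M" and y: "y \<in> carrier M"
  shows "q x \<oplus>\<^bsub>quot_mod M q\<^esub> q y = q (x \<oplus>\<^bsub>M\<^esub> y)"
proof -
  interpret M: Module.module R M by (rule M)
  let ?i = "inv_into (carrier M) q"
  note i = quot_inv[OF x] quot_inv[OF y]
  have "(?i (q x) \<oplus>\<^bsub>M\<^esub> ?i (q y)) \<ominus>\<^bsub>M\<^esub> (x \<oplus>\<^bsub>M\<^esub> y) = (?i (q x) \<ominus>\<^bsub>M\<^esub> x) \<oplus>\<^bsub>M\<^esub> (?i (q y) \<ominus>\<^bsub>M\<^esub> y)"
    using x y i by (simp add: M.minus_eq M.minus_add M.a_ac)
  also have "\<dots> \<in> K" using i Q by (auto simp: is_quot_def)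
  finally show ?thesis
    using i x y by (auto simp: quot_mod_def Let_def intro!: quot_eqI)
qed

lemma quot_smult:
  assumes x: "x \<in> carrier M" and r: "r \<in> carrier R"
  shows "r \<odot>\<^bsub>quot_mod M q\<^esub> q x = q (r \<odot>\<^bsub>M\<^esub> x)"
proof -
  interpret M: Module.module R M by (rule M)
  let ?i = "inv_into (carrier M) q"
  note i = quot_inv[OF x]
  have "(r \<odot>\<^bsub>M\<^esub> ?i (q x)) \<ominus>\<^bsub>M\<^esub> (r \<odot>\<^bsub>M\<^esub> x) = r \<odot>\<^bsub>M\<^esub> (?i (q x) \<ominus>\<^bsub>M\<^esub> x)"
    using x i r by (simp add: M.minus_eq M.smult_r_distr M.smult_r_minus)
  also have "\<dots> \<in> K" using i r Q by (auto simp: is_quot_def)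
  finally show ?thesis
    using i x r by (auto simp: quot_mod_def Let_def intro!: quot_eqI)
qed

lemma module_quot: "Module.module R (quot_mod M q)"
proof -
  interpret M: Module.module R M by (rule M)
  have ab: "abelian_group (quot_mod M q)"
  proof (rule abelian_groupI)
    fix x assume "x \<in> carrier (quot_mod M q)"
    then obtain y where "y \<in> carrier M" "x = q y" by (auto simp: quot_mod_simps)
    then show "\<exists>z\<in>carrier (quot_mod M q). z \<oplus>\<^bsub>quot_mod M q\<^esub> x = \<zero>\<^bsub>quot_mod M q\<^esub>"
      by (intro bexI[of _ "q (\<ominus>\<^bsub>M\<^esub> y)"]) (auto simp: quot_mod_simps quot_add M.l_neg)
  qed (auto simp: quot_mod_simps quot_add M.a_ac)
  show ?thesis
    by (rule moduleI[OF module.axioms(1)[OF M] ab])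
      (auto simp: quot_mod_simps quot_add quot_smult M.smult_l_distr M.smult_r_distr M.smult_assoc1)
qed

lemma linear_quot: "linear_map R M (quot_mod M q) q"
  by (auto simp: linear_map_def quot_mod_simps quot_add quot_smult)

end

text \<open>Transport of structure appears as a quotient by 0. This is how tensor products are given
  isomorphic copies in the universe.\<close>

lemma is_quot_inj:
  assumes "Module.module R M" "inj_on q (carrier M)"
  shows "is_quot R M {\<zero>\<^bsub>M\<^esub>} q"
proof -
  interpret M: Module.module R M by fact
  have "q x = q y \<longleftrightarrow> x \<ominus>\<^bsub>M\<^esub> y = \<zero>\<^bsub>M\<^esub>" if "x \<in> carrier M" "y \<in> carrier M" for x y
    using that assms(2) M.minus_eq_zeroD[of x y] by (auto simp: inj_on_def M.minus_self)
  then show ?thesis by (auto simp: is_quot_def)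
qed

lemma is_quot_linear:
  assumes "Module.module R M" "Module.module R N" "linear_map R M N q"
  shows "is_quot R M {x \<in> carrier M. q x = \<zero>\<^bsub>N\<^esub>} q"
proof -
  interpret M: Module.module R M by fact
  interpret N: Module.module R N by fact
  note add = linear_mapD(1)[OF assms(3)]
  have "q x = q y \<longleftrightarrow> q (x \<ominus>\<^bsub>M\<^esub> y) = \<zero>\<^bsub>N\<^esub>" if "x \<in> carrier M" "y \<in> carrier M" for x y
    using that N.minus_eq_zeroD[of "q x" "q y"]
    by (auto simp: additive_map_minus[OF M.abelian_group_axioms N.abelian_group_axioms add] N.minus_self linear_mapD(2)[OF assms(3)])
  then show ?thesis by (auto simp: is_quot_def linear_mapD[OF assms(3)])
qed

text \<open>Quotients are realized on representatives of cosets, so that a quotient of an object of the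
  universe lies in the universe again.\<close>

definition coset_rep :: "('r, 'm, 'x) module_scheme \<Rightarrow> 'm set \<Rightarrow> 'm \<Rightarrow> 'm" where
  "coset_rep M K x = (SOME y. y \<in> carrier M \<and> y \<ominus>\<^bsub>M\<^esub> x \<in> K)"

lemma is_quot_coset_rep:
  assumes "Module.module R M" "K \<subseteq> carrier M" "\<zero>\<^bsub>M\<^esub> \<in> K" "\<And>x y. x \<in> K \<Longrightarrow> y \<in> K \<Longrightarrow> x \<oplus>\<^bsub>M\<^esub> y \<in> K"
    "\<And>r x. r \<in> carrier R \<Longrightarrow> x \<in> K \<Longrightarrow> r \<odot>\<^bsub>M\<^esub> x \<in> K"
  shows "is_quot R M K (coset_rep M K)"
proof -
  interpret M: Module.module R M by fact
  \<comment> \<open>Closure under negation comes from closure under the scalar -1.\<close>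
  have neg: "\<ominus>\<^bsub>M\<^esub> x \<in> K" if "x \<in> K" for x
    using assms(5)[of "\<ominus>\<^bsub>R\<^esub> \<one>\<^bsub>R\<^esub>" x] that assms(2) M.smult_l_minus[of "\<one>\<^bsub>R\<^esub>" x] by auto
  have rep: "coset_rep M K x \<in> carrier M \<and> coset_rep M K x \<ominus>\<^bsub>M\<^esub> x \<in> K" if "x \<in> carrier M" for x
    unfolding coset_rep_def
    by (rule someI[where x = x and P = "\<lambda>y. y \<in> carrier M \<and> y \<ominus>\<^bsub>M\<^esub> x \<in> K"]) (use that assms(3) in \<open>simp add: M.minus_self\<close>)
  have tr: "a \<ominus>\<^bsub>M\<^esub> c \<in> K" if "a \<ominus>\<^bsub>M\<^esub> b \<in> K" "b \<ominus>\<^bsub>M\<^esub> c \<in> K" "a \<in> carrier M" "b \<in> carrier M" "c \<in> carrier M" for a b c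
  proof -
    have "a \<ominus>\<^bsub>M\<^esub> c = (a \<ominus>\<^bsub>M\<^esub> b) \<oplus>\<^bsub>M\<^esub> (b \<ominus>\<^bsub>M\<^esub> c)"
      using that(3-5) by (simp add: M.minus_eq M.a_assoc M.r_neg1)
    then show ?thesis using assms(4) that(1,2) by simp
  qed
  have sy: "b \<ominus>\<^bsub>M\<^esub> a \<in> K" if "a \<ominus>\<^bsub>M\<^esub> b \<in> K" "a \<in> carrier M" "b \<in> carrier M" for a b
  proof -
    have "b \<ominus>\<^bsub>M\<^esub> a = \<ominus>\<^bsub>M\<^esub> (a \<ominus>\<^bsub>M\<^esub> b)" using that(2,3) by (simp add: M.minus_eq M.minus_add M.a_comm)
    then show ?thesis using neg that(1) by simp
  qed
  have "coset_rep M K x = coset_rep M K y \<longleftrightarrow> x \<ominus>\<^bsub>M\<^esub> y \<in> K" if xy: "x \<in> carrier M" "y \<in> carrier M" for x y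
  proof
    assume "coset_rep M K x = coset_rep M K y"
    then show "x \<ominus>\<^bsub>M\<^esub> y \<in> K" using rep[OF xy(1)] rep[OF xy(2)] tr sy xy by metis
  next
    assume *: "x \<ominus>\<^bsub>M\<^esub> y \<in> K"
    have "z \<ominus>\<^bsub>M\<^esub> x \<in> K \<longleftrightarrow> z \<ominus>\<^bsub>M\<^esub> y \<in> K" if "z \<in> carrier M" for z
      using tr[OF _ *] tr[OF _ sy[OF *]] that xy by blast
    then have "(\<lambda>z. z \<in> carrier M \<and> z \<ominus>\<^bsub>M\<^esub> x \<in> K) = (\<lambda>z. z \<in> carrier M \<and> z \<ominus>\<^bsub>M\<^esub> y \<in> K)" by auto
    \<comment> \<open>The choice operator depends only on the predicate, and the predicates for
      congruent \<open>x\<close> and \<open>y\<close> are equal.\<close>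
    then show "coset_rep M K x = coset_rep M K y" by (simp add: coset_rep_def)
  qed
  then show ?thesis using assms by (auto simp: is_quot_def)
qed

definition quot_dmod :: "('r, 'm, 'x) dmod_scheme \<Rightarrow> ('m \<Rightarrow> 'p) \<Rightarrow> ('r, 'p) dmod" where
  "quot_dmod M q = module.extend (quot_mod M q) \<lparr>dsigma = (\<lambda>x. q (dsigma M (inv_into (carrier M) q x)))\<rparr>"

definition quot_comod ::
    "('r, 'z) ring_scheme \<Rightarrow> ('r, 'a, 'y) module_scheme \<Rightarrow> ('r, 'a, 'm, 'x) dcomod_scheme \<Rightarrow> ('m \<Rightarrow> 'p) \<Rightarrow> ('r, 'a, 'p) dcomod" where
  "quot_comod R A M q = dmod.extend (quot_dmod M q)
     \<lparr>coact = (\<lambda>x. tens_map R (quot_mod M q) A 1 q (coact M (inv_into (carrier M) q x)))\<rparr>"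

lemma quot_comod_simps:
  "carrier (quot_comod R A M q) = q ` carrier M"
  "\<zero>\<^bsub>quot_comod R A M q\<^esub> = q \<zero>\<^bsub>M\<^esub>"
  "ring.add (quot_comod R A M q) = ring.add (quot_mod M q)"
  "smult (quot_comod R A M q) = smult (quot_mod M q)"
  "dsigma (quot_comod R A M q) = (\<lambda>x. q (dsigma M (inv_into (carrier M) q x)))"
  "coact (quot_comod R A M q) = (\<lambda>x. tens_map R (quot_mod M q) A 1 q (coact M (inv_into (carrier M) q x)))"
  "tens R (quot_comod R A M q) A n = tens R (quot_mod M q) A n"
  "pure_tens R (quot_comod R A M q) A = pure_tens R (quot_mod M q) A"
  by (simp_all add: quot_comod_def dmod.extend_def quot_dmod_def module.extend_def quot_mod_simps)
     (auto intro!: tens_cong simp: quot_mod_simps)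

lemma tens_map_quot_comod: "tens_map R (quot_comod R A M q) A n = tens_map R (quot_mod M q) A n"
  by (simp add: tens_map_def fun_eq_iff quot_comod_simps)

section \<open>Coactions on quotients\<close>

context hopf_base
begin

lemma difference_ring: "difference_ring R"
  using hopf by (simp add: difference_hopf_algebra_def)

lemma rsigma_closed: "rsigma R \<in> carrier R \<rightarrow> carrier R"
  using difference_ring by (auto simp: difference_ring_def ring_hom_def)

lemma difference_module_semilinear:
  "difference_module R M \<longleftrightarrow> Module.module R M \<and> semilinear R (rsigma R) M M (dsigma M)"
  using rsigma_closed by (auto simp: difference_module_def semilinear_def additive_map_def)

lemma difference_comodule_iff:
  "difference_comodule R A F \<longleftrightarrow> semilinear R (rsigma R) F F (dsigma F) \<and> comod F (coact F) \<and>
     (\<forall>x\<in>carrier F. coact F (dsigma F x) = gmap R F A 1 (dsigma F) (dsigma A) (coact F x))"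
  by (auto simp: difference_comodule_def comod_def dmod_map_def difference_module_semilinear)

lemma dsigma_A: "semilinear R (rsigma R) A A (dsigma A)"
  using hopf by (simp add: difference_hopf_algebra_def difference_module_semilinear)

text \<open>The coaction and \<open>\<Delta>\<close> are maps of difference modules and \<sigma> is
  a ring endomorphism of \<open>A\<close>; so \<sigma> acts on the Hochschild complex through the
  general result on \<open>gmap\<close>.\<close>

lemma compat_dsigma:
  assumes "difference_comodule R A F"
  shows "compat (rsigma R) F (coact F) F (coact F) (dsigma F) (dsigma A)"
proof -
  have "dsigma A \<one>\<^bsub>A\<^esub> = \<one>\<^bsub>A\<^esub>"
    using hopf by (auto simp: difference_hopf_algebra_def intro: ring_hom_one)
  moreover have "\<forall>a\<in>carrier A. \<Delta> (dsigma A a) = gmap R A A 1 (dsigma A) (dsigma A) (\<Delta> a)"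
    using hopf by (simp add: difference_hopf_algebra_def dmod_map_def)
  ultimately show ?thesis using assms dsigma_A by (auto simp: compat_def difference_comodule_iff)
qed

lemma compat_linear:
  assumes "linear_map R M N \<phi>" "\<And>x. x \<in> carrier M \<Longrightarrow> \<nu> (\<phi> x) = tens_map R N A 1 \<phi> (\<mu> x)"
  shows "compat (\<lambda>r. r) M \<mu> N \<nu> \<phi> (\<lambda>a. a)"
  using assms tens_map_id[OF module_A linear_mapD(2)[OF comult_linear] linear_map_id]
  by (auto simp: compat_def tens_map_gmap[symmetric] linear_map_iff[symmetric] linear_map_id)

lemma balanced_counit:
  assumes M: "Module.module R M"
  shows "balanced R M A 1 M (\<lambda>g as. counit A (hd as) \<odot>\<^bsub>M\<^esub> g)"
proof -
  interpret M: Module.module R M by (rule M)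
  have h: "counit A \<in> ring_hom A R" "\<And>r a. r \<in> carrier R \<Longrightarrow> a \<in> carrier A \<Longrightarrow> counit A (r \<odot>\<^bsub>A\<^esub> a) = r \<otimes>\<^bsub>R\<^esub> counit A a"
    using hopf by (auto simp: difference_hopf_algebra_def)
  have c: "\<And>a. a \<in> carrier A \<Longrightarrow> counit A a \<in> carrier R"
    "\<And>a b. a \<in> carrier A \<Longrightarrow> b \<in> carrier A \<Longrightarrow> counit A (a \<oplus>\<^bsub>A\<^esub> b) = counit A a \<oplus>\<^bsub>R\<^esub> counit A b"
    using h(1) by (auto simp: ring_hom_def)
  have l: "as = [hd as] \<and> hd as \<in> carrier A" if "set as \<subseteq> carrier A" "length as = 1" for as
    using that by (cases as) auto
  show ?thesis
  proof (rule balancedI)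
    fix m as assume "m \<in> carrier M" "set as \<subseteq> carrier A" "length as = 1"
    then show "counit A (hd as) \<odot>\<^bsub>M\<^esub> m \<in> carrier M" using l[of as] c by auto
  next
    fix m m' as assume "m \<in> carrier M" "m' \<in> carrier M" "set as \<subseteq> carrier A" "length as = 1"
    then show "counit A (hd as) \<odot>\<^bsub>M\<^esub> (m \<oplus>\<^bsub>M\<^esub> m') = counit A (hd as) \<odot>\<^bsub>M\<^esub> m \<oplus>\<^bsub>M\<^esub> counit A (hd as) \<odot>\<^bsub>M\<^esub> m'"
      using l[of as] c by (auto simp: M.smult_r_distr)
  next
    fix m xs ys a b
    assume "m \<in> carrier M" "a \<in> carrier A" "b \<in> carrier A" "set xs \<subseteq> carrier A" "set ys \<subseteq> carrier A"
        "length xs + Suc (length ys) = 1"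
    then show "counit A (hd (xs @ (a \<oplus>\<^bsub>A\<^esub> b) # ys)) \<odot>\<^bsub>M\<^esub> m =
        counit A (hd (xs @ a # ys)) \<odot>\<^bsub>M\<^esub> m \<oplus>\<^bsub>M\<^esub> counit A (hd (xs @ b # ys)) \<odot>\<^bsub>M\<^esub> m"
      using c by (cases xs) (auto simp: M.smult_l_distr)
  next
    fix m xs ys a r
    assume "m \<in> carrier M" "a \<in> carrier A" "r \<in> carrier R" "set xs \<subseteq> carrier A" "set ys \<subseteq> carrier A"
        "length xs + Suc (length ys) = 1"
    then show "counit A (hd (xs @ a # ys)) \<odot>\<^bsub>M\<^esub> (r \<odot>\<^bsub>M\<^esub> m) = counit A (hd (xs @ (r \<odot>\<^bsub>A\<^esub> a) # ys)) \<odot>\<^bsub>M\<^esub> m"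
      using c h(2) by (cases xs) (auto simp: M.smult_assoc1[symmetric] M.R.m_comm)
  qed
qed

text \<open>The map id \<otimes> \<epsilon> with \<epsilon> the counit; by the counit law it is a
  left inverse of every coaction.\<close>

definition ev :: "('r, 'm, 'x) module_scheme \<Rightarrow> ('m, 'a) tens \<Rightarrow> 'm" where
  "ev M = tens_ext M (\<lambda>(g, as). counit A (hd as) \<odot>\<^bsub>M\<^esub> g)"

lemma ev_additive: "Module.module R M \<Longrightarrow> additive_map (tens R M A 1) M (ev M)"
  unfolding ev_def using tens_ext_additive[OF _ module.axioms(2) balanced_counit] by blast

lemma ev_pure:
  "Module.module R M \<Longrightarrow> m \<in> carrier M \<Longrightarrow> a \<in> carrier A \<Longrightarrow> ev M (pure_tens R M A m [a]) = counit A a \<odot>\<^bsub>M\<^esub> m"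
  unfolding ev_def by (subst tens_ext_pure[OF _ module.axioms(2) balanced_counit]) auto

lemma counit_closed: "a \<in> carrier A \<Longrightarrow> counit A a \<in> carrier R"
  using hopf by (auto simp: difference_hopf_algebra_def ring_hom_def)

lemma ev_natural:
  assumes M: "Module.module R M" "Module.module R N" and \<phi>: "linear_map R M N \<phi>" and X: "X \<in> carrier (tens R M A 1)"
  shows "ev N (tens_map R N A 1 \<phi> X) = \<phi> (ev M X)"
proof (rule tens_eqI[OF M(1) module.axioms(2)[OF M(2)] additive_map_comp[OF tens_map_additive[OF M \<phi>] ev_additive[OF M(2)]]
       additive_map_comp[OF ev_additive[OF M(1)] linear_mapD(1)[OF \<phi>]] _ X])
  fix m as assume m: "m \<in> carrier M" and "set as \<subseteq> carrier A" "length as = 1"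
  then obtain a where as: "as = [a]" and a: "a \<in> carrier A" by (cases as) auto
  show "ev N (tens_map R N A 1 \<phi> (pure_tens R M A m as)) = \<phi> (ev M (pure_tens R M A m as))"
    using m a by (simp add: as tens_map_pure[OF M \<phi>] ev_pure M linear_mapD[OF \<phi>] counit_closed)
qed

text \<open>Stability of \<open>K\<close> under the coaction is stated as vanishing in
  \<open>(M / K) \<otimes> A\<close>. In this form the descent works without comparing
  \<open>K \<otimes> A\<close> with a submodule of \<open>M \<otimes> A\<close>; the axioms then
  pass to the quotient because \<open>q\<close> is surjective and commutes with all structure
  maps.\<close>

lemma comod_quot:
  fixes M :: "('r, 'a, 'm, 'x) dcomod_scheme" and q :: "'m \<Rightarrow> 'p"
  assumes M: "difference_comodule R A M" and Q: "is_quot R M K q"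
    and sK: "\<And>x. x \<in> K \<Longrightarrow> dsigma M x \<in> K"
    and cK: "\<And>x. x \<in> K \<Longrightarrow> tens_map R (quot_mod M q) A 1 q (coact M x) = \<zero>\<^bsub>tens R (quot_mod M q) A 1\<^esub>"
  defines "C \<equiv> quot_comod R A M q"
  shows "difference_comodule R A C" "dmod_map R M C q"
    "\<And>x. x \<in> carrier M \<Longrightarrow> coact C (q x) = tens_map R C A 1 q (coact M x)"
proof -
  have m: "Module.module R M" and s: "semilinear R (rsigma R) M M (dsigma M)" and c: "comod M (coact M)"
    and cs: "\<And>x. x \<in> carrier M \<Longrightarrow> coact M (dsigma M x) = gmap R M A 1 (dsigma M) (dsigma A) (coact M x)"
    using M by (auto simp: difference_comodule_iff comod_def)
  interpret M: Module.module R M by (rule m)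
  note \<mu> = comodD(2)[OF c]
  have K: "K \<subseteq> carrier M" using Q by (simp add: is_quot_def)
  let ?P = "quot_mod M q"
  have P: "Module.module R ?P" by (rule module_quot[OF m Q])
  have q: "linear_map R M ?P q" by (rule linear_quot[OF m Q])
  interpret T: abelian_group "tens R ?P A 1" by (rule tens_group[OF P])
  have mC: "Module.module R C"
    by (rule module_cong[OF P]) (auto simp: C_def quot_comod_simps quot_mod_simps)
  have t: "tens R C A n = tens R ?P A n" "pure_tens R C A = pure_tens R ?P A" "tens_map R C A n = tens_map R ?P A n" for n
    by (simp_all add: C_def quot_comod_simps tens_map_quot_comod)
  have qC: "linear_map R M C q"
    using q by (simp add: linear_map_def C_def quot_comod_simps quot_mod_simps)
  have car: "carrier C = q ` carrier M" by (simp add: C_def quot_comod_simps)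
  have sC: "dsigma C (q x) = q (dsigma M x)" if x: "x \<in> carrier M" for x
  proof -
    note i = quot_inv[OF m Q x]
    have "dsigma M (inv_into (carrier M) q (q x)) \<ominus>\<^bsub>M\<^esub> dsigma M x \<in> K"
      using sK[OF i(2)] additive_map_minus[OF M.abelian_group_axioms M.abelian_group_axioms semilinearD(1)[OF s] i(1) x] by simp
    then show ?thesis
      using i x by (auto simp: C_def quot_comod_simps semilinearD(2)[OF s] intro!: quot_eqI[OF m Q])
  qed
  show cC: "coact C (q x) = tens_map R C A 1 q (coact M x)" if x: "x \<in> carrier M" for x
  proof -
    note i = quot_inv[OF m Q x]
    let ?y = "inv_into (carrier M) q (q x)"
    \<comment> \<open>The chosen preimage differs from \<open>x\<close> by an element of
      \<open>K\<close>, whose coaction dies in the quotient.\<close>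
    have "tens_map R ?P A 1 q (coact M ?y) \<ominus>\<^bsub>tens R ?P A 1\<^esub> tens_map R ?P A 1 q (coact M x) = \<zero>\<^bsub>tens R ?P A 1\<^esub>"
      using cK[OF i(2)] i x
      by (simp add: additive_map_minus[OF M.abelian_group_axioms tens_group[OF m] linear_mapD(1)[OF \<mu>]]
           additive_map_minus[OF tens_group[OF m] tens_group[OF P] tens_map_additive[OF m P q]] linear_mapD(2)[OF \<mu>])
    then have "tens_map R ?P A 1 q (coact M ?y) = tens_map R ?P A 1 q (coact M x)"
      by (rule T.minus_eq_zeroD) (intro additive_map_closed[OF tens_map_additive[OF m P q]] linear_mapD(2)[OF \<mu>] i(1) x)+
    then show ?thesis by (simp add: t) (simp add: C_def quot_comod_simps)
  qed
  have lC: "linear_map R C (tens R C A 1) (coact C)"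
  proof -
    have "coact C (q x \<oplus>\<^bsub>C\<^esub> q y) = coact C (q x) \<oplus>\<^bsub>tens R C A 1\<^esub> coact C (q y)" if "x \<in> carrier M" "y \<in> carrier M" for x y
      using that by (simp add: linear_mapD(3)[OF qC, symmetric] cC linear_mapD(2,3)[OF \<mu>] additive_map_add[OF tens_map_additive[OF m mC qC]])
    moreover have "coact C (r \<odot>\<^bsub>C\<^esub> q x) = r \<odot>\<^bsub>tens R C A 1\<^esub> coact C (q x)" if "x \<in> carrier M" "r \<in> carrier R" for x r
      using that by (simp add: linear_mapD(4)[OF qC, symmetric] cC linear_mapD(2,4)[OF \<mu>] linear_mapD(4)[OF tens_map_linear[OF m mC qC]])
    moreover have "coact C (q x) \<in> carrier (tens R C A 1)" if "x \<in> carrier M" for x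
      using that by (simp add: cC additive_map_closed[OF tens_map_additive[OF m mC qC]] linear_mapD(2)[OF \<mu>])
    ultimately show ?thesis by (auto simp: linear_map_def car)
  qed
  have compat: "compat (\<lambda>r. r) M (coact M) C (coact C) q (\<lambda>a. a)"
    by (rule compat_linear[OF qC]) (rule cC)
  have "comod C (coact C)"
    unfolding comod_def
  proof (intro conjI ballI mC lC)
    fix f assume "f \<in> carrier C"
    then obtain x where x: "x \<in> carrier M" "f = q x" by (auto simp: car)
    note \<mu>x = linear_mapD(2)[OF \<mu> x(1)]
    show "coact_first R C A (coact C) 1 (coact C f) = comult_at R C A \<Delta> 1 0 (coact C f)"
      using coact_first_gmap[OF m \<mu> mC lC compat \<mu>x] comult_at_gmap[OF m mC compat _ \<mu>x, of 0] comodD(3)[OF c x(1)]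
      by (simp add: x cC tens_map_gmap)
    show "tens_ext C (\<lambda>(g, as). counit A (hd as) \<odot>\<^bsub>C\<^esub> g) (coact C f) = f"
      using ev_natural[OF m mC qC \<mu>x] comodD(4)[OF c x(1)] by (simp add: ev_def x cC)
  qed
  moreover have scC: "semilinear R (rsigma R) C C (dsigma C)"
  proof -
    have "dsigma C (q x \<oplus>\<^bsub>C\<^esub> q y) = dsigma C (q x) \<oplus>\<^bsub>C\<^esub> dsigma C (q y)" if "x \<in> carrier M" "y \<in> carrier M" for x y
      using that by (simp add: linear_mapD(3)[OF qC, symmetric] sC semilinearD(2,3)[OF s])
    moreover have "dsigma C (r \<odot>\<^bsub>C\<^esub> q x) = rsigma R r \<odot>\<^bsub>C\<^esub> dsigma C (q x)" if "x \<in> carrier M" "r \<in> carrier R" for x r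
      using that by (simp add: linear_mapD(4)[OF qC, symmetric] sC semilinearD(2,4,5)[OF s])
    ultimately show ?thesis using semilinearD(2)[OF s] sC rsigma_closed by (auto simp: semilinear_def additive_map_def car)
  qed
  moreover have "coact C (dsigma C f) = gmap R C A 1 (dsigma C) (dsigma A) (coact C f)" if f: "f \<in> carrier C" for f
  proof -
    obtain x where x: "x \<in> carrier M" "f = q x" using f by (auto simp: car)
    note \<mu>x = linear_mapD(2)[OF \<mu> x(1)]
    have qs: "semilinear R (\<lambda>r. r) M C q" using qC by (simp add: linear_map_iff)
    have "coact C (dsigma C f) = gmap R C A 1 q (\<lambda>a. a) (gmap R M A 1 (dsigma M) (dsigma A) (coact M x))"
      by (simp add: x sC cC semilinearD(2)[OF s] cs tens_map_gmap)
    also have "\<dots> = gmap R C A 1 (\<lambda>x. q (dsigma M x)) (dsigma A) (coact M x)"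
      using gmap_comp[OF m m mC s dsigma_A qs semilinear_id \<mu>x] by simp
    also have "\<dots> = gmap R C A 1 (\<lambda>x. dsigma C (q x)) (dsigma A) (coact M x)"
    proof (rule gmap_cong[OF m mC _ dsigma_A _ dsigma_A _ _ \<mu>x])
      show "semilinear R (rsigma R) M C (\<lambda>x. q (dsigma M x))"
        using qs s by (auto simp: semilinear_def additive_map_def Pi_iff)
      show "semilinear R (rsigma R) M C (\<lambda>x. dsigma C (q x))"
        using qs scC by (auto simp: semilinear_def additive_map_def Pi_iff)
    qed (auto simp: sC)
    also have "\<dots> = gmap R C A 1 (dsigma C) (dsigma A) (gmap R C A 1 q (\<lambda>a. a) (coact M x))"
      using gmap_comp[OF m mC mC qs semilinear_id scC dsigma_A \<mu>x] by simp
    finally show ?thesis by (simp add: x cC tens_map_gmap)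
  qed
  ultimately show "difference_comodule R A C" by (simp add: difference_comodule_iff)
  show "dmod_map R M C q" using qC sC by (simp add: dmod_map_def)
qed

end

text \<open>The coaction is id \<otimes> \<Delta>. Its value must lie in the nested product
  \<open>(M \<otimes> A) \<otimes> A\<close>, whereas \<open>comult_at\<close> produces the flat
  \<open>M \<otimes> A \<otimes> A\<close>; \<open>con\<close> with the identity does the
  rebracketing.\<close>

definition cofree ::
    "('r, 'z) dring_scheme \<Rightarrow> ('r, 'a, 'y) dhopf_scheme \<Rightarrow> ('r, 'm, 'x) dmod_scheme \<Rightarrow> ('r, 'a, ('m, 'a) tens) dcomod" where
  "cofree R A M = dmod.extend (dtens R M A 1)
     \<lparr>coact = (\<lambda>X. con R M (tens R M A 1) A 1 (\<lambda>x. x) (comult_at R M A (comult A) 1 0 X))\<rparr>"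

lemma cofree_simps:
  "carrier (cofree R A M) = carrier (tens R M A 1)"
  "\<zero>\<^bsub>cofree R A M\<^esub> = \<zero>\<^bsub>tens R M A 1\<^esub>"
  "ring.add (cofree R A M) = ring.add (tens R M A 1)"
  "smult (cofree R A M) = smult (tens R M A 1)"
  "dsigma (cofree R A M) = gmap R M A 1 (dsigma M) (dsigma A)"
  "coact (cofree R A M) = (\<lambda>X. con R M (tens R M A 1) A 1 (\<lambda>x. x) (comult_at R M A (comult A) 1 0 X))"
  by (simp_all add: cofree_def dmod.extend_def del: One_nat_def[symmetric])

lemma tens_cofree:
  "tens R (cofree R A M) A n = tens R (tens R M A 1) A n"
  "pure_tens R (cofree R A M) A = pure_tens R (tens R M A 1) A"
  by (rule tens_cong; simp add: cofree_def dmod.extend_def dtens_def module.extend_def)+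

section \<open>The cofree comodule\<close>

context hopf_base
begin

lemma gmap_semilinear:
  assumes M: "Module.module R M" "Module.module R N" and \<phi>: "semilinear R \<theta> M N \<phi>" and \<tau>: "semilinear R \<theta> A A \<tau>"
  shows "semilinear R \<theta> (tens R M A n) (tens R N A n) (gmap R N A n \<phi> \<tau>)"
proof -
  have s: "set (map \<tau> as) \<subseteq> carrier A" if "set as \<subseteq> carrier A" for as
    using that semilinearD(2)[OF \<tau>] by auto
  interpret M: Module.module R M by (rule M(1))
  have "gmap R N A n \<phi> \<tau> (r \<odot>\<^bsub>tens R M A n\<^esub> X) = \<theta> r \<odot>\<^bsub>tens R N A n\<^esub> gmap R N A n \<phi> \<tau> X"
    if r: "r \<in> carrier R" and X: "X \<in> carrier (tens R M A n)" for r X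
    by (rule tens_eqI[OF M(1) tens_group[OF M(2)] additive_map_comp[OF smult_additive[OF M(1) r] gmap_additive[OF M \<phi> \<tau>]]
         additive_map_comp[OF gmap_additive[OF M \<phi> \<tau>] smult_additive[OF M(2) semilinearD(4)[OF \<phi> r]]] _ X])
       (use r in \<open>simp add: smult_pure[OF M(1)] smult_pure[OF M(2)] gmap_pure[OF M \<phi> \<tau>] s semilinearD[OF \<phi>] del: set_map\<close>)
  then show ?thesis using gmap_additive[OF M \<phi> \<tau>, of n] \<phi> by (auto simp: semilinear_def)
qed

lemma linear_pure:
  assumes M: "Module.module R M" and m: "m \<in> carrier M"
  shows "linear_map R A (tens R M A 1) (\<lambda>b. pure_tens R M A m [b])"
proof -
  interpret M: Module.module R M by (rule M)
  have "pure_tens R M A m [r \<odot>\<^bsub>A\<^esub> a] = r \<odot>\<^bsub>tens R M A 1\<^esub> pure_tens R M A m [a]" if "r \<in> carrier R" "a \<in> carrier A" for r a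
    using that m pure_tens_smult_slot[OF M m, of a r "[]" "[]" 1] by (simp add: smult_pure[OF M])
  moreover have "pure_tens R M A m [a \<oplus>\<^bsub>A\<^esub> b] = pure_tens R M A m [a] \<oplus>\<^bsub>tens R M A 1\<^esub> pure_tens R M A m [b]" if "b \<in> carrier A" "a \<in> carrier A" for a b
    using that m pure_tens_add_slot[OF M m, of a b "[]" "[]" 1] by simp
  ultimately show ?thesis using m by (auto simp: linear_map_def pure_tens_closed[OF M])
qed

context
  fixes M :: "('r, 'm, 'x) dmod_scheme"
  assumes M: "Module.module R M"
begin

abbreviation "T1 \<equiv> tens R M A 1"

lemma module_T1: "Module.module R T1" by (rule module_tens[OF M])

lemma module_cofree: "Module.module R (cofree R A M)"
  by (rule module_cong[OF module_T1]) (simp_all add: cofree_simps)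

lemma con_pre:
  assumes m: "m \<in> carrier M" and Y: "Y \<in> carrier (tens R A A 1)"
  shows "con R M T1 A 1 (\<lambda>x. x) (pre M (Suc 1) m Y) = tens_map R T1 A 1 (\<lambda>b. pure_tens R M A m [b]) Y"
  by (rule tens_eqI[OF module_A tens_group[OF module_T1] additive_map_comp[OF wrap_additive[OF M m] con_additive[OF M module_T1 linear_map_id]]
      tens_map_additive[OF module_A module_T1 linear_pure[OF M m]] _ Y])
    (use m in \<open>simp_all add: wrap_pure[OF M] con_pure[OF M module_T1 linear_map_id] tens_map_pure[OF module_A module_T1 linear_pure[OF M m]]
       del: One_nat_def[symmetric] One_nat_def\<close>)

text \<open>For fixed \<open>m\<close> this exhibits \<open>b \<mapsto> m \<otimes> b\<close> as a
  comodule map from \<open>A\<close>, through which properties of \<open>A\<close> reach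
  \<open>M \<otimes> A\<close>.\<close>

lemma coact_cofree_pure:
  assumes m: "m \<in> carrier M" and a: "a \<in> carrier A"
  shows "coact (cofree R A M) (pure_tens R M A m [a]) = tens_map R T1 A 1 (\<lambda>b. pure_tens R M A m [b]) (\<Delta> a)"
  using con_pre[OF m linear_mapD(2)[OF comult_linear a]] m a
  by (simp add: cofree_simps comult_at_pure[OF M comult_linear])

lemma coact_cofree_additive: "additive_map T1 (tens R T1 A 1) (coact (cofree R A M))"
  unfolding cofree_simps
  by (rule additive_map_comp[OF comult_at_additive[OF M comult_linear] con_additive[OF M module_T1 linear_map_id]]) simp

lemma coact_cofree_linear: "linear_map R T1 (tens R T1 A 1) (coact (cofree R A M))"
proof (rule linear_map_eqI[OF M module_tens[OF module_T1] coact_cofree_additive])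
  interpret M: Module.module R M by (rule M)
  fix r m as assume r: "r \<in> carrier R" and m: "m \<in> carrier M" and "set as \<subseteq> carrier A" "length as = 1"
  then obtain a where as: "as = [a]" and a: "a \<in> carrier A" by (cases as) auto
  have rm: "r \<odot>\<^bsub>M\<^esub> m \<in> carrier M" using r m by simp
  have "tens_map R T1 A 1 (\<lambda>b. pure_tens R M A (r \<odot>\<^bsub>M\<^esub> m) [b]) (\<Delta> a) = r \<odot>\<^bsub>tens R T1 A 1\<^esub> tens_map R T1 A 1 (\<lambda>b. pure_tens R M A m [b]) (\<Delta> a)"
    by (rule tens_eqI[OF module_A tens_group[OF module_T1] tens_map_additive[OF module_A module_T1 linear_pure[OF M rm]]
         additive_map_comp[OF tens_map_additive[OF module_A module_T1 linear_pure[OF M m]] smult_additive[OF module_T1 r]]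
         _ linear_mapD(2)[OF comult_linear a]])
      (use m r in \<open>simp add: tens_map_pure[OF module_A module_T1 linear_pure[OF M m]] tens_map_pure[OF module_A module_T1 linear_pure[OF M rm]]
          smult_pure[OF module_T1] smult_pure[OF M] pure_tens_closed[OF M]\<close>)
  then show "coact (cofree R A M) (pure_tens R M A (r \<odot>\<^bsub>M\<^esub> m) as) = r \<odot>\<^bsub>tens R T1 A 1\<^esub> coact (cofree R A M) (pure_tens R M A m as)"
    by (simp add: as coact_cofree_pure rm m a)
qed

text \<open>The images of the comodule maps \<open>b \<mapsto> m \<otimes> b\<close> generate
  \<open>M \<otimes> A\<close>, so both laws are inherited from \<open>A\<close> with
  \<open>\<Delta>\<close>.\<close>

lemma comod_cofree: "comod (cofree R A M) (coact (cofree R A M))"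
proof -
  let ?J = "cofree R A M"
  have lin: "linear_map R ?J (tens R ?J A 1) (coact ?J)"
    using coact_cofree_linear unfolding tens_cofree by (simp add: linear_map_def cofree_simps(1,3,4))
  note J = module_cofree
  have linp: "linear_map R A ?J (\<lambda>b. pure_tens R M A m [b])" if "m \<in> carrier M" for m
    using linear_pure[OF M that] by (simp add: linear_map_def cofree_simps)
  have eq: "coact ?J (pure_tens R M A m [a]) = tens_map R ?J A 1 (\<lambda>b. pure_tens R M A m [b]) (\<Delta> a)"
    if "m \<in> carrier M" "a \<in> carrier A" for m a
    using coact_cofree_pure[OF that] by (simp add: tens_map_def tens_cofree)
  have ind: "f X = g X" if "abelian_group B" "additive_map ?J B f" "additive_map ?J B g" "X \<in> carrier ?J"
    "\<And>m a. m \<in> carrier M \<Longrightarrow> a \<in> carrier A \<Longrightarrow> f (pure_tens R M A m [a]) = g (pure_tens R M A m [a])"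
    for B :: "('g, 'h) ring_scheme" and f g X
  proof (rule tens_eqI[OF M that(1)])
    show "additive_map T1 B f" "additive_map T1 B g" "X \<in> carrier T1" using that(2-4) by (simp_all add: additive_map_def cofree_simps)
    fix m as assume m: "m \<in> carrier M" and "set as \<subseteq> carrier A" "length as = 1"
    then obtain a where as: "as = [a]" and a: "a \<in> carrier A" by (cases as) auto
    then show "f (pure_tens R M A m as) = g (pure_tens R M A m as)" using that(5) m by simp
  qed
  have compat: "compat (\<lambda>r. r) A \<Delta> ?J (coact ?J) (\<lambda>b. pure_tens R M A m [b]) (\<lambda>a. a)" if "m \<in> carrier M" for m
    by (rule compat_linear[OF linp[OF that]]) (rule eq[OF that])
  show ?thesis
    unfolding comod_def
  proof (intro conjI ballI J lin)
    fix X assume X: "X \<in> carrier ?J"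
    have "additive_map ?J (tens R ?J A (Suc 1)) (\<lambda>X. comult_at R ?J A \<Delta> 1 0 (coact ?J X))"
      by (rule additive_map_comp[OF linear_mapD(1)[OF lin] comult_at_additive[OF J comult_linear]]) simp
    then show "coact_first R ?J A (coact ?J) 1 (coact ?J X) = comult_at R ?J A \<Delta> 1 0 (coact ?J X)"
    proof (rule ind[OF tens_group[OF J] additive_map_comp[OF linear_mapD(1)[OF lin] coact_first_additive[OF J lin]] _ X])
      fix m a assume m: "m \<in> carrier M" and a: "a \<in> carrier A"
      note \<Delta>a = linear_mapD(2)[OF comult_linear a]
      show "coact_first R ?J A (coact ?J) 1 (coact ?J (pure_tens R M A m [a])) = comult_at R ?J A \<Delta> 1 0 (coact ?J (pure_tens R M A m [a]))"
        using coact_first_gmap[OF module_A comult_linear J lin compat[OF m] \<Delta>a] comult_at_gmap[OF module_A J compat[OF m] _ \<Delta>a, of 0]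
          comodD(3)[OF comod_hopf a]
        by (simp add: eq m a tens_map_gmap)
    qed
    have "additive_map ?J ?J (\<lambda>X. X)" by (simp add: additive_map_def)
    then have "ev ?J (coact ?J X) = X"
    proof (rule ind[OF module.axioms(2)[OF J] additive_map_comp[OF linear_mapD(1)[OF lin] ev_additive[OF J]] _ X])
      fix m a assume m: "m \<in> carrier M" and a: "a \<in> carrier A"
      note \<Delta>a = linear_mapD(2)[OF comult_linear a]
      show "ev ?J (coact ?J (pure_tens R M A m [a])) = pure_tens R M A m [a]"
        using ev_natural[OF module_A J linp[OF m] \<Delta>a] comodD(4)[OF comod_hopf a]
        by (simp add: eq m a) (simp add: ev_def)
    qed
    then show "tens_ext ?J (\<lambda>(g, as). counit A (hd as) \<odot>\<^bsub>?J\<^esub> g) (coact ?J X) = X" by (simp add: ev_def)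
  qed
qed

lemma difference_comodule_cofree:
  assumes s: "semilinear R (rsigma R) M M (dsigma M)"
  shows "difference_comodule R A (cofree R A M)"
proof -
  let ?J = "cofree R A M"
  note J = module_cofree
  let ?g = "gmap R M A 1 (dsigma M) (dsigma A)"
  have sT: "semilinear R (rsigma R) T1 T1 ?g"
    by (rule gmap_semilinear[OF M M s dsigma_A])
  have sJ: "semilinear R (rsigma R) ?J ?J (dsigma ?J)"
    using sT by (simp add: semilinear_def additive_map_def cofree_simps)
  have "coact ?J (?g X) = gmap R T1 A 1 ?g (dsigma A) (coact ?J X)" if X: "X \<in> carrier T1" for X
  proof (rule tens_eqI[OF M tens_group[OF module_T1] additive_map_comp[OF gmap_additive[OF M M s dsigma_A] coact_cofree_additive]
       additive_map_comp[OF coact_cofree_additive gmap_additive[OF module_T1 module_T1 sT dsigma_A]] _ X])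
    fix m as assume m: "m \<in> carrier M" and "set as \<subseteq> carrier A" "length as = 1"
    then obtain a where as: "as = [a]" and a: "a \<in> carrier A" by (cases as) auto
    have sm: "dsigma M m \<in> carrier M" and sa: "dsigma A a \<in> carrier A"
      using semilinearD(2)[OF s m] semilinearD(2)[OF dsigma_A a] by auto
    note \<Delta>a = linear_mapD(2)[OF comult_linear a]
    have \<Delta>s: "\<Delta> (dsigma A a) = gmap R A A 1 (dsigma A) (dsigma A) (\<Delta> a)"
      using hopf a by (simp add: difference_hopf_algebra_def dmod_map_def)
    have l: "semilinear R (\<lambda>r. r) A T1 (\<lambda>b. pure_tens R M A m' [b])" if "m' \<in> carrier M" for m'
      using linear_pure[OF M that] by (simp add: linear_map_iff)
    \<comment> \<open>Both composites turn out to be the image of \<open>\<Delta> a\<close> under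
      the map that sends \<open>b\<close> to \<sigma>m \<otimes> \<sigma>b on the first factor and
      applies \<sigma> to the second.\<close>
    have "coact ?J (?g (pure_tens R M A m as)) = tens_map R T1 A 1 (\<lambda>b. pure_tens R M A (dsigma M m) [b]) (gmap R A A 1 (dsigma A) (dsigma A) (\<Delta> a))"
      using m a sm sa by (simp add: as gmap_pure[OF M M s dsigma_A] coact_cofree_pure \<Delta>s)
    also have "\<dots> = gmap R T1 A 1 (\<lambda>b. pure_tens R M A (dsigma M m) [dsigma A b]) (dsigma A) (\<Delta> a)"
      unfolding tens_map_gmap
      using gmap_comp[OF module_A module_A module_T1 dsigma_A dsigma_A l[OF sm] semilinear_id \<Delta>a] by simp
    also have "\<dots> = gmap R T1 A 1 (\<lambda>b. ?g (pure_tens R M A m [b])) (dsigma A) (\<Delta> a)"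
    proof (rule gmap_cong[OF module_A module_T1 _ dsigma_A _ dsigma_A _ _ \<Delta>a])
      show "semilinear R (rsigma R) A T1 (\<lambda>b. pure_tens R M A (dsigma M m) [dsigma A b])"
        using l[OF sm] dsigma_A unfolding semilinear_def additive_map_def Pi_iff by simp
      show "semilinear R (rsigma R) A T1 (\<lambda>b. ?g (pure_tens R M A m [b]))"
        using l[OF m] sT unfolding semilinear_def additive_map_def Pi_iff by simp
    qed (use m in \<open>simp_all add: gmap_pure[OF M M s dsigma_A]\<close>)
    also have "\<dots> = gmap R T1 A 1 ?g (dsigma A) (tens_map R T1 A 1 (\<lambda>b. pure_tens R M A m [b]) (\<Delta> a))"
      unfolding tens_map_gmap
      using gmap_comp[OF module_A module_T1 module_T1 l[OF m] semilinear_id sT dsigma_A \<Delta>a] by simp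
    finally show "coact ?J (?g (pure_tens R M A m as)) = gmap R T1 A 1 ?g (dsigma A) (coact ?J (pure_tens R M A m as))"
      using m a by (simp add: as coact_cofree_pure)
  qed
  then show ?thesis
    using comod_cofree sJ by (simp add: difference_comodule_iff cofree_simps(1,5) gmap_def tens_cofree)
qed

text \<open>A contraction along \<open>r\<close> factors through the rebracketing. This identifies
  the condition on \<open>r\<close> in the contracting homotopy with colinearity from the cofree
  comodule.\<close>

lemma con_comult_natural:
  assumes N: "Module.module R N" and r: "linear_map R T1 N r" and X: "X \<in> carrier (tens R M A (Suc 1))"
  shows "tens_map R N A 1 r (con R M T1 A 1 (\<lambda>x. x) X) = con R M N A 1 r X"
proof (rule tens_eqI[OF M tens_group[OF N] additive_map_comp[OF con_additive[OF M module_T1 linear_map_id] tens_map_additive[OF module_T1 N r]]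
       con_additive[OF M N r] _ X])
  fix m as assume m: "m \<in> carrier M" and as: "set as \<subseteq> carrier A" "length as = Suc 1"
  then obtain b bs where b: "as = b # bs" "b \<in> carrier A" "set bs \<subseteq> carrier A" "length bs = 1" by (cases as) auto
  show "tens_map R N A 1 r (con R M T1 A 1 (\<lambda>x. x) (pure_tens R M A m as)) = con R M N A 1 r (pure_tens R M A m as)"
    using m b by (simp add: con_pure[OF M module_T1 linear_map_id] con_pure[OF M N r] tens_map_pure[OF module_T1 N r] pure_tens_closed[OF M])
qed

text \<open>Coassociativity read differently: the coaction is a comodule map into the cofree
  comodule.\<close>

lemma coact_cofree_coact:
  assumes c: "comod M \<mu>" and x: "x \<in> carrier M"
  shows "coact (cofree R A M) (\<mu> x) = tens_map R T1 A 1 \<mu> (\<mu> x)"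
proof -
  note \<mu> = comodD(2)[OF c]
  have "con R M T1 A 1 (\<lambda>x. x) (coact_first R M A \<mu> 1 X) = tens_map R T1 A 1 \<mu> X" if X: "X \<in> carrier (tens R M A 1)" for X
    by (rule tens_eqI[OF M tens_group[OF module_T1] additive_map_comp[OF coact_first_additive[OF M \<mu>] con_additive[OF M module_T1 linear_map_id]]
          tens_map_additive[OF M module_T1 \<mu>] _ X])
       (simp add: coact_first_pure[OF M \<mu>] con_app[OF M module_T1 linear_map_id, where n = 1, simplified] tens_map_pure[OF M module_T1 \<mu>] linear_mapD(2)[OF \<mu>])
  then show ?thesis
    unfolding cofree_simps comodD(3)[OF c x, symmetric] using linear_mapD(2)[OF \<mu> x] by blast
qed

end

end

section \<open>Flatness\<close>

locale flat_hopf = hopf_base R A for R :: "('u::infinite) dring" and A :: "('u, 'u) dhopf" +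
  assumes flat: "flat R A"
begin

text \<open>The tensor product is a quotient of a free abelian group on pairs of an element and a
  list. Over an infinite type there are no more such pairs than elements, and a free abelian group
  on an infinite set has the cardinality of that set.\<close>

lemma ex_inj_tens:
  fixes M :: "('u, 'u, 'x) module_scheme"
  shows "\<exists>j :: ('u, 'u) tens \<Rightarrow> 'u. inj_on j (carrier (tens R M A n))"
proof -
  let ?U = "UNIV :: 'u set" and ?S = "tens_gens M A n"
  let ?V = "UNIV :: ('u \<times> 'u list) set"
  have inf: "infinite ?U" by (rule infinite_UNIV)
  have "carrier (tens R M A n) = (\<lambda>x. tens_sub R M A n #>\<^bsub>free_Abelian_group ?S\<^esub> x) ` carrier (free_Abelian_group ?S)"
    by (auto simp: tens_simps FactGroup_def RCOSETS_def)
  then have "carrier (tens R M A n) \<lesssim> carrier (free_Abelian_group ?S)" by (simp add: image_lepoll)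
  also have "carrier (free_Abelian_group ?S) \<lesssim> carrier (free_Abelian_group ?V)"
    by (rule subset_imp_lepoll) auto
  also have "carrier (free_Abelian_group ?V) \<approx> ?V"
    using inf by (intro eqpoll_free_Abelian_group_infinite) (simp add: finite_prod)
  also have "?V \<lesssim> ?U"
  proof -
    have "|UNIV :: 'u list set| =o |?U|" using card_of_lists_infinite[OF inf] by simp
    then have "|?U \<times> (UNIV :: 'u list set)| \<le>o |?U|"
      using inf by (intro card_of_Times_ordLeq_infinite) (auto intro: ordIso_imp_ordLeq)
    then show ?thesis by (auto simp: lepoll_def card_of_ordLeq[symmetric])
  qed
  finally show ?thesis by (auto simp: lepoll_def)
qed

text \<open>Flatness quantifies over bare module records. Dropping the extra fields of comodules
  brings them into its scope without changing their tensor products.\<close>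

lemma tens_truncate:
  "tens R (module.truncate M) A n = tens R M A n" "pure_tens R (module.truncate M) A = pure_tens R M A"
  "tens_map R (module.truncate M) A n = tens_map R M A n"
proof -
  show *: "tens R (module.truncate M) A n = tens R M A n" "pure_tens R (module.truncate M) A = pure_tens R M A"
    by (rule tens_cong; simp add: module.truncate_def)+
  show "tens_map R (module.truncate M) A n = tens_map R M A n"
    by (simp add: fun_eq_iff tens_map_def *)
qed

lemma module_truncate: "Module.module R M \<Longrightarrow> Module.module R (module.truncate M)"
  by (rule module_cong) (auto simp: module.truncate_def)

lemma linear_map_truncate: "linear_map R (module.truncate M) (module.truncate N) f \<longleftrightarrow> linear_map R M N f"
  by (simp add: linear_map_def module.truncate_def)

lemma flat_inj_1:
  fixes M :: "('u, 'u, 'x) module_scheme" and N :: "('u, 'u, 'y) module_scheme"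
  assumes "Module.module R M" "Module.module R N" "linear_map R M N f" "inj_on f (carrier M)"
  shows "inj_on (tens_map R N A 1 f) (carrier (tens R M A 1))"
proof -
  have "inj_on f (carrier (module.truncate M))" using assms(4) by (simp add: module.truncate_def)
  then have "inj_on (tens_map R (module.truncate N) A 1 f) (carrier (tens R (module.truncate M) A 1))"
    using flat[unfolded flat_def, THEN conjunct2, rule_format, of "module.truncate M" "module.truncate N" f]
      module_truncate[OF assms(1)] module_truncate[OF assms(2)] assms(3) by (simp only: linear_map_truncate)
  then show ?thesis by (simp only: tens_truncate)
qed

text \<open>With no factor \<open>A\<close> the projection to the first component is balanced, and
  it inverts \<open>m \<mapsto> m \<otimes> ()\<close>.\<close>

lemma tens_0_repr:
  assumes M: "Module.module R M" and X: "X \<in> carrier (tens R M A 0)"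
  shows "\<exists>m\<in>carrier M. X = pure_tens R M A m []"
proof -
  interpret M: Module.module R M by (rule M)
  have bal: "balanced R M A 0 M (\<lambda>m as. m)" by (simp add: balanced_def)
  note e = tens_ext_additive[OF M M.abelian_group_axioms bal] and ep = tens_ext_pure[OF M M.abelian_group_axioms bal]
  have p: "additive_map M (tens R M A 0) (\<lambda>m. pure_tens R M A m [])"
    by (simp add: additive_map_def pure_tens_closed[OF M] pure_tens_add[OF M, where n=0])
  have "X = pure_tens R M A (tens_ext M (\<lambda>(m, as). m) X) []"
    by (rule tens_eqI[OF M tens_group[OF M] _ additive_map_comp[OF e p] _ X]) (simp_all add: ep additive_map_def)
  then show ?thesis using additive_map_closed[OF e X] by blast
qed

lemma tens_0_inj:
  assumes M: "Module.module R M" and "m \<in> carrier M" "m' \<in> carrier M" "pure_tens R M A m [] = pure_tens R M A m' []"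
  shows "m = m'"
proof -
  interpret M: Module.module R M by (rule M)
  have bal: "balanced R M A 0 M (\<lambda>m as. m)" by (simp add: balanced_def)
  show ?thesis using tens_ext_pure[OF M M.abelian_group_axioms bal, of _ "[]"] assms by (metis empty_subsetI list.set(1) list.size(3))
qed

text \<open>With \<open>j\<close> an isomorphism from \<open>M \<otimes> A\<close> onto a copy
  \<open>P\<close>, contraction rewrites a tensor with \<open>n + 1\<close> factors over
  \<open>M\<close> as one with \<open>n\<close> factors over \<open>P\<close>, without loss of
  information.\<close>

lemma con_inj:
  assumes M: "Module.module R M" and P: "Module.module R P" and j: "linear_map R (tens R M A 1) P j"
    and i: "linear_map R P (tens R M A 1) i" "\<And>X. X \<in> carrier (tens R M A 1) \<Longrightarrow> i (j X) = X"
  shows "inj_on (con R M P A n j) (carrier (tens R M A (Suc n)))"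
proof (rule inj_on_inverseI)
  \<comment> \<open>The left inverse expands the first factor by \<open>i\<close> and appends the
    remaining slots.\<close>
  let ?g = "tens_ext (tens R M A (Suc n)) (\<lambda>(m, as). app R M A (Suc n) as (i m))"
  note b = balanced_coact_first[OF M i(1)]
  note g = tens_ext_additive[OF P tens_group[OF M] b] and gp = tens_ext_pure[OF P tens_group[OF M] b]
  fix X assume X: "X \<in> carrier (tens R M A (Suc n))"
  show "?g (con R M P A n j X) = X"
  proof (rule tens_eqI[OF M tens_group[OF M] additive_map_comp[OF con_additive[OF M P j] g] _ _ X])
    show "additive_map (tens R M A (Suc n)) (tens R M A (Suc n)) (\<lambda>X. X)" by (simp add: additive_map_def)
    fix m as assume m: "m \<in> carrier M" and as: "set as \<subseteq> carrier A" "length as = Suc n"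
    then obtain b bs where b: "as = b # bs" "b \<in> carrier A" "set bs \<subseteq> carrier A" "length bs = n" by (cases as) auto
    show "?g (con R M P A n j (pure_tens R M A m as)) = pure_tens R M A m as"
      using m b by (simp add: con_pure[OF M P j] gp i(2) pure_tens_closed[OF M] linear_mapD(2)[OF j] app_pure[OF M])
  qed
qed

lemma inv_quot_linear:
  assumes M: "Module.module R M" and j: "inj_on j (carrier M)"
  shows "linear_map R (quot_mod M j) M (inv_into (carrier M) j)"
proof -
  interpret M: Module.module R M by (rule M)
  note Q = is_quot_inj[OF M j]
  show ?thesis
    using j by (auto simp: linear_map_def quot_mod_simps quot_add[OF M Q] quot_smult[OF M Q] inv_into_f_f)
qed

text \<open>Tensoring with \<open>n + 1\<close> factors is tensoring once and then with
  \<open>n\<close> more. After one factor the modules have left the universe, so copies of them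
  replace them before the induction hypothesis is used.\<close>

lemma flat_inj:
  fixes M :: "('u, 'u, 'x) module_scheme" and N :: "('u, 'u, 'y) module_scheme"
  assumes "Module.module R M" "Module.module R N" "linear_map R M N f" "inj_on f (carrier M)"
  shows "inj_on (tens_map R N A n f) (carrier (tens R M A n))"
proof -
  \<comment> \<open>Every step of the induction passes to new modules. It therefore runs over the
    record type of the copies produced by \<open>quot_mod\<close>, and the given records are
    truncated to that type at the end.\<close>
  have "inj_on (tens_map R N A n f) (carrier (tens R M A n))"
    if "Module.module R M" "Module.module R N" "linear_map R M N f" "inj_on f (carrier M)"
    for M N :: "('u, 'u) module" and f
    using that
  proof (induction n arbitrary: M N f)
    case 0
    show ?case
    proof (rule inj_onI)
      fix X Y assume X: "X \<in> carrier (tens R M A 0)" and Y: "Y \<in> carrier (tens R M A 0)"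
        and eq: "tens_map R N A 0 f X = tens_map R N A 0 f Y"
      obtain x y where x: "x \<in> carrier M" "X = pure_tens R M A x []" and y: "y \<in> carrier M" "Y = pure_tens R M A y []"
        using tens_0_repr[OF 0(1) X] tens_0_repr[OF 0(1) Y] by blast
      have "pure_tens R N A (f x) [] = pure_tens R N A (f y) []"
        using eq x y by (simp add: tens_map_pure[OF 0(1,2,3)])
      then have "f x = f y" using x y linear_mapD(2)[OF 0(3)] tens_0_inj[OF 0(2)] by blast
      then show "X = Y" using x y 0(4) by (auto simp: inj_on_def)
    qed
  next
    case (Suc n)
    note M = Suc.prems(1) and N = Suc.prems(2) and f = Suc.prems(3)
    let ?TM = "tens R M A 1" and ?TN = "tens R N A 1"
    note TM = module_tens[OF M, of 1] and TN = module_tens[OF N, of 1]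
    obtain j k :: "('u, 'u) tens \<Rightarrow> 'u" where j: "inj_on j (carrier ?TM)" and k: "inj_on k (carrier ?TN)"
      using ex_inj_tens by blast
    let ?P = "quot_mod ?TM j" and ?Q = "quot_mod ?TN k"
    note qj = is_quot_inj[OF TM j] and qk = is_quot_inj[OF TN k]
    note P = module_quot[OF TM qj] and Q = module_quot[OF TN qk]
    note lj = linear_quot[OF TM qj] and lk = linear_quot[OF TN qk]
    note ij = inv_quot_linear[OF TM j] and ik = inv_quot_linear[OF TN k]
    let ?f = "tens_map R N A 1 f"
    \<comment> \<open>The map \<open>f \<otimes> id\<close> seen between the copies of
      \<open>M \<otimes> A\<close> and \<open>N \<otimes> A\<close> in the universe.\<close>
    let ?g = "\<lambda>p. k (?f (inv_into (carrier ?TM) j p))"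
    have g: "linear_map R ?P ?Q ?g"
      by (rule linear_map_comp[OF linear_map_comp[OF ij tens_map_linear[OF M N f]] lk])
    have ginj: "inj_on ?g (carrier ?P)"
    proof (rule inj_onI)
      fix p q assume p: "p \<in> carrier ?P" and q: "q \<in> carrier ?P" and eq: "?g p = ?g q"
      note p' = linear_mapD(2)[OF ij p] and q' = linear_mapD(2)[OF ij q]
      note fp = additive_map_closed[OF tens_map_additive[OF M N f] p'] and fq = additive_map_closed[OF tens_map_additive[OF M N f] q']
      have "inv_into (carrier ?TM) j p = inv_into (carrier ?TM) j q"
        by (rule inj_onD[OF flat_inj_1[OF M N f Suc.prems(4)] inj_onD[OF k eq fp fq] p' q'])
      then show "p = q" using p q by (auto simp: quot_mod_simps intro: inv_into_injective)
    qed
    \<comment> \<open>The square that compares \<open>f\<close> on \<open>n + 1\<close> factors with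
      \<open>?g\<close> on \<open>n\<close> factors; its vertical maps are the contractions, and
      \<open>con_inj\<close> makes the one on the side of \<open>M\<close> injective.\<close>
    have comm: "tens_map R ?Q A n ?g (con R M ?P A n j X) = con R N ?Q A n k (tens_map R N A (Suc n) f X)"
      if X: "X \<in> carrier (tens R M A (Suc n))" for X
    proof (rule tens_eqI[OF M tens_group[OF Q] additive_map_comp[OF con_additive[OF M P lj] tens_map_additive[OF P Q g]]
         additive_map_comp[OF tens_map_additive[OF M N f] con_additive[OF N Q lk]] _ X])
      fix m as assume m: "m \<in> carrier M" and as: "set as \<subseteq> carrier A" "length as = Suc n"
      then obtain b bs where b: "as = b # bs" "b \<in> carrier A" "set bs \<subseteq> carrier A" "length bs = n" by (cases as) auto
      have "pure_tens R M A m [b] \<in> carrier ?TM" using m b by (intro pure_tens_closed[OF M]) auto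
      then show "tens_map R ?Q A n ?g (con R M ?P A n j (pure_tens R M A m as)) = con R N ?Q A n k (tens_map R N A (Suc n) f (pure_tens R M A m as))"
        using m b j by (simp add: con_pure[OF M P lj] con_pure[OF N Q lk] tens_map_pure[OF P Q g] tens_map_pure[OF M N f]
           linear_mapD(2)[OF lj] linear_mapD(2)[OF f] inv_into_f_f)
    qed
    show ?case
    proof (rule inj_onI)
      fix X Y assume X: "X \<in> carrier (tens R M A (Suc n))" and Y: "Y \<in> carrier (tens R M A (Suc n))"
        and eq: "tens_map R N A (Suc n) f X = tens_map R N A (Suc n) f Y"
      have "tens_map R ?Q A n ?g (con R M ?P A n j X) = tens_map R ?Q A n ?g (con R M ?P A n j Y)"
        by (simp add: comm X Y eq)
      then have "con R M ?P A n j X = con R M ?P A n j Y"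
        using Suc.IH[OF P Q g ginj] additive_map_closed[OF con_additive[OF M P lj]] X Y by (auto simp: inj_on_def)
      then show "X = Y"
        using con_inj[OF M P lj ij inv_into_f_f[OF j], of n] X Y by (auto simp: inj_on_def)
    qed
  qed
  from this[OF module_truncate[OF assms(1)] module_truncate[OF assms(2)]] assms(3,4)
  show ?thesis by (simp add: linear_map_truncate tens_truncate) (simp add: module.truncate_def)
qed

text \<open>The projection onto the cokernel of \<open>f \<otimes> id\<close> factors through
  \<open>g \<otimes> id\<close>, because a tensor over \<open>P\<close> can be lifted to
  \<open>N\<close> up to the image of \<open>f\<close>. Whatever \<open>g \<otimes> id\<close> kills
  is therefore 0 in the cokernel.\<close>

lemma tens_right_exact:
  assumes M: "Module.module R M" and N: "Module.module R N" and P: "Module.module R P"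
    and f: "linear_map R M N f" and g: "linear_map R N P g" and surj: "g ` carrier N = carrier P"
    and ex: "{x \<in> carrier N. g x = \<zero>\<^bsub>P\<^esub>} = f ` carrier M"
    and X: "X \<in> carrier (tens R N A n)" and z: "tens_map R P A n g X = \<zero>\<^bsub>tens R P A n\<^esub>"
  shows "X \<in> tens_map R N A n f ` carrier (tens R M A n)"
proof -
  let ?T = "tens R N A n" and ?K = "tens_map R N A n f ` carrier (tens R M A n)"
  note T = module_tens[OF N, of n]
  interpret T: Module.module R ?T by (rule T)
  interpret TM: Module.module R "tens R M A n" by (rule module_tens[OF M])
  interpret N: Module.module R N by (rule N)
  interpret P: Module.module R P by (rule P)
  note tf = tens_map_linear[OF M N f, of n]
  \<comment> \<open>The projection onto the cokernel of \<open>f \<otimes> id\<close>.\<close>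
  define q where "q = coset_rep ?T ?K"
  have K1: "?K \<subseteq> carrier ?T" using linear_mapD(2)[OF tf] by blast
  have K2: "\<zero>\<^bsub>?T\<^esub> \<in> ?K"
    by (rule image_eqI[where x = "\<zero>\<^bsub>tens R M A n\<^esub>"])
      (rule additive_map_zero[OF TM.abelian_group_axioms T.abelian_group_axioms linear_mapD(1)[OF tf], symmetric],
       rule TM.zero_closed)
  have K3: "x \<oplus>\<^bsub>?T\<^esub> y \<in> ?K" if x: "x \<in> ?K" and y: "y \<in> ?K" for x y
  proof -
    from x obtain X where X: "x = tens_map R N A n f X" "X \<in> carrier (tens R M A n)" by (rule imageE)
    from y obtain Y where Y: "y = tens_map R N A n f Y" "Y \<in> carrier (tens R M A n)" by (rule imageE)
    show ?thesis
      unfolding X(1) Y(1) linear_mapD(3)[OF tf X(2) Y(2), symmetric] by (rule imageI[OF TM.a_closed[OF X(2) Y(2)]])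
  qed
  have K4: "r \<odot>\<^bsub>?T\<^esub> x \<in> ?K" if r: "r \<in> carrier R" and x: "x \<in> ?K" for r x
  proof -
    from x obtain X where X: "x = tens_map R N A n f X" "X \<in> carrier (tens R M A n)" by (rule imageE)
    show ?thesis
      unfolding X(1) linear_mapD(4)[OF tf r X(2), symmetric] by (rule imageI[OF TM.smult_closed[OF r X(2)]])
  qed
  have Q: "is_quot R ?T ?K q"
    unfolding q_def by (rule is_quot_coset_rep[OF T K1 K2 K3 K4])
  let ?B = "quot_mod ?T q"
  note B = module_quot[OF T Q] and ql = linear_quot[OF T Q]
  interpret B: Module.module R ?B by (rule B)
  \<comment> \<open>A set-theoretic section of \<open>g\<close>, in general not linear. By
    \<open>key\<close> the projection \<open>q\<close> does not see the choice of preimage, and this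
    restores linearity.\<close>
  define s where "s = inv_into (carrier N) g"
  have s: "s p \<in> carrier N" "g (s p) = p" if "p \<in> carrier P" for p
    using that surj by (auto simp: s_def inv_into_into f_inv_into_f)
  have key: "q (pure_tens R N A x as) = q (pure_tens R N A y as)"
    if "x \<in> carrier N" "y \<in> carrier N" "g x = g y" "set as \<subseteq> carrier A" "length as = n" for x y as
  proof -
    have "g (x \<ominus>\<^bsub>N\<^esub> y) = \<zero>\<^bsub>P\<^esub>"
      using that additive_map_minus[OF N.abelian_group_axioms P.abelian_group_axioms linear_mapD(1)[OF g]] by (simp add: P.minus_self linear_mapD(2)[OF g])
    then have "x \<ominus>\<^bsub>N\<^esub> y \<in> f ` carrier M" using that ex by auto
    then obtain m where m: "m \<in> carrier M" "f m = x \<ominus>\<^bsub>N\<^esub> y" by auto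
    have "pure_tens R N A x as \<ominus>\<^bsub>?T\<^esub> pure_tens R N A y as = pure_tens R N A (x \<ominus>\<^bsub>N\<^esub> y) as"
    proof -
      have "additive_map N ?T (\<lambda>x. pure_tens R N A x as)"
        using that by (simp add: additive_map_def pure_tens_closed[OF N] pure_tens_add[OF N, where n=n])
      from additive_map_minus[OF N.abelian_group_axioms T.abelian_group_axioms this that(1,2)] show ?thesis by simp
    qed
    also have "\<dots> = tens_map R N A n f (pure_tens R M A m as)"
      using m that by (simp add: tens_map_pure[OF M N f])
    also have "\<dots> \<in> ?K" using m that by (auto intro: pure_tens_closed[OF M])
    finally show ?thesis using that by (intro quot_eqI[OF T Q]) (auto intro: pure_tens_closed[OF N])
  qed
  have bal: "balanced R P A n ?B (\<lambda>p as. q (pure_tens R N A (s p) as))"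
  proof (rule balancedI)
    fix p as assume "p \<in> carrier P" "set as \<subseteq> carrier A" "length as = n"
    then show "q (pure_tens R N A (s p) as) \<in> carrier ?B"
      using s by (intro linear_mapD(2)[OF ql] pure_tens_closed[OF N]) auto
  next
    fix p p' as assume *: "p \<in> carrier P" "p' \<in> carrier P" "set as \<subseteq> carrier A" "length as = n"
    then have "q (pure_tens R N A (s (p \<oplus>\<^bsub>P\<^esub> p')) as) = q (pure_tens R N A (s p \<oplus>\<^bsub>N\<^esub> s p') as)"
      by (intro key) (auto simp: s linear_mapD(3)[OF g])
    then show "q (pure_tens R N A (s (p \<oplus>\<^bsub>P\<^esub> p')) as) = q (pure_tens R N A (s p) as) \<oplus>\<^bsub>?B\<^esub> q (pure_tens R N A (s p') as)"
      using * by (simp add: pure_tens_add[OF N, where n=n] s linear_mapD(3)[OF ql] pure_tens_closed[OF N])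
  next
    fix p xs ys a b
    assume *: "p \<in> carrier P" "a \<in> carrier A" "b \<in> carrier A" "set xs \<subseteq> carrier A" "set ys \<subseteq> carrier A"
      "length xs + Suc (length ys) = n"
    then show "q (pure_tens R N A (s p) (xs @ (a \<oplus>\<^bsub>A\<^esub> b) # ys)) =
       q (pure_tens R N A (s p) (xs @ a # ys)) \<oplus>\<^bsub>?B\<^esub> q (pure_tens R N A (s p) (xs @ b # ys))"
      by (simp add: pure_tens_add_slot[OF N, where n=n] s linear_mapD(3)[OF ql] pure_tens_closed[OF N])
  next
    fix p xs ys a r
    assume *: "p \<in> carrier P" "a \<in> carrier A" "r \<in> carrier R" "set xs \<subseteq> carrier A" "set ys \<subseteq> carrier A"
      "length xs + Suc (length ys) = n"
    then have "q (pure_tens R N A (s (r \<odot>\<^bsub>P\<^esub> p)) (xs @ a # ys)) = q (pure_tens R N A (r \<odot>\<^bsub>N\<^esub> s p) (xs @ a # ys))"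
      by (intro key) (auto simp: s linear_mapD(4)[OF g])
    then show "q (pure_tens R N A (s (r \<odot>\<^bsub>P\<^esub> p)) (xs @ a # ys)) = q (pure_tens R N A (s p) (xs @ (r \<odot>\<^bsub>A\<^esub> a) # ys))"
      using * by (simp add: pure_tens_smult_slot[OF N, where n=n] s)
  qed
  let ?\<theta> = "tens_ext ?B (\<lambda>(p, as). q (pure_tens R N A (s p) as))"
  note \<theta> = tens_ext_additive[OF P B.abelian_group_axioms bal] and \<theta>p = tens_ext_pure[OF P B.abelian_group_axioms bal]
  \<comment> \<open>Lifting after projecting changes a tensor only within the image of
    \<open>f \<otimes> id\<close>.\<close>
  have "?\<theta> (tens_map R P A n g X) = q X"
  proof (rule tens_eqI[OF N B.abelian_group_axioms additive_map_comp[OF tens_map_additive[OF N P g] \<theta>] linear_mapD(1)[OF ql] _ X])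
    fix m as assume *: "m \<in> carrier N" "set as \<subseteq> carrier A" "length as = n"
    then have "q (pure_tens R N A (s (g m)) as) = q (pure_tens R N A m as)"
      using s linear_mapD(2)[OF g] by (intro key) auto
    then show "?\<theta> (tens_map R P A n g (pure_tens R N A m as)) = q (pure_tens R N A m as)"
      using * by (simp add: tens_map_pure[OF N P g] \<theta>p linear_mapD(2)[OF g])
  qed
  moreover have "?\<theta> (tens_map R P A n g X) = q \<zero>\<^bsub>?T\<^esub>"
    unfolding z using additive_map_zero[OF tens_group[OF P] B.abelian_group_axioms \<theta>] by (simp add: quot_mod_simps)
  ultimately have "q X = q \<zero>\<^bsub>?T\<^esub>" by simp
  then have "X \<ominus>\<^bsub>?T\<^esub> \<zero>\<^bsub>?T\<^esub> \<in> ?K" using Q X by (auto simp: is_quot_def)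
  then show ?thesis using X by (simp add: T.minus_zero_right)
qed

lemma incl_quot_linear:
  assumes M: "Module.module R M" and N: "Module.module R N" and f: "linear_map R M N f"
  shows "linear_map R (quot_mod M f) N (\<lambda>x. x)"
proof -
  note Q = is_quot_linear[OF M N f]
  interpret M: Module.module R M by (rule M)
  show ?thesis
    by (auto simp: linear_map_def quot_mod_simps quot_add[OF M Q] quot_smult[OF M Q] linear_mapD[OF f])
qed

text \<open>\<open>g\<close> is factored through its image: onto the image right exactness applies,
  and by flatness the inclusion of the image stays injective after tensoring.\<close>

lemma tens_exact:
  fixes N :: "('u, 'u, 'x) module_scheme" and P :: "('u, 'u, 'y) module_scheme"
  assumes M: "Module.module R M" and N: "Module.module R N" and P: "Module.module R P"
    and f: "linear_map R M N f" and g: "linear_map R N P g"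
    and ex: "{x \<in> carrier N. g x = \<zero>\<^bsub>P\<^esub>} = f ` carrier M"
    and X: "X \<in> carrier (tens R N A n)" and z: "tens_map R P A n g X = \<zero>\<^bsub>tens R P A n\<^esub>"
  shows "X \<in> tens_map R N A n f ` carrier (tens R M A n)"
proof -
  note Q = is_quot_linear[OF N P g]
  let ?P = "quot_mod N g"
  note mP = module_quot[OF N Q] and gP = linear_quot[OF N Q] and inc = incl_quot_linear[OF N P g]
  have zero: "\<zero>\<^bsub>?P\<^esub> = \<zero>\<^bsub>P\<^esub>"
    using additive_map_zero[OF module.axioms(2)[OF N] module.axioms(2)[OF P] linear_mapD(1)[OF g]] by (simp add: quot_mod_simps)
  have inj: "inj_on (tens_map R P A n (\<lambda>x. x)) (carrier (tens R ?P A n))"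
    by (rule flat_inj[OF mP P inc]) simp
  have "tens_map R P A n (\<lambda>x. x) (tens_map R ?P A n g X) = tens_map R P A n (\<lambda>x. x) \<zero>\<^bsub>tens R ?P A n\<^esub>"
    using z tens_map_comp[OF N mP P gP inc X] additive_map_zero[OF tens_group[OF mP] tens_group[OF P] tens_map_additive[OF mP P inc]] by simp
  then have "tens_map R ?P A n g X = \<zero>\<^bsub>tens R ?P A n\<^esub>"
    using inj additive_map_closed[OF tens_map_additive[OF N mP gP] X] abelian_monoid.zero_closed[OF abelian_group.axioms(1)[OF tens_group[OF mP]]]
    by (auto simp: inj_on_def)
  then show ?thesis
    using ex by (intro tens_right_exact[OF M N mP f gP _ _ X]) (auto simp: quot_mod_simps zero[unfolded quot_mod_simps])
qed

end

section \<open>Enriched injectives\<close>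

lemma linear_map_cong:
  assumes M: "Module.module R M" and f: "linear_map R M N f" and eq: "\<And>x. x \<in> carrier M \<Longrightarrow> g x = f x"
  shows "linear_map R M N g"
proof -
  interpret M: Module.module R M by (rule M)
  show ?thesis using f by (simp add: linear_map_def eq Pi_iff)
qed

lemma linear_map_minus:
  assumes "Module.module R M" "Module.module R N" "linear_map R M N f" "x \<in> carrier M" "y \<in> carrier M"
  shows "f (x \<ominus>\<^bsub>M\<^esub> y) = f x \<ominus>\<^bsub>N\<^esub> f y"
  by (rule additive_map_minus[OF module.axioms(2)[OF assms(1)] module.axioms(2)[OF assms(2)] linear_mapD(1)[OF assms(3)] assms(4,5)])

lemma linear_map_zero:
  assumes "Module.module R M" "Module.module R N" "linear_map R M N f"
  shows "f \<zero>\<^bsub>M\<^esub> = \<zero>\<^bsub>N\<^esub>"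
  by (rule additive_map_zero[OF module.axioms(2)[OF assms(1)] module.axioms(2)[OF assms(2)] linear_mapD(1)[OF assms(3)]])

lemma ehom_iff:
  "\<phi> \<in> carrier (comod_ehom R A F F') \<longleftrightarrow>
     (\<forall>i. \<phi> i \<in> extensional (carrier F)) \<and> (\<forall>i. linear_map R F F' (\<phi> i)) \<and>
     (\<forall>i. \<forall>x\<in>carrier F. \<phi> (Suc i) (dsigma F x) = dsigma F' (\<phi> i x)) \<and>
     (\<forall>i. \<forall>x\<in>carrier F. coact F' (\<phi> i x) = tens_map R F' A 1 (\<phi> i) (coact F x))"
  by (auto simp: comod_ehom_def internal_hom_def linear_maps_def)

lemma comod_hom_iff:
  "f \<in> comod_hom R A F F' \<longleftrightarrow> f \<in> extensional (carrier F) \<and> linear_map R F F' f \<and>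
     (\<forall>x\<in>carrier F. f (dsigma F x) = dsigma F' (f x)) \<and>
     (\<forall>x\<in>carrier F. coact F' (f x) = tens_map R F' A 1 f (coact F x))"
  by (auto simp: comod_hom_def dmod_map_def)

lemma comod_hom_ehom: "f \<in> comod_hom R A F F' \<Longrightarrow> (\<lambda>_. f) \<in> carrier (comod_ehom R A F F')"
  by (auto simp: ehom_iff comod_hom_iff)

context hopf_base
begin

lemma difference_comoduleD:
  assumes "difference_comodule R A F"
  shows "Module.module R F" "semilinear R (rsigma R) F F (dsigma F)" "comod F (coact F)"
    "linear_map R F (tens R F A 1) (coact F)"
    "x \<in> carrier F \<Longrightarrow> coact F x \<in> carrier (tens R F A 1)"
    "x \<in> carrier F \<Longrightarrow> dsigma F x \<in> carrier F"
  using assms linear_mapD(2)[of R F "tens R F A 1" "coact F" x]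
  by (auto simp: difference_comodule_iff comod_def semilinear_def additive_map_def)

lemma comod_quot_map:
  fixes M :: "('r, 'a, 'm, 'x) dcomod_scheme" and q :: "'m \<Rightarrow> 'p"
  assumes "difference_comodule R A M" "is_quot R M K q" "\<And>x. x \<in> K \<Longrightarrow> dsigma M x \<in> K"
    "\<And>x. x \<in> K \<Longrightarrow> tens_map R (quot_mod M q) A 1 q (coact M x) = \<zero>\<^bsub>tens R (quot_mod M q) A 1\<^esub>"
  shows "restrict q (carrier M) \<in> comod_hom R A M (quot_comod R A M q)"
proof -
  let ?C = "quot_comod R A M q"
  have c: "difference_comodule R A ?C" "dmod_map R M ?C q"
    "\<And>x. x \<in> carrier M \<Longrightarrow> coact ?C (q x) = tens_map R ?C A 1 q (coact M x)"
    using comod_quot[OF assms] by blast+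
  note M = difference_comoduleD[OF assms(1)] and C = difference_comoduleD[OF c(1)]
  have q: "linear_map R M ?C q" using c(2) by (simp add: dmod_map_def)
  have r: "linear_map R M ?C (restrict q (carrier M))"
    by (rule linear_map_cong[OF M(1) q]) simp
  have "tens_map R ?C A 1 (restrict q (carrier M)) (coact M x) = tens_map R ?C A 1 q (coact M x)" if "x \<in> carrier M" for x
    by (rule tens_map_cong[OF M(1) C(1) r q _ M(5)[OF that]]) simp
  then show ?thesis
    using c(2,3) r M(6) by (simp add: comod_hom_iff dmod_map_def)
qed

end

section \<open>Extension of enriched morphisms and acyclicity\<close>

context flat_hopf
begin

text \<open>Injectivity speaks of short exact sequences within the universe. The image and the
  cokernel of \<open>f\<close> provide such a sequence on subsets of the carrier of
  \<open>N\<close>; \<chi> descends to the image because it kills the kernel, and surjectivity of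
  restriction extends it to \<open>N\<close>.\<close>

lemma enriched_extension:
  fixes M N I :: "('u, 'u, 'u) dcomod"
  assumes I: "enriched_injective R A I" and M: "difference_comodule R A M" and N: "difference_comodule R A N"
    and f: "f \<in> comod_hom R A M N" and \<chi>: "\<chi> \<in> carrier (comod_ehom R A M I)"
    and ker: "\<And>x i. x \<in> carrier M \<Longrightarrow> f x = \<zero>\<^bsub>N\<^esub> \<Longrightarrow> \<chi> i x = \<zero>\<^bsub>I\<^esub>"
  shows "\<exists>\<psi>\<in>carrier (comod_ehom R A N I). \<forall>x\<in>carrier M. \<forall>i. \<psi> i (f x) = \<chi> i x"
proof -
  have I': "difference_comodule R A I" using I by (simp add: enriched_injective_def)
  note Md = difference_comoduleD[OF M] and Nd = difference_comoduleD[OF N] and Id = difference_comoduleD[OF I']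
  interpret M: Module.module R M by (rule Md(1))
  interpret N: Module.module R N by (rule Nd(1))
  have fl: "linear_map R M N f" and f\<sigma>: "\<And>x. x \<in> carrier M \<Longrightarrow> f (dsigma M x) = dsigma N (f x)"
    and fc: "\<And>x. x \<in> carrier M \<Longrightarrow> coact N (f x) = tens_map R N A 1 f (coact M x)"
    using f by (auto simp: comod_hom_iff)
  have \<sigma>0: "dsigma N \<zero>\<^bsub>N\<^esub> = \<zero>\<^bsub>N\<^esub>"
    using additive_map_zero[OF N.abelian_group_axioms N.abelian_group_axioms semilinearD(1)[OF Nd(2)]] .
  note f0 = linear_map_zero[OF Md(1) Nd(1) fl]

  let ?K = "{x \<in> carrier M. f x = \<zero>\<^bsub>N\<^esub>}"
  note Qf = is_quot_linear[OF Md(1) Nd(1) fl]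
  let ?P0 = "quot_mod M f"
  note P0 = module_quot[OF Md(1) Qf] and fP0 = linear_quot[OF Md(1) Qf] and inc0 = incl_quot_linear[OF Md(1) Nd(1) fl]
  have ks: "\<And>x. x \<in> ?K \<Longrightarrow> dsigma M x \<in> ?K" using f\<sigma> \<sigma>0 Md(6) by auto
  \<comment> \<open>By flatness the tensored image embeds into \<open>N \<otimes> A\<close>, so
    vanishing can be tested there, where the coaction of \<open>f x = 0\<close> is 0.\<close>
  have kc: "tens_map R ?P0 A 1 f (coact M x) = \<zero>\<^bsub>tens R ?P0 A 1\<^esub>" if x: "x \<in> ?K" for x
  proof -
    have xM: "x \<in> carrier M" and fx: "f x = \<zero>\<^bsub>N\<^esub>" using x by auto
    have "inj_on (tens_map R N A 1 (\<lambda>x. x)) (carrier (tens R ?P0 A 1))"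
      by (rule flat_inj_1[OF P0 Nd(1) inc0]) simp
    moreover have "tens_map R N A 1 (\<lambda>x. x) (tens_map R ?P0 A 1 f (coact M x)) = tens_map R N A 1 (\<lambda>x. x) \<zero>\<^bsub>tens R ?P0 A 1\<^esub>"
      using tens_map_comp[OF Md(1) P0 Nd(1) fP0 inc0 Md(5)[OF xM]] fc[OF xM] fx linear_map_zero[OF Nd(1) module_tens[OF Nd(1)] Nd(4)]
        additive_map_zero[OF tens_group[OF P0] tens_group[OF Nd(1)] tens_map_additive[OF P0 Nd(1) inc0]] by simp
    ultimately show ?thesis
      by (rule inj_onD) (rule additive_map_closed[OF tens_map_additive[OF Md(1) P0 fP0] Md(5)[OF xM]],
          rule abelian_monoid.zero_closed[OF abelian_group.axioms(1)[OF tens_group[OF P0]]])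
  qed
  define P where "P = quot_comod R A M f"
  have Pc: "difference_comodule R A P" "dmod_map R M P f"
    "\<And>x. x \<in> carrier M \<Longrightarrow> coact P (f x) = tens_map R P A 1 f (coact M x)"
    using comod_quot[OF M Qf ks kc, folded P_def] by blast+
  note Pd = difference_comoduleD[OF Pc(1)]
  have Pcar: "carrier P = f ` carrier M" by (simp add: P_def quot_comod_simps)
  have fP: "linear_map R M P f" and fP\<sigma>: "\<And>x. x \<in> carrier M \<Longrightarrow> f (dsigma M x) = dsigma P (f x)"
    using Pc(2) by (auto simp: dmod_map_def)
  have inc: "linear_map R P N (\<lambda>x. x)"
    using inc0 by (simp add: linear_map_def P_def quot_comod_simps quot_mod_simps)
  \<comment> \<open>The inclusion of the image, cut down to an extensional function since morphisms
    are elements of hom sets.\<close>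
  define u where "u = (\<lambda>x\<in>carrier P. x)"
  have ul: "linear_map R P N u" by (rule linear_map_cong[OF Pd(1) inc]) (simp add: u_def)
  have u: "u \<in> comod_hom R A P N"
    unfolding comod_hom_iff
  proof (intro conjI ballI ul)
    fix y assume y: "y \<in> carrier P"
    then obtain x where x: "x \<in> carrier M" "y = f x" by (auto simp: Pcar)
    show "u (dsigma P y) = dsigma N (u y)"
      using x y Md(6)[OF x(1)] by (simp add: u_def Pcar fP\<sigma>[symmetric] f\<sigma>[symmetric])
    have "coact N (u y) = tens_map R N A 1 f (coact M x)" using x y fc by (simp add: u_def)
    also have "\<dots> = tens_map R N A 1 (\<lambda>x. u (f x)) (coact M x)"
      by (rule tens_map_cong[OF Md(1) Nd(1) fl linear_map_comp[OF fP ul] _ Md(5)[OF x(1)]]) (simp add: u_def Pcar)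
    also have "\<dots> = tens_map R N A 1 u (tens_map R P A 1 f (coact M x))"
      using tens_map_comp[OF Md(1) Pd(1) Nd(1) fP ul Md(5)[OF x(1)]] by simp
    finally show "coact N (u y) = tens_map R N A 1 u (coact P y)" using Pc(3) x by simp
  qed (simp add: u_def)

  let ?L = "f ` carrier M"
  \<comment> \<open>The cokernel of \<open>f\<close>, realized on coset representatives inside the
    carrier of \<open>N\<close>.\<close>
  define q where "q = coset_rep N ?L"
  have L1: "?L \<subseteq> carrier N" using linear_mapD(2)[OF fl] by blast
  have L2: "\<zero>\<^bsub>N\<^esub> \<in> ?L" unfolding f0[symmetric] by (rule imageI[OF M.zero_closed])
  have L3: "x \<oplus>\<^bsub>N\<^esub> y \<in> ?L" if x: "x \<in> ?L" and y: "y \<in> ?L" for x y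
  proof -
    from x obtain X where X: "x = f X" "X \<in> carrier M" by (rule imageE)
    from y obtain Y where Y: "y = f Y" "Y \<in> carrier M" by (rule imageE)
    show ?thesis unfolding X(1) Y(1) linear_mapD(3)[OF fl X(2) Y(2), symmetric] by (rule imageI[OF M.a_closed[OF X(2) Y(2)]])
  qed
  have L4: "r \<odot>\<^bsub>N\<^esub> x \<in> ?L" if r: "r \<in> carrier R" and x: "x \<in> ?L" for r x
  proof -
    from x obtain X where X: "x = f X" "X \<in> carrier M" by (rule imageE)
    show ?thesis unfolding X(1) linear_mapD(4)[OF fl r X(2), symmetric] by (rule imageI[OF M.smult_closed[OF r X(2)]])
  qed
  have Qq: "is_quot R N ?L q" unfolding q_def by (rule is_quot_coset_rep[OF Nd(1) L1 L2 L3 L4])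
  let ?Q0 = "quot_mod N q"
  note Q0 = module_quot[OF Nd(1) Qq] and qQ0 = linear_quot[OF Nd(1) Qq]
  have qf: "q (f x) = \<zero>\<^bsub>?Q0\<^esub>" if x: "x \<in> carrier M" for x
    unfolding quot_mod_simps
    using linear_mapD(2)[OF fl x] x by (intro quot_eqI[OF Nd(1) Qq]) (auto simp: N.minus_zero_right)
  have ls: "\<And>x. x \<in> ?L \<Longrightarrow> dsigma N x \<in> ?L" using f\<sigma> Md(6) by (auto simp flip: f\<sigma>)
  have lc: "tens_map R ?Q0 A 1 q (coact N x) = \<zero>\<^bsub>tens R ?Q0 A 1\<^esub>" if x: "x \<in> ?L" for x
  proof -
    from x obtain y where y: "x = f y" "y \<in> carrier M" by (rule imageE)
    have "tens_map R ?Q0 A 1 q (coact N x) = tens_map R ?Q0 A 1 (\<lambda>x. q (f x)) (coact M y)"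
      using tens_map_comp[OF Md(1) Nd(1) Q0 fl qQ0 Md(5)[OF y(2)]] fc y by simp
    also have "\<dots> = \<zero>\<^bsub>tens R ?Q0 A 1\<^esub>"
      by (rule tens_map_zero[OF Md(1) Q0 Md(5)[OF y(2)] linear_map_comp[OF fl qQ0] qf])
    finally show ?thesis .
  qed
  define Q where "Q = quot_comod R A N q"
  have Qc: "difference_comodule R A Q" "dmod_map R N Q q"
    "\<And>x. x \<in> carrier N \<Longrightarrow> coact Q (q x) = tens_map R Q A 1 q (coact N x)"
    using comod_quot[OF N Qq ls lc, folded Q_def] by blast+
  have v: "restrict q (carrier N) \<in> comod_hom R A N Q"
    using comod_quot_map[OF N Qq ls lc, folded Q_def] by blast
  define w where "w = restrict q (carrier N)"
  have Qcar: "carrier Q = q ` carrier N" "\<zero>\<^bsub>Q\<^esub> = q \<zero>\<^bsub>N\<^esub>" by (simp_all add: Q_def quot_comod_simps)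
  have "comod_ses R A P u N w Q"
    unfolding comod_ses_def short_exact_def
  proof (intro conjI Pc(1) N Qc(1) u v[folded w_def])
    show "inj_on u (carrier P)" by (simp add: u_def inj_on_def)
    have "q y = q \<zero>\<^bsub>N\<^esub> \<longleftrightarrow> y \<in> ?L" if "y \<in> carrier N" for y
      using Qq that by (simp add: is_quot_def N.minus_zero_right)
    then have "{y \<in> carrier N. w y = \<zero>\<^bsub>Q\<^esub>} = ?L" using L1 by (auto simp: w_def Qcar)
    moreover have "u ` carrier P = ?L" by (simp add: u_def Pcar)
    ultimately show "u ` carrier P = {y \<in> carrier N. w y = \<zero>\<^bsub>Q\<^esub>}" by simp
    show "w ` carrier N = carrier Q" by (simp add: w_def Qcar)
  qed
  then have surj: "(\<lambda>\<phi> i. compose (carrier P) (\<phi> i) u) ` carrier (comod_ehom R A N I) = carrier (comod_ehom R A P I)"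
    using I unfolding enriched_injective_def short_exact_def by blast

  have \<chi>l: "linear_map R M I (\<chi> i)" and \<chi>\<sigma>: "\<And>x. x \<in> carrier M \<Longrightarrow> \<chi> (Suc i) (dsigma M x) = dsigma I (\<chi> i x)"
    and \<chi>c: "\<And>x. x \<in> carrier M \<Longrightarrow> coact I (\<chi> i x) = tens_map R I A 1 (\<chi> i) (coact M x)" for i
    using \<chi> by (auto simp: ehom_iff)
  \<comment> \<open>\<chi> on the image of \<open>f\<close>; independent of the preimage because
    every entry of \<chi> vanishes on the kernel of \<open>f\<close>.\<close>
  define \<xi> where "\<xi> = (\<lambda>i. \<lambda>p\<in>carrier P. \<chi> i (inv_into (carrier M) f p))"
  have \<xi>f: "\<xi> i (f x) = \<chi> i x" if x: "x \<in> carrier M" for i x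
  proof -
    let ?y = "inv_into (carrier M) f (f x)"
    have y: "?y \<in> carrier M" "f ?y = f x" using x by (auto intro: inv_into_into f_inv_into_f)
    interpret I: Module.module R I by (rule Id(1))
    have "f (?y \<ominus>\<^bsub>M\<^esub> x) = \<zero>\<^bsub>N\<^esub>"
      using x y by (simp add: linear_map_minus[OF Md(1) Nd(1) fl] N.minus_self linear_mapD(2)[OF fl])
    then have "\<chi> i (?y \<ominus>\<^bsub>M\<^esub> x) = \<zero>\<^bsub>I\<^esub>" using x y by (intro ker) auto
    then have "\<chi> i ?y = \<chi> i x"
      using x y by (intro I.minus_eq_zeroD[OF _ linear_mapD(2)[OF \<chi>l] linear_mapD(2)[OF \<chi>l]])
        (simp_all add: linear_map_minus[OF Md(1) Id(1) \<chi>l])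
    then show ?thesis using x by (simp add: \<xi>_def Pcar)
  qed
  have \<xi>l: "linear_map R P I (\<xi> i)" for i
  proof -
    have "\<xi> i (f x \<oplus>\<^bsub>P\<^esub> f y) = \<xi> i (f x) \<oplus>\<^bsub>I\<^esub> \<xi> i (f y)" if "x \<in> carrier M" "y \<in> carrier M" for x y
      using that by (simp add: linear_mapD(3)[OF fP, symmetric] \<xi>f linear_mapD(3)[OF \<chi>l])
    moreover have "\<xi> i (r \<odot>\<^bsub>P\<^esub> f x) = r \<odot>\<^bsub>I\<^esub> \<xi> i (f x)" if "x \<in> carrier M" "r \<in> carrier R" for x r
      using that by (simp add: linear_mapD(4)[OF fP, symmetric] \<xi>f linear_mapD(4)[OF \<chi>l])
    moreover have "\<xi> i (f x) \<in> carrier I" if "x \<in> carrier M" for x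
      using that by (simp add: \<xi>f linear_mapD(2)[OF \<chi>l])
    ultimately show ?thesis by (auto simp: linear_map_def Pcar)
  qed
  have "\<xi> \<in> carrier (comod_ehom R A P I)"
    unfolding ehom_iff
  proof (intro conjI allI ballI \<xi>l)
    show "\<xi> i \<in> extensional (carrier P)" for i by (simp add: \<xi>_def)
    fix i p assume "p \<in> carrier P"
    then obtain x where x: "x \<in> carrier M" "p = f x" by (auto simp: Pcar)
    show "\<xi> (Suc i) (dsigma P p) = dsigma I (\<xi> i p)"
      using x Md(6) by (simp add: fP\<sigma>[symmetric] \<xi>f \<chi>\<sigma>)
    have "coact I (\<xi> i p) = tens_map R I A 1 (\<chi> i) (coact M x)" using x by (simp add: \<xi>f \<chi>c)
    also have "\<dots> = tens_map R I A 1 (\<lambda>x. \<xi> i (f x)) (coact M x)"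
      by (rule tens_map_cong[OF Md(1) Id(1) \<chi>l linear_map_comp[OF fP \<xi>l] _ Md(5)[OF x(1)]]) (simp add: \<xi>f)
    also have "\<dots> = tens_map R I A 1 (\<xi> i) (tens_map R P A 1 f (coact M x))"
      using tens_map_comp[OF Md(1) Pd(1) Id(1) fP \<xi>l Md(5)[OF x(1)]] by simp
    finally show "coact I (\<xi> i p) = tens_map R I A 1 (\<xi> i) (coact P p)" using x Pc(3) by simp
  qed
  \<comment> \<open>Exactness of the enriched hom functor extends all entries at once, compatibly
    with \<sigma>.\<close>
  then obtain \<psi> where \<psi>: "\<psi> \<in> carrier (comod_ehom R A N I)" "\<xi> = (\<lambda>i. compose (carrier P) (\<psi> i) u)"
    unfolding surj[symmetric] by (rule imageE)
  have "\<psi> i (f x) = \<chi> i x" if x: "x \<in> carrier M" for i x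
    using \<xi>f[OF x, of i] x unfolding \<psi>(2) by (simp add: compose_def u_def Pcar)
  then show ?thesis using \<psi>(1) by blast
qed

text \<open>Extending the identity of \<open>I\<close> along its coaction yields the retraction
  required by the contracting homotopy.\<close>

lemma injective_acyclic:
  fixes I :: "('u, 'u, 'u) dcomod"
  assumes I: "enriched_injective R A I" and X: "X \<in> carrier (tens R I A (Suc n))"
    and z: "hdiff I (coact I) (Suc n) X = \<zero>\<^bsub>tens R I A (Suc (Suc n))\<^esub>"
  shows "\<exists>Y\<in>carrier (tens R I A n). hdiff I (coact I) n Y = X"
proof -
  have I': "difference_comodule R A I" using I by (simp add: enriched_injective_def)
  note Id = difference_comoduleD[OF I']
  let ?C = "cofree R A I"
  note C = difference_comodule_cofree[OF Id(1,2)]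
  note Cd = difference_comoduleD[OF C]
  interpret I: Module.module R I by (rule Id(1))
  interpret C: Module.module R ?C by (rule Cd(1))
  \<comment> \<open>The cofree comodule has carrier in the tensor type, so the coaction is composed
    with an isomorphism onto a copy in the universe before injectivity is invoked.\<close>
  obtain j :: "('u, 'u) tens \<Rightarrow> 'u" where "inj_on j (carrier (tens R I A 1))" using ex_inj_tens by blast
  then have j: "inj_on j (carrier ?C)" by (simp add: cofree_simps)
  note Q = is_quot_inj[OF Cd(1) j]
  note P0 = module_quot[OF Cd(1) Q] and jP0 = linear_quot[OF Cd(1) Q]
  have ks: "\<And>x. x \<in> {\<zero>\<^bsub>?C\<^esub>} \<Longrightarrow> dsigma ?C x \<in> {\<zero>\<^bsub>?C\<^esub>}"
    using additive_map_zero[OF C.abelian_group_axioms C.abelian_group_axioms semilinearD(1)[OF Cd(2)]] by simp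
  have kc: "\<And>x. x \<in> {\<zero>\<^bsub>?C\<^esub>} \<Longrightarrow> tens_map R (quot_mod ?C j) A 1 j (coact ?C x) = \<zero>\<^bsub>tens R (quot_mod ?C j) A 1\<^esub>"
    using linear_map_zero[OF Cd(1) module_tens[OF Cd(1)] Cd(4)]
      additive_map_zero[OF tens_group[OF Cd(1)] tens_group[OF P0] tens_map_additive[OF Cd(1) P0 jP0]] by simp
  define J where "J = quot_comod R A ?C j"
  have Jc: "difference_comodule R A J" "dmod_map R ?C J j"
    "\<And>x. x \<in> carrier ?C \<Longrightarrow> coact J (j x) = tens_map R J A 1 j (coact ?C x)"
    using comod_quot[OF C Q ks kc, folded J_def] by blast+
  note Jd = difference_comoduleD[OF Jc(1)]
  have jl: "linear_map R ?C J j" and j\<sigma>: "\<And>x. x \<in> carrier ?C \<Longrightarrow> j (dsigma ?C x) = dsigma J (j x)"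
    using Jc(2) by (auto simp: dmod_map_def)
  have J0: "\<zero>\<^bsub>J\<^esub> = j \<zero>\<^bsub>?C\<^esub>" by (simp add: J_def quot_comod_simps)
  let ?\<mu> = "coact I"
  have \<mu>l: "linear_map R I ?C ?\<mu>" using Id(4) by (simp add: linear_map_def cofree_simps)
  have \<mu>\<sigma>: "?\<mu> (dsigma I x) = dsigma ?C (?\<mu> x)" if "x \<in> carrier I" for x
    using I' that by (simp add: difference_comodule_iff cofree_simps)
  have \<mu>c: "coact ?C (?\<mu> x) = tens_map R ?C A 1 ?\<mu> (?\<mu> x)" if "x \<in> carrier I" for x
    using coact_cofree_coact[OF Id(1,3) that] by (simp add: tens_map_def tens_cofree)
  have j\<mu>: "linear_map R I J (\<lambda>x. j (?\<mu> x))" by (rule linear_map_comp[OF \<mu>l jl])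
  define f where "f = (\<lambda>x\<in>carrier I. j (?\<mu> x))"
  have fl: "linear_map R I J f" by (rule linear_map_cong[OF Id(1) j\<mu>]) (simp add: f_def)
  have f: "f \<in> comod_hom R A I J"
    unfolding comod_hom_iff
  proof (intro conjI ballI fl)
    fix x assume x: "x \<in> carrier I"
    note \<mu>x = linear_mapD(2)[OF \<mu>l x]
    show "f (dsigma I x) = dsigma J (f x)" using x Id(6) \<mu>x by (simp add: f_def \<mu>\<sigma> j\<sigma>)
    have "coact J (f x) = tens_map R J A 1 j (tens_map R ?C A 1 ?\<mu> (?\<mu> x))" using x \<mu>x by (simp add: f_def Jc(3) \<mu>c)
    also have "\<dots> = tens_map R J A 1 (\<lambda>x. j (?\<mu> x)) (?\<mu> x)"
      by (rule tens_map_comp[OF Id(1) Cd(1) Jd(1) \<mu>l jl Id(5)[OF x]])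
    also have "\<dots> = tens_map R J A 1 f (?\<mu> x)"
      by (rule tens_map_cong[OF Id(1) Jd(1) j\<mu> fl _ Id(5)[OF x]]) (simp add: f_def)
    finally show "coact J (f x) = tens_map R J A 1 f (coact I x)" .
  qed (simp add: f_def)
  \<comment> \<open>The identity of \<open>I\<close> as a constant sequence in the enriched hom
    object.\<close>
  define \<iota> where "\<iota> = (\<lambda>i::nat. \<lambda>x\<in>carrier I. x)"
  have \<iota>l: "linear_map R I I (\<iota> i)" for i by (rule linear_map_cong[OF Id(1) linear_map_id]) (simp add: \<iota>_def)
  have "tens_map R I A 1 (\<iota> i) (?\<mu> x) = ?\<mu> x" if "x \<in> carrier I" for i x
    by (rule tens_map_id[OF Id(1) Id(5)[OF that] \<iota>l]) (simp add: \<iota>_def)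
  then have \<iota>: "\<iota> \<in> carrier (comod_ehom R A I I)"
    using \<iota>l Id(6) by (simp add: ehom_iff) (simp add: \<iota>_def)
  \<comment> \<open>The coaction is injective because the counit recovers \<open>x\<close> from
    it.\<close>
  have ker: "\<iota> i x = \<zero>\<^bsub>I\<^esub>" if x: "x \<in> carrier I" and fx: "f x = \<zero>\<^bsub>J\<^esub>" for x i
  proof -
    have "?\<mu> x = \<zero>\<^bsub>?C\<^esub>" using fx x linear_mapD(2)[OF \<mu>l x] by (intro inj_onD[OF j]) (auto simp: f_def J0)
    then have "?\<mu> x = ?\<mu> \<zero>\<^bsub>I\<^esub>" using linear_map_zero[OF Id(1) Cd(1) \<mu>l] by simp
    then have "x = \<zero>\<^bsub>I\<^esub>" using comodD(4)[OF Id(3) x] comodD(4)[OF Id(3) I.zero_closed] by metis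
    then show ?thesis by (simp add: \<iota>_def)
  qed
  obtain \<psi> where \<psi>: "\<psi> \<in> carrier (comod_ehom R A J I)" "\<And>x i. x \<in> carrier I \<Longrightarrow> \<psi> i (f x) = \<iota> i x"
    using enriched_extension[OF I I' Jc(1) f \<iota> ker] by blast
  have \<psi>l: "linear_map R J I (\<psi> 0)" and \<psi>c: "\<And>x. x \<in> carrier J \<Longrightarrow> coact I (\<psi> 0 x) = tens_map R I A 1 (\<psi> 0) (coact J x)"
    using \<psi>(1) by (auto simp: ehom_iff)
  \<comment> \<open>Each single entry of \<psi> is linear and colinear; the homotopy is built from
    entry 0, which retracts the coaction since entry 0 of \<open>\<iota>\<close> is the
    identity.\<close>
  define r where "r = (\<lambda>X. \<psi> 0 (j X))"
  have rC: "linear_map R ?C I r" unfolding r_def by (rule linear_map_comp[OF jl \<psi>l])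
  then have rT: "linear_map R (tens R I A 1) I r" by (simp add: linear_map_def cofree_simps)
  have r\<mu>: "r (?\<mu> m) = m" if "m \<in> carrier I" for m
    using \<psi>(2)[OF that, of 0] that by (simp add: r_def f_def \<iota>_def)
  have \<mu>r: "?\<mu> (r Z) = con R I I A 1 r (comult_at R I A \<Delta> 1 0 Z)" if Z: "Z \<in> carrier (tens R I A 1)" for Z
  proof -
    have ZC: "Z \<in> carrier ?C" using Z by (simp add: cofree_simps)
    have "?\<mu> (r Z) = tens_map R I A 1 (\<psi> 0) (tens_map R J A 1 j (coact ?C Z))"
      using linear_mapD(2)[OF jl ZC] ZC by (simp add: r_def \<psi>c Jc(3))
    also have "\<dots> = tens_map R I A 1 r (coact ?C Z)"
      unfolding r_def by (rule tens_map_comp[OF Cd(1) Jd(1) Id(1) jl \<psi>l Cd(5)[OF ZC]])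
    also have "\<dots> = con R I I A 1 r (comult_at R I A \<Delta> 1 0 Z)"
      unfolding cofree_simps
      by (rule con_comult_natural[OF Id(1) Id(1) rT]) (rule additive_map_closed[OF comult_at_additive[OF Id(1) comult_linear] Z], simp)
    finally show ?thesis .
  qed
  show ?thesis by (rule hdiff_acyclic[OF Id(3) rT r\<mu> \<mu>r X z])
qed

end

section \<open>Double complexes with exact rows and columns\<close>

text \<open>Starting from \<open>y\<close> in position \<open>(p + 1, m + 1)\<close>, lift along \<open>d\<close> and apply \<open>\<delta>\<close>, repeatedly, until
  position \<open>(p + m + 1, 1)\<close> is reached.\<close>

primrec zig ::
    "(nat \<Rightarrow> nat \<Rightarrow> ('x, 'b) ring_scheme) \<Rightarrow> (nat \<Rightarrow> nat \<Rightarrow> 'x \<Rightarrow> 'x) \<Rightarrow> (nat \<Rightarrow> nat \<Rightarrow> 'x \<Rightarrow> 'x) \<Rightarrow>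
     nat \<Rightarrow> nat \<Rightarrow> 'x \<Rightarrow> 'x \<Rightarrow> bool" where
  "zig X d \<delta> 0 p y z \<longleftrightarrow> y = z"
| "zig X d \<delta> (Suc m) p y z \<longleftrightarrow>
     (\<exists>x\<in>carrier (X (Suc p) (Suc m)). d (Suc p) (Suc m) x = y \<and> zig X d \<delta> m (Suc p) (\<delta> (Suc p) (Suc m) x) z)"

text \<open>The lifts chosen along a zigzag are carried by \<open>h\<close> to lifts of the images,
  so the image of a zigzag is again a zigzag.\<close>

lemma zig_natural:
  assumes h: "\<And>p q x. x \<in> carrier (X (Suc p) (Suc q)) \<Longrightarrow> h (Suc p) (Suc q) x \<in> carrier (X' (Suc p) (Suc q))"
    and hd: "\<And>p q x. x \<in> carrier (X (Suc p) (Suc q)) \<Longrightarrow> h (Suc p) (Suc (Suc q)) (d (Suc p) (Suc q) x) = d' (Suc p) (Suc q) (h (Suc p) (Suc q) x)"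
    and h\<delta>: "\<And>p q x. x \<in> carrier (X (Suc p) (Suc q)) \<Longrightarrow> h (Suc (Suc p)) (Suc q) (\<delta> (Suc p) (Suc q) x) = \<delta>' (Suc p) (Suc q) (h (Suc p) (Suc q) x)"
    and z: "zig X d \<delta> m p y z"
  shows "zig X' d' \<delta>' m p (h (Suc p) (Suc m) y) (h (Suc (p + m)) (Suc 0) z)"
  using z
proof (induction m arbitrary: p y)
  case 0
  then show ?case by (simp del: One_nat_def[symmetric])
next
  case (Suc m)
  then obtain x where x: "x \<in> carrier (X (Suc p) (Suc m))" "d (Suc p) (Suc m) x = y"
    and zz: "zig X d \<delta> m (Suc p) (\<delta> (Suc p) (Suc m) x) z" by auto
  have "zig X' d' \<delta>' m (Suc p) (\<delta>' (Suc p) (Suc m) (h (Suc p) (Suc m) x)) (h (Suc (p + Suc m)) (Suc 0) z)"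
    using Suc.IH[OF zz] h\<delta>[OF x(1)] by simp
  then show ?case
    unfolding zig.simps by (intro bexI[OF _ h[OF x(1)]] conjI) (simp_all add: hd[OF x(1), symmetric] x(2))
qed

text \<open>The squares commute and do not anticommute, since no total complex is formed. Index 0 in
  either direction is the augmentation, and exactness is demanded only where both indices are
  positive.\<close>

locale bicomplex =
  fixes X :: "nat \<Rightarrow> nat \<Rightarrow> ('x, 'b) ring_scheme" and d \<delta> :: "nat \<Rightarrow> nat \<Rightarrow> 'x \<Rightarrow> 'x"
  assumes ab: "abelian_group (X p q)"
    and d: "additive_map (X p q) (X p (Suc q)) (d p q)"
    and \<delta>: "additive_map (X p q) (X (Suc p) q) (\<delta> p q)"
    and dd: "x \<in> carrier (X p q) \<Longrightarrow> d p (Suc q) (d p q x) = \<zero>\<^bsub>X p (Suc (Suc q))\<^esub>"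
    and \<delta>\<delta>: "x \<in> carrier (X p q) \<Longrightarrow> \<delta> (Suc p) q (\<delta> p q x) = \<zero>\<^bsub>X (Suc (Suc p)) q\<^esub>"
    and comm: "x \<in> carrier (X p q) \<Longrightarrow> \<delta> p (Suc q) (d p q x) = d (Suc p) q (\<delta> p q x)"
    and row: "y \<in> carrier (X (Suc p) (Suc q)) \<Longrightarrow> d (Suc p) (Suc q) y = \<zero>\<^bsub>X (Suc p) (Suc (Suc q))\<^esub> \<Longrightarrow>
       \<exists>x\<in>carrier (X (Suc p) q). d (Suc p) q x = y"
    and col: "y \<in> carrier (X (Suc p) (Suc q)) \<Longrightarrow> \<delta> (Suc p) (Suc q) y = \<zero>\<^bsub>X (Suc (Suc p)) (Suc q)\<^esub> \<Longrightarrow>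
       \<exists>x\<in>carrier (X p (Suc q)). \<delta> p (Suc q) x = y"
begin

text \<open>Cycles for both differentials. In the first interior row and column they correspond to
  the cocycles of the two edge complexes (\<open>bic_bottom\<close>,
  \<open>bic_left\<close>).\<close>

definition bic :: "nat \<Rightarrow> nat \<Rightarrow> 'x set" where
  "bic p q = {y \<in> carrier (X p q). d p q y = \<zero>\<^bsub>X p (Suc q)\<^esub> \<and> \<delta> p q y = \<zero>\<^bsub>X (Suc p) q\<^esub>}"

text \<open>These elements lie in position \<open>(p + 1, q + 1)\<close>. Exactness makes a zigzag step a bijection between
  the classes of bicycles modulo them; at both ends of the zigzag they are the coboundaries.\<close>

definition bd :: "nat \<Rightarrow> nat \<Rightarrow> 'x set" where
  "bd p q = (\<lambda>z. \<delta> p (Suc q) (d p q z)) ` carrier (X p q)"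

lemmas d_closed = additive_map_closed[OF d]
lemmas \<delta>_closed = additive_map_closed[OF \<delta>]
lemmas d_minus = additive_map_minus[OF ab ab d]
lemmas \<delta>_minus = additive_map_minus[OF ab ab \<delta>]

lemma minus_closed: "x \<in> carrier (X p q) \<Longrightarrow> y \<in> carrier (X p q) \<Longrightarrow> x \<ominus>\<^bsub>X p q\<^esub> y \<in> carrier (X p q)"
proof -
  interpret abelian_group "X p q" by (rule ab)
  show "x \<in> carrier (X p q) \<Longrightarrow> y \<in> carrier (X p q) \<Longrightarrow> x \<ominus>\<^bsub>X p q\<^esub> y \<in> carrier (X p q)" by simp
qed

lemma minus_self': "x \<in> carrier (X p q) \<Longrightarrow> x \<ominus>\<^bsub>X p q\<^esub> x = \<zero>\<^bsub>X p q\<^esub>"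
  by (rule abelian_group.minus_self[OF ab])

lemma step_bic_down:
  assumes x: "x \<in> carrier (X p q)" and y: "d p q x \<in> bic p (Suc q)"
  shows "\<delta> p q x \<in> bic (Suc p) q"
  using y comm[OF x] \<delta>\<delta>[OF x] \<delta>_closed[OF x] by (auto simp: bic_def)

lemma step_bic_up:
  assumes x: "x \<in> carrier (X p q)" and y: "\<delta> p q x \<in> bic (Suc p) q"
  shows "d p q x \<in> bic p (Suc q)"
  using y comm[OF x] dd[OF x] d_closed[OF x] by (auto simp: bic_def)

text \<open>If dx = \<delta>dz, then x - \<delta>z is a d-cycle, hence equals dw by exactness of the
  row, and \<delta>x = \<delta>dw. The converse exchanges the two directions and uses the
  column.\<close>

lemma step_bd:
  assumes x: "x \<in> carrier (X (Suc p) (Suc q))"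
  shows "d (Suc p) (Suc q) x \<in> bd p (Suc q) \<longleftrightarrow> \<delta> (Suc p) (Suc q) x \<in> bd (Suc p) q"
proof
  assume "d (Suc p) (Suc q) x \<in> bd p (Suc q)"
  then obtain z where z: "z \<in> carrier (X p (Suc q))" "d (Suc p) (Suc q) x = \<delta> p (Suc (Suc q)) (d p (Suc q) z)"
    by (auto simp: bd_def)
  note dz = \<delta>_closed[OF z(1)]
  have "d (Suc p) (Suc q) (x \<ominus>\<^bsub>X (Suc p) (Suc q)\<^esub> \<delta> p (Suc q) z) = \<zero>\<^bsub>X (Suc p) (Suc (Suc q))\<^esub>"
    using z(2) comm[OF z(1)] minus_self'[OF d_closed[OF x]] by (simp add: d_minus[OF x dz])
  then obtain w where w: "w \<in> carrier (X (Suc p) q)" "d (Suc p) q w = x \<ominus>\<^bsub>X (Suc p) (Suc q)\<^esub> \<delta> p (Suc q) z"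
    using row minus_closed[OF x dz] by blast
  have "\<delta> (Suc p) (Suc q) (d (Suc p) q w) = \<delta> (Suc p) (Suc q) x"
    unfolding w(2) \<delta>_minus[OF x dz] \<delta>\<delta>[OF z(1)]
    by (rule abelian_group.minus_zero_right[OF ab \<delta>_closed[OF x]])
  then show "\<delta> (Suc p) (Suc q) x \<in> bd (Suc p) q"
    unfolding bd_def by (intro image_eqI[OF _ w(1)]) simp
next
  assume "\<delta> (Suc p) (Suc q) x \<in> bd (Suc p) q"
  then obtain w where w: "w \<in> carrier (X (Suc p) q)" "\<delta> (Suc p) (Suc q) x = \<delta> (Suc p) (Suc q) (d (Suc p) q w)"
    by (auto simp: bd_def)
  note dw = d_closed[OF w(1)]
  have "\<delta> (Suc p) (Suc q) (x \<ominus>\<^bsub>X (Suc p) (Suc q)\<^esub> d (Suc p) q w) = \<zero>\<^bsub>X (Suc (Suc p)) (Suc q)\<^esub>"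
    using w(2) minus_self'[OF \<delta>_closed[OF x]] by (simp add: \<delta>_minus[OF x dw])
  then obtain z where z: "z \<in> carrier (X p (Suc q))" "\<delta> p (Suc q) z = x \<ominus>\<^bsub>X (Suc p) (Suc q)\<^esub> d (Suc p) q w"
    using col minus_closed[OF x dw] by blast
  have "d (Suc p) (Suc q) (\<delta> p (Suc q) z) = d (Suc p) (Suc q) x"
    unfolding z(2) d_minus[OF x dw] dd[OF w(1)]
    by (rule abelian_group.minus_zero_right[OF ab d_closed[OF x]])
  then show "d (Suc p) (Suc q) x \<in> bd p (Suc q)"
    unfolding bd_def using comm[OF z(1)] by (intro image_eqI[OF _ z(1)]) simp
qed

lemma zig_bic:
  "zig X d \<delta> m p y z \<Longrightarrow> y \<in> bic (Suc p) (Suc m) \<Longrightarrow> z \<in> bic (Suc (p + m)) (Suc 0)"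
proof (induction m arbitrary: p y)
  case (Suc m)
  then obtain x where x: "x \<in> carrier (X (Suc p) (Suc m))" "d (Suc p) (Suc m) x = y"
    "zig X d \<delta> m (Suc p) (\<delta> (Suc p) (Suc m) x) z" by auto
  show ?case using Suc.IH[OF x(3) step_bic_down[OF x(1)]] Suc.prems(2) x(2) by simp
qed simp

lemma zig_total:
  "y \<in> bic (Suc p) (Suc m) \<Longrightarrow> \<exists>z. zig X d \<delta> m p y z"
proof (induction m arbitrary: p y)
  case (Suc m)
  then obtain x where x: "x \<in> carrier (X (Suc p) (Suc m))" "d (Suc p) (Suc m) x = y"
    using row[of y p "Suc m"] by (auto simp: bic_def)
  with Suc show ?case using step_bic_down[OF x(1)] by force
qed auto

text \<open>The zigzag is read backwards, so the lifts are taken along \<delta> and exactness of the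
  columns takes over the role of the rows.\<close>

lemma zig_onto:
  "z \<in> bic (Suc (p + m)) (Suc 0) \<Longrightarrow> \<exists>y\<in>bic (Suc p) (Suc m). zig X d \<delta> m p y z"
proof (induction m arbitrary: p)
  case (Suc m)
  then obtain w where w: "w \<in> bic (Suc (Suc p)) (Suc m)" "zig X d \<delta> m (Suc p) w z" by force
  then obtain x where x: "x \<in> carrier (X (Suc p) (Suc m))" "\<delta> (Suc p) (Suc m) x = w"
    using col[of w "Suc p" m] by (auto simp: bic_def)
  then show ?case using w step_bic_up[OF x(1)] by auto
qed simp

lemma zig_bd:
  "zig X d \<delta> m p y z \<Longrightarrow> y \<in> bic (Suc p) (Suc m) \<Longrightarrow> y \<in> bd p m \<longleftrightarrow> z \<in> bd (p + m) 0"
proof (induction m arbitrary: p y)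
  case (Suc m)
  then obtain x where x: "x \<in> carrier (X (Suc p) (Suc m))" "d (Suc p) (Suc m) x = y"
    "zig X d \<delta> m (Suc p) (\<delta> (Suc p) (Suc m) x) z" by auto
  show ?case using Suc.IH[OF x(3) step_bic_down[OF x(1)]] Suc.prems(2) x(2) step_bd[OF x(1)] by simp
qed simp

text \<open>Zigzags form a subgroup of pairs. With \<open>zig_bd\<close> this removes the dependence
  on the lifts: two ends of zigzags from one start differ by an element of
  \<open>bd\<close>.\<close>

lemma zig_minus:
  "zig X d \<delta> m p y z \<Longrightarrow> zig X d \<delta> m p y' z' \<Longrightarrow>
   zig X d \<delta> m p (y \<ominus>\<^bsub>X (Suc p) (Suc m)\<^esub> y') (z \<ominus>\<^bsub>X (Suc (p + m)) (Suc 0)\<^esub> z')"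
proof (induction m arbitrary: p y y')
  case (Suc m)
  then obtain x x' where x: "x \<in> carrier (X (Suc p) (Suc m))" "d (Suc p) (Suc m) x = y"
    "zig X d \<delta> m (Suc p) (\<delta> (Suc p) (Suc m) x) z"
    and x': "x' \<in> carrier (X (Suc p) (Suc m))" "d (Suc p) (Suc m) x' = y'"
    "zig X d \<delta> m (Suc p) (\<delta> (Suc p) (Suc m) x') z'" by auto
  show ?case
    unfolding zig.simps
    using Suc.IH[OF x(3) x'(3)] x x'
    by (intro bexI[of _ "x \<ominus>\<^bsub>X (Suc p) (Suc m)\<^esub> x'"] conjI) (simp_all add: d_minus \<delta>_minus minus_closed)
qed (simp del: One_nat_def[symmetric])

end

section \<open>Isomorphisms on cohomology induced by additive relations\<close>

text \<open>Closure under differences makes \<rho> a subgroup of pairs with a single condition. The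
  equivalence \<open>bdry\<close> gives well-definedness in one direction and injectivity in the
  other, while \<open>total\<close> and \<open>onto\<close> supply domain and range.\<close>

locale coset_relation =
  G: abelian_group G + H: abelian_group H
  for G :: "('x, 'b) ring_scheme" and Z B and H :: "('y, 'c) ring_scheme" and Z' B' and \<rho> :: "('x \<times> 'y) set" +
  assumes Z: "Z \<subseteq> carrier G" and B: "B \<subseteq> Z" and Z': "Z' \<subseteq> carrier H" and B': "B' \<subseteq> Z'"
    and zero: "\<zero>\<^bsub>G\<^esub> \<in> B"
    and \<rho>: "\<rho> \<subseteq> Z \<times> Z'" and total: "x \<in> Z \<Longrightarrow> \<exists>y. (x, y) \<in> \<rho>" and onto: "y \<in> Z' \<Longrightarrow> \<exists>x. (x, y) \<in> \<rho>"
    and diff: "(x, y) \<in> \<rho> \<Longrightarrow> (x', y') \<in> \<rho> \<Longrightarrow> (x \<ominus>\<^bsub>G\<^esub> x', y \<ominus>\<^bsub>H\<^esub> y') \<in> \<rho>"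
    and bdry: "(x, y) \<in> \<rho> \<Longrightarrow> x \<in> B \<longleftrightarrow> y \<in> B'"
    and Bdiff: "x \<in> B \<Longrightarrow> x' \<in> B \<Longrightarrow> x \<ominus>\<^bsub>G\<^esub> x' \<in> B"
    and Bdiff': "y \<in> B' \<Longrightarrow> y' \<in> B' \<Longrightarrow> y \<ominus>\<^bsub>H\<^esub> y' \<in> B'"
begin

lemma mem: "(x, y) \<in> \<rho> \<Longrightarrow> x \<in> Z \<and> y \<in> Z' \<and> x \<in> carrier G \<and> y \<in> carrier H"
  using \<rho> Z Z' by auto

lemma zero': "\<zero>\<^bsub>H\<^esub> \<in> B'" "(\<zero>\<^bsub>G\<^esub>, \<zero>\<^bsub>H\<^esub>) \<in> \<rho>"
proof -
  obtain y where y: "(\<zero>\<^bsub>G\<^esub>, y) \<in> \<rho>" using total B zero by blast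
  show *: "(\<zero>\<^bsub>G\<^esub>, \<zero>\<^bsub>H\<^esub>) \<in> \<rho>" using diff[OF y y] mem[OF y] by (simp add: G.minus_self H.minus_self)
  show "\<zero>\<^bsub>H\<^esub> \<in> B'" using bdry[OF *] zero by simp
qed

lemma add:
  assumes "(x, y) \<in> \<rho>" "(x', y') \<in> \<rho>"
  shows "(x \<oplus>\<^bsub>G\<^esub> x', y \<oplus>\<^bsub>H\<^esub> y') \<in> \<rho>"
  using diff[OF assms(1) diff[OF zero'(2) assms(2)]] mem[OF assms(1)] mem[OF assms(2)]
  by (simp add: G.minus_eq H.minus_eq G.minus_add H.minus_add)

lemma subgroup_B: "additive_subgroup B G"
proof -
  have c: "B \<subseteq> carrier G" using Z B by auto
  have inv: "\<ominus>\<^bsub>G\<^esub> a \<in> B" if a: "a \<in> B" for a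
    using Bdiff[OF zero a] subsetD[OF c a] by (simp add: G.minus_eq)
  have sum: "a \<oplus>\<^bsub>G\<^esub> b \<in> B" if a: "a \<in> B" and b: "b \<in> B" for a b
    using Bdiff[OF a inv[OF b]] subsetD[OF c a] subsetD[OF c b] by (simp add: G.minus_eq)
  have "subgroup B (add_monoid G)"
    by (rule G.add.subgroupI) (use c zero inv sum in auto)
  then show ?thesis by (rule additive_subgroup.intro)
qed

lemma subgroup_B': "additive_subgroup B' H"
proof -
  have c: "B' \<subseteq> carrier H" using Z' B' by auto
  have inv: "\<ominus>\<^bsub>H\<^esub> a \<in> B'" if a: "a \<in> B'" for a
    using Bdiff'[OF zero'(1) a] subsetD[OF c a] by (simp add: H.minus_eq)
  have sum: "a \<oplus>\<^bsub>H\<^esub> b \<in> B'" if a: "a \<in> B'" and b: "b \<in> B'" for a b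
    using Bdiff'[OF a inv[OF b]] subsetD[OF c a] subsetD[OF c b] by (simp add: H.minus_eq)
  have "subgroup B' (add_monoid H)"
    by (rule H.add.subgroupI) (use c zero'(1) inv sum in auto)
  then show ?thesis by (rule additive_subgroup.intro)
qed

text \<open>The relational image of a whole coset is again a whole coset. The isomorphism is
  therefore the image operation of \<rho>, and no representative has to be chosen.\<close>

lemma coset:
  assumes xy: "(x, y) \<in> \<rho>"
  shows "\<rho> `` (B +>\<^bsub>G\<^esub> x) = B' +>\<^bsub>H\<^esub> y"
proof
  note m = mem[OF xy]
  show "\<rho> `` (B +>\<^bsub>G\<^esub> x) \<subseteq> B' +>\<^bsub>H\<^esub> y"
  proof
    fix w assume "w \<in> \<rho> `` (B +>\<^bsub>G\<^esub> x)"
    then obtain b where b: "b \<in> B" "(b \<oplus>\<^bsub>G\<^esub> x, w) \<in> \<rho>" by (auto simp: a_r_coset_def')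
    have bG: "b \<in> carrier G" using b B Z by auto
    \<comment> \<open>Subtracting the given pair leaves an element of \<open>B\<close> in the first
      component, so \<open>bdry\<close> puts the second component into \<open>B'\<close>.\<close>
    have "(b, w \<ominus>\<^bsub>H\<^esub> y) \<in> \<rho>"
      using diff[OF b(2) xy] m bG by (simp add: G.minus_eq G.a_assoc G.r_neg)
    then have "w \<ominus>\<^bsub>H\<^esub> y \<in> B'" using bdry b(1) by blast
    moreover have "w = (w \<ominus>\<^bsub>H\<^esub> y) \<oplus>\<^bsub>H\<^esub> y" using mem[OF b(2)] m by (simp add: H.minus_eq H.a_assoc H.l_neg)
    ultimately show "w \<in> B' +>\<^bsub>H\<^esub> y" by (auto simp: a_r_coset_def')
  qed
  show "B' +>\<^bsub>H\<^esub> y \<subseteq> \<rho> `` (B +>\<^bsub>G\<^esub> x)"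
  proof
    fix w assume "w \<in> B' +>\<^bsub>H\<^esub> y"
    then obtain b' where b': "b' \<in> B'" "w = b' \<oplus>\<^bsub>H\<^esub> y" by (auto simp: a_r_coset_def')
    then obtain b where b: "(b, b') \<in> \<rho>" using onto B' by blast
    then have "b \<in> B" using bdry b'(1) by blast
    moreover have "(b \<oplus>\<^bsub>G\<^esub> x, w) \<in> \<rho>" using add[OF b xy] b'(2) by simp
    ultimately show "w \<in> \<rho> `` (B +>\<^bsub>G\<^esub> x)" by (auto simp: a_r_coset_def')
  qed
qed

lemma bij: "bij_betw (\<lambda>X. \<rho> `` X) ((\<lambda>x. B +>\<^bsub>G\<^esub> x) ` Z) ((\<lambda>y. B' +>\<^bsub>H\<^esub> y) ` Z')"
  unfolding bij_betw_def
proof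
  show "inj_on (\<lambda>X. \<rho> `` X) ((\<lambda>x. B +>\<^bsub>G\<^esub> x) ` Z)"
  proof (rule inj_onI, clarify)
    fix x x' assume x: "x \<in> Z" and x': "x' \<in> Z" and eq: "\<rho> `` (B +>\<^bsub>G\<^esub> x) = \<rho> `` (B +>\<^bsub>G\<^esub> x')"
    obtain y y' where y: "(x, y) \<in> \<rho>" "(x', y') \<in> \<rho>" using total x x' by blast
    interpret B': additive_subgroup B' H by (rule subgroup_B')
    interpret B: additive_subgroup B G by (rule subgroup_B)
    have "B' +>\<^bsub>H\<^esub> y = B' +>\<^bsub>H\<^esub> y'" using eq by (simp add: coset[OF y(1)] coset[OF y(2)])
    moreover have "y \<in> B' +>\<^bsub>H\<^esub> y"
      using zero'(1) mem[OF y(1)] by (auto simp: a_r_coset_def' intro!: bexI[of _ "\<zero>\<^bsub>H\<^esub>"])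
    ultimately obtain b where b: "b \<in> B'" "y = b \<oplus>\<^bsub>H\<^esub> y'" by (auto simp: a_r_coset_def')
    then have "y \<ominus>\<^bsub>H\<^esub> y' = b" using mem[OF y(2)] B' Z' by (auto simp: H.minus_eq H.a_assoc H.r_neg)
    then have "x \<ominus>\<^bsub>G\<^esub> x' \<in> B" using bdry[OF diff[OF y]] b by simp
    moreover have "x = (x \<ominus>\<^bsub>G\<^esub> x') \<oplus>\<^bsub>G\<^esub> x'" using mem[OF y(1)] mem[OF y(2)] by (simp add: G.minus_eq G.a_assoc G.l_neg)
    ultimately have "x \<in> B +>\<^bsub>G\<^esub> x'" by (auto simp: a_r_coset_def')
    then show "B +>\<^bsub>G\<^esub> x = B +>\<^bsub>G\<^esub> x'"
      using G.a_repr_independence[of x B x'] mem[OF y(2)] B.a_subgroup by simp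
  qed
  show "(\<lambda>X. \<rho> `` X) ` (\<lambda>x. B +>\<^bsub>G\<^esub> x) ` Z = (\<lambda>y. B' +>\<^bsub>H\<^esub> y) ` Z'"
  proof (intro equalityI subsetI)
    fix W assume "W \<in> (\<lambda>X. \<rho> `` X) ` (\<lambda>x. B +>\<^bsub>G\<^esub> x) ` Z"
    then obtain x where x: "x \<in> Z" "W = \<rho> `` (B +>\<^bsub>G\<^esub> x)" by auto
    then obtain y where y: "(x, y) \<in> \<rho>" using total by blast
    then show "W \<in> (\<lambda>y. B' +>\<^bsub>H\<^esub> y) ` Z'" using x coset[OF y] mem[OF y] by auto
  next
    fix W assume "W \<in> (\<lambda>y. B' +>\<^bsub>H\<^esub> y) ` Z'"
    then obtain y where y: "y \<in> Z'" "W = B' +>\<^bsub>H\<^esub> y" by auto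
    then obtain x where x: "(x, y) \<in> \<rho>" using onto by blast
    then show "W \<in> (\<lambda>X. \<rho> `` X) ` (\<lambda>x. B +>\<^bsub>G\<^esub> x) ` Z" using y coset[OF x] mem[OF x] by auto
  qed
qed

lemma coset_add:
  assumes xy: "(x, y) \<in> \<rho>" and xy': "(x', y') \<in> \<rho>"
  shows "\<rho> `` ((B +>\<^bsub>G\<^esub> x) <+>\<^bsub>G\<^esub> (B +>\<^bsub>G\<^esub> x')) = (\<rho> `` (B +>\<^bsub>G\<^esub> x)) <+>\<^bsub>H\<^esub> (\<rho> `` (B +>\<^bsub>G\<^esub> x'))"
    "(B +>\<^bsub>G\<^esub> x) <+>\<^bsub>G\<^esub> (B +>\<^bsub>G\<^esub> x') = B +>\<^bsub>G\<^esub> (x \<oplus>\<^bsub>G\<^esub> x')"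
proof -
  interpret B: abelian_subgroup B G by (rule abelian_subgroupI3[OF subgroup_B G.abelian_group_axioms])
  interpret B': abelian_subgroup B' H by (rule abelian_subgroupI3[OF subgroup_B' H.abelian_group_axioms])
  show s: "(B +>\<^bsub>G\<^esub> x) <+>\<^bsub>G\<^esub> (B +>\<^bsub>G\<^esub> x') = B +>\<^bsub>G\<^esub> (x \<oplus>\<^bsub>G\<^esub> x')"
    using mem[OF xy] mem[OF xy'] by (intro B.a_rcos_sum) auto
  show "\<rho> `` ((B +>\<^bsub>G\<^esub> x) <+>\<^bsub>G\<^esub> (B +>\<^bsub>G\<^esub> x')) = (\<rho> `` (B +>\<^bsub>G\<^esub> x)) <+>\<^bsub>H\<^esub> (\<rho> `` (B +>\<^bsub>G\<^esub> x'))"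
    unfolding s coset[OF add[OF xy xy']] coset[OF xy] coset[OF xy']
    using mem[OF xy] mem[OF xy'] by (intro B'.a_rcos_sum[symmetric]) auto
qed

end

text \<open>\<open>coset_map\<close> is a union over all representatives. When \<open>f\<close> maps
  \<open>B\<close> into \<open>B'\<close>, all the cosets in that union coincide.\<close>

lemma coset_map_coset:
  assumes sg: "additive_subgroup B' N" and N: "abelian_group N" and BG: "B \<subseteq> carrier G" "\<zero>\<^bsub>G\<^esub> \<in> B" and G: "abelian_group G"
    and f: "additive_map G N f" and fB: "\<And>b. b \<in> B \<Longrightarrow> f b \<in> B'" and x: "x \<in> carrier G"
  shows "coset_map N B' f (B +>\<^bsub>G\<^esub> x) = B' +>\<^bsub>N\<^esub> f x"
proof -
  interpret N: abelian_group N by fact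
  interpret G: abelian_group G by fact
  interpret B': additive_subgroup B' N by fact
  have "B' +>\<^bsub>N\<^esub> f (b \<oplus>\<^bsub>G\<^esub> x) = B' +>\<^bsub>N\<^esub> f x" if b: "b \<in> B" for b
  proof -
    have "f (b \<oplus>\<^bsub>G\<^esub> x) \<in> B' +>\<^bsub>N\<^esub> f x"
      using b BG x unfolding a_r_coset_def'
      by (auto simp: additive_map_add[OF f] subset_iff intro: fB[OF b] bexI[OF _ fB[OF b]])
    then show ?thesis
      using N.a_repr_independence[of "f (b \<oplus>\<^bsub>G\<^esub> x)" B' "f x"] B'.a_subgroup additive_map_closed[OF f x] by simp
  qed
  then show ?thesis using BG(2) by (auto simp: coset_map_def a_r_coset_def'[of G])
qed

text \<open>Positions in the double complex are built with \<open>Suc\<close>, so the usual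
  orientation of the equation is restored.\<close>

declare One_nat_def [symmetric, simp del] One_nat_def [simp]

section \<open>The double complex of a resolution\<close>

lemma abelian_group_restrict:
  assumes "abelian_group G" "S \<subseteq> carrier G" "\<zero>\<^bsub>G\<^esub> \<in> S" "\<And>x y. x \<in> S \<Longrightarrow> y \<in> S \<Longrightarrow> x \<oplus>\<^bsub>G\<^esub> y \<in> S"
    "\<And>x. x \<in> S \<Longrightarrow> \<ominus>\<^bsub>G\<^esub> x \<in> S"
  shows "abelian_group (G\<lparr>carrier := S\<rparr>)"
proof -
  interpret abelian_group G by fact
  have "x \<in> carrier G" if "x \<in> S" for x using that assms(2) by auto
  moreover from this have "\<exists>y\<in>S. x \<oplus>\<^bsub>G\<^esub> y = \<zero>\<^bsub>G\<^esub>" if "x \<in> S" for x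
    using that assms(5) by (intro bexI[of _ "\<ominus>\<^bsub>G\<^esub> x"]) (auto simp: r_neg)
  ultimately show ?thesis
    using assms(3-5) by (intro abelian_groupI) (auto simp: a_ac)
qed

context flat_hopf
begin

text \<open>Shifts the resolution by one, so that \<open>F\<close> is term 0 and the augmentation is
  the differential leaving it; statements about all columns then need no separate case for
  \<open>F\<close>.\<close>

definition res_term :: "('u, 'u, 'u) dcomod \<Rightarrow> ('u, 'u, 'u) resolution \<Rightarrow> nat \<Rightarrow> ('u, 'u, 'u) dcomod" where
  "res_term F I q = (case q of 0 \<Rightarrow> F | Suc k \<Rightarrow> res_obj I k)"

definition res_map :: "('u, 'u, 'u) resolution \<Rightarrow> nat \<Rightarrow> 'u \<Rightarrow> 'u" where
  "res_map I q = (case q of 0 \<Rightarrow> aug I | Suc k \<Rightarrow> res_diff I k)"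

lemma res_simps [simp]:
  "res_term F I 0 = F" "res_term F I (Suc k) = res_obj I k"
  "res_map I 0 = aug I" "res_map I (Suc k) = res_diff I k"
  by (simp_all add: res_term_def res_map_def)

text \<open>The invariants as kernel of the first Hochschild differential. In this form they augment
  the Hochschild complex without a change of type.\<close>

definition inv_tens :: "('u, 'u, 'u) dcomod \<Rightarrow> ('u, 'u) tens set" where
  "inv_tens F = {X \<in> carrier (tens R F A 0). hdiff F (coact F) 0 X = \<zero>\<^bsub>tens R F A 1\<^esub>}"

text \<open>The Hochschild complexes of \<open>F \<rightarrow> I\<^sup>0 \<rightarrow> I\<^sup>1 \<rightarrow> \<dots>\<close>, augmented by the invariants in row \<open>0\<close>. The
  corner is \<open>0\<close> rather than the invariants of \<open>F\<close>, so that the classes in degree \<open>0\<close> are not divided out.\<close>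

definition dcx :: "('u, 'u, 'u) dcomod \<Rightarrow> ('u, 'u, 'u) resolution \<Rightarrow> nat \<Rightarrow> nat \<Rightarrow> ('u, ('u, 'u) tens) module" where
  "dcx F I p q = (case p of
      0 \<Rightarrow> (tens R (res_term F I q) A 0)
         \<lparr>carrier := (if q = 0 then {\<zero>\<^bsub>tens R F A 0\<^esub>} else inv_tens (res_term F I q))\<rparr>
    | Suc p' \<Rightarrow> tens R (res_term F I q) A p')"

text \<open>Rows 0 and 1 both have tensor degree 0 and row \<open>p + 1\<close> has degree
  \<open>p\<close>; truncated subtraction gives the right degree in every row.\<close>

definition dcx_d :: "('u, 'u, 'u) dcomod \<Rightarrow> ('u, 'u, 'u) resolution \<Rightarrow> nat \<Rightarrow> nat \<Rightarrow> ('u, 'u) tens \<Rightarrow> ('u, 'u) tens" where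
  "dcx_d F I p q = tens_map R (res_term F I (Suc q)) A (p - Suc 0) (res_map I q)"

text \<open>Out of row 0 it is the inclusion of the invariants.\<close>

definition dcx_\<delta> :: "('u, 'u, 'u) dcomod \<Rightarrow> ('u, 'u, 'u) resolution \<Rightarrow> nat \<Rightarrow> nat \<Rightarrow> ('u, 'u) tens \<Rightarrow> ('u, 'u) tens" where
  "dcx_\<delta> F I p q = (case p of 0 \<Rightarrow> (\<lambda>X. X) | Suc p' \<Rightarrow> hdiff (res_term F I q) (coact (res_term F I q)) p')"

lemma dcx_simps:
  "dcx F I (Suc p) q = tens R (res_term F I q) A p"
  "dcx_d F I (Suc p) q = tens_map R (res_term F I (Suc q)) A p (res_map I q)"
  "dcx_d F I 0 q = tens_map R (res_term F I (Suc q)) A 0 (res_map I q)"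
  "dcx_\<delta> F I (Suc p) q = hdiff (res_term F I q) (coact (res_term F I q)) p"
  "dcx_\<delta> F I 0 q = (\<lambda>X. X)"
  "carrier (dcx F I 0 0) = {\<zero>\<^bsub>tens R F A 0\<^esub>}"
  "carrier (dcx F I 0 (Suc k)) = inv_tens (res_obj I k)"
  "\<zero>\<^bsub>dcx F I 0 q\<^esub> = \<zero>\<^bsub>tens R (res_term F I q) A 0\<^esub>"
  "ring.add (dcx F I 0 q) = ring.add (tens R (res_term F I q) A 0)"
  by (simp_all add: dcx_def dcx_d_def dcx_\<delta>_def fun_eq_iff)

lemma comod_hom_tens_map:
  assumes "difference_comodule R A F" "difference_comodule R A G" "f \<in> comod_hom R A F G"
    "X \<in> carrier (tens R F A n)"
  shows "hdiff G (coact G) n (tens_map R G A n f X) = tens_map R G A (Suc n) f (hdiff F (coact F) n X)"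
proof -
  note F = difference_comoduleD[OF assms(1)] and G = difference_comoduleD[OF assms(2)]
  have "compat (\<lambda>r. r) F (coact F) G (coact G) f (\<lambda>a. a)"
    using assms(3) by (intro compat_linear) (auto simp: comod_hom_iff)
  from hdiff_gmap[OF F(1,4) G(1,4) this assms(4)] show ?thesis by (simp add: tens_map_gmap)
qed

lemma inv_tens_abelian:
  assumes F: "difference_comodule R A F"
  shows "abelian_group ((tens R F A 0)\<lparr>carrier := inv_tens F\<rparr>)"
proof -
  note FD = difference_comoduleD[OF F]
  define T where "T = tens R F A 0"
  define U where "U = tens R F A 1"
  define h where "h = hdiff F (coact F) 0"
  have h: "additive_map T U h"
    using hdiff_additive[OF FD(1,4), of 0] by (simp add: T_def U_def h_def)
  interpret T: abelian_group T unfolding T_def by (rule tens_group[OF FD(1)])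
  interpret U: abelian_group U unfolding U_def by (rule tens_group[OF FD(1)])
  have inv: "inv_tens F = {X \<in> carrier T. h X = \<zero>\<^bsub>U\<^esub>}"
    by (simp add: inv_tens_def T_def U_def h_def)
  note z = additive_map_zero[OF T.abelian_group_axioms U.abelian_group_axioms h]
    and n = additive_map_neg[OF T.abelian_group_axioms U.abelian_group_axioms h]
  show ?thesis
    unfolding inv T_def[symmetric]
    by (rule abelian_group_restrict[OF T.abelian_group_axioms]) (auto simp: z n additive_map_add[OF h])
qed

context
  fixes F :: "('u, 'u, 'u) dcomod" and I :: "('u, 'u, 'u) resolution"
  assumes F: "difference_comodule R A F" and I: "enriched_injective_resolution R A F I"
begin

lemma res_term_comodule: "difference_comodule R A (res_term F I q)"
  using F I by (cases q) (auto simp: enriched_injective_resolution_def enriched_injective_def)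

lemmas resD = difference_comoduleD[OF res_term_comodule]

lemma res_map_hom: "res_map I q \<in> comod_hom R A (res_term F I q) (res_term F I (Suc q))"
  using I by (cases q) (auto simp: enriched_injective_resolution_def)

lemma res_map_linear: "linear_map R (res_term F I q) (res_term F I (Suc q)) (res_map I q)"
  using res_map_hom by (simp add: comod_hom_iff)

lemma res_exact:
  "{x \<in> carrier (res_term F I (Suc q)). res_map I (Suc q) x = \<zero>\<^bsub>res_term F I (Suc (Suc q))\<^esub>} =
     res_map I q ` carrier (res_term F I q)"
proof (cases q)
  case 0
  have "aug I ` carrier F = {x \<in> carrier (res_obj I 0). res_diff I 0 x = \<zero>\<^bsub>res_obj I 1\<^esub>}"
    using I by (simp add: enriched_injective_resolution_def)
  then show ?thesis by (simp add: 0)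
next
  case (Suc k)
  then show ?thesis using I by (simp add: enriched_injective_resolution_def)
qed

lemma res_inj: "inj_on (aug I) (carrier F)"
  using I by (simp add: enriched_injective_resolution_def)

lemma res_zero: "x \<in> carrier (res_term F I q) \<Longrightarrow> res_map I (Suc q) (res_map I q x) = \<zero>\<^bsub>res_term F I (Suc (Suc q))\<^esub>"
  using res_exact[of q] by blast

lemma tens_map_res_closed:
  "X \<in> carrier (tens R (res_term F I q) A n) \<Longrightarrow>
   tens_map R (res_term F I (Suc q)) A n (res_map I q) X \<in> carrier (tens R (res_term F I (Suc q)) A n)"
  by (rule additive_map_closed[OF tens_map_additive[OF resD(1) resD(1) res_map_linear]])

lemma tens_map_zero_elem:
  "tens_map R (res_term F I (Suc q)) A n (res_map I q) \<zero>\<^bsub>tens R (res_term F I q) A n\<^esub> = \<zero>\<^bsub>tens R (res_term F I (Suc q)) A n\<^esub>"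
  by (rule additive_map_zero[OF tens_group[OF resD(1)] tens_group[OF resD(1)] tens_map_additive[OF resD(1) resD(1) res_map_linear]])

lemmas hdiff_res = comod_hom_tens_map[OF res_term_comodule res_term_comodule res_map_hom]

lemma inv_tens_closed:
  "X \<in> inv_tens (res_term F I q) \<Longrightarrow> tens_map R (res_term F I (Suc q)) A 0 (res_map I q) X \<in> inv_tens (res_term F I (Suc q))"
  by (simp add: inv_tens_def hdiff_res tens_map_res_closed tens_map_zero_elem del: res_simps)

lemmas inv_tens_group = inv_tens_abelian[OF res_term_comodule]

text \<open>Lets the zero corner be treated together with the rest of row 0.\<close>

lemma dcx_0_subset: "carrier (dcx F I 0 q) \<subseteq> inv_tens (res_term F I q)"
proof (cases q)
  case 0
  have "\<zero>\<^bsub>tens R F A 0\<^esub> \<in> inv_tens F"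
    using abelian_monoid.zero_closed[OF abelian_group.axioms(1)[OF inv_tens_group[of 0]]] by simp
  then show ?thesis by (simp add: 0 dcx_simps)
next
  case (Suc k)
  then show ?thesis by (simp add: dcx_simps)
qed

lemma tens_map_res_zero:
  assumes X: "X \<in> carrier (tens R (res_term F I q) A n)"
  shows "tens_map R (res_term F I (Suc (Suc q))) A n (res_map I (Suc q)) (tens_map R (res_term F I (Suc q)) A n (res_map I q) X) =
     \<zero>\<^bsub>tens R (res_term F I (Suc (Suc q))) A n\<^esub>"
  unfolding tens_map_comp[OF resD(1) resD(1) resD(1) res_map_linear res_map_linear X]
  by (rule tens_map_zero[OF resD(1) resD(1) X linear_map_comp[OF res_map_linear res_map_linear] res_zero])

text \<open>All identities are functoriality of the tensor product or naturality of the Hochschild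
  differential. The exactness conditions at the end are where flatness and injectivity
  enter.\<close>

lemma bicomplex_dcx: "bicomplex (dcx F I) (dcx_d F I) (dcx_\<delta> F I)"
proof (rule bicomplex.intro)
  have inv: "X \<in> carrier (tens R (res_term F I q) A 0)"
    "hdiff (res_term F I q) (coact (res_term F I q)) 0 X = \<zero>\<^bsub>tens R (res_term F I q) A 1\<^esub>"
    if "X \<in> carrier (dcx F I 0 q)" for X q
    using that dcx_0_subset[of q] by (auto simp: inv_tens_def)
  show "abelian_group (dcx F I p q)" for p q
  proof (cases p)
    case 0
    show ?thesis
    proof (cases q)
      case z: 0
      interpret abelian_group "tens R F A 0" using tens_group[OF resD(1)[of 0]] by simp
      show ?thesis
        unfolding 0 z dcx_def by (simp, rule abelian_group_restrict[OF abelian_group_axioms]) auto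
    next
      case (Suc k)
      then show ?thesis using 0 inv_tens_group[of q] by (simp add: dcx_def)
    qed
  next
    case (Suc p')
    then show ?thesis by (simp add: dcx_simps tens_group[OF resD(1)])
  qed
  show "additive_map (dcx F I p q) (dcx F I p (Suc q)) (dcx_d F I p q)" for p q
  proof (cases p)
    case 0
    note t = tens_map_additive[OF resD(1) resD(1) res_map_linear[of q], of 0]
    show ?thesis
      unfolding 0
    proof (rule additive_mapI)
      fix X assume X: "X \<in> carrier (dcx F I 0 q)"
      then show "dcx_d F I 0 q X \<in> carrier (dcx F I 0 (Suc q))"
        using inv_tens_closed[of X q] dcx_0_subset[of q] by (auto simp: dcx_simps)
    next
      fix X Y assume X: "X \<in> carrier (dcx F I 0 q)" and Y: "Y \<in> carrier (dcx F I 0 q)"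
      show "dcx_d F I 0 q (X \<oplus>\<^bsub>dcx F I 0 q\<^esub> Y) = dcx_d F I 0 q X \<oplus>\<^bsub>dcx F I 0 (Suc q)\<^esub> dcx_d F I 0 q Y"
        unfolding dcx_simps by (rule additive_map_add[OF t inv(1)[OF X] inv(1)[OF Y]])
    qed
  next
    case (Suc p')
    then show ?thesis unfolding Suc dcx_simps by (intro tens_map_additive[OF resD(1) resD(1) res_map_linear])
  qed
  show "additive_map (dcx F I p q) (dcx F I (Suc p) q) (dcx_\<delta> F I p q)" for p q
  proof (cases p)
    case 0
    then show ?thesis using inv(1) by (auto simp: additive_map_def dcx_simps)
  next
    case (Suc p')
    then show ?thesis unfolding Suc dcx_simps by (intro hdiff_additive resD(1,4))
  qed
  show "dcx_d F I p (Suc q) (dcx_d F I p q x) = \<zero>\<^bsub>dcx F I p (Suc (Suc q))\<^esub>" if "x \<in> carrier (dcx F I p q)" for p q x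
    using that tens_map_res_zero[of x q] inv(1)[of x q] by (cases p) (auto simp: dcx_simps simp del: res_simps)
  show "dcx_\<delta> F I (Suc p) q (dcx_\<delta> F I p q x) = \<zero>\<^bsub>dcx F I (Suc (Suc p)) q\<^esub>" if "x \<in> carrier (dcx F I p q)" for p q x
    using that hdiff_hdiff[OF resD(3)] inv(2)[of x q] by (cases p) (auto simp: dcx_simps simp del: res_simps)
  show "dcx_\<delta> F I p (Suc q) (dcx_d F I p q x) = dcx_d F I (Suc p) q (dcx_\<delta> F I p q x)" if "x \<in> carrier (dcx F I p q)" for p q x
    using that hdiff_res[of x q] inv(1)[of x q]
    by (cases p) (auto simp: dcx_simps simp del: res_simps)
  \<comment> \<open>A row in positive position is the augmented resolution tensored with a power of
    \<open>A\<close>.\<close>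
  show "\<exists>x\<in>carrier (dcx F I (Suc p) q). dcx_d F I (Suc p) q x = y"
    if "y \<in> carrier (dcx F I (Suc p) (Suc q))" "dcx_d F I (Suc p) (Suc q) y = \<zero>\<^bsub>dcx F I (Suc p) (Suc (Suc q))\<^esub>" for p q y
    using tens_exact[OF resD(1) resD(1) resD(1) res_map_linear res_map_linear res_exact, of y q p] that
    by (auto simp: dcx_simps simp del: res_simps)
  show "\<exists>x\<in>carrier (dcx F I p (Suc q)). dcx_\<delta> F I p (Suc q) x = y"
    if y: "y \<in> carrier (dcx F I (Suc p) (Suc q))" and z: "dcx_\<delta> F I (Suc p) (Suc q) y = \<zero>\<^bsub>dcx F I (Suc (Suc p)) (Suc q)\<^esub>" for p q y
  proof (cases p)
    \<comment> \<open>In the lowest interior row a cocycle is an invariant by definition, so it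
      already lies in row 0.\<close>
    case 0
    then show ?thesis using y z by (auto simp: dcx_simps inv_tens_def)
  next
    case (Suc p')
    have "enriched_injective R A (res_obj I q)" using I by (simp add: enriched_injective_resolution_def)
    from injective_acyclic[OF this] show ?thesis using y z by (simp add: Suc dcx_simps)
  qed
qed

end

end

section \<open>Cohomology as a derived functor\<close>

lemma a_minus_cong:
  assumes "carrier G = carrier G'" "ring.add G = ring.add G'" "\<zero>\<^bsub>G\<^esub> = \<zero>\<^bsub>G'\<^esub>"
  shows "x \<ominus>\<^bsub>G\<^esub> y = x \<ominus>\<^bsub>G'\<^esub> y"
  by (simp add: a_minus_def a_inv_def m_inv_def assms)

lemma abelian_group_cong:
  assumes "abelian_group G" "carrier G' = carrier G" "ring.add G' = ring.add G" "\<zero>\<^bsub>G'\<^esub> = \<zero>\<^bsub>G\<^esub>"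
  shows "abelian_group G'"
  by (rule abelian_group_of_comm_group[OF abelian_group.a_comm_group[OF assms(1)]]) (simp_all add: assms)

text \<open>The values of an abstract functor of invariants are known only through the bijection
  with the invariants; the group laws are pulled back along it.\<close>

lemma abelian_group_bij:
  assumes H: "abelian_group H" and bij: "bij_betw f (carrier G) (carrier H)"
    and add: "\<And>x y. x \<in> carrier G \<Longrightarrow> y \<in> carrier G \<Longrightarrow> x \<oplus>\<^bsub>G\<^esub> y \<in> carrier G \<and> f (x \<oplus>\<^bsub>G\<^esub> y) = f x \<oplus>\<^bsub>H\<^esub> f y"
    and zero: "\<zero>\<^bsub>G\<^esub> \<in> carrier G" "f \<zero>\<^bsub>G\<^esub> = \<zero>\<^bsub>H\<^esub>"
  shows "abelian_group G"
proof -
  interpret H: abelian_group H by (rule H)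
  have inj: "x = y" if "f x = f y" "x \<in> carrier G" "y \<in> carrier G" for x y
    using bij that by (auto simp: bij_betw_def inj_on_def)
  have fH: "f x \<in> carrier H" if "x \<in> carrier G" for x using bij that by (auto simp: bij_betw_def)
  show ?thesis
  proof (rule abelian_groupI)
    fix x assume x: "x \<in> carrier G"
    obtain y where y: "y \<in> carrier G" "f y = \<ominus>\<^bsub>H\<^esub> f x"
      using bij fH[OF x] H.a_inv_closed[OF fH[OF x]] unfolding bij_betw_def by (metis imageE)
    show "\<exists>y\<in>carrier G. y \<oplus>\<^bsub>G\<^esub> x = \<zero>\<^bsub>G\<^esub>"
      using y x add zero fH by (intro bexI[OF _ y(1)] inj) (auto simp: H.l_neg)
    show "\<zero>\<^bsub>G\<^esub> \<oplus>\<^bsub>G\<^esub> x = x" using x add zero fH by (intro inj) auto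
  next
    fix x y assume x: "x \<in> carrier G" "y \<in> carrier G"
    then show "x \<oplus>\<^bsub>G\<^esub> y \<in> carrier G" using add by blast
    show "x \<oplus>\<^bsub>G\<^esub> y = y \<oplus>\<^bsub>G\<^esub> x" using x add fH by (intro inj) (auto simp: H.a_comm)
    fix z assume z: "z \<in> carrier G"
    then show "x \<oplus>\<^bsub>G\<^esub> y \<oplus>\<^bsub>G\<^esub> z = x \<oplus>\<^bsub>G\<^esub> (y \<oplus>\<^bsub>G\<^esub> z)" using x z add fH by (intro inj) (auto simp: H.a_assoc)
  qed (use zero in auto)
qed

section \<open>Functors isomorphic to the invariants and the comparison relation\<close>

context flat_hopf
begin

text \<open>\<open>T\<close> is isomorphic, via \<open>\<iota>\<close>, to the functor of invariants; invariants are taken inside \<open>F \<otimes> A\<^bsup>\<otimes>0\<^esup>\<close>, the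
  degree \<open>0\<close> part of the Hochschild complex.\<close>

definition inv_functor ::
    "('u, 'u, 'u, 'x) efunctor \<Rightarrow> (('u, 'u, 'u) dcomod \<Rightarrow> 'x \<Rightarrow> ('u, 'u) tens) \<Rightarrow> bool" where
  "inv_functor T \<iota> \<longleftrightarrow> (\<forall>F. difference_comodule R A F \<longrightarrow>
     bij_betw (\<iota> F) (carrier (on_obj T F)) (inv_tens F) \<and>
     (\<forall>x\<in>carrier (on_obj T F). \<forall>y\<in>carrier (on_obj T F).
        x \<oplus>\<^bsub>on_obj T F\<^esub> y \<in> carrier (on_obj T F) \<and> \<iota> F (x \<oplus>\<^bsub>on_obj T F\<^esub> y) = \<iota> F x \<oplus>\<^bsub>tens R F A 0\<^esub> \<iota> F y) \<and>
     \<zero>\<^bsub>on_obj T F\<^esub> \<in> carrier (on_obj T F) \<and> \<iota> F \<zero>\<^bsub>on_obj T F\<^esub> = \<zero>\<^bsub>tens R F A 0\<^esub> \<and>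
     (\<forall>r\<in>carrier R. \<forall>x\<in>carrier (on_obj T F).
        r \<odot>\<^bsub>on_obj T F\<^esub> x \<in> carrier (on_obj T F) \<and> \<iota> F (r \<odot>\<^bsub>on_obj T F\<^esub> x) = r \<odot>\<^bsub>tens R F A 0\<^esub> \<iota> F x) \<and>
     (\<forall>x\<in>carrier (on_obj T F).
        dsigma (on_obj T F) x \<in> carrier (on_obj T F) \<and>
        \<iota> F (dsigma (on_obj T F) x) = gmap R F A 0 (dsigma F) (dsigma A) (\<iota> F x)) \<and>
     (\<forall>F' \<phi> i. \<forall>x\<in>carrier (on_obj T F). difference_comodule R A F' \<and> \<phi> \<in> carrier (comod_ehom R A F F') \<longrightarrow>
        on_hom T F F' \<phi> i x \<in> carrier (on_obj T F') \<and>
        \<iota> F' (on_hom T F F' \<phi> i x) = tens_map R F' A 0 (\<phi> i) (\<iota> F x)))"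

lemma cocycles_hoch:
  assumes F: "difference_comodule R A F"
  shows "cocycles (hoch_complex R A F) (hoch_diff R A F) n =
    {k \<in> carrier (tens R F A n). hdiff F (coact F) n k = \<zero>\<^bsub>tens R F A (Suc n)\<^esub>}"
  using hoch_diff_eq[OF difference_comoduleD(1,4)[OF F]] by (auto simp: cocycles_def hoch_complex_def)

lemma coboundaries_hoch:
  assumes F: "difference_comodule R A F"
  shows "coboundaries (hoch_complex R A F) (hoch_diff R A F) 0 = {\<zero>\<^bsub>tens R F A 0\<^esub>}"
    "coboundaries (hoch_complex R A F) (hoch_diff R A F) (Suc m) = hdiff F (coact F) m ` carrier (tens R F A m)"
  using hoch_diff_eq[OF difference_comoduleD(1,4)[OF F]] by (auto simp: coboundaries_def hoch_complex_def)

lemma hoch_group: "difference_comodule R A F \<Longrightarrow> abelian_group (hoch_complex R A F n)"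
  unfolding hoch_complex_def
  by (rule abelian_group_cong[OF tens_group[OF difference_comoduleD(1)]]) auto

lemma hoch_minus: "x \<ominus>\<^bsub>hoch_complex R A F n\<^esub> y = x \<ominus>\<^bsub>tens R F A n\<^esub> y"
  by (rule a_minus_cong) (auto simp: hoch_complex_def)

lemma hoch_coboundaries_closed:
  assumes F: "difference_comodule R A F"
  shows "x \<in> coboundaries (hoch_complex R A F) (hoch_diff R A F) n \<Longrightarrow> x \<in> cocycles (hoch_complex R A F) (hoch_diff R A F) n"
    "x \<in> coboundaries (hoch_complex R A F) (hoch_diff R A F) n \<Longrightarrow> y \<in> coboundaries (hoch_complex R A F) (hoch_diff R A F) n \<Longrightarrow>
       x \<ominus>\<^bsub>tens R F A n\<^esub> y \<in> coboundaries (hoch_complex R A F) (hoch_diff R A F) n"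
    "\<zero>\<^bsub>tens R F A n\<^esub> \<in> coboundaries (hoch_complex R A F) (hoch_diff R A F) n"
proof -
  note FD = difference_comoduleD[OF F]
  note g = tens_group[OF FD(1)] and h = hdiff_additive[OF FD(1,4)]
  note z = additive_map_zero[OF g g h] and zc = abelian_monoid.zero_closed[OF abelian_group.axioms(1)[OF g]]
  show "x \<in> coboundaries (hoch_complex R A F) (hoch_diff R A F) n \<Longrightarrow> x \<in> cocycles (hoch_complex R A F) (hoch_diff R A F) n"
  proof (cases n)
    case 0
    then show "x \<in> coboundaries (hoch_complex R A F) (hoch_diff R A F) n \<Longrightarrow> x \<in> cocycles (hoch_complex R A F) (hoch_diff R A F) n"
      using z[of 0] zc[of 0] by (simp add: coboundaries_hoch(1)[OF F] cocycles_hoch[OF F])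
  next
    case (Suc m)
    then show "x \<in> coboundaries (hoch_complex R A F) (hoch_diff R A F) n \<Longrightarrow> x \<in> cocycles (hoch_complex R A F) (hoch_diff R A F) n"
      using hdiff_hdiff[OF FD(3)] hdiff_closed[OF FD(1,4)] by (auto simp: coboundaries_hoch(2)[OF F] cocycles_hoch[OF F])
  qed
  show "\<zero>\<^bsub>tens R F A n\<^esub> \<in> coboundaries (hoch_complex R A F) (hoch_diff R A F) n"
  proof (cases n)
    case 0
    then show ?thesis by (simp add: coboundaries_hoch(1)[OF F])
  next
    case (Suc m)
    then show ?thesis unfolding Suc coboundaries_hoch(2)[OF F] z[of m, symmetric] by (intro imageI zc)
  qed
  assume x: "x \<in> coboundaries (hoch_complex R A F) (hoch_diff R A F) n" and y: "y \<in> coboundaries (hoch_complex R A F) (hoch_diff R A F) n"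
  show "x \<ominus>\<^bsub>tens R F A n\<^esub> y \<in> coboundaries (hoch_complex R A F) (hoch_diff R A F) n"
  proof (cases n)
    case 0
    then show ?thesis using x y abelian_group.minus_self[OF g zc[of 0]] by (simp add: coboundaries_hoch(1)[OF F])
  next
    case (Suc m)
    interpret g: abelian_group "tens R F A m" by (rule g)
    obtain X Y where X: "X \<in> carrier (tens R F A m)" "x = hdiff F (coact F) m X" and Y: "Y \<in> carrier (tens R F A m)" "y = hdiff F (coact F) m Y"
      using x y by (auto simp: Suc coboundaries_hoch(2)[OF F])
    show ?thesis
      unfolding Suc X(2) Y(2) coboundaries_hoch(2)[OF F] additive_map_minus[OF g g h X(1) Y(1), symmetric]
      by (intro imageI g.minus_closed X(1) Y(1))
  qed
qed

context
  fixes T :: "('u, 'u, 'u, 'x) efunctor" and \<iota> :: "('u, 'u, 'u) dcomod \<Rightarrow> 'x \<Rightarrow> ('u, 'u) tens"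
  assumes T: "inv_functor T \<iota>"
begin

lemma
  assumes F: "difference_comodule R A F"
  shows \<iota>_bij: "bij_betw (\<iota> F) (carrier (on_obj T F)) (inv_tens F)"
    and T_add: "\<And>x y. x \<in> carrier (on_obj T F) \<Longrightarrow> y \<in> carrier (on_obj T F) \<Longrightarrow>
      x \<oplus>\<^bsub>on_obj T F\<^esub> y \<in> carrier (on_obj T F) \<and> \<iota> F (x \<oplus>\<^bsub>on_obj T F\<^esub> y) = \<iota> F x \<oplus>\<^bsub>tens R F A 0\<^esub> \<iota> F y"
    and T_zero: "\<zero>\<^bsub>on_obj T F\<^esub> \<in> carrier (on_obj T F)" "\<iota> F \<zero>\<^bsub>on_obj T F\<^esub> = \<zero>\<^bsub>tens R F A 0\<^esub>"
    and T_smult: "\<And>r x. r \<in> carrier R \<Longrightarrow> x \<in> carrier (on_obj T F) \<Longrightarrow>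
      r \<odot>\<^bsub>on_obj T F\<^esub> x \<in> carrier (on_obj T F) \<and> \<iota> F (r \<odot>\<^bsub>on_obj T F\<^esub> x) = r \<odot>\<^bsub>tens R F A 0\<^esub> \<iota> F x"
    and T_sigma: "\<And>x. x \<in> carrier (on_obj T F) \<Longrightarrow> dsigma (on_obj T F) x \<in> carrier (on_obj T F) \<and>
        \<iota> F (dsigma (on_obj T F) x) = gmap R F A 0 (dsigma F) (dsigma A) (\<iota> F x)"
    and T_hom: "\<And>F' \<phi> i x. difference_comodule R A F' \<Longrightarrow> \<phi> \<in> carrier (comod_ehom R A F F') \<Longrightarrow> x \<in> carrier (on_obj T F) \<Longrightarrow>
        on_hom T F F' \<phi> i x \<in> carrier (on_obj T F') \<and>
        \<iota> F' (on_hom T F F' \<phi> i x) = tens_map R F' A 0 (\<phi> i) (\<iota> F x)"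
  using T F unfolding inv_functor_def by blast+

lemma \<iota>_inv: "difference_comodule R A F \<Longrightarrow> x \<in> carrier (on_obj T F) \<Longrightarrow> \<iota> F x \<in> inv_tens F"
  using \<iota>_bij by (auto simp: bij_betw_def)

lemma \<iota>_closed: "difference_comodule R A F \<Longrightarrow> x \<in> carrier (on_obj T F) \<Longrightarrow> \<iota> F x \<in> carrier (tens R F A 0)"
  using \<iota>_inv[of F x] by (simp add: inv_tens_def)

lemma \<iota>_inj: "difference_comodule R A F \<Longrightarrow> \<iota> F x = \<iota> F y \<Longrightarrow> x \<in> carrier (on_obj T F) \<Longrightarrow> y \<in> carrier (on_obj T F) \<Longrightarrow> x = y"
  using \<iota>_bij[of F] by (auto simp: bij_betw_def inj_on_def)

lemma \<iota>_surj: "difference_comodule R A F \<Longrightarrow> X \<in> inv_tens F \<Longrightarrow> \<exists>x\<in>carrier (on_obj T F). \<iota> F x = X"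
  using \<iota>_bij[of F] unfolding bij_betw_def by (metis imageE)

lemma T_group: "difference_comodule R A F \<Longrightarrow> abelian_group (on_obj T F)"
  by (rule abelian_group_bij[OF inv_tens_abelian, of F "\<iota> F"]) (use T_add T_zero \<iota>_bij in auto)

lemma \<iota>_additive: "difference_comodule R A F \<Longrightarrow> additive_map (on_obj T F) (tens R F A 0) (\<iota> F)"
  using T_add \<iota>_closed by (auto simp: additive_map_def)

lemma T_hom_additive:
  assumes F: "difference_comodule R A F" "difference_comodule R A F'" and \<phi>: "\<phi> \<in> carrier (comod_ehom R A F F')"
  shows "additive_map (on_obj T F) (on_obj T F') (on_hom T F F' \<phi> i)"
proof (rule additive_mapI)
  fix x y assume x: "x \<in> carrier (on_obj T F)" and y: "y \<in> carrier (on_obj T F)"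
  note h = T_hom[OF F \<phi>]
  have l: "linear_map R F F' (\<phi> i)" using \<phi> by (simp add: ehom_iff)
  note t = tens_map_additive[OF difference_comoduleD(1)[OF F(1)] difference_comoduleD(1)[OF F(2)] l]
  show "on_hom T F F' \<phi> i (x \<oplus>\<^bsub>on_obj T F\<^esub> y) = on_hom T F F' \<phi> i x \<oplus>\<^bsub>on_obj T F'\<^esub> on_hom T F F' \<phi> i y"
    using x y h T_add[OF F(1)] T_add[OF F(2)] \<iota>_closed[OF F(1)] additive_map_add[OF t]
    by (intro \<iota>_inj[OF F(2)]) auto
qed (use T_hom[OF F \<phi>] in blast)

text \<open>The zigzag runs from position (1, n+1), where \<open>\<iota>\<close> places a cocycle of
  the complex computing the derived functor, to position (n+1, 1), where the augmentation places a
  Hochschild cocycle of \<open>F\<close>.\<close>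

definition hrel :: "('u, 'u, 'u) dcomod \<Rightarrow> ('u, 'u, 'u) resolution \<Rightarrow> nat \<Rightarrow> (('u, 'u) tens \<times> 'x) set" where
  "hrel F I n = {(k, l). k \<in> cocycles (hoch_complex R A F) (hoch_diff R A F) n \<and>
     l \<in> cocycles (applied_complex T I) (applied_diff T I) n \<and>
     zig (dcx F I) (dcx_d F I) (dcx_\<delta> F I) n 0 (\<iota> (res_obj I n) l) (tens_map R (res_obj I 0) A n (aug I) k)}"

context
  fixes F :: "('u, 'u, 'u) dcomod" and I :: "('u, 'u, 'u) resolution"
  assumes F: "difference_comodule R A F" and I: "enriched_injective_resolution R A F I"
begin

abbreviation "K n \<equiv> hoch_complex R A F n"
abbreviation "ZK n \<equiv> cocycles (hoch_complex R A F) (hoch_diff R A F) n"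
abbreviation "BK n \<equiv> coboundaries (hoch_complex R A F) (hoch_diff R A F) n"
abbreviation "L n \<equiv> on_obj T (res_obj I n)"
abbreviation "dL \<equiv> applied_diff T I"
abbreviation "ZL n \<equiv> cocycles (applied_complex T I) dL n"
abbreviation "BL n \<equiv> coboundaries (applied_complex T I) dL n"
abbreviation "eps n \<equiv> tens_map R (res_obj I 0) A n (aug I)"

lemma obj: "difference_comodule R A (res_obj I n)"
  using res_term_comodule[OF F I, of "Suc n"] by simp

lemma diff_ehom: "(\<lambda>_. res_diff I n) \<in> carrier (comod_ehom R A (res_obj I n) (res_obj I (Suc n)))"
  using res_map_hom[OF F I, of "Suc n"] by (intro comod_hom_ehom) simp

lemma dL_additive: "additive_map (L n) (L (Suc n)) (dL n)"
  unfolding applied_diff_def by (rule T_hom_additive[OF obj obj diff_ehom])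

lemma \<iota>_dL: "l \<in> carrier (L n) \<Longrightarrow> \<iota> (res_obj I (Suc n)) (dL n l) = tens_map R (res_obj I (Suc n)) A 0 (res_diff I n) (\<iota> (res_obj I n) l)"
  using T_hom[OF obj obj diff_ehom] unfolding applied_diff_def by blast

lemma ZL_iff: "l \<in> ZL n \<longleftrightarrow> l \<in> carrier (L n) \<and> tens_map R (res_obj I (Suc n)) A 0 (res_diff I n) (\<iota> (res_obj I n) l) = \<zero>\<^bsub>tens R (res_obj I (Suc n)) A 0\<^esub>"
proof (cases "l \<in> carrier (L n)")
  case l: True
  note d = additive_map_closed[OF dL_additive l]
  have "dL n l = \<zero>\<^bsub>L (Suc n)\<^esub> \<longleftrightarrow> \<iota> (res_obj I (Suc n)) (dL n l) = \<iota> (res_obj I (Suc n)) \<zero>\<^bsub>L (Suc n)\<^esub>"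
    using \<iota>_inj[OF obj _ d T_zero(1)[OF obj]] by metis
  then show ?thesis
    unfolding cocycles_def applied_complex_def \<iota>_dL[OF l] T_zero(2)[OF obj] using l by simp
next
  case False
  then show ?thesis by (simp add: cocycles_def applied_complex_def)
qed

lemma BL_simps: "BL 0 = {\<zero>\<^bsub>L 0\<^esub>}" "BL (Suc m) = dL m ` carrier (L m)"
  by (simp_all add: coboundaries_def applied_complex_def)

lemma BL_closed:
  "x \<in> BL n \<Longrightarrow> x \<in> ZL n" "x \<in> BL n \<Longrightarrow> y \<in> BL n \<Longrightarrow> x \<ominus>\<^bsub>L n\<^esub> y \<in> BL n"
proof -
  note g = T_group[OF obj]
  note z = additive_map_zero[OF g g dL_additive]
  show "x \<in> BL n \<Longrightarrow> x \<in> ZL n"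
  proof (cases n)
    case 0
    then show "x \<in> BL n \<Longrightarrow> x \<in> ZL n" using z[of 0] T_zero[OF obj] by (simp add: BL_simps cocycles_def applied_complex_def)
  next
    case (Suc m)
    assume "x \<in> BL n"
    then obtain y where y: "y \<in> carrier (L m)" "x = dL m y" by (auto simp: Suc BL_simps)
    have "tens_map R (res_obj I (Suc (Suc m))) A 0 (res_diff I (Suc m)) (\<iota> (res_obj I (Suc m)) (dL m y)) = \<zero>\<^bsub>tens R (res_obj I (Suc (Suc m))) A 0\<^esub>"
      using tens_map_res_zero[OF F I, of "\<iota> (res_obj I m) y" "Suc m" 0] \<iota>_closed[OF obj y(1)] by (simp add: \<iota>_dL[OF y(1)])
    then show "x \<in> ZL n" using additive_map_closed[OF dL_additive y(1)] by (simp add: Suc ZL_iff y(2))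
  qed
  show "x \<ominus>\<^bsub>L n\<^esub> y \<in> BL n" if x: "x \<in> BL n" and y: "y \<in> BL n"
  proof (cases n)
    case 0
    then show ?thesis using x y abelian_group.minus_self[OF g T_zero(1)[OF obj]] by (simp add: BL_simps)
  next
    case (Suc m)
    interpret g: abelian_group "L m" by (rule g)
    obtain X Y where X: "X \<in> carrier (L m)" "x = dL m X" and Y: "Y \<in> carrier (L m)" "y = dL m Y"
      using x y by (auto simp: Suc BL_simps)
    show ?thesis
      unfolding Suc X(2) Y(2) BL_simps additive_map_minus[OF g g dL_additive X(1) Y(1), symmetric]
      by (intro imageI g.minus_closed X(1) Y(1))
  qed
qed

lemma eps_additive: "additive_map (tens R F A n) (tens R (res_obj I 0) A n) (eps n)"
  using tens_map_additive[OF resD(1)[OF F I, of 0] resD(1)[OF F I, of "Suc 0"] res_map_linear[OF F I, of 0], of n] by simp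

lemma eps_inj: "inj_on (eps n) (carrier (tens R F A n))"
  using flat_inj[OF resD(1)[OF F I, of 0] resD(1)[OF F I, of "Suc 0"] res_map_linear[OF F I, of 0], of n] res_inj[OF F I] by simp

lemma eps_zero_iff: "k \<in> carrier (tens R F A n) \<Longrightarrow> eps n k = \<zero>\<^bsub>tens R (res_obj I 0) A n\<^esub> \<longleftrightarrow> k = \<zero>\<^bsub>tens R F A n\<^esub>"
proof -
  note FD = difference_comoduleD[OF F] and D0 = difference_comoduleD[OF obj[of 0]]
  have z: "eps n \<zero>\<^bsub>tens R F A n\<^esub> = \<zero>\<^bsub>tens R (res_obj I 0) A n\<^esub>"
    by (rule additive_map_zero[OF tens_group[OF FD(1)] tens_group[OF D0(1)] eps_additive])
  assume k: "k \<in> carrier (tens R F A n)"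
  have "k = \<zero>\<^bsub>tens R F A n\<^esub>" if "eps n k = \<zero>\<^bsub>tens R (res_obj I 0) A n\<^esub>"
    by (rule inj_onD[OF eps_inj _ k abelian_monoid.zero_closed[OF abelian_group.axioms(1)[OF tens_group[OF FD(1)]]]]) (simp add: z that)
  then show "eps n k = \<zero>\<^bsub>tens R (res_obj I 0) A n\<^esub> \<longleftrightarrow> k = \<zero>\<^bsub>tens R F A n\<^esub>" using z by auto
qed

lemma eps_hdiff: "k \<in> carrier (tens R F A n) \<Longrightarrow>
    hdiff (res_obj I 0) (coact (res_obj I 0)) n (eps n k) = eps (Suc n) (hdiff F (coact F) n k)"
  using hdiff_res[OF F I, of k 0 n] by simp

interpretation bc: bicomplex "dcx F I" "dcx_d F I" "dcx_\<delta> F I"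
  by (rule bicomplex_dcx[OF F I])

text \<open>Exactness of the row produces \<open>k\<close>. It is a cocycle because tensoring keeps
  the augmentation injective, so \<partial>k = 0 can be tested in the next column.\<close>

lemma bic_left: "bc.bic (Suc n) (Suc 0) = eps n ` ZK n"
proof
  show "bc.bic (Suc n) (Suc 0) \<subseteq> eps n ` ZK n"
  proof
    fix z assume z: "z \<in> bc.bic (Suc n) (Suc 0)"
    then obtain k where k: "k \<in> carrier (tens R F A n)" "eps n k = z"
      using bc.row[of z n 0] by (auto simp: bc.bic_def dcx_simps)
    then have "eps (Suc n) (hdiff F (coact F) n k) = \<zero>\<^bsub>tens R (res_obj I 0) A (Suc n)\<^esub>"
      using z by (simp add: eps_hdiff[symmetric] bc.bic_def dcx_simps)
    then have "k \<in> ZK n"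
      using eps_zero_iff[OF hdiff_closed[OF difference_comoduleD(1,4)[OF F] k(1)]] k(1) by (simp add: cocycles_hoch[OF F])
    then show "z \<in> eps n ` ZK n" using k by blast
  qed
  show "eps n ` ZK n \<subseteq> bc.bic (Suc n) (Suc 0)"
  proof
    fix z assume "z \<in> eps n ` ZK n"
    then obtain k where k: "k \<in> carrier (tens R F A n)" "hdiff F (coact F) n k = \<zero>\<^bsub>tens R F A (Suc n)\<^esub>" "z = eps n k"
      by (auto simp: cocycles_hoch[OF F])
    have "eps (Suc n) \<zero>\<^bsub>tens R F A (Suc n)\<^esub> = \<zero>\<^bsub>tens R (res_obj I 0) A (Suc n)\<^esub>"
      by (rule additive_map_zero[OF tens_group[OF difference_comoduleD(1)[OF F]] tens_group[OF difference_comoduleD(1)[OF obj]] eps_additive])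
    then show "z \<in> bc.bic (Suc n) (Suc 0)"
      using k additive_map_closed[OF eps_additive k(1)] tens_map_res_zero[OF F I, of k 0 n] eps_hdiff[OF k(1)]
      by (simp add: bc.bic_def dcx_simps)
  qed
qed

text \<open>In tensor degree 0 the \<delta>-cycles are the invariants, that is, the values of
  \<open>\<iota>\<close>; being a d-cycle is then the cocycle condition.\<close>

lemma bic_bottom: "bc.bic (Suc 0) (Suc n) = \<iota> (res_obj I n) ` ZL n"
proof
  show "bc.bic (Suc 0) (Suc n) \<subseteq> \<iota> (res_obj I n) ` ZL n"
  proof
    fix y assume y: "y \<in> bc.bic (Suc 0) (Suc n)"
    then have "y \<in> inv_tens (res_obj I n)" by (auto simp: bc.bic_def dcx_simps inv_tens_def)
    then obtain l where l: "l \<in> carrier (L n)" "\<iota> (res_obj I n) l = y" using \<iota>_surj[OF obj] by blast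
    then have "l \<in> ZL n" using y by (simp add: ZL_iff bc.bic_def dcx_simps)
    then show "y \<in> \<iota> (res_obj I n) ` ZL n" using l by blast
  qed
  show "\<iota> (res_obj I n) ` ZL n \<subseteq> bc.bic (Suc 0) (Suc n)"
    using \<iota>_inv[OF obj] by (auto simp: bc.bic_def dcx_simps ZL_iff inv_tens_def)
qed

text \<open>In positive degree these elements are augmented coboundaries, and injectivity of
  \<open>eps\<close> removes the augmentation. In degree 0 the zero corner leaves only 0, in
  agreement with \<open>coboundaries\<close>.\<close>

lemma bd_left: "k \<in> carrier (tens R F A n) \<Longrightarrow> eps n k \<in> bc.bd n 0 \<longleftrightarrow> k \<in> BK n"
proof -
  assume k: "k \<in> carrier (tens R F A n)"
  note FD = difference_comoduleD[OF F] and D0 = difference_comoduleD[OF obj[of 0]]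
  show ?thesis
  proof (cases n)
    case 0
    have "eps 0 \<zero>\<^bsub>tens R F A 0\<^esub> = \<zero>\<^bsub>tens R (res_obj I 0) A 0\<^esub>"
      by (rule additive_map_zero[OF tens_group[OF FD(1)] tens_group[OF D0(1)] eps_additive])
    then show ?thesis using eps_zero_iff[OF k] by (simp add: 0 bc.bd_def dcx_simps coboundaries_hoch(1)[OF F])
  next
    case (Suc m)
    have "bc.bd (Suc m) 0 = (\<lambda>z. eps (Suc m) (hdiff F (coact F) m z)) ` carrier (tens R F A m)"
      unfolding bc.bd_def dcx_simps by (rule image_cong) (simp_all add: eps_hdiff)
    then have "eps n k \<in> bc.bd n 0 \<longleftrightarrow> (\<exists>z\<in>carrier (tens R F A m). eps (Suc m) k = eps (Suc m) (hdiff F (coact F) m z))"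
      by (auto simp: Suc)
    also have "\<dots> \<longleftrightarrow> (\<exists>z\<in>carrier (tens R F A m). k = hdiff F (coact F) m z)"
      using inj_on_eq_iff[OF eps_inj[of "Suc m"]] k hdiff_closed[OF FD(1,4)] by (auto simp: Suc)
    finally show ?thesis by (auto simp: Suc coboundaries_hoch(2)[OF F])
  qed
qed

text \<open>Row 0 consists of invariants and is included by \<delta>, so in positive degree
  \<open>bd 0 n\<close> is the image of the differential between invariants; in degree 0 the zero
  corner again leaves only 0.\<close>

lemma bd_bottom: "l \<in> carrier (L n) \<Longrightarrow> \<iota> (res_obj I n) l \<in> bc.bd 0 n \<longleftrightarrow> l \<in> BL n"
proof -
  assume l: "l \<in> carrier (L n)"
  show ?thesis
  proof (cases n)
    case 0
    have "eps 0 \<zero>\<^bsub>tens R F A 0\<^esub> = \<zero>\<^bsub>tens R (res_obj I 0) A 0\<^esub>"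
      by (rule additive_map_zero[OF tens_group[OF difference_comoduleD(1)[OF F]] tens_group[OF difference_comoduleD(1)[OF obj]] eps_additive])
    then have "\<iota> (res_obj I n) l \<in> bc.bd 0 n \<longleftrightarrow> \<iota> (res_obj I 0) l = \<iota> (res_obj I 0) \<zero>\<^bsub>L 0\<^esub>"
      using T_zero[OF obj[of 0]] by (simp add: 0 bc.bd_def dcx_simps)
    then show ?thesis using \<iota>_inj[OF obj[of 0]] l T_zero[OF obj[of 0]] by (auto simp: 0 BL_simps)
  next
    case (Suc m)
    have "inv_tens (res_obj I m) = \<iota> (res_obj I m) ` carrier (L m)"
      using \<iota>_bij[OF obj, of m] by (simp add: bij_betw_def)
    then have "bc.bd 0 (Suc m) = (\<lambda>x. tens_map R (res_obj I (Suc m)) A 0 (res_diff I m) (\<iota> (res_obj I m) x)) ` carrier (L m)"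
      by (simp add: bc.bd_def dcx_simps image_image)
    also have "\<dots> = (\<lambda>x. \<iota> (res_obj I (Suc m)) (dL m x)) ` carrier (L m)"
      by (rule image_cong) (simp_all add: \<iota>_dL)
    finally have "\<iota> (res_obj I n) l \<in> bc.bd 0 n \<longleftrightarrow> (\<exists>x\<in>carrier (L m). \<iota> (res_obj I (Suc m)) l = \<iota> (res_obj I (Suc m)) (dL m x))"
      by (auto simp: Suc)
    also have "\<dots> \<longleftrightarrow> (\<exists>x\<in>carrier (L m). l = dL m x)"
    proof (rule bex_cong[OF refl])
      fix x assume "x \<in> carrier (L m)"
      then have "dL m x \<in> carrier (L (Suc m))" by (rule additive_map_closed[OF dL_additive])
      then show "\<iota> (res_obj I (Suc m)) l = \<iota> (res_obj I (Suc m)) (dL m x) \<longleftrightarrow> l = dL m x"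
        using \<iota>_inj[OF obj[of "Suc m"]] l by (auto simp: Suc)
    qed
    finally show ?thesis by (auto simp: Suc BL_simps)
  qed
qed

lemma coset_relation_hrel: "coset_relation (K n) (ZK n) (BK n) (L n) (ZL n) (BL n) (hrel F I n)"
proof -
  note FD = difference_comoduleD[OF F] and D0 = difference_comoduleD[OF obj[of 0]]
  have ZKc: "k \<in> carrier (tens R F A n)" if "k \<in> ZK n" for k using that by (simp add: cocycles_hoch[OF F])
  have ZLc: "l \<in> carrier (L n)" if "l \<in> ZL n" for l using that by (simp add: ZL_iff)
  note gK = tens_group[OF FD(1)] and gL = T_group[OF obj]
  note hK = hdiff_additive[OF FD(1,4)]
  note minusK = additive_map_minus[OF gK gK hK] and minusL = additive_map_minus[OF gL gL dL_additive]
  interpret K1: abelian_group "tens R F A n" by (rule gK)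
  interpret K2: abelian_group "tens R F A (Suc n)" by (rule gK)
  interpret L1: abelian_group "L n" by (rule gL)
  interpret L2: abelian_group "L (Suc n)" by (rule gL)
  have ZKm: "k \<ominus>\<^bsub>tens R F A n\<^esub> k' \<in> ZK n" if "k \<in> ZK n" "k' \<in> ZK n" for k k'
    using that by (simp add: cocycles_hoch[OF F] minusK K2.minus_self)
  have ZLm: "l \<ominus>\<^bsub>L n\<^esub> l' \<in> ZL n" if "l \<in> ZL n" "l' \<in> ZL n" for l l'
    using that by (simp add: cocycles_def applied_complex_def minusL L2.minus_self)
  show ?thesis
  proof (intro coset_relation.intro coset_relation_axioms.intro hoch_group[OF F] gL)
    show "ZK n \<subseteq> carrier (K n)" using ZKc by (auto simp: hoch_complex_def)
    show "BK n \<subseteq> ZK n" using hoch_coboundaries_closed(1)[OF F] by blast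
    show "ZL n \<subseteq> carrier (L n)" using ZLc by blast
    show "BL n \<subseteq> ZL n" using BL_closed(1) by blast
    show "\<zero>\<^bsub>K n\<^esub> \<in> BK n" using hoch_coboundaries_closed(3)[OF F] by (simp add: hoch_complex_def)
    show "hrel F I n \<subseteq> ZK n \<times> ZL n" by (auto simp: hrel_def)
    show "\<exists>l. (k, l) \<in> hrel F I n" if k: "k \<in> ZK n" for k
    proof -
      \<comment> \<open>\<open>k\<close> sits at the end of the zigzag, so totality of the relation
        in \<open>k\<close> is \<open>zig_onto\<close>, and ontoness is
        \<open>zig_total\<close>.\<close>
      have "eps n k \<in> bc.bic (Suc (0 + n)) (Suc 0)" using bic_left k by auto
      then obtain y where y: "y \<in> bc.bic (Suc 0) (Suc n)" "zig (dcx F I) (dcx_d F I) (dcx_\<delta> F I) n 0 y (eps n k)"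
        using bc.zig_onto by blast
      then obtain l where "l \<in> ZL n" "y = \<iota> (res_obj I n) l" using bic_bottom by auto
      then show ?thesis using y k by (auto simp: hrel_def)
    qed
    show "\<exists>k. (k, l) \<in> hrel F I n" if l: "l \<in> ZL n" for l
    proof -
      have y: "\<iota> (res_obj I n) l \<in> bc.bic (Suc 0) (Suc n)" using bic_bottom l by auto
      then obtain z where z: "zig (dcx F I) (dcx_d F I) (dcx_\<delta> F I) n 0 (\<iota> (res_obj I n) l) z"
        using bc.zig_total by blast
      then have "z \<in> bc.bic (Suc n) (Suc 0)" using bc.zig_bic[OF z y] by simp
      then obtain k where "k \<in> ZK n" "z = eps n k" using bic_left by auto
      then show ?thesis using z l by (auto simp: hrel_def)
    qed
    show "(k \<ominus>\<^bsub>K n\<^esub> k', l \<ominus>\<^bsub>L n\<^esub> l') \<in> hrel F I n" if "(k, l) \<in> hrel F I n" "(k', l') \<in> hrel F I n" for k l k' l'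
    proof -
      have kl: "k \<in> ZK n" "k' \<in> ZK n" "l \<in> ZL n" "l' \<in> ZL n"
        "zig (dcx F I) (dcx_d F I) (dcx_\<delta> F I) n 0 (\<iota> (res_obj I n) l) (eps n k)"
        "zig (dcx F I) (dcx_d F I) (dcx_\<delta> F I) n 0 (\<iota> (res_obj I n) l') (eps n k')"
        using that by (auto simp: hrel_def)
      have "\<iota> (res_obj I n) (l \<ominus>\<^bsub>L n\<^esub> l') = \<iota> (res_obj I n) l \<ominus>\<^bsub>dcx F I (Suc 0) (Suc n)\<^esub> \<iota> (res_obj I n) l'"
        using additive_map_minus[OF gL tens_group[OF difference_comoduleD(1)[OF obj]] \<iota>_additive[OF obj] ZLc[OF kl(3)] ZLc[OF kl(4)]]
        by (simp add: dcx_simps)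
      moreover have "eps n (k \<ominus>\<^bsub>tens R F A n\<^esub> k') = eps n k \<ominus>\<^bsub>dcx F I (Suc (0 + n)) (Suc 0)\<^esub> eps n k'"
        using additive_map_minus[OF gK tens_group[OF D0(1)] eps_additive ZKc[OF kl(1)] ZKc[OF kl(2)]]
        by (simp add: dcx_simps)
      ultimately show ?thesis
        using bc.zig_minus[OF kl(5,6)] ZKm[OF kl(1,2)] ZLm[OF kl(3,4)] by (simp add: hrel_def hoch_minus)
    qed
    show "k \<in> BK n \<longleftrightarrow> l \<in> BL n" if "(k, l) \<in> hrel F I n" for k l
    proof -
      have kl: "k \<in> ZK n" "l \<in> ZL n"
        "zig (dcx F I) (dcx_d F I) (dcx_\<delta> F I) n 0 (\<iota> (res_obj I n) l) (eps n k)"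
        using that by (auto simp: hrel_def)
      have "\<iota> (res_obj I n) l \<in> bc.bic (Suc 0) (Suc n)" using bic_bottom kl by auto
      from bc.zig_bd[OF kl(3) this] show ?thesis
        using bd_left[OF ZKc[OF kl(1)]] bd_bottom[OF ZLc[OF kl(2)]] by simp
    qed
    show "x \<ominus>\<^bsub>K n\<^esub> y \<in> BK n" if "x \<in> BK n" "y \<in> BK n" for x y
      using hoch_coboundaries_closed(2)[OF F that] by (simp add: hoch_minus)
  qed (use BL_closed(2) in auto)
qed

end

end

end

text \<open>One related pair with first component in \<open>X\<close> computes both sides, since the
  relation and the induced maps all send cosets to cosets.\<close>

lemma coset_relation_map:
  assumes r1: "coset_relation G Z B H Z' B' \<rho>" and r2: "coset_relation G2 Z2 B2 H2 Z2' B2' \<rho>2"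
    and f: "additive_map G G2 f" "\<And>b. b \<in> B \<Longrightarrow> f b \<in> B2"
    and g: "additive_map H H2 g" "\<And>b. b \<in> B' \<Longrightarrow> g b \<in> B2'"
    and fg: "\<And>x y. (x, y) \<in> \<rho> \<Longrightarrow> (f x, g y) \<in> \<rho>2"
    and X: "X \<in> (\<lambda>x. B +>\<^bsub>G\<^esub> x) ` Z"
  shows "\<rho>2 `` (coset_map G2 B2 f X) = coset_map H2 B2' g (\<rho> `` X)"
proof -
  interpret r1: coset_relation G Z B H Z' B' \<rho> by (rule r1)
  interpret r2: coset_relation G2 Z2 B2 H2 Z2' B2' \<rho>2 by (rule r2)
  obtain x where x: "x \<in> Z" "X = B +>\<^bsub>G\<^esub> x" using X by blast
  obtain y where xy: "(x, y) \<in> \<rho>" using r1.total[OF x(1)] by blast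
  have "coset_map G2 B2 f X = B2 +>\<^bsub>G2\<^esub> f x"
    unfolding x(2)
    by (rule coset_map_coset[OF r2.subgroup_B r2.G.abelian_group_axioms _ r1.zero r1.G.abelian_group_axioms f])
      (use r1.B r1.Z x in auto)
  moreover have "coset_map H2 B2' g (B' +>\<^bsub>H\<^esub> y) = B2' +>\<^bsub>H2\<^esub> g y"
    by (rule coset_map_coset[OF r2.subgroup_B' r2.H.abelian_group_axioms _ r1.zero'(1) r1.H.abelian_group_axioms g])
      (use r1.B' r1.Z' r1.mem[OF xy] in auto)
  ultimately show ?thesis
    using r1.coset[OF xy] r2.coset[OF fg[OF xy]] by (simp add: x(2))
qed

section \<open>Naturality of the comparison\<close>

context flat_hopf
begin

text \<open>The single naturality statement behind scalars, \<sigma> and enriched morphisms.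
  \<open>f\<close> and \<open>hL\<close> are described by their effect only, because in these uses
  they appear as the scalar action, the difference operator or the action on hom objects.\<close>

lemma hrel_map:
  fixes T :: "('u, 'u, 'u, 'x) efunctor"
  assumes T: "inv_functor T \<iota>"
    and F: "difference_comodule R A F" and I: "enriched_injective_resolution R A F I"
    and F': "difference_comodule R A F'" and I': "enriched_injective_resolution R A F' I'"
    and c: "\<And>q. compat \<theta> (res_term F I q) (coact (res_term F I q)) (res_term F' I' q) (coact (res_term F' I' q)) (\<phi> q) \<tau>"
    and e: "\<And>q x. x \<in> carrier (res_term F I q) \<Longrightarrow> \<phi> (Suc q) (res_map I q x) = res_map I' q (\<phi> q x)"
    and hL: "\<And>q l. l \<in> carrier (on_obj T (res_obj I q)) \<Longrightarrow> hL q l \<in> carrier (on_obj T (res_obj I' q))"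
      "\<And>q l. l \<in> carrier (on_obj T (res_obj I q)) \<Longrightarrow>
        \<iota> (res_obj I' q) (hL q l) = gmap R (res_obj I' q) A 0 (\<phi> (Suc q)) \<tau> (\<iota> (res_obj I q) l)"
    and f: "\<And>k. k \<in> carrier (tens R F A n) \<Longrightarrow> f k = gmap R F' A n (\<phi> 0) \<tau> k"
    and X: "X \<in> carrier (cohomology (hoch_complex R A F) (hoch_diff R A F) n)"
  shows "hrel T \<iota> F' I' n `` coset_map (hoch_complex R A F' n) (coboundaries (hoch_complex R A F') (hoch_diff R A F') n) f X =
    coset_map (applied_complex T I' n) (coboundaries (applied_complex T I') (applied_diff T I') n) (hL n) (hrel T \<iota> F I n `` X)"
proof -
  note D = resD[OF F I] and D' = resD[OF F' I']
  note FD = difference_comoduleD[OF F] and FD' = difference_comoduleD[OF F']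
  note l = res_map_linear[OF F I] and l' = res_map_linear[OF F' I']
  have s: "semilinear R \<theta> (res_term F I q) (res_term F' I' q) (\<phi> q)" and \<tau>: "semilinear R \<theta> A A \<tau>" for q
    using c[of q] by (auto simp: compat_def)
  have s0: "semilinear R \<theta> F F' (\<phi> 0)" using s[of 0] by simp
  note sl = l[unfolded linear_map_iff] and sl' = l'[unfolded linear_map_iff]
  \<comment> \<open>\<open>\<phi> 0\<close> acts on \<open>F\<close> and
    \<open>\<phi> (Suc q)\<close> on term \<open>q\<close> of the resolution; the factors
    \<open>A\<close> are acted on by \<open>\<tau>\<close>.\<close>
  let ?h = "\<lambda>p q. gmap R (res_term F' I' q) A p (\<phi> q) \<tau>"
  have hc: "?h p q X \<in> carrier (tens R (res_term F' I' q) A p)" if "X \<in> carrier (tens R (res_term F I q) A p)" for p q X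
    by (rule additive_map_closed[OF gmap_additive[OF D(1) D'(1) s \<tau>] that])
  have hd: "?h p (Suc q) (tens_map R (res_term F I (Suc q)) A p (res_map I q) X) =
      tens_map R (res_term F' I' (Suc q)) A p (res_map I' q) (?h p q X)"
    if X: "X \<in> carrier (tens R (res_term F I q) A p)" for p q X
  proof -
    have s1: "semilinear R \<theta> (res_term F I q) (res_term F' I' (Suc q)) (\<lambda>x. \<phi> (Suc q) (res_map I q x))"
      using sl[of q] s[of "Suc q"] unfolding semilinear_def additive_map_def Pi_iff by simp
    have s2: "semilinear R \<theta> (res_term F I q) (res_term F' I' (Suc q)) (\<lambda>x. res_map I' q (\<phi> q x))"
      using sl'[of q] s[of q] unfolding semilinear_def additive_map_def Pi_iff by simp
    show ?thesis
      unfolding tens_map_gmap gmap_comp[OF D(1) D(1) D'(1) sl semilinear_id s \<tau> X] gmap_comp[OF D(1) D'(1) D'(1) s \<tau> sl' semilinear_id X]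
      by (rule gmap_cong[OF D(1) D'(1) s1 \<tau> s2 \<tau> e _ X]) auto
  qed
  have h\<delta>: "hdiff (res_term F' I' q) (coact (res_term F' I' q)) p (?h p q X) = ?h (Suc p) q (hdiff (res_term F I q) (coact (res_term F I q)) p X)"
    if "X \<in> carrier (tens R (res_term F I q) A p)" for p q X
    by (rule hdiff_gmap[OF D(1,4) D'(1,4) c that])
  have fc: "f k \<in> carrier (tens R F' A n)" if "k \<in> carrier (tens R F A n)" for k
    using hc[of k 0 n] that by (simp add: f)
  have fadd: "additive_map (hoch_complex R A F n) (hoch_complex R A F' n) f"
    using gmap_additive[OF FD(1) FD'(1) s0 \<tau>, of n] abelian_monoid.a_closed[OF abelian_group.axioms(1)[OF tens_group[OF FD(1), of n]]]
    by (simp add: additive_map_def hoch_complex_def f Pi_iff)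
  have obj: "difference_comodule R A (res_obj I q)" "difference_comodule R A (res_obj I' q)" for q
    using obj[OF T F I] obj[OF T F' I'] by auto
  have gadd: "additive_map (on_obj T (res_obj I n)) (on_obj T (res_obj I' n)) (hL n)"
  proof (rule additive_mapI)
    fix x y assume x: "x \<in> carrier (on_obj T (res_obj I n))" and y: "y \<in> carrier (on_obj T (res_obj I n))"
    note ga = gmap_additive[OF D(1)[of "Suc n"] D'(1)[of "Suc n"] s \<tau>, of 0, simplified]
    show "hL n (x \<oplus>\<^bsub>on_obj T (res_obj I n)\<^esub> y) = hL n x \<oplus>\<^bsub>on_obj T (res_obj I' n)\<^esub> hL n y"
      using T_add[OF T obj(1) x y] T_add[OF T obj(2) hL(1)[OF x] hL(1)[OF y]] hL(1)[of _ n] \<iota>_closed[OF T obj(1) x] \<iota>_closed[OF T obj(1) y]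
      by (intro \<iota>_inj[OF T obj(2)]) (auto simp: hL x y additive_map_add[OF ga])
  qed (rule hL(1))
  \<comment> \<open>\<open>hL\<close> is known only through the injective map
    \<open>\<iota>\<close>; after applying it, the claim becomes functoriality of
    \<open>gmap\<close> in degree 0.\<close>
  have hLd: "hL (Suc m) (applied_diff T I m l) = applied_diff T I' m (hL m l)" if l: "l \<in> carrier (on_obj T (res_obj I m))" for m l
  proof (rule \<iota>_inj[OF T obj(2)])
    note d = additive_map_closed[OF dL_additive[OF T F I] l] and d' = additive_map_closed[OF dL_additive[OF T F' I'] hL(1)[OF l]]
    show "hL (Suc m) (applied_diff T I m l) \<in> carrier (on_obj T (res_obj I' (Suc m)))" by (rule hL(1)[OF d])
    show "applied_diff T I' m (hL m l) \<in> carrier (on_obj T (res_obj I' (Suc m)))" by (rule d')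
    show "\<iota> (res_obj I' (Suc m)) (hL (Suc m) (applied_diff T I m l)) = \<iota> (res_obj I' (Suc m)) (applied_diff T I' m (hL m l))"
      unfolding hL(2)[OF d] \<iota>_dL[OF T F I l] \<iota>_dL[OF T F' I' hL(1)[OF l]] hL(2)[OF l]
      using hd[of "\<iota> (res_obj I m) l" "Suc m" 0] \<iota>_closed[OF T obj(1) l] by simp
  qed
  have nat: "(f k, hL n l) \<in> hrel T \<iota> F' I' n" if kl: "(k, l) \<in> hrel T \<iota> F I n" for k l
  proof -
    have k: "k \<in> carrier (tens R F A n)" "hdiff F (coact F) n k = \<zero>\<^bsub>tens R F A (Suc n)\<^esub>"
      and l: "l \<in> cocycles (applied_complex T I) (applied_diff T I) n"
      and z: "zig (dcx F I) (dcx_d F I) (dcx_\<delta> F I) n 0 (\<iota> (res_obj I n) l) (tens_map R (res_obj I 0) A n (aug I) k)"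
      using kl by (auto simp: hrel_def[OF T] cocycles_hoch[OF F])
    have lc: "l \<in> carrier (on_obj T (res_obj I n))" and dl: "applied_diff T I n l = \<zero>\<^bsub>on_obj T (res_obj I (Suc n))\<^esub>"
      using l by (auto simp: cocycles_def applied_complex_def)
    have "hdiff F' (coact F') n (f k) = \<zero>\<^bsub>tens R F' A (Suc n)\<^esub>"
      using h\<delta>[of k 0 n] k additive_map_zero[OF tens_group[OF FD(1)] tens_group[OF FD'(1)] gmap_additive[OF FD(1) FD'(1) s0 \<tau>, of "Suc n"]]
      by (simp add: f)
    then have 1: "f k \<in> cocycles (hoch_complex R A F') (hoch_diff R A F') n"
      using fc[OF k(1)] by (simp add: cocycles_hoch[OF F'])
    have "hL (Suc n) \<zero>\<^bsub>on_obj T (res_obj I (Suc n))\<^esub> = \<zero>\<^bsub>on_obj T (res_obj I' (Suc n))\<^esub>"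
    proof (rule \<iota>_inj[OF T obj(2)])
      note z = T_zero[OF T obj(1), of "Suc n"] and z' = T_zero[OF T obj(2), of "Suc n"]
      show "hL (Suc n) \<zero>\<^bsub>on_obj T (res_obj I (Suc n))\<^esub> \<in> carrier (on_obj T (res_obj I' (Suc n)))" by (rule hL(1)[OF z(1)])
      show "\<iota> (res_obj I' (Suc n)) (hL (Suc n) \<zero>\<^bsub>on_obj T (res_obj I (Suc n))\<^esub>) = \<iota> (res_obj I' (Suc n)) \<zero>\<^bsub>on_obj T (res_obj I' (Suc n))\<^esub>"
        unfolding hL(2)[OF z(1)] z(2) z'(2)
        using additive_map_zero[OF tens_group[OF D(1)] tens_group[OF D'(1)] gmap_additive[OF D(1) D'(1) s \<tau>], of "Suc (Suc n)" 0] by simp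
    qed (rule T_zero(1)[OF T obj(2)])
    then have 2: "hL n l \<in> cocycles (applied_complex T I') (applied_diff T I') n"
      using hLd[OF lc] hL(1)[OF lc] dl by (simp add: cocycles_def applied_complex_def)
    \<comment> \<open>Row \<open>p + 1\<close> has tensor degree \<open>p\<close>, hence the shifted
      index in the family handed to \<open>zig_natural\<close>.\<close>
    have "zig (dcx F' I') (dcx_d F' I') (dcx_\<delta> F' I') n 0 ((\<lambda>p q. ?h (p - Suc 0) q) (Suc 0) (Suc n) (\<iota> (res_obj I n) l))
        ((\<lambda>p q. ?h (p - Suc 0) q) (Suc (0 + n)) (Suc 0) (tens_map R (res_obj I 0) A n (aug I) k))"
    proof (rule zig_natural[OF _ _ _ z])
      fix p q X assume X: "X \<in> carrier (dcx F I (Suc p) (Suc q))"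
      then have X': "X \<in> carrier (tens R (res_term F I (Suc q)) A p)" by (simp add: dcx_simps)
      show "?h (Suc p - Suc 0) (Suc q) X \<in> carrier (dcx F' I' (Suc p) (Suc q))"
        using hc[OF X'] by (simp add: dcx_simps)
      show "?h (Suc p - Suc 0) (Suc (Suc q)) (dcx_d F I (Suc p) (Suc q) X) = dcx_d F' I' (Suc p) (Suc q) (?h (Suc p - Suc 0) (Suc q) X)"
        using hd[OF X'] by (simp add: dcx_simps)
      show "?h (Suc (Suc p) - Suc 0) (Suc q) (dcx_\<delta> F I (Suc p) (Suc q) X) = dcx_\<delta> F' I' (Suc p) (Suc q) (?h (Suc p - Suc 0) (Suc q) X)"
        using h\<delta>[OF X'] by (simp add: dcx_simps)
    qed
    then have 3: "zig (dcx F' I') (dcx_d F' I') (dcx_\<delta> F' I') n 0 (\<iota> (res_obj I' n) (hL n l)) (tens_map R (res_obj I' 0) A n (aug I') (f k))"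
      using hd[of k 0 n] k(1) by (simp add: hL(2)[OF lc] f)
    show ?thesis using 1 2 3 by (simp add: hrel_def[OF T])
  qed
  have fB: "f b \<in> coboundaries (hoch_complex R A F') (hoch_diff R A F') n" if b: "b \<in> coboundaries (hoch_complex R A F) (hoch_diff R A F) n" for b
  proof (cases n)
    case 0
    then show ?thesis
      using b f[of b] additive_map_zero[OF tens_group[OF FD(1)] tens_group[OF FD'(1)] gmap_additive[OF FD(1) FD'(1) s0 \<tau>, of 0]]
       abelian_monoid.zero_closed[OF abelian_group.axioms(1)[OF tens_group[OF FD(1), of 0]]]
      by (simp add: coboundaries_hoch(1)[OF F] coboundaries_hoch(1)[OF F'])
  next
    case (Suc m)
    then obtain y where y: "y \<in> carrier (tens R F A m)" "b = hdiff F (coact F) m y" using b by (auto simp: coboundaries_hoch(2)[OF F])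
    have "f b = hdiff F' (coact F') m (?h m 0 y)"
      using h\<delta>[of y 0 m] f[of b] hdiff_closed[OF FD(1,4) y(1)] y by (simp add: Suc)
    then show ?thesis using hc[of y 0 m] y(1) by (simp add: Suc coboundaries_hoch(2)[OF F'])
  qed
  have gB: "hL n b \<in> coboundaries (applied_complex T I') (applied_diff T I') n" if b: "b \<in> coboundaries (applied_complex T I) (applied_diff T I) n" for b
  proof (cases n)
    case 0
    then show ?thesis
      using b additive_map_zero[OF T_group[OF T obj(1)] T_group[OF T obj(2)] gadd] by (simp add: BL_simps[OF T F I] BL_simps[OF T F' I'])
  next
    case (Suc m)
    then obtain y where y: "y \<in> carrier (on_obj T (res_obj I m))" "b = applied_diff T I m y" using b by (auto simp: BL_simps[OF T F I])
    then show ?thesis using hLd[OF y(1)] hL(1)[OF y(1)] by (simp add: Suc BL_simps[OF T F' I'])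
  qed
  have X': "X \<in> (\<lambda>x. coboundaries (hoch_complex R A F) (hoch_diff R A F) n +>\<^bsub>hoch_complex R A F n\<^esub> x) ` cocycles (hoch_complex R A F) (hoch_diff R A F) n"
    using X by (simp add: cohomology_def Let_def)
  show ?thesis
    unfolding applied_complex_def[of T I' n]
    by (rule coset_relation_map[OF coset_relation_hrel[OF T F I] coset_relation_hrel[OF T F' I'] fadd fB gadd gB nat X'])
qed

lemma ehom_comp_hom:
  fixes F G H :: "('u, 'u, 'u) dcomod"
  assumes F: "difference_comodule R A F" and G: "difference_comodule R A G" and H: "difference_comodule R A H"
    and \<phi>: "\<phi> \<in> carrier (comod_ehom R A F G)" and g: "g \<in> comod_hom R A G H"
  shows "(\<lambda>i. \<lambda>x\<in>carrier F. g (\<phi> i x)) \<in> carrier (comod_ehom R A F H)"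
proof -
  note FD = difference_comoduleD[OF F] and GD = difference_comoduleD[OF G] and HD = difference_comoduleD[OF H]
  have \<phi>l: "linear_map R F G (\<phi> i)" for i using \<phi> by (simp add: ehom_iff)
  have gl: "linear_map R G H g" using g by (simp add: comod_hom_iff)
  have l: "linear_map R F H (\<lambda>x\<in>carrier F. g (\<phi> i x))" for i
    by (rule linear_map_cong[OF FD(1) linear_map_comp[OF \<phi>l gl]]) simp
  have "coact H (g (\<phi> i x)) = tens_map R H A 1 (\<lambda>x\<in>carrier F. g (\<phi> i x)) (coact F x)" if x: "x \<in> carrier F" for i x
  proof -
    have "coact H (g (\<phi> i x)) = tens_map R H A 1 g (tens_map R G A 1 (\<phi> i) (coact F x))"
      using \<phi> g x linear_mapD(2)[OF \<phi>l x] by (simp add: ehom_iff comod_hom_iff)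
    also have "\<dots> = tens_map R H A 1 (\<lambda>x. g (\<phi> i x)) (coact F x)"
      by (rule tens_map_comp[OF FD(1) GD(1) HD(1) \<phi>l gl FD(5)[OF x]])
    also have "\<dots> = tens_map R H A 1 (\<lambda>x\<in>carrier F. g (\<phi> i x)) (coact F x)"
      by (rule tens_map_cong[OF FD(1) HD(1) linear_map_comp[OF \<phi>l gl] l _ FD(5)[OF x]]) simp
    finally show ?thesis .
  qed
  then show ?thesis
    using \<phi> g l FD(6) linear_mapD(2)[OF \<phi>l] by (simp add: ehom_iff comod_hom_iff)
qed

text \<open>\<open>derived_act\<close> takes a common value over all lifts, which requires that one
  exists. The lift is built degree by degree, all entries of the sequence being extended
  simultaneously.\<close>

lemma ex_resolution_lift:
  fixes F F' :: "('u, 'u, 'u) dcomod" and I I' :: "('u, 'u, 'u) resolution"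
  assumes F: "difference_comodule R A F" and I: "enriched_injective_resolution R A F I"
    and F': "difference_comodule R A F'" and I': "enriched_injective_resolution R A F' I'"
    and \<phi>: "\<phi> \<in> carrier (comod_ehom R A F F')"
  shows "resolution_lifts R A F I I' \<phi> \<noteq> {}"
proof -
  have obj: "difference_comodule R A (res_obj I q)" "difference_comodule R A (res_obj I' q)" for q
    using res_term_comodule[OF F I, of "Suc q"] res_term_comodule[OF F' I', of "Suc q"] by auto
  have inj: "enriched_injective R A (res_obj I' q)" for q using I' by (simp add: enriched_injective_resolution_def)
  have augh: "aug I \<in> comod_hom R A F (res_obj I 0)" "aug I' \<in> comod_hom R A F' (res_obj I' 0)"
    and dh: "res_diff I q \<in> comod_hom R A (res_obj I q) (res_obj I (Suc q))"
      "res_diff I' q \<in> comod_hom R A (res_obj I' q) (res_obj I' (Suc q))" for q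
    using I I' by (auto simp: enriched_injective_resolution_def)
  have ex0: "\<exists>y\<in>carrier F. x = aug I y" if "x \<in> carrier (res_obj I 0)" "res_diff I 0 x = \<zero>\<^bsub>res_obj I 1\<^esub>" for x
    using that I unfolding enriched_injective_resolution_def by blast
  have exS: "\<exists>y\<in>carrier (res_obj I q). x = res_diff I q y"
    if "x \<in> carrier (res_obj I (Suc q))" "res_diff I (Suc q) x = \<zero>\<^bsub>res_obj I (Suc (Suc q))\<^esub>" for x q
    using that I unfolding enriched_injective_resolution_def by blast
  have z0: "res_diff I' 0 (aug I' y) = \<zero>\<^bsub>res_obj I' 1\<^esub>" if "y \<in> carrier F'" for y
    using res_zero[OF F' I', of y 0] that by simp
  have zS: "res_diff I' (Suc q) (res_diff I' q y) = \<zero>\<^bsub>res_obj I' (Suc (Suc q))\<^esub>" if "y \<in> carrier (res_obj I' q)" for y q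
    using res_zero[OF F' I', of y "Suc q"] that by simp
  have \<phi>l: "linear_map R F F' (\<phi> i)" for i using \<phi> by (simp add: ehom_iff)
  \<comment> \<open>Besides being an enriched morphism, a partial lift must send the kernel of the
    differential into the kernel of the target differential: this is the vanishing condition that
    \<open>enriched_extension\<close> asks for in the next degree.\<close>
  define P where "P = (\<lambda>n (\<chi> :: nat \<Rightarrow> 'u \<Rightarrow> 'u). \<chi> \<in> carrier (comod_ehom R A (res_obj I n) (res_obj I' n)) \<and>
     (\<forall>i. \<forall>x\<in>carrier (res_obj I n). res_diff I n x = \<zero>\<^bsub>res_obj I (Suc n)\<^esub> \<longrightarrow> res_diff I' n (\<chi> i x) = \<zero>\<^bsub>res_obj I' (Suc n)\<^esub>) \<and>
     (n = 0 \<longrightarrow> (\<forall>i. \<forall>x\<in>carrier F. \<chi> i (aug I x) = aug I' (\<phi> i x))))"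
  define Q where "Q = (\<lambda>n (\<chi> :: nat \<Rightarrow> 'u \<Rightarrow> 'u) (\<chi>' :: nat \<Rightarrow> 'u \<Rightarrow> 'u). \<forall>i. \<forall>x\<in>carrier (res_obj I n). \<chi>' i (res_diff I n x) = res_diff I' n (\<chi> i x))"
  have base: "\<exists>\<chi>. P 0 \<chi>"
  proof -
    have "(\<lambda>x\<in>carrier F. aug I' (\<phi> i x)) x = \<zero>\<^bsub>res_obj I' 0\<^esub>" if x: "x \<in> carrier F" and z: "aug I x = \<zero>\<^bsub>res_obj I 0\<^esub>" for x i
    proof -
      note m = difference_comoduleD(1)[OF F] and m' = difference_comoduleD(1)[OF F']
      have al: "linear_map R F (res_obj I 0) (aug I)" "linear_map R F' (res_obj I' 0) (aug I')" using augh by (auto simp: comod_hom_iff)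
      have "aug I x = aug I \<zero>\<^bsub>F\<^esub>" using z linear_map_zero[OF m difference_comoduleD(1)[OF obj(1)] al(1)] by simp
      then have "x = \<zero>\<^bsub>F\<^esub>"
        using inj_onD[OF res_inj[OF F I] _ x abelian_monoid.zero_closed[OF abelian_group.axioms(1)[OF module.axioms(2)[OF m]]]] by blast
      then show ?thesis
        using x linear_map_zero[OF m m' \<phi>l] linear_map_zero[OF m' difference_comoduleD(1)[OF obj(2)] al(2)] by simp
    qed
    from enriched_extension[OF inj F obj(1) augh(1) ehom_comp_hom[OF F F' obj(2) \<phi> augh(2)] this]
    obtain \<chi> where \<chi>: "\<chi> \<in> carrier (comod_ehom R A (res_obj I 0) (res_obj I' 0))"
      "\<And>i x. x \<in> carrier F \<Longrightarrow> \<chi> i (aug I x) = aug I' (\<phi> i x)" by auto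
    have "res_diff I' 0 (\<chi> i x) = \<zero>\<^bsub>res_obj I' (Suc 0)\<^esub>" if "x \<in> carrier (res_obj I 0)" "res_diff I 0 x = \<zero>\<^bsub>res_obj I (Suc 0)\<^esub>" for i x
      using ex0[of x] that \<chi>(2) z0 linear_mapD(2)[OF \<phi>l] by auto
    then show ?thesis using \<chi> by (auto simp: P_def)
  qed
  have step: "\<exists>\<chi>'. P (Suc n) \<chi>' \<and> Q n \<chi> \<chi>'" if \<chi>: "P n \<chi>" for n \<chi>
  proof -
    have \<chi>h: "\<chi> \<in> carrier (comod_ehom R A (res_obj I n) (res_obj I' n))"
      and \<chi>z: "\<And>i x. x \<in> carrier (res_obj I n) \<Longrightarrow> res_diff I n x = \<zero>\<^bsub>res_obj I (Suc n)\<^esub> \<Longrightarrow> res_diff I' n (\<chi> i x) = \<zero>\<^bsub>res_obj I' (Suc n)\<^esub>"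
      using \<chi> by (auto simp: P_def)
    have \<chi>c: "\<chi> i x \<in> carrier (res_obj I' n)" if "x \<in> carrier (res_obj I n)" for i x
      using linear_mapD(2)[of R "res_obj I n" "res_obj I' n" "\<chi> i" x] \<chi>h that by (simp add: ehom_iff)
    have "(\<lambda>x\<in>carrier (res_obj I n). res_diff I' n (\<chi> i x)) x = \<zero>\<^bsub>res_obj I' (Suc n)\<^esub>"
      if "x \<in> carrier (res_obj I n)" "res_diff I n x = \<zero>\<^bsub>res_obj I (Suc n)\<^esub>" for x i
      using \<chi>z[OF that] that by simp
    from enriched_extension[OF inj obj(1) obj(1) dh(1) ehom_comp_hom[OF obj(1) obj(2) obj(2) \<chi>h dh(2)] this]
    obtain \<chi>' where \<chi>': "\<chi>' \<in> carrier (comod_ehom R A (res_obj I (Suc n)) (res_obj I' (Suc n)))"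
      "\<And>i x. x \<in> carrier (res_obj I n) \<Longrightarrow> \<chi>' i (res_diff I n x) = res_diff I' n (\<chi> i x)" by auto
    have "res_diff I' (Suc n) (\<chi>' i x) = \<zero>\<^bsub>res_obj I' (Suc (Suc n))\<^esub>"
      if x: "x \<in> carrier (res_obj I (Suc n))" "res_diff I (Suc n) x = \<zero>\<^bsub>res_obj I (Suc (Suc n))\<^esub>" for i x
    proof -
      obtain y where y: "y \<in> carrier (res_obj I n)" "x = res_diff I n y" using exS[OF x] by blast
      show ?thesis unfolding y(2) \<chi>'(2)[OF y(1)] by (rule zS[OF \<chi>c[OF y(1)]])
    qed
    then show ?thesis using \<chi>' by (intro exI[of _ \<chi>']) (simp add: P_def Q_def)
  qed
  obtain \<psi> where \<psi>: "\<And>n. P n (\<psi> n)" "\<And>n. Q n (\<psi> n) (\<psi> (Suc n))"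
    using dependent_nat_choice[of P Q, OF base step] by blast
  have "\<psi> \<in> resolution_lifts R A F I I' \<phi>"
    using \<psi> by (auto simp: resolution_lifts_def P_def Q_def)
  then show ?thesis by blast
qed

text \<open>Stated for any model of the functor of invariants, because the two functors of the final
  theorem take values in different types.\<close>

theorem group_cohomology_derived:
  fixes T :: "('u, 'u, 'u, 'x) efunctor"
  assumes T: "inv_functor T \<iota>"
  shows "enriched_derived_functor R A T n (group_cohomology R A n)"
  unfolding enriched_derived_functor_def
\<comment> \<open>The witness is the relational image of a coset under \<open>hrel\<close>, given by
  one formula for all comodules and resolutions.\<close>
proof (intro exI[of _ "\<lambda>F I X. hrel T \<iota> F I n `` X"] conjI allI impI; elim conjE)
  fix F :: "('u, 'u, 'u) dcomod" and I :: "('u, 'u, 'u) resolution"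
  assume F: "difference_comodule R A F" and I: "enriched_injective_resolution R A F I"
  let ?K = "hoch_complex R A F" and ?L = "applied_complex T I"
  let ?HK = "cohomology ?K (hoch_diff R A F) n" and ?HL = "cohomology ?L (applied_diff T I) n"
  note D = resD[OF F I] and FD = difference_comoduleD[OF F]
  note hom = res_map_hom[OF F I]
  have obj: "difference_comodule R A (res_obj I q)" for q by (rule obj[OF T F I])
  interpret c: coset_relation "?K n" "cocycles ?K (hoch_diff R A F) n" "coboundaries ?K (hoch_diff R A F) n"
    "?L n" "cocycles ?L (applied_diff T I) n" "coboundaries ?L (applied_diff T I) n" "hrel T \<iota> F I n"
    using coset_relation_hrel[OF T F I] by (simp add: applied_complex_def)
  have "dmod_iso R ?HK ?HL (\<lambda>X. hrel T \<iota> F I n `` X)"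
    unfolding dmod_iso_def dmod_map_def linear_map_def
  proof (intro conjI ballI)
    show bij: "bij_betw (\<lambda>X. hrel T \<iota> F I n `` X) (carrier ?HK) (carrier ?HL)"
      using c.bij by (simp add: cohomology_def Let_def)
    then show "(\<lambda>X. hrel T \<iota> F I n `` X) \<in> carrier ?HK \<rightarrow> carrier ?HL" by (auto simp: bij_betw_def)
    fix X Y assume "X \<in> carrier ?HK" "Y \<in> carrier ?HK"
    then obtain x y where x: "x \<in> cocycles ?K (hoch_diff R A F) n" "X = coboundaries ?K (hoch_diff R A F) n +>\<^bsub>?K n\<^esub> x"
      and y: "y \<in> cocycles ?K (hoch_diff R A F) n" "Y = coboundaries ?K (hoch_diff R A F) n +>\<^bsub>?K n\<^esub> y"
      by (auto simp: cohomology_def Let_def)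
    obtain x' y' where "(x, x') \<in> hrel T \<iota> F I n" "(y, y') \<in> hrel T \<iota> F I n" using c.total x y by blast
    then show "hrel T \<iota> F I n `` (X \<oplus>\<^bsub>?HK\<^esub> Y) = (hrel T \<iota> F I n `` X) \<oplus>\<^bsub>?HL\<^esub> (hrel T \<iota> F I n `` Y)"
      using c.coset_add(1) by (simp add: x y cohomology_def Let_def)
  next
    fix r X assume r: "r \<in> carrier R" and X: "X \<in> carrier ?HK"
    \<comment> \<open>Multiplication by \<open>r\<close> on every term is a compatible family with
      identity twist; \<sigma> is handled in the same way afterwards, with twist
      \<open>rsigma R\<close>.\<close>
    have lin: "linear_map R (res_term F I q) (res_term F I q) (\<lambda>x. r \<odot>\<^bsub>res_term F I q\<^esub> x)" for q
      by (rule semilinear_smult[OF D(1) r])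
    have "compat (\<lambda>r. r) (res_term F I q) (coact (res_term F I q)) (res_term F I q) (coact (res_term F I q)) (\<lambda>x. r \<odot>\<^bsub>res_term F I q\<^esub> x) (\<lambda>a. a)" for q
      using smult_gmap[OF D(1) r D(5)] linear_mapD(4)[OF D(4) r] by (intro compat_linear[OF lin]) simp
    from hrel_map[OF T F I F I this, of "\<lambda>q l. r \<odot>\<^bsub>on_obj T (res_obj I q)\<^esub> l" n "\<lambda>x. r \<odot>\<^bsub>?K n\<^esub> x" X]
    show "hrel T \<iota> F I n `` (r \<odot>\<^bsub>?HK\<^esub> X) = r \<odot>\<^bsub>?HL\<^esub> (hrel T \<iota> F I n `` X)"
      using X r T_smult[OF T obj] linear_mapD(4)[OF res_map_linear[OF F I] r] smult_gmap[OF FD(1) r] smult_gmap[OF D(1)[of "Suc q" for q] r] \<iota>_closed[OF T obj]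
      by (simp add: cohomology_def Let_def hoch_complex_def applied_complex_def tens_map_gmap)
  next
    fix X assume X: "X \<in> carrier ?HK"
    have "compat (rsigma R) (res_term F I q) (coact (res_term F I q)) (res_term F I q) (coact (res_term F I q)) (dsigma (res_term F I q)) (dsigma A)" for q
      by (rule compat_dsigma[OF res_term_comodule[OF F I]])
    from hrel_map[OF T F I F I this, of "\<lambda>q. dsigma (on_obj T (res_obj I q))" n "dsigma (?K n)" X]
    show "hrel T \<iota> F I n `` (dsigma ?HK X) = dsigma ?HL (hrel T \<iota> F I n `` X)"
      using X T_sigma[OF T obj] hom by (simp add: cohomology_def Let_def hoch_complex_def applied_complex_def comod_hom_iff)
  qed
  then show "dmod_iso R (on_obj (group_cohomology R A n) F) (derived_obj T I n) (\<lambda>X. hrel T \<iota> F I n `` X)"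
    by (simp add: group_cohomology_def derived_obj_def)
next
  fix F F' :: "('u, 'u, 'u) dcomod" and I I' :: "('u, 'u, 'u) resolution" and \<phi> i X
  assume F: "difference_comodule R A F" and I: "enriched_injective_resolution R A F I"
    and F': "difference_comodule R A F'" and I': "enriched_injective_resolution R A F' I'"
    and \<phi>: "\<phi> \<in> carrier (comod_ehom R A F F')" and X: "X \<in> carrier (on_obj (group_cohomology R A n) F)"
  have obj: "difference_comodule R A (res_obj I q)" "difference_comodule R A (res_obj I' q)" for q
    using obj[OF T F I] obj[OF T F' I'] by auto
  let ?lhs = "hrel T \<iota> F' I' n `` on_hom (group_cohomology R A n) F F' \<phi> i X"
  have X': "X \<in> carrier (cohomology (hoch_complex R A F) (hoch_diff R A F) n)"
    using X by (simp add: group_cohomology_def)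
  have "coset_map (applied_complex T I' n) (coboundaries (applied_complex T I') (applied_diff T I') n)
      (on_hom T (res_obj I n) (res_obj I' n) (\<psi> n) i) (hrel T \<iota> F I n `` X) = ?lhs"
    if \<psi>: "\<psi> \<in> resolution_lifts R A F I I' \<phi>" for \<psi>
  proof -
    \<comment> \<open>Entry \<open>i\<close> of \<phi> and entry \<open>i\<close> of the lift form
      one family on the augmented resolution. The index stays fixed because the maps of the
      resolution are ordinary morphisms, that is, constant sequences.\<close>
    define \<eta> where "\<eta> = (\<lambda>q. case q of 0 \<Rightarrow> \<phi> i | Suc k \<Rightarrow> \<psi> k i)"
    have \<psi>h: "\<psi> k \<in> carrier (comod_ehom R A (res_obj I k) (res_obj I' k))" for k
      using \<psi> by (simp add: resolution_lifts_def)
    have "compat (\<lambda>r. r) (res_term F I q) (coact (res_term F I q)) (res_term F' I' q) (coact (res_term F' I' q)) (\<eta> q) (\<lambda>a. a)" for q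
      using \<phi> \<psi>h by (intro compat_linear; cases q) (simp_all add: \<eta>_def ehom_iff)
    moreover have "\<eta> (Suc q) (res_map I q x) = res_map I' q (\<eta> q x)" if "x \<in> carrier (res_term F I q)" for q x
      using \<psi> that by (cases q) (auto simp: \<eta>_def resolution_lifts_def)
    ultimately have "hrel T \<iota> F' I' n `` coset_map (hoch_complex R A F' n) (coboundaries (hoch_complex R A F') (hoch_diff R A F') n) (tens_map R F' A n (\<phi> i)) X =
        coset_map (applied_complex T I' n) (coboundaries (applied_complex T I') (applied_diff T I') n)
          (on_hom T (res_obj I n) (res_obj I' n) (\<psi> n) i) (hrel T \<iota> F I n `` X)"
      by (rule hrel_map[OF T F I F' I', where hL = "\<lambda>q. on_hom T (res_obj I q) (res_obj I' q) (\<psi> q) i"])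
         (use T_hom[OF T obj \<psi>h] X' in \<open>auto simp: \<eta>_def tens_map_gmap\<close>)
    then show ?thesis using X' by (simp add: group_cohomology_def)
  qed
  \<comment> \<open>Every lift gives the value \<open>?lhs\<close>, and a lift exists, so the set
    under \<open>the_elem\<close> is a singleton.\<close>
  then have "(\<lambda>\<psi>. coset_map (applied_complex T I' n) (coboundaries (applied_complex T I') (applied_diff T I') n)
      (on_hom T (res_obj I n) (res_obj I' n) (\<psi> n) i) (hrel T \<iota> F I n `` X)) ` resolution_lifts R A F I I' \<phi> = {?lhs}"
    using ex_resolution_lift[OF F I F' I' \<phi>] by auto
  then show "?lhs = derived_act R A T F I I' n \<phi> i (hrel T \<iota> F I n `` X)"
    by (simp add: derived_act_def)
qed

end

lemma zero_coset:
  assumes "abelian_group G" "x \<in> carrier G"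
  shows "{\<zero>\<^bsub>G\<^esub>} +>\<^bsub>G\<^esub> x = {x}"
proof -
  interpret abelian_group G by fact
  show ?thesis using assms(2) by (simp add: a_r_coset_def')
qed

section \<open>The two models of the functor of invariants\<close>

context flat_hopf
begin

lemma inv_tens_pure:
  fixes F :: "('u, 'u, 'u) dcomod"
  assumes F: "difference_comodule R A F" and m: "m \<in> carrier F"
  shows "pure_tens R F A m [] \<in> inv_tens F \<longleftrightarrow> coact F m = pure_tens R F A m [\<one>\<^bsub>A\<^esub>]"
proof -
  note FD = difference_comoduleD[OF F]
  interpret T: abelian_group "tens R F A 1" by (rule tens_group[OF FD(1)])
  have p: "pure_tens R F A m [\<one>\<^bsub>A\<^esub>] \<in> carrier (tens R F A 1)" using m by (intro pure_tens_closed[OF FD(1)]) auto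
  have "pure_tens R F A m [] \<in> carrier (tens R F A 0)" using m by (intro pure_tens_closed[OF FD(1)]) auto
  then show ?thesis
    using hdiff_0[OF FD(3) m] T.minus_eq_zeroD[OF _ FD(5)[OF m] p] T.minus_self[OF p]
    by (simp only: inv_tens_def mem_Collect_eq) metis
qed

lemma inv_tens_gmap:
  fixes F F' :: "('u, 'u, 'u) dcomod"
  assumes F: "difference_comodule R A F" "difference_comodule R A F'"
    and c: "compat \<theta> F (coact F) F' (coact F') \<phi> \<tau>" and x: "x \<in> inv_tens F"
  shows "gmap R F' A 0 \<phi> \<tau> x \<in> inv_tens F'"
proof -
  note FD = difference_comoduleD[OF F(1)] and F'D = difference_comoduleD[OF F(2)]
  have s: "semilinear R \<theta> F F' \<phi>" "semilinear R \<theta> A A \<tau>" using c by (auto simp: compat_def)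
  have x': "x \<in> carrier (tens R F A 0)" using x by (simp add: inv_tens_def)
  have "hdiff F' (coact F') 0 (gmap R F' A 0 \<phi> \<tau> x) = \<zero>\<^bsub>tens R F' A 1\<^esub>"
    using hdiff_gmap[OF FD(1,4) F'D(1,4) c x'] x
      additive_map_zero[OF tens_group[OF FD(1)] tens_group[OF F'D(1)] gmap_additive[OF FD(1) F'D(1) s], of 1]
    by (simp add: inv_tens_def)
  then show ?thesis
    using additive_map_closed[OF gmap_additive[OF FD(1) F'D(1) s] x'] by (simp add: inv_tens_def)
qed

lemma inv_tens_ops:
  fixes F :: "('u, 'u, 'u) dcomod"
  assumes F: "difference_comodule R A F"
  shows "\<zero>\<^bsub>tens R F A 0\<^esub> \<in> inv_tens F"
    "\<And>x y. x \<in> inv_tens F \<Longrightarrow> y \<in> inv_tens F \<Longrightarrow> x \<oplus>\<^bsub>tens R F A 0\<^esub> y \<in> inv_tens F"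
    "\<And>r x. r \<in> carrier R \<Longrightarrow> x \<in> inv_tens F \<Longrightarrow> r \<odot>\<^bsub>tens R F A 0\<^esub> x \<in> inv_tens F"
    "\<And>x. x \<in> inv_tens F \<Longrightarrow> gmap R F A 0 (dsigma F) (dsigma A) x \<in> inv_tens F"
    "\<And>F' :: ('u, 'u, 'u) dcomod. \<And>\<phi> i x. difference_comodule R A F' \<Longrightarrow> \<phi> \<in> carrier (comod_ehom R A F F') \<Longrightarrow> x \<in> inv_tens F \<Longrightarrow>
      tens_map R F' A 0 (\<phi> i) x \<in> inv_tens F'"
proof -
  note FD = difference_comoduleD[OF F]
  interpret I: abelian_group "(tens R F A 0)\<lparr>carrier := inv_tens F\<rparr>" by (rule inv_tens_abelian[OF F])
  show "\<zero>\<^bsub>tens R F A 0\<^esub> \<in> inv_tens F" using I.zero_closed by simp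
  show "x \<oplus>\<^bsub>tens R F A 0\<^esub> y \<in> inv_tens F" if "x \<in> inv_tens F" "y \<in> inv_tens F" for x y
    using I.a_closed[of x y] that by simp
  show "r \<odot>\<^bsub>tens R F A 0\<^esub> x \<in> inv_tens F" if r: "r \<in> carrier R" and x: "x \<in> inv_tens F" for r x
  proof -
    have "compat (\<lambda>r. r) F (coact F) F (coact F) (\<lambda>x. r \<odot>\<^bsub>F\<^esub> x) (\<lambda>a. a)"
      using smult_gmap[OF FD(1) r FD(5)] linear_mapD(4)[OF FD(4) r] by (intro compat_linear[OF semilinear_smult[OF FD(1) r]]) simp
    from inv_tens_gmap[OF F F this x] show ?thesis
      using smult_gmap[OF FD(1) r, of x 0] x by (simp add: tens_map_gmap inv_tens_def)
  qed
  show "gmap R F A 0 (dsigma F) (dsigma A) x \<in> inv_tens F" if x: "x \<in> inv_tens F" for x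
    by (rule inv_tens_gmap[OF F F compat_dsigma[OF F] x])
  show "tens_map R F' A 0 (\<phi> i) x \<in> inv_tens F'"
    if F': "difference_comodule R A F'" and \<phi>: "\<phi> \<in> carrier (comod_ehom R A F F')" and x: "x \<in> inv_tens F"
    for F' :: "('u, 'u, 'u) dcomod" and \<phi> i x
  proof -
    have "compat (\<lambda>r. r) F (coact F) F' (coact F') (\<phi> i) (\<lambda>a. a)" using \<phi> by (intro compat_linear) (simp_all add: ehom_iff)
    from inv_tens_gmap[OF F F' this x] show ?thesis by (simp add: tens_map_gmap)
  qed
qed

text \<open>The only coboundary in degree 0 is 0, so the cohomology classes are singletons and
  \<open>the_elem\<close> extracts the invariant.\<close>

lemma inv_functor_group_cohomology:
  "inv_functor (group_cohomology R A 0 :: ('u, 'u, 'u, ('u, 'u) tens set) efunctor) (\<lambda>F. the_elem)"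
  unfolding inv_functor_def
proof (intro allI impI)
  fix F :: "('u, 'u, 'u) dcomod" assume F: "difference_comodule R A F"
  let ?H = "on_obj (group_cohomology R A 0) F"
  note FD = difference_comoduleD[OF F]
  have coset: "{\<zero>\<^bsub>tens R F A 0\<^esub>} +>\<^bsub>hoch_complex R A F 0\<^esub> x = {x}" if "x \<in> carrier (tens R F A 0)"
    and F: "difference_comodule R A F" for x and F :: "('u, 'u, 'u) dcomod"
    using zero_coset[OF hoch_group[OF F, of 0], of x] that by (simp add: hoch_complex_def)
  have closed: "x \<in> carrier (tens R F A 0)" if "x \<in> inv_tens F" for x and F :: "('u, 'u, 'u) dcomod"
    using that by (simp add: inv_tens_def)
  have car: "carrier (on_obj (group_cohomology R A 0) F) = (\<lambda>x. {x}) ` inv_tens F" if F: "difference_comodule R A F" for F :: "('u, 'u, 'u) dcomod"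
  proof -
    have "cocycles (hoch_complex R A F) (hoch_diff R A F) 0 = inv_tens F"
      by (simp add: cocycles_hoch[OF F] inv_tens_def)
    then show ?thesis
      using coset[OF closed F]
      by (auto simp: group_cohomology_def cohomology_def Let_def coboundaries_hoch(1)[OF F])
  qed
  have cmap: "\<And>f x (F :: ('u, 'u, 'u) dcomod). f x \<in> carrier (tens R F A 0) \<Longrightarrow> difference_comodule R A F \<Longrightarrow> coset_map (hoch_complex R A F 0) (coboundaries (hoch_complex R A F) (hoch_diff R A F) 0) f {x} = {f x}"
    by (simp add: coset_map_def coboundaries_hoch(1) coset)
  note ops = inv_tens_ops[OF F]
  have add: "{x} \<oplus>\<^bsub>?H\<^esub> {y} = {x \<oplus>\<^bsub>tens R F A 0\<^esub> y}" for x y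
    by (simp add: group_cohomology_def cohomology_def Let_def hoch_complex_def set_add_def' )
  have zero: "\<zero>\<^bsub>?H\<^esub> = {\<zero>\<^bsub>tens R F A 0\<^esub>}"
    by (simp add: group_cohomology_def cohomology_def Let_def coboundaries_hoch(1)[OF F])
  have smH: "r \<odot>\<^bsub>?H\<^esub> {x} = {r \<odot>\<^bsub>tens R F A 0\<^esub> x}" if "r \<in> carrier R" "x \<in> inv_tens F" for r x
    using cmap[of "\<lambda>x. r \<odot>\<^bsub>tens R F A 0\<^esub> x", OF closed[OF ops(3)[OF that]] F] by (simp add: group_cohomology_def cohomology_def Let_def hoch_complex_def)
  have sgH: "dsigma ?H {x} = {gmap R F A 0 (dsigma F) (dsigma A) x}" if x: "x \<in> inv_tens F" for x
    using cmap[of "gmap R F A 0 (dsigma F) (dsigma A)", OF closed[OF ops(4)[OF x]] F] by (simp add: group_cohomology_def cohomology_def Let_def hoch_complex_def)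
  have hmH: "on_hom (group_cohomology R A 0) F F' \<phi> i {x} = {tens_map R F' A 0 (\<phi> i) x}"
    if F': "difference_comodule R A F'" and \<phi>: "\<phi> \<in> carrier (comod_ehom R A F F')" and x: "x \<in> inv_tens F"
    for F' :: "('u, 'u, 'u) dcomod" and \<phi> i x
    using cmap[of "tens_map R F' A 0 (\<phi> i)", OF closed[OF ops(5)[OF F' \<phi> x]] F'] car[OF F] x by (simp add: group_cohomology_def)
  have "bij_betw the_elem (carrier ?H) (inv_tens F)"
    unfolding car[OF F] by (rule bij_betw_byWitness[where f' = "\<lambda>x. {x}"]) auto
  then show "bij_betw the_elem (carrier ?H) (inv_tens F) \<and>
     (\<forall>x\<in>carrier ?H. \<forall>y\<in>carrier ?H. x \<oplus>\<^bsub>?H\<^esub> y \<in> carrier ?H \<and> the_elem (x \<oplus>\<^bsub>?H\<^esub> y) = the_elem x \<oplus>\<^bsub>tens R F A 0\<^esub> the_elem y) \<and>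
     \<zero>\<^bsub>?H\<^esub> \<in> carrier ?H \<and> the_elem \<zero>\<^bsub>?H\<^esub> = \<zero>\<^bsub>tens R F A 0\<^esub> \<and>
     (\<forall>r\<in>carrier R. \<forall>x\<in>carrier ?H. r \<odot>\<^bsub>?H\<^esub> x \<in> carrier ?H \<and> the_elem (r \<odot>\<^bsub>?H\<^esub> x) = r \<odot>\<^bsub>tens R F A 0\<^esub> the_elem x) \<and>
     (\<forall>x\<in>carrier ?H. dsigma ?H x \<in> carrier ?H \<and> the_elem (dsigma ?H x) = gmap R F A 0 (dsigma F) (dsigma A) (the_elem x)) \<and>
     (\<forall>F' \<phi> i. \<forall>x\<in>carrier ?H. difference_comodule R A F' \<and> \<phi> \<in> carrier (comod_ehom R A F F') \<longrightarrow>
        on_hom (group_cohomology R A 0) F F' \<phi> i x \<in> carrier (on_obj (group_cohomology R A 0) F') \<and>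
        the_elem (on_hom (group_cohomology R A 0) F F' \<phi> i x) = tens_map R F' A 0 (\<phi> i) (the_elem x))"
    using ops by (simp add: car[OF F] car add zero smH sgH hmH)
qed

definition orbit :: "('u, 'u, 'u) dcomod \<Rightarrow> 'u \<Rightarrow> nat \<Rightarrow> 'u \<Rightarrow> 'u" where
  "orbit F m = (\<lambda>i. \<lambda>r\<in>carrier R. r \<odot>\<^bsub>F\<^esub> (dsigma F ^^ i) m)"

lemma base_comodule_simps:
  "carrier (base_comodule R A) = carrier R" "dsigma (base_comodule R A) = rsigma R"
  "ring.add (base_comodule R A) = ring.add R" "smult (base_comodule R A) = monoid.mult R"
  "coact (base_comodule R A) r = pure_tens R (base_module R) A r [\<one>\<^bsub>A\<^esub>]"
  by (simp_all add: base_comodule_def base_module_def dmod.extend_def)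

lemma module_base: "Module.module R (base_module R)"
proof -
  interpret cring R by (rule ring_R)
  show ?thesis
  proof (rule moduleI)
    show "abelian_group (base_module R)"
      by (rule abelian_group_cong[OF abelian_group_axioms]) (simp_all add: base_module_def)
  qed (auto simp: base_module_def l_distr r_distr m_assoc cring_axioms)
qed

context
  fixes F :: "('u, 'u, 'u) dcomod"
  assumes F: "difference_comodule R A F"
begin

lemma funpow_dsigma:
  "x \<in> carrier F \<Longrightarrow> (dsigma F ^^ i) x \<in> carrier F"
  "x \<in> carrier F \<Longrightarrow> y \<in> carrier F \<Longrightarrow> (dsigma F ^^ i) (x \<oplus>\<^bsub>F\<^esub> y) = (dsigma F ^^ i) x \<oplus>\<^bsub>F\<^esub> (dsigma F ^^ i) y"
  "r \<in> carrier R \<Longrightarrow> (rsigma R ^^ i) r \<in> carrier R"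
  "r \<in> carrier R \<Longrightarrow> x \<in> carrier F \<Longrightarrow> (dsigma F ^^ i) (r \<odot>\<^bsub>F\<^esub> x) = (rsigma R ^^ i) r \<odot>\<^bsub>F\<^esub> (dsigma F ^^ i) x"
proof -
  note s = semilinearD[OF difference_comoduleD(2)[OF F]]
  show 1: "x \<in> carrier F \<Longrightarrow> (dsigma F ^^ i) x \<in> carrier F" for x i by (induction i) (auto simp: s)
  show 2: "r \<in> carrier R \<Longrightarrow> (rsigma R ^^ i) r \<in> carrier R" for r i by (induction i) (use rsigma_closed in auto)
  show "x \<in> carrier F \<Longrightarrow> y \<in> carrier F \<Longrightarrow> (dsigma F ^^ i) (x \<oplus>\<^bsub>F\<^esub> y) = (dsigma F ^^ i) x \<oplus>\<^bsub>F\<^esub> (dsigma F ^^ i) y"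
    by (induction i) (auto simp: s 1)
  show "r \<in> carrier R \<Longrightarrow> x \<in> carrier F \<Longrightarrow> (dsigma F ^^ i) (r \<odot>\<^bsub>F\<^esub> x) = (rsigma R ^^ i) r \<odot>\<^bsub>F\<^esub> (dsigma F ^^ i) x"
    by (induction i) (auto simp: s 1 2)
qed

lemma orbit_eqI:
  assumes "\<And>i. \<phi> i \<in> extensional (carrier R)" "\<And>i r. r \<in> carrier R \<Longrightarrow> \<phi> i r = r \<odot>\<^bsub>F\<^esub> (dsigma F ^^ i) m"
  shows "\<phi> = orbit F m"
proof (intro ext)
  fix i r show "\<phi> i r = orbit F m i r"
    using assms by (cases "r \<in> carrier R") (auto simp: orbit_def extensional_def)
qed

lemma orbit_hom:
  assumes m: "m \<in> carrier F" "coact F m = pure_tens R F A m [\<one>\<^bsub>A\<^esub>]"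
  shows "orbit F m \<in> carrier (comod_ehom R A (base_comodule R A) F)"
proof -
  note FD = difference_comoduleD[OF F]
  interpret F: Module.module R F by (rule FD(1))
  note B = module_base
  \<comment> \<open>Applying \<sigma> preserves invariance, because the coaction commutes with
    \<sigma> and \<sigma> fixes the unit of \<open>A\<close>.\<close>
  have c: "coact F ((dsigma F ^^ i) m) = pure_tens R F A ((dsigma F ^^ i) m) [\<one>\<^bsub>A\<^esub>]" for i
  proof (induction i)
    case (Suc i)
    note mi = funpow_dsigma(1)[OF m(1), of i]
    have "coact F (dsigma F ((dsigma F ^^ i) m)) = gmap R F A 1 (dsigma F) (dsigma A) (pure_tens R F A ((dsigma F ^^ i) m) [\<one>\<^bsub>A\<^esub>])"
      using F mi Suc by (simp add: difference_comodule_iff)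
    also have "\<dots> = pure_tens R F A (dsigma F ((dsigma F ^^ i) m)) [dsigma A \<one>\<^bsub>A\<^esub>]"
      using gmap_pure[OF FD(1) FD(1) FD(2) dsigma_A mi, of "[\<one>\<^bsub>A\<^esub>]" 1] by simp
    also have "dsigma A \<one>\<^bsub>A\<^esub> = \<one>\<^bsub>A\<^esub>" using compat_dsigma[OF F] by (simp add: compat_def)
    finally show ?case by simp
  qed (simp add: m)
  have l: "linear_map R (base_module R) F (orbit F m i)" for i
    using funpow_dsigma(1)[OF m(1), of i]
    by (auto simp: linear_map_def base_module_def orbit_def F.smult_l_distr F.smult_assoc1)
  have "coact F (orbit F m i r) = tens_map R F A 1 (orbit F m i) (pure_tens R (base_module R) A r [\<one>\<^bsub>A\<^esub>])" if r: "r \<in> carrier R" for i r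
  proof -
    note mi = funpow_dsigma(1)[OF m(1), of i]
    have "tens_map R F A 1 (orbit F m i) (pure_tens R (base_module R) A r [\<one>\<^bsub>A\<^esub>]) = pure_tens R F A (orbit F m i r) [\<one>\<^bsub>A\<^esub>]"
      using r by (intro tens_map_pure[OF B FD(1) l]) (auto simp: base_module_def)
    moreover have "coact F (orbit F m i r) = r \<odot>\<^bsub>tens R F A 1\<^esub> pure_tens R F A ((dsigma F ^^ i) m) [\<one>\<^bsub>A\<^esub>]"
      using r mi c linear_mapD(4)[OF FD(4) r mi] by (simp add: orbit_def)
    moreover have "\<dots> = pure_tens R F A (r \<odot>\<^bsub>F\<^esub> (dsigma F ^^ i) m) [\<one>\<^bsub>A\<^esub>]"
      using mi by (intro smult_pure[OF FD(1) r]) auto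
    ultimately show ?thesis using r by (simp add: orbit_def)
  qed
  moreover have "linear_map R (base_comodule R A) F (orbit F m i)" for i
    using l[of i] by (simp add: linear_map_def base_comodule_simps) (simp add: base_module_def)
  moreover have "orbit F m (Suc i) (rsigma R r) = dsigma F (orbit F m i r)" if "r \<in> carrier R" for i r
    using that funpow_dsigma(3)[of r 1] semilinearD(5)[OF FD(2)] funpow_dsigma(1)[OF m(1), of i] by (simp add: orbit_def)
  ultimately show ?thesis by (simp add: ehom_iff base_comodule_simps orbit_def)
qed

lemma ehom_base:
  assumes \<phi>: "\<phi> \<in> carrier (comod_ehom R A (base_comodule R A) F)"
  shows "\<phi> 0 \<one>\<^bsub>R\<^esub> \<in> carrier F" "coact F (\<phi> 0 \<one>\<^bsub>R\<^esub>) = pure_tens R F A (\<phi> 0 \<one>\<^bsub>R\<^esub>) [\<one>\<^bsub>A\<^esub>]"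
    "\<phi> = orbit F (\<phi> 0 \<one>\<^bsub>R\<^esub>)"
proof -
  note FD = difference_comoduleD[OF F]
  interpret F: Module.module R F by (rule FD(1))
  note \<phi>' = \<phi>[unfolded ehom_iff base_comodule_simps]
  have l: "linear_map R (base_module R) F (\<phi> i)" for i
    using \<phi> by (simp add: ehom_iff linear_map_def base_comodule_simps) (simp add: base_module_def)
  note lb = linear_mapD[OF l, unfolded base_module_def, simplified]
  show 1: "\<phi> 0 \<one>\<^bsub>R\<^esub> \<in> carrier F" using lb(2) by simp
  have "coact F (\<phi> 0 \<one>\<^bsub>R\<^esub>) = tens_map R F A 1 (\<phi> 0) (pure_tens R (base_module R) A \<one>\<^bsub>R\<^esub> [\<one>\<^bsub>A\<^esub>])"
    using \<phi>' by (simp add: base_comodule_simps)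
  also have "\<dots> = pure_tens R F A (\<phi> 0 \<one>\<^bsub>R\<^esub>) [\<one>\<^bsub>A\<^esub>]"
    by (rule tens_map_pure[OF module_base FD(1) l]) (auto simp: base_module_def)
  finally show "coact F (\<phi> 0 \<one>\<^bsub>R\<^esub>) = pure_tens R F A (\<phi> 0 \<one>\<^bsub>R\<^esub>) [\<one>\<^bsub>A\<^esub>]" .
  have s1: "rsigma R \<one>\<^bsub>R\<^esub> = \<one>\<^bsub>R\<^esub>"
    using hopf by (auto simp: difference_hopf_algebra_def difference_ring_def intro: ring_hom_one)
  \<comment> \<open>The shift condition evaluated at 1, which \<open>rsigma R\<close> fixes,
    determines each entry at 1 from the previous one; linearity then determines the entry.\<close>
  have i: "\<phi> i \<one>\<^bsub>R\<^esub> = (dsigma F ^^ i) (\<phi> 0 \<one>\<^bsub>R\<^esub>)" for i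
  proof (induction i)
    case (Suc i)
    have "\<phi> (Suc i) (rsigma R \<one>\<^bsub>R\<^esub>) = dsigma F (\<phi> i \<one>\<^bsub>R\<^esub>)" using \<phi>' by blast
    then show ?case by (simp add: s1 Suc)
  qed simp
  show "\<phi> = orbit F (\<phi> 0 \<one>\<^bsub>R\<^esub>)"
  proof (rule orbit_eqI)
    show "\<phi> i \<in> extensional (carrier R)" for i using \<phi>' by blast
    fix i r assume r: "r \<in> carrier R"
    have "\<phi> i (r \<otimes>\<^bsub>R\<^esub> \<one>\<^bsub>R\<^esub>) = r \<odot>\<^bsub>F\<^esub> \<phi> i \<one>\<^bsub>R\<^esub>" using lb(4)[OF r] by blast
    then show "\<phi> i r = r \<odot>\<^bsub>F\<^esub> (dsigma F ^^ i) (\<phi> 0 \<one>\<^bsub>R\<^esub>)" using r i[of i] by simp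
  qed
qed

end

text \<open>Every operation on the hom object takes orbits to orbits, so each condition reduces to a
  statement about the generating invariant.\<close>

lemma inv_functor_ehom:
  "inv_functor (ehom_functor R A (base_comodule R A)) (\<lambda>F f. pure_tens R F A (f 0 \<one>\<^bsub>R\<^esub>) [])"
  unfolding inv_functor_def
proof (intro allI impI)
  fix F :: "('u, 'u, 'u) dcomod" assume F: "difference_comodule R A F"
  let ?T = "ehom_functor R A (base_comodule R A)" and ?p = "\<lambda>F m. pure_tens R F A m []"
  let ?E = "on_obj ?T F"
  \<comment> \<open>The invariants as elements of \<open>F\<close> itself; the degree 0 tensor
    \<open>?p F m\<close> only serves the comparison with \<open>inv_tens\<close>.\<close>
  define M where "M = (\<lambda>F :: ('u, 'u, 'u) dcomod. {m \<in> carrier F. ?p F m \<in> inv_tens F})"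
  note FD = difference_comoduleD[OF F]
  interpret F: Module.module R F by (rule FD(1))
  note fp = funpow_dsigma[OF F] and ops = inv_tens_ops[OF F]
  have obj: "on_obj ?T F = comod_ehom R A (base_comodule R A) F" for F :: "('u, 'u, 'u) dcomod"
    by (simp add: ehom_functor_def)
  have Mc: "m \<in> carrier F" if "m \<in> M F" for m and F :: "('u, 'u, 'u) dcomod" using that by (simp add: M_def)
  have orb1: "orbit F m 0 \<one>\<^bsub>R\<^esub> = m" if F: "difference_comodule R A F" and m: "m \<in> M F" for m and F :: "('u, 'u, 'u) dcomod"
    using module.smult_one[OF difference_comoduleD(1)[OF F] Mc[OF m]] by (simp add: orbit_def)
  have car: "carrier (on_obj ?T F) = orbit F ` M F" if F: "difference_comodule R A F" for F :: "('u, 'u, 'u) dcomod"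
    using ehom_base[OF F] orbit_hom[OF F] inv_tens_pure[OF F] unfolding obj M_def by (auto intro!: rev_image_eqI)
  have inj: "m = m'" if "m \<in> M F" "m' \<in> M F" "?p F m = ?p F m'" for m m'
    using tens_0_inj[OF FD(1)] that by (simp add: M_def)
  have bij: "bij_betw (\<lambda>f. ?p F (f 0 \<one>\<^bsub>R\<^esub>)) (carrier ?E) (inv_tens F)"
  proof (rule bij_betw_imageI)
    show "inj_on (\<lambda>f. ?p F (f 0 \<one>\<^bsub>R\<^esub>)) (carrier ?E)"
      unfolding car[OF F] using inj orb1[OF F] by (intro inj_onI) (metis imageE)
    have "x \<in> ?p F ` M F" if x: "x \<in> inv_tens F" for x
      using tens_0_repr[OF FD(1), of x] x by (auto simp: M_def inv_tens_def)
    moreover have "?p F ` M F \<subseteq> inv_tens F" by (auto simp: M_def)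
    ultimately show "(\<lambda>f. ?p F (f 0 \<one>\<^bsub>R\<^esub>)) ` carrier ?E = inv_tens F"
      unfolding car[OF F] image_image using orb1[OF F] by (simp cong: image_cong_simp) blast
  qed
  have pz: "?p F \<zero>\<^bsub>F\<^esub> = \<zero>\<^bsub>tens R F A 0\<^esub>"
    by (rule additive_map_zero[OF F.abelian_group_axioms tens_group[OF FD(1)]])
      (simp add: additive_map_def pure_tens_closed[OF FD(1)] pure_tens_add[OF FD(1), where n=0])
  have pa: "?p F (m \<oplus>\<^bsub>F\<^esub> m') = ?p F m \<oplus>\<^bsub>tens R F A 0\<^esub> ?p F m'" if "m \<in> M F" "m' \<in> M F" for m m'
    using that Mc by (intro pure_tens_add[OF FD(1)]) auto
  have ps: "?p F (r \<odot>\<^bsub>F\<^esub> m) = r \<odot>\<^bsub>tens R F A 0\<^esub> ?p F m" if "r \<in> carrier R" "m \<in> M F" for r m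
    using that Mc by (simp add: smult_pure[OF FD(1)])
  have pg: "?p F (dsigma F m) = gmap R F A 0 (dsigma F) (dsigma A) (?p F m)" if "m \<in> M F" for m
    using gmap_pure[OF FD(1) FD(1) FD(2) dsigma_A Mc[OF that], of "[]" 0] by simp
  have ph: "?p F' (\<phi> i m) = tens_map R F' A 0 (\<phi> i) (?p F m)"
    if "difference_comodule R A F'" "\<phi> \<in> carrier (comod_ehom R A F F')" "m \<in> M F" for F' :: "('u, 'u, 'u) dcomod" and \<phi> i m
    using tens_map_pure[OF FD(1) difference_comoduleD(1)[OF that(1)] _ Mc[OF that(3)], of "\<phi> i" "[]" 0] that(2) by (simp add: ehom_iff)
  have pM: "?p F m \<in> inv_tens F" if "m \<in> M F" for m using that by (simp add: M_def)
  have Ma: "m \<oplus>\<^bsub>F\<^esub> m' \<in> M F" if "m \<in> M F" "m' \<in> M F" for m m'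
    using pa[OF that] ops(2)[OF pM[OF that(1)] pM[OF that(2)]] Mc that by (simp add: M_def)
  have Mz: "\<zero>\<^bsub>F\<^esub> \<in> M F" using pz ops(1) by (simp add: M_def)
  have Ms: "r \<odot>\<^bsub>F\<^esub> m \<in> M F" if "r \<in> carrier R" "m \<in> M F" for r m
    using ps[OF that] ops(3)[OF that(1) pM[OF that(2)]] Mc that by (simp add: M_def)
  have Mg: "dsigma F m \<in> M F" if "m \<in> M F" for m
    using pg[OF that] ops(4)[OF pM[OF that]] FD(6)[OF Mc[OF that]] by (simp add: M_def)
  have Mh: "\<phi> i m \<in> M F'" if \<phi>: "difference_comodule R A F'" "\<phi> \<in> carrier (comod_ehom R A F F')" and m: "m \<in> M F"
    for F' :: "('u, 'u, 'u) dcomod" and \<phi> i m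
    using ph[OF \<phi> m] ops(5)[OF \<phi> pM[OF m]] linear_mapD(2)[of R F F' "\<phi> i", OF _ Mc[OF m]] \<phi>(2) by (simp add: M_def ehom_iff)
  have oa: "orbit F m \<oplus>\<^bsub>?E\<^esub> orbit F m' = orbit F (m \<oplus>\<^bsub>F\<^esub> m')" if "m \<in> M F" "m' \<in> M F" for m m'
    by (rule orbit_eqI[OF F])
      (use that in \<open>simp_all add: obj comod_ehom_def internal_hom_def base_comodule_simps orbit_def fp F.smult_r_distr Mc\<close>)
  have oz: "\<zero>\<^bsub>?E\<^esub> = orbit F \<zero>\<^bsub>F\<^esub>"
  proof (rule orbit_eqI[OF F])
    have "(dsigma F ^^ i) \<zero>\<^bsub>F\<^esub> = \<zero>\<^bsub>F\<^esub>" for i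
      by (rule additive_map_zero[OF F.abelian_group_axioms F.abelian_group_axioms]) (simp add: additive_map_def fp)
    then show "\<zero>\<^bsub>?E\<^esub> i r = r \<odot>\<^bsub>F\<^esub> (dsigma F ^^ i) \<zero>\<^bsub>F\<^esub>" if "r \<in> carrier R" for i r
      using that by (simp add: obj comod_ehom_def internal_hom_def base_comodule_simps)
  qed (simp add: obj comod_ehom_def internal_hom_def base_comodule_simps)
  \<comment> \<open>The twist by \<sigma>^i(r) in entry i of the scalar action is what makes it
    match \<sigma>^i(r m).\<close>
  have os: "r \<odot>\<^bsub>?E\<^esub> orbit F m = orbit F (r \<odot>\<^bsub>F\<^esub> m)" if "r \<in> carrier R" "m \<in> M F" for r m
  proof (rule orbit_eqI[OF F])
    fix i s assume s: "s \<in> carrier R"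
    note * = fp(3)[OF that(1), of i] fp(1)[OF Mc[OF that(2)], of i]
    have "(rsigma R ^^ i) r \<odot>\<^bsub>F\<^esub> (s \<odot>\<^bsub>F\<^esub> (dsigma F ^^ i) m) = s \<odot>\<^bsub>F\<^esub> ((rsigma R ^^ i) r \<odot>\<^bsub>F\<^esub> (dsigma F ^^ i) m)"
      using s * by (simp add: F.smult_assoc1[symmetric] F.R.m_comm)
    then show "(r \<odot>\<^bsub>?E\<^esub> orbit F m) i s = s \<odot>\<^bsub>F\<^esub> (dsigma F ^^ i) (r \<odot>\<^bsub>F\<^esub> m)"
      using s fp(4)[OF that(1) Mc[OF that(2)]] by (simp add: obj comod_ehom_def internal_hom_def base_comodule_simps orbit_def)
  qed (simp add: obj comod_ehom_def internal_hom_def base_comodule_simps)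
  \<comment> \<open>Shifting the sequence replaces m by \<sigma>m, since \<sigma>^(i+1) m is
    \<sigma>^i applied to \<sigma>m.\<close>
  have og: "dsigma ?E (orbit F m) = orbit F (dsigma F m)" for m
    by (rule orbit_eqI[OF F]) (simp_all add: obj comod_ehom_def internal_hom_def orbit_def funpow_swap1)
  have oh: "on_hom ?T F F' \<phi> j (orbit F m) = orbit F' (\<phi> j m)"
    if F': "difference_comodule R A F'" and \<phi>: "\<phi> \<in> carrier (comod_ehom R A F F')" and m: "m \<in> M F"
    for F' :: "('u, 'u, 'u) dcomod" and \<phi> j m
  proof (rule orbit_eqI[OF F'])
    have l: "linear_map R F F' (\<phi> i)" for i using \<phi> by (simp add: ehom_iff)
    have on: "on_hom ?T F F' \<phi> j (orbit F m) = (\<lambda>i. compose (carrier R) (\<phi> (i + j)) (orbit F m i))"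
      using car[OF F] m by (simp add: ehom_functor_def base_comodule_simps)
    \<comment> \<open>Iterating the shift condition of \<phi> moves \<sigma>^i to the other side and
      lowers the index from i + j to j.\<close>
    have sh: "\<phi> (i + j) ((dsigma F ^^ i) m) = (dsigma F' ^^ i) (\<phi> j m)" for i
    proof (induction i)
      case (Suc i)
      have "\<phi> (Suc (i + j)) (dsigma F ((dsigma F ^^ i) m)) = dsigma F' (\<phi> (i + j) ((dsigma F ^^ i) m))"
        using \<phi> fp(1)[OF Mc[OF m]] by (simp add: ehom_iff)
      then show ?case by (simp add: Suc)
    qed simp
    show "on_hom ?T F F' \<phi> j (orbit F m) i \<in> extensional (carrier R)" for i by (simp add: on)
    show "on_hom ?T F F' \<phi> j (orbit F m) i r = r \<odot>\<^bsub>F'\<^esub> (dsigma F' ^^ i) (\<phi> j m)" if r: "r \<in> carrier R" for i r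
      using r linear_mapD(4)[OF l r fp(1)[OF Mc[OF m]], of "i + j" i] by (simp add: on compose_def sh) (simp add: orbit_def sh)
  qed
  have b2: "x \<oplus>\<^bsub>?E\<^esub> y \<in> carrier ?E \<and> ?p F ((x \<oplus>\<^bsub>?E\<^esub> y) 0 \<one>\<^bsub>R\<^esub>) = ?p F (x 0 \<one>\<^bsub>R\<^esub>) \<oplus>\<^bsub>tens R F A 0\<^esub> ?p F (y 0 \<one>\<^bsub>R\<^esub>)"
    if x: "x \<in> carrier ?E" "y \<in> carrier ?E" for x y
    using x oa Ma pa orb1[OF F] unfolding car[OF F] by (elim imageE) simp
  have b3: "\<zero>\<^bsub>?E\<^esub> \<in> carrier ?E \<and> ?p F (\<zero>\<^bsub>?E\<^esub> 0 \<one>\<^bsub>R\<^esub>) = \<zero>\<^bsub>tens R F A 0\<^esub>"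
    using oz Mz pz orb1[OF F] by (simp add: car[OF F])
  have b4: "r \<odot>\<^bsub>?E\<^esub> x \<in> carrier ?E \<and> ?p F ((r \<odot>\<^bsub>?E\<^esub> x) 0 \<one>\<^bsub>R\<^esub>) = r \<odot>\<^bsub>tens R F A 0\<^esub> ?p F (x 0 \<one>\<^bsub>R\<^esub>)"
    if "r \<in> carrier R" and x: "x \<in> carrier ?E" for r x
    using x that os Ms ps orb1[OF F] unfolding car[OF F] by (elim imageE) simp
  have b5: "dsigma ?E x \<in> carrier ?E \<and> ?p F (dsigma ?E x 0 \<one>\<^bsub>R\<^esub>) = gmap R F A 0 (dsigma F) (dsigma A) (?p F (x 0 \<one>\<^bsub>R\<^esub>))"
    if x: "x \<in> carrier ?E" for x
    using x og Mg pg orb1[OF F] unfolding car[OF F] by (elim imageE) simp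
  have b6: "on_hom ?T F F' \<phi> i x \<in> carrier (on_obj ?T F') \<and>
      ?p F' (on_hom ?T F F' \<phi> i x 0 \<one>\<^bsub>R\<^esub>) = tens_map R F' A 0 (\<phi> i) (?p F (x 0 \<one>\<^bsub>R\<^esub>))"
    if \<phi>: "difference_comodule R A F'" "\<phi> \<in> carrier (comod_ehom R A F F')" and x: "x \<in> carrier ?E"
    for F' :: "('u, 'u, 'u) dcomod" and \<phi> i x
    using x oh[OF \<phi>] Mh[OF \<phi>] ph[OF \<phi>] orb1[OF F] orb1[OF \<phi>(1)] unfolding car[OF F] car[OF \<phi>(1)] by (elim imageE) simp
  show "bij_betw (\<lambda>f. ?p F (f 0 \<one>\<^bsub>R\<^esub>)) (carrier ?E) (inv_tens F) \<and>
     (\<forall>x\<in>carrier ?E. \<forall>y\<in>carrier ?E. x \<oplus>\<^bsub>?E\<^esub> y \<in> carrier ?E \<and> ?p F ((x \<oplus>\<^bsub>?E\<^esub> y) 0 \<one>\<^bsub>R\<^esub>) = ?p F (x 0 \<one>\<^bsub>R\<^esub>) \<oplus>\<^bsub>tens R F A 0\<^esub> ?p F (y 0 \<one>\<^bsub>R\<^esub>)) \<and>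
     \<zero>\<^bsub>?E\<^esub> \<in> carrier ?E \<and> ?p F (\<zero>\<^bsub>?E\<^esub> 0 \<one>\<^bsub>R\<^esub>) = \<zero>\<^bsub>tens R F A 0\<^esub> \<and>
     (\<forall>r\<in>carrier R. \<forall>x\<in>carrier ?E. r \<odot>\<^bsub>?E\<^esub> x \<in> carrier ?E \<and> ?p F ((r \<odot>\<^bsub>?E\<^esub> x) 0 \<one>\<^bsub>R\<^esub>) = r \<odot>\<^bsub>tens R F A 0\<^esub> ?p F (x 0 \<one>\<^bsub>R\<^esub>)) \<and>
     (\<forall>x\<in>carrier ?E. dsigma ?E x \<in> carrier ?E \<and> ?p F (dsigma ?E x 0 \<one>\<^bsub>R\<^esub>) = gmap R F A 0 (dsigma F) (dsigma A) (?p F (x 0 \<one>\<^bsub>R\<^esub>))) \<and>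
     (\<forall>F' \<phi> i. \<forall>x\<in>carrier ?E. difference_comodule R A F' \<and> \<phi> \<in> carrier (comod_ehom R A F F') \<longrightarrow>
        on_hom ?T F F' \<phi> i x \<in> carrier (on_obj ?T F') \<and>
        ?p F' (on_hom ?T F F' \<phi> i x 0 \<one>\<^bsub>R\<^esub>) = tens_map R F' A 0 (\<phi> i) (?p F (x 0 \<one>\<^bsub>R\<^esub>)))"
    using bij b2 b3 b4 b5 b6 by (intro conjI ballI allI impI; (elim conjE)?) simp_all
qed

end

theorem theorem21p27:
  fixes R :: "'u::infinite dring" and A :: "('u, 'u) dhopf" and n :: nat
  assumes "difference_ring R"
    and "difference_hopf_algebra R A"
    and "flat R A"
  shows "enriched_derived_functor R A
           (group_cohomology R A 0 :: ('u, 'u, 'u, ('u, 'u) tens set) efunctor) n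
           (group_cohomology R A n) \<and>
         enriched_derived_functor R A
           (ehom_functor R A (base_comodule R A)) n
           (group_cohomology R A n :: ('u, 'u, 'u, ('u, 'u) tens set) efunctor)"
proof -
  interpret flat_hopf R A
    using assms by (simp add: flat_hopf_def flat_hopf_axioms_def hopf_base_def)
  show ?thesis
    by (intro conjI group_cohomology_derived[OF inv_functor_group_cohomology] group_cohomology_derived[OF inv_functor_ehom])
qed

end
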